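(* Consider the algorithm FPC-ADLEG$(\theta,\delta,tol)$ described in the context, with $\theta\in(0,1)$, $0<\delta<\sqrt{1-\theta^2}$ and $tol\in[0,1)$, applied to the elliptic problem described there with exact solution $u\in H^1_0(\Omega)$. Set $$\rho:=9\,\frac{\alpha^*}{\alpha_*}\,\frac{\beta^*}{\beta_*}\,\frac{\sqrt{1-\theta^2}}{1-\delta}.$$ Then the errors $u-u_n$ generated by the algorithm for $n\ge0$ satisfy $$\|u-u_{n+1}\|_{H^1_0(\Omega)}\le\rho\,\|u-u_n\|_{H^1_0(\Omega)} .$$ Therefore, if $\theta$ is chosen in such a way that $\rho<1$, for any $tol>0$ the algorithm terminates in a finite number of iterations, whereas for $tol=0$ the sequence $u_n$ converges to $u$ in $H^1_0(\Omega)$ as $n\to\infty$.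
   Context: **Problem.** $\Omega=(-1,1)^2$, $V=H^1_0(\Omega)$ with $(u,v)_{H^1_0(\Omega)}=\int_\Omega\nabla u\cdot\nabla v$, $V'=H^{-1}(\Omega)$. The operator is $\mathcal Lu=-\nabla\cdot(\nu\nabla u)+\sigma u$ with smooth real coefficients, $0<\nu_*\le\nu\le\nu^*<\infty$, $0\le\sigma\le\sigma^*<\infty$; $\alpha_*=\nu_*$, $\alpha^*=\max(\nu^*,\sigma^* )$. $a(u,v)=\int_\Omega\nu\nabla u\cdot\nabla v+\int_\Omega\sigma uv$; the constants are used through $\sqrt{\alpha_*}\|v\|_{H^1_0(\Omega)}\le\sqrt{a(v,v)}\le\sqrt{\alpha^*}\|v\|_{H^1_0(\Omega)}$ and the resulting bounds $\frac1{\alpha^*}\|r(w)\|_{H^{-1}(\Omega)}\le\|u-w\|_{H^1_0(\Omega)}\le\frac1{\alpha_*}\|r(w)\|_{H^{-1}(\Omega)}$ (where $r(w)=f-\mathcal Lw$). Given $f\in V'$, $u\in V$ is the solution of $a(u,v)=\langle f,v\rangle$ for all $v\in V$. **Basis.** Let $L_k$ be the Legendre polynomials and, for $k\ge2$, $\eta_k=\frac1{\sqrt{4k-2}}(L_{k-2}-L_k)$. For $k\in\mathcal K=\{k\in\mathbb N^2:k_1,k_2\ge2\}$, let $\eta_k(x)=\eta_{k_1}(x_1)\eta_{k_2}(x_2)$, normalized to unit $H^1_0(\Omega)$-norm. These split into four mutually orthogonal families according to the parities of $k_1,k_2$. Within each family, ordered by increasing $k_1+k_2$ and then by increasing $k_1$,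 let $S_\eta$ be the $H^1_0$-Gram matrix and let $G=(g_{mk})$ be the upper triangular Gram–Schmidt matrix, $G^TS_\eta G=I$; put $L=G^{-T}$. Fix $tol_G<1$ and a maximal degree $p_{\max}$. $G_t$ is obtained from $G$ by setting to zero those off-diagonal entries $g_{mk}$, with indices of total degree at most $p_{\max}$, for which $|g_{mk}|/g_{kk}<t$, where the threshold $t\in(0,1)$ is such that $E=G_t-G$ satisfies $\|L^TE\|\le tol_G$ ($\ell^2$ operator norm). The basis functions are $\phi_k=\sum_m(G_t)_{mk}\eta_m$; collecting the four families, $\{\phi_k\}_{k\in\mathcal K}$ is a Riesz basis of $V$, with dual basis $\{\phi_k^*\}$ of $V'$. Let $d_k=\|\phi_k\|_{H^1_0(\Omega)}^2$. For $v=\sum_k\hat v_k\phi_k$ and $f=\sum_k\hat f_k\phi_k^*$, with $\hat f_k=\langle f,\phi_k\rangle$, let $\|v\|_\phi^2=\sum_k|\hat v_k|^2d_k$ and $\|f\|_{\phi^*}^2=\sum_k|\hat f_k|^2d_k^{-1}$. The constants $0<\beta_*\le\beta^*$ satisfy $\beta_*\|v\|_{H^1_0(\Omega)}\le\|v\|_\phi\le\beta^*\|v\|_{H^1_0(\Omega)}$ for all $v\in V$ (hence $\frac1{\beta^*}\|f\|_{H^{-1}(\Omega)}\le\|f\|_{\phi^*}\le\frac1{\beta_*}\|f\|_{H^{-1}(\Omega)}$), and $d^*=1+\|L^TE\|^2$ (so $d_k\le d^*$). **Stiffness matrix.** $A_\phi=(a(\phi_k,\phi_\ell))_{\ell,k\in\mathcal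 K}$. It is assumed to have exponential off-diagonal decay, $|a(\phi_k,\phi_\ell)|\le c\,e^{-\gamma_{\mathcal L}\|k-\ell\|_{\ell^1}}$ for some $c,\gamma_{\mathcal L}>0$, and $C_{A^{-1}},\bar\gamma_{\mathrm{inv}}>0$ are constants such that $\|A_\phi^{-1}-(A_\phi^{-1})_J\|\le C_{A^{-1}}e^{-\bar\gamma_{\mathrm{inv}}J}$ for all integers $J\ge0$, where $(B)_J$ retains only the entries $B_{\ell k}$ with $\|\ell-k\|_{\ell^1}\le J$. **Procedures.** For $\Lambda\subset\mathcal K$, $V_\Lambda=\mathrm{span}\{\phi_k:k\in\Lambda\}$, $P_\Lambda v=\sum_{k\in\Lambda}\hat v_k\phi_k$, $P^*_\Lambda f=\sum_{k\in\Lambda}\hat f_k\phi^*_k$. - GAL$(\Lambda)$, $\Lambda$ finite: the $u_\Lambda\in V_\Lambda$ with $a(u_\Lambda,v)=\langle f,v\rangle$ for all $v\in V_\Lambda$. - F-RES$(v,\delta)$, $v$ with finite expansion: an element $\tilde r\in V'$ with finite expansion in $\{\phi_k^*\}$ such that $\|r(v)-\tilde r\|_{\phi^*}\le\delta\|\tilde r\|_{\phi^*}$. - DÖRFLER$(r,\theta)$: a finite set $\Lambda^*\subset\mathcal K$ of minimal cardinality such that $\|P^*_{\Lambda^*}r\|_{\phi^*}\ge\theta\|r\|_{\phi^*}$. - ENRICH$(\Lambda,J)=\{k\in\mathcal K:\exists\,\ell\in\Lambda,\ \|k-\ell\|_{\ell^1}\le J\}$. - E-DÖRFLER$(r,\theta)$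 = ENRICH(DÖRFLER$(r,\theta),J_\theta)$, where $J_\theta$ is the smallest integer with $C_{A^{-1}}e^{-\bar\gamma_{\mathrm{inv}}J_\theta}\le\frac{\beta_*^2}{d^*}\sqrt{\frac{1-\theta^2}{\alpha_*\alpha^*}}$. - COARSE$(w,\epsilon)$, for $w\in V_{\Lambda^*}$ ($\Lambda^*$ finite) known to satisfy $\|u-w\|_{H^1_0(\Omega)}\le\epsilon$: a set $\Lambda\subseteq\Lambda^*$ of minimal cardinality such that $\|w-P_\Lambda w\|_\phi\le2\beta_*\epsilon$. **Algorithm FPC-ADLEG$(\theta,\delta,tol)$.** Set $u_0=0$, $\Lambda_0=\emptyset$, $\tilde r_0=$ F-RES$(u_0,\delta)$. For $n=0,1,2,\dots$ do: $\partial\Lambda_n=$ E-DÖRFLER$(\tilde r_n,\theta)$; $\widehat\Lambda_{n+1}=\Lambda_n\cup\partial\Lambda_n$; $\widehat u_{n+1}=$ GAL$(\widehat\Lambda_{n+1})$; $\Lambda_{n+1}=$ COARSE$\bigl(\widehat u_{n+1},\,3\frac{\beta^*}{\alpha_*}\sqrt{1-\theta^2}\,\|\tilde r_n\|_{\phi^*}\bigr)$; $u_{n+1}=$ GAL$(\Lambda_{n+1})$; $\tilde r_{n+1}=$ F-RES$(u_{n+1},\delta)$; continue while $\|\tilde r_{n+1}\|_{\phi^*}>\frac{tol}{1+\delta}$. *)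

theory Defs
  imports "HOL-Analysis.Analysis" "HOL-Library.Extended_Nat"
begin

section \<open>Sobolev spaces on the square\<close>

type_synonym plane_fun = "real \<times> real \<Rightarrow> real"
type_synonym functional = "plane_fun \<Rightarrow> real"
type_synonym index = "nat \<times> nat"
type_synonym index_matrix = "index \<Rightarrow> index \<Rightarrow> real"

definition Omega :: "(real \<times> real) set" where
  "Omega = {-1<..<1} \<times> {-1<..<1}"

fun Ck_on :: "nat \<Rightarrow> 'a::euclidean_space set \<Rightarrow> ('a \<Rightarrow> real) \<Rightarrow> bool" where
  "Ck_on 0 S f \<longleftrightarrow> continuous_on S f"
| "Ck_on (Suc n) S f \<longleftrightarrow>
     (\<forall>x\<in>S. f differentiable (at x)) \<and>
     (\<forall>b\<in>Basis. Ck_on n S (\<lambda>x. frechet_derivative f (at x) b))"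

text \<open>Meant for open \<open>S\<close> only.\<close>

definition smooth_on :: "'a::euclidean_space set \<Rightarrow> ('a \<Rightarrow> real) \<Rightarrow> bool" where
  "smooth_on S f \<longleftrightarrow> (\<forall>n. Ck_on n S f)"

definition test_functions :: "plane_fun set" where
  "test_functions = {\<psi>. smooth_on UNIV \<psi> \<and> (\<exists>S. compact S \<and> S \<subseteq> Omega \<and> (\<forall>x. x \<notin> S \<longrightarrow> \<psi> x = 0))}"

definition grad :: "plane_fun \<Rightarrow> real \<times> real \<Rightarrow> real \<times> real" where
  "grad \<psi> x = (frechet_derivative \<psi> (at x) (1, 0), frechet_derivative \<psi> (at x) (0, 1))"

text \<open>
  Elements of \<open>L\<^sup>2(\<Omega>)\<close>, \<open>H\<^sup>1(\<Omega>)\<close> and \<open>H\<^sup>1\<^sub>0(\<Omega>)\<close> are represented by functions on the plane, of which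
  only the values in \<^const>\<open>Omega\<close> matter.  Functions that agree almost everywhere in \<^const>\<open>Omega\<close>
  are not identified, so all norms below are seminorms, and elements are compared through
  the norm of their difference.
\<close>

definition L2 :: "(real \<times> real \<Rightarrow> 'b::euclidean_space) set" where
  "L2 = {v \<in> borel_measurable (lebesgue_on Omega). integrable (lebesgue_on Omega) (\<lambda>x. (norm (v x))\<^sup>2)}"

definition is_weak_grad :: "plane_fun \<Rightarrow> (real \<times> real \<Rightarrow> real \<times> real) \<Rightarrow> bool" where
  "is_weak_grad v g \<longleftrightarrow> g \<in> L2 \<and>
     (\<forall>\<psi>\<in>test_functions.
        (LINT x|lebesgue_on Omega. v x *\<^sub>R grad \<psi> x) = - (LINT x|lebesgue_on Omega. \<psi> x *\<^sub>R g x))"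

definition H1 :: "plane_fun set" where
  "H1 = {v \<in> L2. \<exists>g. is_weak_grad v g}"

text \<open>Determined by \<open>v \<in> H1\<close> only up to a null set.\<close>

definition wgrad :: "plane_fun \<Rightarrow> real \<times> real \<Rightarrow> real \<times> real" where
  "wgrad v = (SOME g. is_weak_grad v g)"

definition H1_norm :: "plane_fun \<Rightarrow> real" where
  "H1_norm v = sqrt ((LINT x|lebesgue_on Omega. (v x)\<^sup>2) + (LINT x|lebesgue_on Omega. (norm (wgrad v x))\<^sup>2))"

definition H10 :: "plane_fun set" where
  "H10 = {v \<in> H1. \<exists>\<psi> :: nat \<Rightarrow> plane_fun.
            (\<forall>n. \<psi> n \<in> test_functions) \<and> (\<lambda>n. H1_norm (\<lambda>x. v x - \<psi> n x)) \<longlonglongrightarrow> 0}"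

definition H10_inner :: "plane_fun \<Rightarrow> plane_fun \<Rightarrow> real" where
  "H10_inner u v = (LINT x|lebesgue_on Omega. wgrad u x \<bullet> wgrad v x)"

definition H10_norm :: "plane_fun \<Rightarrow> real" where
  "H10_norm v = sqrt (H10_inner v v)"

text \<open>
  The dual space \<open>H\<^sup>-\<^sup>1(\<Omega>)\<close>; a functional is only relevant through its values on \<^const>\<open>H10\<close>.
  Boundedness makes it compatible with almost everywhere equality.
\<close>

definition H10_dual :: "functional set" where
  "H10_dual = {f. (\<forall>v\<in>H10. \<forall>w\<in>H10. f (\<lambda>x. v x + w x) = f v + f w) \<and>
                  (\<forall>c. \<forall>v\<in>H10. f (\<lambda>x. c * v x) = c * f v) \<and>
                  (\<exists>C. \<forall>v\<in>H10. \<bar>f v\<bar> \<le> C * H10_norm v)}"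


section \<open>The elliptic problem\<close>

definition a_form ::
  "plane_fun \<Rightarrow> plane_fun \<Rightarrow> plane_fun \<Rightarrow> plane_fun \<Rightarrow> real" where
  "a_form \<nu> \<sigma> u v =
     (LINT x|lebesgue_on Omega. \<nu> x * (wgrad u x \<bullet> wgrad v x)) +
     (LINT x|lebesgue_on Omega. \<sigma> x * (u x * v x))"

text \<open>\<open>r(w) = f - \<L>w\<close> as a functional.\<close>

definition residual ::
  "plane_fun \<Rightarrow> plane_fun \<Rightarrow> functional \<Rightarrow> plane_fun \<Rightarrow> functional" where
  "residual \<nu> \<sigma> f w = (\<lambda>v. f v - a_form \<nu> \<sigma> w v)"


section \<open>Matrices on an infinite index set\<close>

definition ell2 :: "'i set \<Rightarrow> ('i \<Rightarrow> real) set" where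
  "ell2 I = {x. (\<lambda>i. (x i)\<^sup>2) summable_on I}"

definition ell2_norm :: "'i set \<Rightarrow> ('i \<Rightarrow> real) \<Rightarrow> real" where
  "ell2_norm I x = sqrt (\<Sum>\<^sub>\<infinity>i\<in>I. (x i)\<^sup>2)"

definition mat_vec :: "'i set \<Rightarrow> ('i \<Rightarrow> 'i \<Rightarrow> real) \<Rightarrow> ('i \<Rightarrow> real) \<Rightarrow> 'i \<Rightarrow> real" where
  "mat_vec I M x i = (\<Sum>\<^sub>\<infinity>j\<in>I. M i j * x j)"

definition mat_mult :: "'i set \<Rightarrow> ('i \<Rightarrow> 'i \<Rightarrow> real) \<Rightarrow> ('i \<Rightarrow> 'i \<Rightarrow> real) \<Rightarrow> 'i \<Rightarrow> 'i \<Rightarrow> real" where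
  "mat_mult I M N i j = (\<Sum>\<^sub>\<infinity>l\<in>I. M i l * N l j)"

definition mat_transp :: "('i \<Rightarrow> 'i \<Rightarrow> real) \<Rightarrow> 'i \<Rightarrow> 'i \<Rightarrow> real" where
  "mat_transp M i j = M j i"

definition is_identity :: "'i set \<Rightarrow> ('i \<Rightarrow> 'i \<Rightarrow> real) \<Rightarrow> bool" where
  "is_identity I M \<longleftrightarrow> (\<forall>i\<in>I. \<forall>j\<in>I. M i j = (if i = j then 1 else 0))"

definition op_bound :: "'i set \<Rightarrow> ('i \<Rightarrow> 'i \<Rightarrow> real) \<Rightarrow> real \<Rightarrow> bool" where
  "op_bound I M C \<longleftrightarrow> 0 \<le> C \<and>
     (\<forall>x\<in>ell2 I. (\<forall>i\<in>I. (\<lambda>j. M i j * x j) summable_on I) \<and>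
        mat_vec I M x \<in> ell2 I \<and> ell2_norm I (mat_vec I M x) \<le> C * ell2_norm I x)"

definition op_bounded :: "'i set \<Rightarrow> ('i \<Rightarrow> 'i \<Rightarrow> real) \<Rightarrow> bool" where
  "op_bounded I M \<longleftrightarrow> (\<exists>C. op_bound I M C)"

text \<open>The operator norm on \<open>\<ell>\<^sup>2(I)\<close>; meaningful only together with \<^const>\<open>op_bounded\<close>.\<close>

definition op_norm :: "'i set \<Rightarrow> ('i \<Rightarrow> 'i \<Rightarrow> real) \<Rightarrow> real" where
  "op_norm I M = Inf {C. op_bound I M C}"

definition is_ell2_inverse :: "'i set \<Rightarrow> ('i \<Rightarrow> 'i \<Rightarrow> real) \<Rightarrow> ('i \<Rightarrow> 'i \<Rightarrow> real) \<Rightarrow> bool" where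
  "is_ell2_inverse I A B \<longleftrightarrow> op_bounded I A \<and> op_bounded I B \<and>
     is_identity I (mat_mult I A B) \<and> is_identity I (mat_mult I B A)"

definition l1_dist :: "index \<Rightarrow> index \<Rightarrow> nat" where
  "l1_dist k l = nat (\<bar>int (fst k) - int (fst l)\<bar> + \<bar>int (snd k) - int (snd l)\<bar>)"

definition band :: "nat \<Rightarrow> index_matrix \<Rightarrow> index_matrix" where
  "band J B l k = (if l1_dist l k \<le> J then B l k else 0)"


section \<open>The basis\<close>

fun legendre :: "nat \<Rightarrow> real \<Rightarrow> real" where
  "legendre 0 x = 1"
| "legendre (Suc 0) x = x"
| "legendre (Suc (Suc n)) x =
     ((2 * real n + 3) * x * legendre (Suc n) x - (real n + 1) * legendre n x) / (real n + 2)"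

definition eta1 :: "nat \<Rightarrow> real \<Rightarrow> real" where
  "eta1 k s = (legendre (k - 2) s - legendre k s) / sqrt (4 * real k - 2)"

definition KK :: "index set" where
  "KK = {k. 2 \<le> fst k \<and> 2 \<le> snd k}"

definition eta_tensor :: "index \<Rightarrow> plane_fun" where
  "eta_tensor k x = eta1 (fst k) (fst x) * eta1 (snd k) (snd x)"

definition eta :: "index \<Rightarrow> plane_fun" where
  "eta k x = eta_tensor k x / H10_norm (eta_tensor k)"

definition total_deg :: "index \<Rightarrow> nat" where
  "total_deg k = fst k + snd k"

definition same_family :: "index \<Rightarrow> index \<Rightarrow> bool" where
  "same_family k l \<longleftrightarrow> even (fst k) = even (fst l) \<and> even (snd k) = even (snd l)"

text \<open>The indices that precede or equal \<open>k\<close> in the ordered parity family of \<open>k\<close>.\<close>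

definition upto_index :: "index \<Rightarrow> index set" where
  "upto_index k = {m \<in> KK. same_family m k \<and>
     (total_deg m < total_deg k \<or> (total_deg m = total_deg k \<and> fst m \<le> fst k))}"

text \<open>
  The matrices of the four families are collected into one block-diagonal matrix indexed
  by \<^const>\<open>KK\<close>; its operator norm is the maximum of those of the four blocks.
\<close>

definition gram :: "index_matrix" where
  "gram m k = (if same_family m k then H10_inner (eta m) (eta k) else 0)"

definition upper_triangular :: "index_matrix \<Rightarrow> bool" where
  "upper_triangular M \<longleftrightarrow> (\<forall>m\<in>KK. \<forall>k\<in>KK. M m k \<noteq> 0 \<longrightarrow> m \<in> upto_index k)"

text \<open>Positivity of the diagonal is the Gram--Schmidt normalization that makes \<open>G\<close> unique.\<close>

definition is_gram_schmidt :: "index_matrix \<Rightarrow> bool" where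
  "is_gram_schmidt G \<longleftrightarrow> upper_triangular G \<and> (\<forall>k\<in>KK. 0 < G k k) \<and>
     is_identity KK (mat_mult KK (mat_mult KK (mat_transp G) gram) G)"

text \<open>\<open>L = G\<^sup>-\<^sup>T\<close>; all sums are finite by triangularity.\<close>

definition is_inverse_transpose ::
  "index_matrix \<Rightarrow> index_matrix \<Rightarrow> bool" where
  "is_inverse_transpose G L \<longleftrightarrow> upper_triangular (mat_transp L) \<and>
     is_identity KK (mat_mult KK (mat_transp L) G) \<and> is_identity KK (mat_mult KK G (mat_transp L))"

definition thresholded ::
  "nat \<Rightarrow> real \<Rightarrow> index_matrix \<Rightarrow> index_matrix" where
  "thresholded pmax t G m k =
     (if m \<noteq> k \<and> total_deg m \<le> pmax \<and> total_deg k \<le> pmax \<and> \<bar>G m k\<bar> / G k k < t then 0 else G m k)"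

definition basis_fun ::
  "index_matrix \<Rightarrow> index \<Rightarrow> plane_fun" where
  "basis_fun Gt k x = (\<Sum>m\<in>upto_index k. Gt m k * eta m x)"

definition is_riesz_basis :: "(index \<Rightarrow> plane_fun) \<Rightarrow> bool" where
  "is_riesz_basis \<phi> \<longleftrightarrow> (\<forall>k\<in>KK. \<phi> k \<in> H10) \<and>
     (\<forall>v\<in>H10. \<forall>e>0. \<exists>F c. finite F \<and> F \<subseteq> KK \<and> H10_norm (\<lambda>x. v x - (\<Sum>k\<in>F. c k * \<phi> k x)) < e) \<and>
     (\<exists>A B. 0 < A \<and> 0 < B \<and>
        (\<forall>F c. finite F \<longrightarrow> F \<subseteq> KK \<longrightarrow>
           A * (\<Sum>k\<in>F. (c k)\<^sup>2) \<le> (H10_norm (\<lambda>x. \<Sum>k\<in>F. c k * \<phi> k x))\<^sup>2 \<and>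
           (H10_norm (\<lambda>x. \<Sum>k\<in>F. c k * \<phi> k x))\<^sup>2 \<le> B * (\<Sum>k\<in>F. (c k)\<^sup>2)))"

definition is_dual_basis ::
  "(index \<Rightarrow> plane_fun) \<Rightarrow> (index \<Rightarrow> functional) \<Rightarrow> bool" where
  "is_dual_basis \<phi> \<phi>s \<longleftrightarrow> (\<forall>k\<in>KK. \<phi>s k \<in> H10_dual \<and> (\<forall>l\<in>KK. \<phi>s k (\<phi> l) = (if k = l then 1 else 0)))"

text \<open>
  For a Riesz basis \<open>\<phi>\<close> with dual basis \<open>\<phi>s\<close>, the coefficients of \<open>v = \<Sum>\<^sub>k v\<^sub>k \<phi>\<^sub>k\<close> are \<open>v\<^sub>k = \<phi>s k v\<close>,
  and those of \<open>f = \<Sum>\<^sub>k f\<^sub>k \<phi>s\<^sub>k\<close> are \<open>f\<^sub>k = f (\<phi> k)\<close>.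
\<close>

definition d_weight :: "(index \<Rightarrow> plane_fun) \<Rightarrow> index \<Rightarrow> real" where
  "d_weight \<phi> k = (H10_norm (\<phi> k))\<^sup>2"

definition phi_norm ::
  "(index \<Rightarrow> plane_fun) \<Rightarrow> (index \<Rightarrow> functional) \<Rightarrow> plane_fun \<Rightarrow> real" where
  "phi_norm \<phi> \<phi>s v = sqrt (\<Sum>\<^sub>\<infinity>k\<in>KK. \<bar>\<phi>s k v\<bar>\<^sup>2 * d_weight \<phi> k)"

definition phi_dual_norm ::
  "(index \<Rightarrow> plane_fun) \<Rightarrow> functional \<Rightarrow> real" where
  "phi_dual_norm \<phi> f = sqrt (\<Sum>\<^sub>\<infinity>k\<in>KK. \<bar>f (\<phi> k)\<bar>\<^sup>2 / d_weight \<phi> k)"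

definition span_of ::
  "(index \<Rightarrow> plane_fun) \<Rightarrow> index set \<Rightarrow> plane_fun set" where
  "span_of \<phi> \<Lambda> = {\<lambda>x. \<Sum>k\<in>F. c k * \<phi> k x | F c. finite F \<and> F \<subseteq> \<Lambda>}"

text \<open>The projections \<open>P\<^sub>\<Lambda>\<close> and \<open>P\<^sup>*\<^sub>\<Lambda>\<close>, for finite \<open>\<Lambda>\<close>.\<close>

definition proj ::
  "(index \<Rightarrow> plane_fun) \<Rightarrow> (index \<Rightarrow> functional) \<Rightarrow>
   index set \<Rightarrow> plane_fun \<Rightarrow> plane_fun" where
  "proj \<phi> \<phi>s \<Lambda> v = (\<lambda>x. \<Sum>k\<in>\<Lambda>. \<phi>s k v * \<phi> k x)"

definition proj_dual ::
  "(index \<Rightarrow> plane_fun) \<Rightarrow> (index \<Rightarrow> functional) \<Rightarrow>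
   index set \<Rightarrow> functional \<Rightarrow> functional" where
  "proj_dual \<phi> \<phi>s \<Lambda> f = (\<lambda>v. \<Sum>k\<in>\<Lambda>. f (\<phi> k) * \<phi>s k v)"


section \<open>The procedures\<close>

text \<open>
  A procedure whose output is not uniquely determined is rendered by the relation between
  its input and its possible outputs (the last argument).
\<close>

definition is_GAL ::
  "plane_fun \<Rightarrow> plane_fun \<Rightarrow> functional \<Rightarrow>
   (index \<Rightarrow> plane_fun) \<Rightarrow> index set \<Rightarrow> plane_fun \<Rightarrow> bool" where
  "is_GAL \<nu> \<sigma> f \<phi> \<Lambda> w \<longleftrightarrow> w \<in> span_of \<phi> \<Lambda> \<and> (\<forall>v\<in>span_of \<phi> \<Lambda>. a_form \<nu> \<sigma> w v = f v)"

definition is_F_RES ::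
  "plane_fun \<Rightarrow> plane_fun \<Rightarrow> functional \<Rightarrow>
   (index \<Rightarrow> plane_fun) \<Rightarrow> (index \<Rightarrow> functional) \<Rightarrow>
   plane_fun \<Rightarrow> real \<Rightarrow> functional \<Rightarrow> bool" where
  "is_F_RES \<nu> \<sigma> f \<phi> \<phi>s v \<delta> rt \<longleftrightarrow>
     rt \<in> H10_dual \<and>
     (\<exists>F c. finite F \<and> F \<subseteq> KK \<and> (\<forall>w\<in>H10. rt w = (\<Sum>k\<in>F. c k * \<phi>s k w))) \<and>
     phi_dual_norm \<phi> (\<lambda>w. residual \<nu> \<sigma> f v w - rt w) \<le> \<delta> * phi_dual_norm \<phi> rt"

definition doerfler_admissible ::
  "(index \<Rightarrow> plane_fun) \<Rightarrow> (index \<Rightarrow> functional) \<Rightarrow>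
   functional \<Rightarrow> real \<Rightarrow> index set \<Rightarrow> bool" where
  "doerfler_admissible \<phi> \<phi>s r \<theta> \<Lambda> \<longleftrightarrow> finite \<Lambda> \<and> \<Lambda> \<subseteq> KK \<and>
     phi_dual_norm \<phi> (proj_dual \<phi> \<phi>s \<Lambda> r) \<ge> \<theta> * phi_dual_norm \<phi> r"

definition is_DOERFLER ::
  "(index \<Rightarrow> plane_fun) \<Rightarrow> (index \<Rightarrow> functional) \<Rightarrow>
   functional \<Rightarrow> real \<Rightarrow> index set \<Rightarrow> bool" where
  "is_DOERFLER \<phi> \<phi>s r \<theta> \<Lambda> \<longleftrightarrow> doerfler_admissible \<phi> \<phi>s r \<theta> \<Lambda> \<and>
     (\<forall>\<Lambda>'. doerfler_admissible \<phi> \<phi>s r \<theta> \<Lambda>' \<longrightarrow> card \<Lambda> \<le> card \<Lambda>')"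

definition ENRICH :: "index set \<Rightarrow> nat \<Rightarrow> index set" where
  "ENRICH \<Lambda> J = {k \<in> KK. \<exists>l\<in>\<Lambda>. l1_dist k l \<le> J}"

text \<open>
  \<open>J\<^sub>\<theta>\<close> is taken as the smallest nonnegative integer: the decay bound for the inverse is only
  available for \<open>J \<ge> 0\<close>, and enriching with a negative radius would give the empty set.
\<close>

definition J_theta :: "real \<Rightarrow> real \<Rightarrow> real \<Rightarrow> real \<Rightarrow> real \<Rightarrow> real \<Rightarrow> real \<Rightarrow> nat" where
  "J_theta CA \<gamma>inv \<alpha>l \<alpha>u \<beta>l ds \<theta> =
     (LEAST J. CA * exp (- \<gamma>inv * real J) \<le> \<beta>l\<^sup>2 / ds * sqrt ((1 - \<theta>\<^sup>2) / (\<alpha>l * \<alpha>u)))"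

definition is_E_DOERFLER ::
  "(index \<Rightarrow> plane_fun) \<Rightarrow> (index \<Rightarrow> functional) \<Rightarrow>
   nat \<Rightarrow> functional \<Rightarrow> real \<Rightarrow> index set \<Rightarrow> bool" where
  "is_E_DOERFLER \<phi> \<phi>s J r \<theta> \<Lambda> \<longleftrightarrow> (\<exists>\<Lambda>s. is_DOERFLER \<phi> \<phi>s r \<theta> \<Lambda>s \<and> \<Lambda> = ENRICH \<Lambda>s J)"

text \<open>
  That \<open>w\<close> is within distance \<open>\<epsilon>\<close> of the exact solution is a precondition for calling this
  procedure that does not enter the definition of its output.
\<close>

definition is_COARSE ::
  "(index \<Rightarrow> plane_fun) \<Rightarrow> (index \<Rightarrow> functional) \<Rightarrow>
   real \<Rightarrow> index set \<Rightarrow> plane_fun \<Rightarrow> real \<Rightarrow> index set \<Rightarrow> bool" where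
  "is_COARSE \<phi> \<phi>s \<beta>l \<Lambda>s w \<epsilon> \<Lambda> \<longleftrightarrow>
     \<Lambda> \<subseteq> \<Lambda>s \<and> phi_norm \<phi> \<phi>s (\<lambda>x. w x - proj \<phi> \<phi>s \<Lambda> w x) \<le> 2 * \<beta>l * \<epsilon> \<and>
     (\<forall>\<Lambda>'. \<Lambda>' \<subseteq> \<Lambda>s \<and> phi_norm \<phi> \<phi>s (\<lambda>x. w x - proj \<phi> \<phi>s \<Lambda>' w x) \<le> 2 * \<beta>l * \<epsilon> \<longrightarrow> card \<Lambda> \<le> card \<Lambda>')"


section \<open>The algorithm\<close>

text \<open>One pass through the loop, from \<open>\<Lambda>\<close>, \<open>r\<close> to \<open>\<Lambda>'\<close>, \<open>u'\<close>, \<open>r'\<close>; the radius \<open>J\<close> is \<open>J\<^sub>\<theta>\<close>.\<close>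

definition fpc_step ::
  "plane_fun \<Rightarrow> plane_fun \<Rightarrow> functional \<Rightarrow>
   (index \<Rightarrow> plane_fun) \<Rightarrow> (index \<Rightarrow> functional) \<Rightarrow>
   real \<Rightarrow> real \<Rightarrow> real \<Rightarrow> nat \<Rightarrow> real \<Rightarrow> real \<Rightarrow>
   index set \<Rightarrow> functional \<Rightarrow>
   index set \<Rightarrow> plane_fun \<Rightarrow> functional \<Rightarrow> bool" where
  "fpc_step \<nu> \<sigma> f \<phi> \<phi>s \<alpha>l \<beta>l \<beta>u J \<theta> \<delta> \<Lambda> r \<Lambda>' u' r' \<longleftrightarrow>
     (\<exists>\<Lambda>d \<Lambda>h uh.
        is_E_DOERFLER \<phi> \<phi>s J r \<theta> \<Lambda>d \<and>
        \<Lambda>h = \<Lambda> \<union> \<Lambda>d \<and>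
        is_GAL \<nu> \<sigma> f \<phi> \<Lambda>h uh \<and>
        is_COARSE \<phi> \<phi>s \<beta>l \<Lambda>h uh (3 * (\<beta>u / \<alpha>l) * sqrt (1 - \<theta>\<^sup>2) * phi_dual_norm \<phi> r) \<Lambda>' \<and>
        is_GAL \<nu> \<sigma> f \<phi> \<Lambda>' u' \<and>
        is_F_RES \<nu> \<sigma> f \<phi> \<phi>s u' \<delta> r')"

text \<open>
  \<open>N\<close> is the number of passes performed, \<open>\<infinity>\<close> if the loop never ends.  The sequences record
  \<open>\<Lambda>\<^sub>n\<close>, \<open>u\<^sub>n\<close> and the approximate residuals for \<open>n \<le> N\<close>; their further values are irrelevant.  The
  continuation test comes after each pass, so the first pass is unconditional.  Runs that
  have not yet reached the stopping criterion are included.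
\<close>

definition fpc_run ::
  "plane_fun \<Rightarrow> plane_fun \<Rightarrow> functional \<Rightarrow>
   (index \<Rightarrow> plane_fun) \<Rightarrow> (index \<Rightarrow> functional) \<Rightarrow>
   real \<Rightarrow> real \<Rightarrow> real \<Rightarrow> nat \<Rightarrow> real \<Rightarrow> real \<Rightarrow> real \<Rightarrow> enat \<Rightarrow>
   (nat \<Rightarrow> index set) \<Rightarrow> (nat \<Rightarrow> plane_fun) \<Rightarrow>
   (nat \<Rightarrow> functional) \<Rightarrow> bool" where
  "fpc_run \<nu> \<sigma> f \<phi> \<phi>s \<alpha>l \<beta>l \<beta>u J \<theta> \<delta> tol N \<Lambda> u r \<longleftrightarrow>
     u 0 = (\<lambda>x. 0) \<and> \<Lambda> 0 = {} \<and> is_F_RES \<nu> \<sigma> f \<phi> \<phi>s (u 0) \<delta> (r 0) \<and>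
     (\<forall>n. enat n < N \<longrightarrow>
        fpc_step \<nu> \<sigma> f \<phi> \<phi>s \<alpha>l \<beta>l \<beta>u J \<theta> \<delta> (\<Lambda> n) (r n) (\<Lambda> (Suc n)) (u (Suc n)) (r (Suc n))) \<and>
     (\<forall>n. enat (Suc n) < N \<longrightarrow> phi_dual_norm \<phi> (r (Suc n)) > tol / (1 + \<delta>))"

end

theory Submission
  imports Defs "HOL-Complex_Analysis.Complex_Analysis"
begin

text \<open>
  The decay assumed of the stiffness matrix is rigid: it forces \<open>\<nu>\<close> to be constant and \<open>\<sigma>\<close> to vanish.  Write
  \<open>b = (1 - x\<^sup>2)(1 - y\<^sup>2)\<close>.  All but finitely many \<open>\<phi>\<^sub>k\<close> are elements of the orthonormal basis obtained from the
  \<open>\<eta>\<^sub>k\<close>, so for every polynomial \<open>P\<close> the functional \<open>a(bP, \<cdot>)\<close> has an \<open>H\<^sup>1\<^sub>0\<close> representer \<open>W\<^sub>P\<close> whose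
  expansion converges geometrically, hence extends analytically to a complex neighbourhood of the closed
  square, where \<open>\<L>(bP) = - \<Delta>W\<^sub>P\<close>.  Since \<open>W\<^sub>P\<close> vanishes for \<open>x = -1\<close> and for \<open>y = -1\<close>, the integral of \<open>\<Delta>W\<^sub>P\<close>
  over a small square in the characteristic coordinates \<open>(x + 1) \<plusminus> \<i>(y + 1)\<close> at the corner is zero.  Testing this
  with all \<open>P\<close> gives moment conditions which show that \<open>\<Delta>W\<^sub>P - \<nu>\<^sub>0 \<Delta>(bP)\<close> is zero for a constant \<open>\<nu>\<^sub>0\<close>.

  So \<open>a = \<nu>\<^sub>0 (\<cdot>, \<cdot>)\<close> on \<open>H\<^sup>1\<^sub>0\<close>, the Galerkin solutions are best approximations in the \<open>H\<^sup>1\<^sub>0\<close> norm, and the saturation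
  argument for the enriched Doerfler set followed by coarsening gives the factor \<open>\<rho>\<close> in that norm; for variable
  coefficients the same argument would lose a factor \<open>(\<alpha>\<^sup>*/\<alpha>\<^sub>*)\<^sup>1\<^sup>/\<^sup>2\<close> in passing from the energy norm.
\<close>

section \<open>Bump functions and the fundamental lemma\<close>

text \<open>Decay is so restrictive because of the corners. The Dirichlet problem for the Laplacian
  on a square has singular solutions there unless the data satisfy compatibility conditions, while a
  geometrically convergent expansion forces the representer to be analytic across the corner. Each
  polynomial P contributes one such condition, and only multiples of the Laplacian meet all of them.
  Two obstacles shape the argument. The coefficients are controlled in the open square only, so
  \<nu> is never differentiated: the coefficients of \<L>(b P) are recovered weakly, from
  commutators with the coordinates. And the H1 norm does not bound values in two dimensions, so the
  growth of the orthonormal basis on complex ellipses is measured on a primitive in y and recovered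
  by a Cauchy estimate. The 9 in \<rho> is 3 times 3: before coarsening three errors of equal size
  add up (approximate residual, Doerfler complement, truncated inverse); coarsening with tolerance
  twice that error, followed by a Galerkin solve, costs another factor 3. The remaining factors come
  from bounding the approximate residual by the error.\<close>

lemma Ck_SucI:
  assumes "\<And>x. (f has_derivative f' x) (at x)"
    and "\<And>b. b \<in> Basis \<Longrightarrow> Ck_on n UNIV (\<lambda>x. f' x b)"
  shows "Ck_on (Suc n) UNIV f"
proof -
  have "frechet_derivative f (at x) = f' x" for x
    using frechet_derivative_at[OF assms(1)] by simp
  then show ?thesis
    using assms by (auto simp: differentiable_def)
qed

lemma Ck_SucD:
  assumes "Ck_on (Suc n) UNIV f"
  obtains f' where "\<And>x. (f has_derivative f' x) (at x)"
    and "\<And>b. b \<in> Basis \<Longrightarrow> Ck_on n UNIV (\<lambda>x. f' x b)"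
  using that[of "\<lambda>x. frechet_derivative f (at x)"] assms
  by (auto simp: frechet_derivative_works)

lemma Ck_dec: "Ck_on (Suc n) UNIV f \<Longrightarrow> Ck_on n UNIV f"
proof (induction n arbitrary: f)
  case 0
  then obtain f' where "\<And>x. (f has_derivative f' x) (at x)" by (rule Ck_SucD) blast
  then show ?case
    by (auto intro!: has_derivative_continuous_on[of UNIV f f'])
next
  case (Suc n)
  from Suc.prems obtain f' where f': "\<And>x. (f has_derivative f' x) (at x)"
     "\<And>b. b \<in> Basis \<Longrightarrow> Ck_on (Suc n) UNIV (\<lambda>x. f' x b)"
    by (rule Ck_SucD) blast
  show ?case
    by (rule Ck_SucI[OF f'(1)]) (use Suc.IH f'(2) in auto)
qed

lemma Ck_const: "Ck_on n UNIV (\<lambda>x. c)"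
proof (induction n arbitrary: c)
  case (Suc n)
  show ?case
    by (rule Ck_SucI[where f' = "\<lambda>_ _. 0"]) (use Suc in \<open>auto\<close>)
qed auto

lemma Ck_add: "Ck_on n UNIV f \<Longrightarrow> Ck_on n UNIV g \<Longrightarrow> Ck_on n UNIV (\<lambda>x. f x + g x)"
proof (induction n arbitrary: f g)
  case 0
  then show ?case by (auto intro: continuous_intros)
next
  case (Suc n)
  from Suc.prems obtain f' g' where f': "\<And>x. (f has_derivative f' x) (at x)"
     "\<And>b. b \<in> Basis \<Longrightarrow> Ck_on n UNIV (\<lambda>x. f' x b)"
     and g': "\<And>x. (g has_derivative g' x) (at x)"
     "\<And>b. b \<in> Basis \<Longrightarrow> Ck_on n UNIV (\<lambda>x. g' x b)"
    by (metis Ck_SucD)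
  show ?case
    by (rule Ck_SucI[where f' = "\<lambda>x h. f' x h + g' x h"])
      (use f' g' Suc.IH in \<open>auto intro!: derivative_intros\<close>)
qed

lemma Ck_mult: "Ck_on n UNIV f \<Longrightarrow> Ck_on n UNIV g \<Longrightarrow> Ck_on n UNIV (\<lambda>x. f x * g x)"
proof (induction n arbitrary: f g)
  case 0
  then show ?case by (auto intro: continuous_intros)
next
  case (Suc n)
  from Suc.prems obtain f' g' where f': "\<And>x. (f has_derivative f' x) (at x)"
     "\<And>b. b \<in> Basis \<Longrightarrow> Ck_on n UNIV (\<lambda>x. f' x b)"
     and g': "\<And>x. (g has_derivative g' x) (at x)"
     "\<And>b. b \<in> Basis \<Longrightarrow> Ck_on n UNIV (\<lambda>x. g' x b)"
    by (metis Ck_SucD)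
  show ?case
    by (rule Ck_SucI[where f' = "\<lambda>x h. f x * g' x h + f' x h * g x"])
      (use f' g' Suc.IH Ck_dec[OF Suc.prems(1)] Ck_dec[OF Suc.prems(2)]
       in \<open>auto intro!: derivative_intros Ck_add simp del: Ck_on.simps\<close>)
qed

lemma Ck_linear:
  assumes "bounded_linear f"
  shows "Ck_on n UNIV f"
proof (cases n)
  case 0
  then show ?thesis using assms by (auto simp: linear_continuous_on)
next
  case (Suc m)
  show ?thesis unfolding Suc
    by (rule Ck_SucI[where f' = "\<lambda>x. f"])
      (use assms in \<open>auto intro!: Ck_const bounded_linear_imp_has_derivative\<close>)
qed

text \<open>The functions \<open>p(1/t) e\<^sup>-\<^sup>1\<^sup>/\<^sup>t\<close>, extended by zero to \<open>t \<le> 0\<close>, are stable under differentiation.\<close>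

definition flat :: "real poly \<Rightarrow> real \<Rightarrow> real" where
  "flat p t = (if t > 0 then poly p (1 / t) * exp (- (1 / t)) else 0)"

text \<open>In the variable s = 1/t one has d/dt = -s^2 d/ds, so p(s) e^(-s) is sent to s^2 (p - p')
  e^(-s).\<close>

definition flat_deriv :: "real poly \<Rightarrow> real poly" where
  "flat_deriv p = [:0, 0, 1:] * (p - pderiv p)"

lemma poly_exp_tendsto_0: "((\<lambda>s. poly p s * exp (- s)) \<longlongrightarrow> (0::real)) at_top"
proof -
  have "((\<lambda>s. \<Sum>i\<le>degree p. coeff p i * (s ^ i / exp s)) \<longlongrightarrow> (\<Sum>i\<le>degree p. coeff p i * 0)) at_top"
    by (intro tendsto_intros tendsto_power_div_exp_0)
  then show ?thesis
    by (simp add: poly_altdef exp_minus divide_inverse sum_distrib_right mult.assoc)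
qed

lemma flat_tendsto_0: "(flat p \<longlongrightarrow> 0) (at 0)"
proof -
  have "((\<lambda>t. poly p (1/t) * exp (- (1/t))) \<longlongrightarrow> 0) (at_right 0)"
    using filterlim_compose[OF poly_exp_tendsto_0 filterlim_inverse_at_top_right]
    by (simp add: inverse_eq_divide)
  then have "(flat p \<longlongrightarrow> 0) (at_right 0)"
    by (rule Lim_transform_eventually) (auto simp: flat_def eventually_at_right_less eventually_at_filter)
  moreover have "(flat p \<longlongrightarrow> 0) (at_left 0)"
    by (rule Lim_transform_eventually[OF tendsto_const]) (auto simp: flat_def eventually_at_filter)
  ultimately show ?thesis by (simp add: filterlim_split_at)
qed

lemma flat_has_derivative: "(flat p has_real_derivative flat (flat_deriv p) t) (at t)"
proof -
  consider "t > 0" | "t < 0" | "t = 0" by linarith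
  then show ?thesis
  proof cases
    case 1
    have "((\<lambda>t. poly p (1/t) * exp (- (1/t))) has_real_derivative flat (flat_deriv p) t) (at t)"
      using 1 by (auto intro!: derivative_eq_intros simp: flat_def flat_deriv_def field_simps power2_eq_square)
    then show ?thesis
      by (rule DERIV_cong_ev[THEN iffD1, rotated 3])
        (use 1 eventually_nhds_in_open[of "{0<..}" t] in \<open>auto simp: flat_def elim: eventually_mono\<close>)
  next
    case 2
    have "((\<lambda>t. 0) has_real_derivative 0) (at t)" by simp
    then have "(flat p has_real_derivative 0) (at t)"
      by (rule DERIV_cong_ev[THEN iffD1, rotated 3])
        (use 2 eventually_nhds_in_open[of "{..<0}" t] in \<open>auto simp: flat_def elim: eventually_mono\<close>)
    then show ?thesis using 2 by (simp add: flat_def)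
  next
    case 3
    \<comment> \<open>For h > 0, dividing by h multiplies p(s) by s = 1/h, which is
      \<open>pCons 0 p\<close>; so the difference quotient at 0 is again a function of the same
      family and tends to 0.\<close>
    have "((\<lambda>h. flat (pCons 0 p) h) \<longlongrightarrow> 0) (at 0)" by (rule flat_tendsto_0)
    then have "((\<lambda>h. (flat p (0 + h) - flat p 0) / h) \<longlongrightarrow> 0) (at 0)"
      by (rule Lim_transform_eventually) (auto simp: flat_def eventually_at_filter)
    then show ?thesis using 3 by (simp add: DERIV_def flat_def)
  qed
qed

lemma Ck_flat_affine: "Ck_on n UNIV (\<lambda>z::'a::euclidean_space. flat p (c + z \<bullet> v))"
proof (induction n arbitrary: p)
  case 0
  have "continuous_on UNIV (flat p)"
    using flat_has_derivative by (meson DERIV_continuous_on continuous_on_eq_continuous_within has_field_derivative_at_within)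
  then show ?case
    by (auto intro!: continuous_on_compose2[of UNIV "flat p"] continuous_intros)
next
  case (Suc n)
  show ?case
  proof (rule Ck_SucI)
    show "((\<lambda>z. flat p (c + z \<bullet> v)) has_derivative (\<lambda>h. (h \<bullet> v) * flat (flat_deriv p) (c + x \<bullet> v))) (at x)" for x
    proof -
      have "((\<lambda>z. c + z \<bullet> v) has_derivative (\<lambda>h. h \<bullet> v)) (at x)"
        by (auto intro!: derivative_eq_intros)
      from this flat_has_derivative[of p "c + x \<bullet> v", unfolded has_field_derivative_def]
      show ?thesis
        by (rule has_derivative_compose[THEN has_derivative_eq_rhs]) (auto simp: mult.commute)
    qed
  qed (use Suc in \<open>auto intro!: Ck_mult Ck_const\<close>)
qed

section \<open>Test functions and smooth approximations of box indicators\<close>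

lemma smooth_on_lincomb:
  assumes "smooth_on UNIV f" "smooth_on UNIV g"
  shows "smooth_on UNIV (\<lambda>x. f x + g x)" "smooth_on UNIV (\<lambda>x. f x * g x)" "smooth_on UNIV (\<lambda>x. c * f x)"
  using assms unfolding smooth_on_def by (simp_all add: Ck_add Ck_mult Ck_const)

lemma test_functionsI:
  assumes "smooth_on UNIV v" "compact S" "S \<subseteq> Omega" "\<And>x. x \<notin> S \<Longrightarrow> v x = 0"
  shows "v \<in> test_functions"
  using assms unfolding test_functions_def by blast

lemma test_functionsE:
  assumes "v \<in> test_functions"
  obtains S where "smooth_on UNIV v" "compact S" "S \<subseteq> Omega" "\<And>x. x \<notin> S \<Longrightarrow> v x = 0"
  using assms unfolding test_functions_def by blast

lemma test_functions_mult:
  assumes "v \<in> test_functions" "smooth_on UNIV f"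
  shows "(\<lambda>x. f x * v x) \<in> test_functions"
proof -
  obtain S where S: "smooth_on UNIV v" "compact S" "S \<subseteq> Omega" "\<And>x. x \<notin> S \<Longrightarrow> v x = 0"
    using test_functionsE[OF assms(1)] by blast
  show ?thesis
    by (rule test_functionsI[OF smooth_on_lincomb(2)[OF assms(2) S(1)] S(2,3)]) (simp add: S(4))
qed

lemma test_functions_add:
  assumes "v \<in> test_functions" "w \<in> test_functions"
  shows "(\<lambda>x. v x + w x) \<in> test_functions"
proof -
  obtain S where S: "smooth_on UNIV v" "compact S" "S \<subseteq> Omega" "\<And>x. x \<notin> S \<Longrightarrow> v x = 0"
    using test_functionsE[OF assms(1)] by blast
  obtain T where T: "smooth_on UNIV w" "compact T" "T \<subseteq> Omega" "\<And>x. x \<notin> T \<Longrightarrow> w x = 0"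
    using test_functionsE[OF assms(2)] by blast
  show ?thesis
    by (rule test_functionsI[OF smooth_on_lincomb(1)[OF S(1) T(1)], of "S \<union> T"]) (use S T in auto)
qed

lemma test_functions_cmult:
  assumes "v \<in> test_functions"
  shows "(\<lambda>x. c * v x) \<in> test_functions"
  using test_functions_mult[OF assms, of "\<lambda>_. c"] by (auto simp: smooth_on_def Ck_const)

text \<open>For k > 0 each factor vanishes up to distance 1/k inside one side and tends to 1 further
  in as k grows. So the support is compact in the open box, and the pointwise limit is the indicator
  of that box.\<close>

definition bump :: "real \<times> real \<Rightarrow> real \<times> real \<Rightarrow> real \<Rightarrow> plane_fun" where
  "bump a b k z = flat 1 (k * (fst z - fst a) - 1) * flat 1 (k * (fst b - fst z) - 1) *
     flat 1 (k * (snd z - snd a) - 1) * flat 1 (k * (snd b - snd z) - 1)"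

lemma smooth_bump: "smooth_on UNIV (bump a b k)"
proof -
  have "Ck_on n UNIV (\<lambda>z::real\<times>real. flat 1 (k * (fst z - fst a) - 1))" for n
    using Ck_flat_affine[of n 1 "- k * fst a - 1" "(k, 0) :: real \<times> real"]
    by (rule back_subst[of "Ck_on n UNIV"]) (auto simp: fun_eq_iff inner_prod_def algebra_simps intro!: arg_cong[of _ _ "flat 1"])
  moreover have "Ck_on n UNIV (\<lambda>z::real\<times>real. flat 1 (k * (snd z - snd a) - 1))" for n
    using Ck_flat_affine[of n 1 "- k * snd a - 1" "(0, k) :: real \<times> real"]
    by (rule back_subst[of "Ck_on n UNIV"]) (auto simp: fun_eq_iff inner_prod_def algebra_simps intro!: arg_cong[of _ _ "flat 1"])
  moreover have "Ck_on n UNIV (\<lambda>z::real\<times>real. flat 1 (k * (fst b - fst z) - 1))" for n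
    using Ck_flat_affine[of n 1 "k * fst b - 1" "(-k, 0) :: real \<times> real"]
    by (rule back_subst[of "Ck_on n UNIV"]) (auto simp: fun_eq_iff inner_prod_def algebra_simps intro!: arg_cong[of _ _ "flat 1"])
  moreover have "Ck_on n UNIV (\<lambda>z::real\<times>real. flat 1 (k * (snd b - snd z) - 1))" for n
    using Ck_flat_affine[of n 1 "k * snd b - 1" "(0, -k) :: real \<times> real"]
    by (rule back_subst[of "Ck_on n UNIV"]) (auto simp: fun_eq_iff inner_prod_def algebra_simps intro!: arg_cong[of _ _ "flat 1"])
  ultimately show ?thesis
    unfolding bump_def smooth_on_def by (intro allI Ck_mult)
qed

lemma bump_bounds: "0 \<le> bump a b k z" "bump a b k z \<le> 1"
proof -
  have "0 \<le> flat 1 t \<and> flat 1 t \<le> 1" for t by (auto simp: flat_def)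
  then show "0 \<le> bump a b k z" "bump a b k z \<le> 1"
    unfolding bump_def by (intro mult_le_one mult_nonneg_nonneg; simp)+
qed

lemma Omega_eq_box: "Omega = box (-1, -1) (1, 1)"
  by (auto simp: Omega_def box_def Basis_prod_def inner_prod_def)

lemma mem_box_pair: "z \<in> box a b \<longleftrightarrow> fst a < fst z \<and> fst z < fst b \<and> snd a < snd z \<and> snd z < snd b"
  for a b z :: "real \<times> real"
  by (auto simp: box_def Basis_prod_def inner_prod_def)

lemma mem_cbox_pair: "z \<in> cbox a b \<longleftrightarrow> fst a \<le> fst z \<and> fst z \<le> fst b \<and> snd a \<le> snd z \<and> snd z \<le> snd b"
  for a b z :: "real \<times> real"
  by (auto simp: cbox_def Basis_prod_def inner_prod_def)

lemma bump_test:
  assumes "box a b \<subseteq> Omega" "0 < k"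
  shows "bump a b k \<in> test_functions"
proof -
  define S where "S = cbox (fst a + 1/k, snd a + 1/k) (fst b - 1/k, snd b - 1/k)"
  have "S \<subseteq> box a b"
    using assms(2) by (auto simp: S_def mem_box_pair mem_cbox_pair) (smt (verit) divide_pos_pos)+
  moreover have "bump a b k x = 0" if "x \<notin> S" for x
  proof -
    have *: "k * c - 1 \<le> 0" if "c < 1 / k" for c
      using that assms(2) by (simp add: field_simps)
    have "fst x - fst a < 1/k \<or> fst b - fst x < 1/k \<or> snd x - snd a < 1/k \<or> snd b - snd x < 1/k"
      using that by (auto simp: S_def mem_cbox_pair)
    then have "k * (fst x - fst a) - 1 \<le> 0 \<or> k * (fst b - fst x) - 1 \<le> 0 \<or>
        k * (snd x - snd a) - 1 \<le> 0 \<or> k * (snd b - snd x) - 1 \<le> 0"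
      using * by blast
    then show ?thesis
      by (auto simp: bump_def flat_def)
  qed
  ultimately show ?thesis
    using assms(1) by (intro test_functionsI[OF smooth_bump, of S]) (auto simp: S_def)
qed

lemma flat_tendsto_1:
  assumes "c > 0"
  shows "(\<lambda>k. flat 1 (real (Suc k) * c - 1)) \<longlonglongrightarrow> 1"
proof -
  have lim: "filterlim (\<lambda>k. real (Suc k) * c - 1) at_top sequentially"
    using filterlim_tendsto_add_at_top[OF tendsto_const[of "-1"] filterlim_at_top_mult_tendsto_pos[OF tendsto_const assms filterlim_compose[OF filterlim_real_sequentially filterlim_Suc]]]
    by simp
  have "(\<lambda>k. exp (- (1 / (real (Suc k) * c - 1)))) \<longlonglongrightarrow> exp (- 0)"
    by (intro tendsto_intros tendsto_divide_0[OF tendsto_const] filterlim_at_top_imp_at_infinity[OF lim])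
  moreover have "\<forall>\<^sub>F k in sequentially. exp (- (1 / (real (Suc k) * c - 1))) = flat 1 (real (Suc k) * c - 1)"
    using lim[unfolded filterlim_at_top_dense, rule_format, of 0]
    by eventually_elim (simp add: flat_def)
  ultimately show ?thesis
    using Lim_transform_eventually by force
qed

lemma bump_tendsto: "(\<lambda>k. bump a b (real (Suc k)) z) \<longlonglongrightarrow> indicator (box a b) z"
proof (cases "z \<in> box a b")
  case True
  then have "(\<lambda>k. bump a b (real (Suc k)) z) \<longlonglongrightarrow> 1 * 1 * 1 * 1"
    unfolding bump_def by (intro tendsto_mult flat_tendsto_1) (auto simp: mem_box_pair)
  with True show ?thesis by simp
next
  case False
  have "flat 1 (real (Suc k) * c - 1) = 0" if "c \<le> 0" for k c
    using that mult_nonneg_nonpos[of "real (Suc k)" c] by (auto simp: flat_def simp del: of_nat_Suc)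
  then have "bump a b (real (Suc k)) z = 0" for k
    using False by (auto simp: bump_def mem_box_pair not_less)
  with False show ?thesis by simp
qed

section \<open>Lebesgue measure on the square, bounded multipliers, the fundamental lemma\<close>

abbreviation MO :: "(real \<times> real) measure" where "MO \<equiv> lebesgue_on Omega"

lemma Omega_lmeasurable: "Omega \<in> lmeasurable"
  by (simp add: Omega_eq_box)

lemma Omega_sets[simp]: "Omega \<in> sets lebesgue"
  using Omega_lmeasurable by (rule fmeasurableD)

lemma open_Omega: "open Omega"
  unfolding Omega_eq_box by (rule open_box)

interpretation MO: finite_measure MO
  using finite_measure_lebesgue_on[OF Omega_lmeasurable] .

lemma borel_indicator_MO: "A \<in> sets borel \<Longrightarrow> indicator A \<in> borel_measurable MO"
  by (intro measurable_restrict_space1 borel_measurable_indicator) (auto intro: lborelD)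

lemma integrable_mult_bounded:
  fixes h :: "'a \<Rightarrow> real"
  assumes "integrable M h" "b \<in> borel_measurable M" "\<And>x. x \<in> space M \<Longrightarrow> \<bar>b x\<bar> \<le> B"
  shows "integrable M (\<lambda>x. b x * h x)"
proof (rule Bochner_Integration.integrable_bound)
  show "integrable M (\<lambda>x. B * h x)" using assms by simp
  show "(\<lambda>x. b x * h x) \<in> borel_measurable M" using assms by auto
  show "AE x in M. norm (b x * h x) \<le> norm (B * h x)"
  proof (rule AE_I2)
    fix x assume "x \<in> space M"
    then have "\<bar>b x\<bar> \<le> \<bar>B\<bar>" using assms(3) by fastforce
    then show "norm (b x * h x) \<le> norm (B * h x)"
      by (auto simp: abs_mult intro: mult_right_mono)
  qed
qed

lemma test_functions_continuous:
  assumes "v \<in> test_functions"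
  shows "continuous_on UNIV v"
proof -
  have "smooth_on UNIV v" using assms by (rule test_functionsE)
  then have "Ck_on 0 UNIV v" unfolding smooth_on_def by (rule spec)
  then show ?thesis by (simp only: Ck_on.simps)
qed

lemma continuous_imp_MO_measurable:
  fixes f :: "real \<times> real \<Rightarrow> 'a::euclidean_space"
  shows "continuous_on UNIV f \<Longrightarrow> f \<in> borel_measurable MO"
  by (rule continuous_imp_measurable_on_sets_lebesgue[OF continuous_on_subset[OF _ subset_UNIV]]) simp_all

lemma continuous_bounded_Omega:
  fixes f :: "real \<times> real \<Rightarrow> real"
  assumes "continuous_on UNIV f"
  shows "\<exists>B. \<forall>x\<in>Omega. \<bar>f x\<bar> \<le> B"
proof -
  have "bounded (f ` cbox (-1,-1) (1,1))"
    by (intro compact_imp_bounded compact_continuous_image continuous_on_subset[OF assms]) auto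
  then obtain B where "\<forall>x\<in>cbox (-1,-1) (1,1). \<bar>f x\<bar> \<le> B"
    unfolding bounded_iff by auto
  then show ?thesis using box_subset_cbox[of "(-1,-1) :: real \<times> real" "(1,1)"] by (auto simp: Omega_eq_box)
qed

text \<open>An algebra of multipliers that preserves integrability and \<open>L2\<close>. It
  contains test functions, polynomials and also the coefficients, which are smooth in the open
  square without any continuity up to the boundary.\<close>

definition bdd_meas :: "plane_fun \<Rightarrow> bool" where
  "bdd_meas f \<longleftrightarrow> f \<in> borel_measurable MO \<and> (\<exists>B. \<forall>x\<in>Omega. \<bar>f x\<bar> \<le> B)"

lemma bdd_meas_continuous: "continuous_on UNIV f \<Longrightarrow> bdd_meas f"
  by (simp add: bdd_meas_def continuous_imp_MO_measurable continuous_bounded_Omega)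

lemma bdd_meas_mult: assumes "bdd_meas f" "bdd_meas g" shows "bdd_meas (\<lambda>x. f x * g x)"
proof -
  obtain B C where "\<forall>x\<in>Omega. \<bar>f x\<bar> \<le> B" "\<forall>x\<in>Omega. \<bar>g x\<bar> \<le> C" using assms by (auto simp: bdd_meas_def)
  then have "\<forall>x\<in>Omega. \<bar>f x * g x\<bar> \<le> B * C"
    unfolding abs_mult by (intro ballI mult_mono') auto
  then show ?thesis using assms by (auto simp: bdd_meas_def)
qed

lemma bdd_meas_add: assumes "bdd_meas f" "bdd_meas g" shows "bdd_meas (\<lambda>x. f x + g x)"
proof -
  obtain B C where "\<forall>x\<in>Omega. \<bar>f x\<bar> \<le> B" "\<forall>x\<in>Omega. \<bar>g x\<bar> \<le> C" using assms by (auto simp: bdd_meas_def)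
  then have "\<forall>x\<in>Omega. \<bar>f x + g x\<bar> \<le> B + C"
    by (intro ballI order_trans[OF abs_triangle_ineq] add_mono) auto
  then show ?thesis using assms by (auto simp: bdd_meas_def)
qed

lemma bdd_meas_const: "bdd_meas (\<lambda>x. c)"
  by (intro bdd_meas_continuous continuous_intros)

lemma bdd_meas_diff: assumes "bdd_meas f" "bdd_meas g" shows "bdd_meas (\<lambda>x. f x - g x)"
  using bdd_meas_add[OF assms(1) bdd_meas_mult[OF bdd_meas_const[of "-1"] assms(2)]] by simp

lemma bdd_meas_mult_integrable: "bdd_meas b \<Longrightarrow> integrable MO h \<Longrightarrow> integrable MO (\<lambda>x. b x * h x)"
  by (auto simp: bdd_meas_def intro!: integrable_mult_bounded)

lemma bdd_meas_integrable: "bdd_meas b \<Longrightarrow> integrable MO b"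
  using bdd_meas_mult_integrable[of b "\<lambda>x. 1"] by simp

text \<open>Bumps approximate indicators of open boxes, the open boxes form a pi-system generating
  the Borel sets, and a Lebesgue set differs from a Borel set by part of a null set. So
  \<open>h\<close> has zero integral over every measurable set. Every weak identity below becomes an
  almost everywhere identity through this lemma.\<close>

lemma fundamental_lemma:
  assumes h: "integrable MO h"
    and test: "\<And>\<psi>. \<psi> \<in> test_functions \<Longrightarrow> (LINT x|MO. \<psi> x * h x) = 0"
  shows "AE x in MO. h x = (0::real)"
proof -
  have int: "integrable MO (\<lambda>x. indicator A x * h x)" if "A \<in> sets borel" for A
    by (rule integrable_mult_bounded[OF h borel_indicator_MO[OF that], where B = 1]) (auto simp: indicator_def)
  have box0: "(LINT x|MO. indicator (box a b) x * h x) = 0" if "box a b \<subseteq> Omega" for a b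
  proof -
    have "(\<lambda>k. LINT x|MO. bump a b (real (Suc k)) x * h x) \<longlonglongrightarrow> (LINT x|MO. indicator (box a b) x * h x)"
    proof (rule integral_dominated_convergence[where w = "\<lambda>x. \<bar>h x\<bar>"])
      show "(\<lambda>x. indicator (box a b) x * h x) \<in> borel_measurable MO"
        by (rule borel_measurable_integrable[OF int]) simp
      show "(\<lambda>x. bump a b (real (Suc k)) x * h x) \<in> borel_measurable MO" for k
        using h continuous_imp_MO_measurable[OF test_functions_continuous[OF bump_test[OF that]]] by auto
      show "integrable MO (\<lambda>x. \<bar>h x\<bar>)" using h by simp
      show "AE x in MO. (\<lambda>k. bump a b (real (Suc k)) x * h x) \<longlonglongrightarrow> indicator (box a b) x * h x"
        by (intro AE_I2 tendsto_intros bump_tendsto)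
      show "AE x in MO. norm (bump a b (real (Suc k)) x * h x) \<le> \<bar>h x\<bar>" for k
        using bump_bounds[of a b "real (Suc k)"]
        by (intro AE_I2) (simp only: real_norm_def abs_mult abs_of_nonneg mult_left_le_one_le abs_ge_zero)
    qed
    moreover have "(LINT x|MO. bump a b (real (Suc k)) x * h x) = 0" for k
      by (rule test[OF bump_test[OF that]]) simp
    ultimately show ?thesis by (simp add: LIMSEQ_const_iff)
  qed
  \<comment> \<open>Intersecting with the square gives a box again, so the generating pi-system can
    consist of all boxes of the plane.\<close>
  have box0': "(LINT x|MO. indicator (box a b) x * h x) = 0" for a b
  proof -
    have eq: "box a b \<inter> Omega = box (max (fst a) (-1), max (snd a) (-1)) (min (fst b) 1, min (snd b) 1)"
      by (auto simp: Omega_eq_box mem_box_pair)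
    have "(LINT x|MO. indicator (box a b) x * h x) = (LINT x|MO. indicator (box a b \<inter> Omega) x * h x)"
      by (rule Bochner_Integration.integral_cong) (auto simp: indicator_def)
    also have "\<dots> = 0" unfolding eq by (rule box0) (use eq in blast)
    finally show ?thesis .
  qed
  have borel0: "(LINT x|MO. indicator A x * h x) = 0" if "A \<in> sets borel" for A
  proof -
    let ?G = "range (\<lambda>(a, b). box a b :: (real \<times> real) set)"
    have sets: "sets borel = sigma_sets UNIV ?G"
      by (subst borel_eq_box) simp
    have "Int_stable ?G"
    proof (rule Int_stableI)
      fix A B assume "A \<in> ?G" "B \<in> ?G"
      then obtain a b c d where "A = box a b" "B = box c d" by auto
      then have "A \<inter> B = box (max (fst a) (fst c), max (snd a) (snd c)) (min (fst b) (fst d), min (snd b) (snd d))"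
        by (auto simp: mem_box_pair)
      then show "A \<inter> B \<in> ?G" by (metis (mono_tags, lifting) case_prod_conv rangeI)
    qed
    moreover have "?G \<subseteq> Pow UNIV" by simp
    moreover have "A \<in> sigma_sets UNIV ?G" using that sets by simp
    ultimately show ?thesis
    proof (induction rule: sigma_sets_induct_disjoint)
      case (basic A)
      then show ?case using box0' by auto
    next
      case empty
      then show ?case by simp
    next
      case (compl A)
      then have A: "A \<in> sets borel" using sets by simp
      have "(LINT x|MO. h x) = (LINT x|MO. indicator Omega x * h x)"
        by (rule Bochner_Integration.integral_cong) auto
      also have "\<dots> = 0" using box0' unfolding Omega_eq_box .
      finally have "(LINT x|MO. h x - indicator A x * h x) = 0"
        using compl h int[OF A] by simp
      moreover have "(\<lambda>x. indicator (UNIV - A) x * h x) = (\<lambda>x. h x - indicator A x * h x)"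
        by (auto simp: indicator_def)
      ultimately show ?case by simp
    next
      case (union A)
      then have A: "A i \<in> sets borel" for i using sets by auto
      have "(\<lambda>i. LINT x|MO. indicator (\<Union>j<i. A j) x * h x) \<longlonglongrightarrow> (LINT x|MO. indicator (\<Union>i. A i) x * h x)"
      proof (rule integral_dominated_convergence[where w = "\<lambda>x. \<bar>h x\<bar>"])
        show "(\<lambda>x. indicator (\<Union>i. A i) x * h x) \<in> borel_measurable MO"
          by (rule borel_measurable_integrable[OF int]) (use A in auto)
        show "(\<lambda>x. indicator (\<Union>j<i. A j) x * h x) \<in> borel_measurable MO" for i
          by (rule borel_measurable_integrable[OF int]) (use A in auto)
        show "integrable MO (\<lambda>x. \<bar>h x\<bar>)" using h by simp
        show "AE x in MO. (\<lambda>i. indicator (\<Union>j<i. A j) x * h x) \<longlonglongrightarrow> indicator (\<Union>i. A i) x * h x"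
          by (intro AE_I2 tendsto_mult LIMSEQ_indicator_UN tendsto_const)
        show "AE x in MO. norm (indicator (\<Union>j<i. A j) x * h x) \<le> \<bar>h x\<bar>" for i
          by (intro AE_I2) (auto simp: indicator_def)
      qed
      moreover have "(LINT x|MO. indicator (\<Union>j<i. A j) x * h x) = 0" for i
      proof -
        have eq: "indicator (\<Union>j<i. A j) x * h x = (\<Sum>j<i. indicator (A j) x * h x)" for x
          using union(1) by (subst indicator_UN_disjoint) (auto simp: disjoint_family_on_def sum_distrib_right)
        show ?thesis unfolding eq using union(3) int[OF A]
          by (subst Bochner_Integration.integral_sum) (auto simp del: sum_mult_indicator)
      qed
      ultimately show ?case by (simp add: LIMSEQ_const_iff)
    qed
  qed
  show ?thesis
  proof (rule density_unique_real[OF h])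
    show "integrable MO (\<lambda>x. 0::real)" by simp
    fix A assume "A \<in> sets MO"
    then have "A \<in> sets lebesgue" using sets_restrict_space_iff[of Omega lebesgue] by simp
    then obtain S N N' where A: "A = S \<union> N" "N \<subseteq> N'" "N' \<in> null_sets lborel" "S \<in> sets borel"
      by (rule sets_completionE) simp
    have "AE x in lebesgue. x \<notin> N'"
      using A(3) by (intro AE_completion AE_not_in)
    then have "AE x in MO. x \<notin> N'"
      by (subst AE_restrict_space_iff) auto
    then have "AE x in MO. indicator A x *\<^sub>R h x = indicator S x * h x"
      by eventually_elim (use A in \<open>auto simp: indicator_def\<close>)
    then have "(LINT x:A|MO. h x) = (LINT x|MO. indicator S x * h x)"
      unfolding set_lebesgue_integral_def
      by (intro integral_cong_AE)
         (use \<open>A \<in> sets MO\<close> A(4) borel_measurable_integrable[OF int[OF A(4)]] h in \<open>auto\<close>)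
    then show "(LINT x:A|MO. h x) = (LINT x:A|MO. 0)"
      using borel0[OF A(4)] by simp
  qed
qed

lemma fundamental_lemma_eq:
  assumes "integrable MO g" "integrable MO h"
    and "\<And>\<psi>. \<psi> \<in> test_functions \<Longrightarrow> (LINT x|MO. \<psi> x * g x) = (LINT x|MO. \<psi> x * (h x :: real))"
  shows "AE x in MO. g x = h x"
proof -
  have "AE x in MO. g x - h x = 0"
  proof (rule fundamental_lemma)
    fix \<psi> assume \<psi>: "\<psi> \<in> test_functions"
    then have "bdd_meas \<psi>" by (intro bdd_meas_continuous test_functions_continuous)
    then show "(LINT x|MO. \<psi> x * (g x - h x)) = 0"
      using assms \<psi> by (simp add: right_diff_distrib bdd_meas_mult_integrable)
  qed (use assms in simp)
  then show ?thesis by simp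
qed

section \<open>Square integrable functions and uniqueness of weak gradients\<close>

lemma L2_integrable_norm: "g \<in> L2 \<Longrightarrow> integrable MO (\<lambda>x. (norm (g x))\<^sup>2)"
  by (simp add: L2_def)

lemma L2_measurable: "g \<in> L2 \<Longrightarrow> g \<in> borel_measurable MO"
  by (simp add: L2_def)

lemma L2I:
  assumes "g \<in> borel_measurable MO" "integrable MO w" "\<And>x. x \<in> Omega \<Longrightarrow> (norm (g x))\<^sup>2 \<le> w x"
  shows "g \<in> L2"
proof -
  have "integrable MO (\<lambda>x. (norm (g x))\<^sup>2)"
  proof (rule Bochner_Integration.integrable_bound[OF assms(2)])
    show "(\<lambda>x. (norm (g x))\<^sup>2) \<in> borel_measurable MO" using assms(1) by simp
    show "AE x in MO. norm ((norm (g x))\<^sup>2) \<le> norm (w x)"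
    proof (rule AE_I2)
      fix x assume "x \<in> space MO"
      then have "(norm (g x))\<^sup>2 \<le> w x" using assms(3) by simp
      then show "norm ((norm (g x))\<^sup>2) \<le> norm (w x)" by simp
    qed
  qed
  with assms(1) show ?thesis by (simp add: L2_def)
qed

lemma L2_integrable:
  assumes "g \<in> L2"
  shows "integrable MO g"
proof (rule Bochner_Integration.integrable_bound)
  show "integrable MO (\<lambda>x. 1 + (norm (g x))\<^sup>2)" using L2_integrable_norm[OF assms] by simp
  show "AE x in MO. norm (g x) \<le> norm (1 + (norm (g x))\<^sup>2)"
  proof (rule AE_I2)
    fix x
    have "0 \<le> (norm (g x) - 1)\<^sup>2 " by simp
    then have "norm (g x) \<le> 1 + (norm (g x))\<^sup>2"
      unfolding power2_diff using norm_ge_zero[of "g x"] by (smt (verit) one_power2 mult.right_neutral)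
    then show "norm (g x) \<le> norm (1 + (norm (g x))\<^sup>2)" by simp
  qed
qed (rule L2_measurable[OF assms])

lemma L2_add:
  assumes "f \<in> L2" "g \<in> L2"
  shows "(\<lambda>x. f x + g x) \<in> L2"
proof (rule L2I)
  show "(\<lambda>x. f x + g x) \<in> borel_measurable MO" using L2_measurable[OF assms(1)] L2_measurable[OF assms(2)] by simp
  show "integrable MO (\<lambda>x. 2 * (norm (f x))\<^sup>2 + 2 * (norm (g x))\<^sup>2)"
    using L2_integrable_norm[OF assms(1)] L2_integrable_norm[OF assms(2)] by simp
  show "(norm (f x + g x))\<^sup>2 \<le> 2 * (norm (f x))\<^sup>2 + 2 * (norm (g x))\<^sup>2" for x
  proof -
    have "(norm (f x + g x))\<^sup>2 \<le> (norm (f x) + norm (g x))\<^sup>2"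
      by (intro power_mono norm_triangle_ineq) simp
    also have "\<dots> \<le> 2 * (norm (f x))\<^sup>2 + 2 * (norm (g x))\<^sup>2"
      using sum_squares_bound[of "norm (f x)" "norm (g x)"] by (simp add: power2_sum)
    finally show ?thesis .
  qed
qed

lemma L2_bdd_meas:
  assumes "f \<in> L2" "bdd_meas b"
  shows "(\<lambda>x. b x *\<^sub>R f x) \<in> L2"
proof -
  obtain B where B: "\<And>x. x \<in> Omega \<Longrightarrow> \<bar>b x\<bar> \<le> B" and b: "b \<in> borel_measurable MO"
    using assms(2) by (auto simp: bdd_meas_def)
  show ?thesis
  proof (rule L2I)
    show "(\<lambda>x. b x *\<^sub>R f x) \<in> borel_measurable MO" using b L2_measurable[OF assms(1)] by simp
    show "integrable MO (\<lambda>x. B\<^sup>2 * (norm (f x))\<^sup>2)"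
      using L2_integrable_norm[OF assms(1)] by simp
    show "(norm (b x *\<^sub>R f x))\<^sup>2 \<le> B\<^sup>2 * (norm (f x))\<^sup>2" if "x \<in> Omega" for x
      using power_mono[OF B[OF that], of 2] by (auto simp: power_mult_distrib intro: mult_right_mono)
  qed
qed

lemma L2_scale: "f \<in> L2 \<Longrightarrow> (\<lambda>x. c *\<^sub>R f x) \<in> L2"
  by (rule L2_bdd_meas[OF _ bdd_meas_const])

lemma bdd_meas_L2: assumes "bdd_meas b" shows "b \<in> L2"
proof -
  have "(\<lambda>x. 1::real) \<in> L2" by (simp add: L2_def)
  from L2_bdd_meas[OF this assms] show ?thesis by simp
qed

lemma L2_pair:
  "g \<in> L2 \<Longrightarrow> (\<lambda>x. fst (g x)) \<in> L2"
  "g \<in> L2 \<Longrightarrow> (\<lambda>x. snd (g x)) \<in> L2"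
  "f \<in> L2 \<Longrightarrow> h \<in> L2 \<Longrightarrow> (\<lambda>x. (f x, h x)) \<in> L2"
  for g :: "real \<times> real \<Rightarrow> real \<times> real" and f h :: "real \<times> real \<Rightarrow> real"
proof -
  assume g: "g \<in> L2"
  have m: "g \<in> borel_measurable MO" by (rule L2_measurable[OF g])
  show "(\<lambda>x. fst (g x)) \<in> L2"
    by (rule L2I[OF _ L2_integrable_norm[OF g]])
      (use borel_measurable_continuous_on[OF continuous_on_fst[OF continuous_on_id] m] in \<open>auto simp: norm_prod_def\<close>)
  show "(\<lambda>x. snd (g x)) \<in> L2"
    by (rule L2I[OF _ L2_integrable_norm[OF g]])
      (use borel_measurable_continuous_on[OF continuous_on_snd[OF continuous_on_id] m] in \<open>auto simp: norm_prod_def\<close>)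
next
  assume fh: "f \<in> L2" "h \<in> L2"
  show "(\<lambda>x. (f x, h x)) \<in> L2"
  proof (rule L2I)
    show "(\<lambda>x. (f x, h x)) \<in> borel_measurable MO"
      using L2_measurable[OF fh(1)] L2_measurable[OF fh(2)] by (intro borel_measurable_Pair)
    show "integrable MO (\<lambda>x. (norm (f x))\<^sup>2 + (norm (h x))\<^sup>2)"
      using L2_integrable_norm[OF fh(1)] L2_integrable_norm[OF fh(2)] by simp
  qed (simp add: norm_Pair)
qed

lemma L2_inner:
  assumes "f \<in> L2" "g \<in> L2"
  shows "integrable MO (\<lambda>x. f x \<bullet> g x)"
proof (rule Bochner_Integration.integrable_bound)
  show "integrable MO (\<lambda>x. (norm (f x))\<^sup>2 + (norm (g x))\<^sup>2)"
    using L2_integrable_norm[OF assms(1)] L2_integrable_norm[OF assms(2)] by simp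
  show "(\<lambda>x. f x \<bullet> g x) \<in> borel_measurable MO" using L2_measurable[OF assms(1)] L2_measurable[OF assms(2)] by simp
  show "AE x in MO. norm (f x \<bullet> g x) \<le> norm ((norm (f x))\<^sup>2 + (norm (g x))\<^sup>2)"
  proof (rule AE_I2)
    fix x
    have "\<bar>f x \<bullet> g x\<bar> \<le> norm (f x) * norm (g x)" by (rule Cauchy_Schwarz_ineq2)
    also have "\<dots> \<le> (norm (f x))\<^sup>2 + (norm (g x))\<^sup>2"
      using sum_squares_bound[of "norm (f x)" "norm (g x)"] mult_nonneg_nonneg[OF norm_ge_zero norm_ge_zero, of "f x" "g x"]
      unfolding mult.assoc by linarith
    finally show "norm (f x \<bullet> g x) \<le> norm ((norm (f x))\<^sup>2 + (norm (g x))\<^sup>2)" by simp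
  qed
qed

lemma L2_mult: "f \<in> L2 \<Longrightarrow> g \<in> L2 \<Longrightarrow> integrable MO (\<lambda>x. f x * g x :: real)"
  using L2_inner[of f g] by simp

lemma test_bdd_meas: "\<psi> \<in> test_functions \<Longrightarrow> bdd_meas \<psi>"
  by (intro bdd_meas_continuous test_functions_continuous)

text \<open>This makes the choice in \<open>wgrad\<close> harmless: any weak gradient that can be
  exhibited agrees with the chosen one almost everywhere. The fundamental lemma is applied to each
  component.\<close>

lemma is_weak_grad_unique:
  assumes "is_weak_grad v g" "is_weak_grad v g'"
  shows "AE x in MO. g x = g' x"
proof -
  have g: "g \<in> L2" "g' \<in> L2" using assms by (auto simp: is_weak_grad_def)
  have eq: "(LINT x|MO. \<psi> x *\<^sub>R g x) = (LINT x|MO. \<psi> x *\<^sub>R g' x)" if "\<psi> \<in> test_functions" for \<psi>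
    using assms that by (simp add: is_weak_grad_def)
  have int: "integrable MO (\<lambda>x. \<psi> x *\<^sub>R h x)" if "\<psi> \<in> test_functions" "h \<in> L2" for \<psi> h
    using L2_integrable[OF L2_bdd_meas[OF that(2) test_bdd_meas[OF that(1)]]] .
  have "AE x in MO. fst (g x) = fst (g' x)"
  proof (rule fundamental_lemma_eq)
    fix \<psi> assume \<psi>: "\<psi> \<in> test_functions"
    show "(LINT x|MO. \<psi> x * fst (g x)) = (LINT x|MO. \<psi> x * fst (g' x))"
      using integral_bounded_linear[OF bounded_linear_fst int[OF \<psi> g(1)]]
        integral_bounded_linear[OF bounded_linear_fst int[OF \<psi> g(2)]] eq[OF \<psi>] by simp
  qed (intro L2_integrable L2_pair g)+
  moreover have "AE x in MO. snd (g x) = snd (g' x)"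
  proof (rule fundamental_lemma_eq)
    fix \<psi> assume \<psi>: "\<psi> \<in> test_functions"
    show "(LINT x|MO. \<psi> x * snd (g x)) = (LINT x|MO. \<psi> x * snd (g' x))"
      using integral_bounded_linear[OF bounded_linear_snd int[OF \<psi> g(1)]]
        integral_bounded_linear[OF bounded_linear_snd int[OF \<psi> g(2)]] eq[OF \<psi>] by simp
  qed (intro L2_integrable L2_pair g)+
  ultimately show ?thesis by eventually_elim (simp add: prod_eq_iff)
qed

lemma wgrad_is_weak_grad: "v \<in> H1 \<Longrightarrow> is_weak_grad v (wgrad v)"
  unfolding H1_def wgrad_def by (auto intro!: someI_ex[of "is_weak_grad v"])

lemma wgrad_AE: "is_weak_grad v g \<Longrightarrow> AE x in MO. wgrad v x = g x"
  by (rule is_weak_grad_unique[of v]) (simp_all add: wgrad_def someI[of "is_weak_grad v" g])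

section \<open>Classical gradients as weak gradients\<close>

text \<open>The two partial derivatives are carried as data, so that gradients of polynomials, test
  functions and their products come from the product rule.\<close>

definition C1_grad :: "plane_fun \<Rightarrow> plane_fun \<Rightarrow> plane_fun \<Rightarrow> bool" where
  "C1_grad v vx vy \<longleftrightarrow> (\<forall>z. (v has_derivative (\<lambda>h. fst h * vx z + snd h * vy z)) (at z)) \<and>
     continuous_on UNIV vx \<and> continuous_on UNIV vy"

lemma c1D:
  assumes "C1_grad v vx vy"
  shows "(v has_derivative (\<lambda>h. fst h * vx z + snd h * vy z)) (at z)"
    "continuous_on UNIV vx" "continuous_on UNIV vy"
  using assms unfolding C1_grad_def by blast+

lemma C1_grad_continuous:
  assumes "C1_grad v vx vy"
  shows "continuous_on UNIV v"
proof (intro continuous_at_imp_continuous_on ballI)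
  fix z
  have "(v has_derivative (\<lambda>h. fst h * vx z + snd h * vy z)) (at z)"
    using assms unfolding C1_grad_def by blast
  then show "isCont v z" by (rule has_derivative_continuous)
qed

lemma C1_grad_mult:
  assumes "C1_grad u ux uy" "C1_grad v vx vy"
  shows "C1_grad (\<lambda>z. u z * v z) (\<lambda>z. u z * vx z + ux z * v z) (\<lambda>z. u z * vy z + uy z * v z)"
proof -
  have "((\<lambda>z. u z * v z) has_derivative (\<lambda>h. fst h * (u z * vx z + ux z * v z) + snd h * (u z * vy z + uy z * v z))) (at z)" for z
  proof -
    have "(u has_derivative (\<lambda>h. fst h * ux z + snd h * uy z)) (at z)" "(v has_derivative (\<lambda>h. fst h * vx z + snd h * vy z)) (at z)"
      using assms unfolding C1_grad_def by blast+
    from has_derivative_mult[OF this] show ?thesis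
      by (rule has_derivative_eq_rhs) (auto simp: algebra_simps)
  qed
  moreover have "continuous_on UNIV u" "continuous_on UNIV v" by (intro C1_grad_continuous[OF assms(1)] C1_grad_continuous[OF assms(2)])+
  ultimately show ?thesis
    using assms unfolding C1_grad_def by (intro conjI allI continuous_intros) blast+
qed

lemma test_C1_grad:
  assumes "\<psi> \<in> test_functions"
  shows "C1_grad \<psi> (\<lambda>z. fst (grad \<psi> z)) (\<lambda>z. snd (grad \<psi> z))"
proof -
  have "smooth_on UNIV \<psi>" using assms by (rule test_functionsE)
  then have C: "Ck_on (Suc 0) UNIV \<psi>" unfolding smooth_on_def by (rule spec)
  then have D: "(\<psi> has_derivative frechet_derivative \<psi> (at z)) (at z)" for z
    by (simp only: Ck_on.simps frechet_derivative_works UNIV_I simp_thms)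
  have lin: "frechet_derivative \<psi> (at z) h = fst h * fst (grad \<psi> z) + snd h * snd (grad \<psi> z)" for z h
  proof -
    interpret linear "frechet_derivative \<psi> (at z)"
      using D has_derivative_linear by blast
    have "h = fst h *\<^sub>R (1, 0) + snd h *\<^sub>R (0, 1)" by (simp add: prod_eq_iff)
    then have "frechet_derivative \<psi> (at z) h = frechet_derivative \<psi> (at z) (fst h *\<^sub>R (1, 0) + snd h *\<^sub>R (0, 1))"
      by simp
    also have "\<dots> = fst h * fst (grad \<psi> z) + snd h * snd (grad \<psi> z)"
      unfolding add scaleR grad_def by simp
    finally show ?thesis .
  qed
  have eq: "frechet_derivative \<psi> (at z) = (\<lambda>h. fst h * fst (grad \<psi> z) + snd h * snd (grad \<psi> z))" for z
    by (rule ext) (rule lin)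
  have b: "(1, 0) \<in> (Basis :: (real \<times> real) set)" "(0, 1) \<in> (Basis :: (real \<times> real) set)"
    by (auto simp: Basis_prod_def)
  have "continuous_on UNIV (\<lambda>x. frechet_derivative \<psi> (at x) (1, 0))" "continuous_on UNIV (\<lambda>x. frechet_derivative \<psi> (at x) (0, 1))"
    using C b by auto
  then show ?thesis
    using D unfolding C1_grad_def eq by (simp add: grad_def)
qed

lemma continuous_LINT_eq:
  fixes f :: plane_fun
  assumes "continuous_on UNIV f"
  shows "(LINT x|MO. f x) = integral (cbox (-1,-1) (1,1)) f"
proof -
  have "(LINT x|MO. f x) = integral Omega f"
    by (rule lebesgue_integral_eq_integral) (use bdd_meas_integrable[OF bdd_meas_continuous[OF assms]] in auto)
  then show ?thesis unfolding Omega_eq_box by (simp add: integral_open_interval)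
qed

lemma C1_grad_section_derivative:
  assumes "C1_grad F Fx Fy"
  shows "((\<lambda>t. F (x, t)) has_real_derivative Fy (x, y)) (at y)"
    and "((\<lambda>t. F (t, y)) has_real_derivative Fx (x, y)) (at x)"
proof -
  have F: "(F has_derivative (\<lambda>h. fst h * Fx (x, y) + snd h * Fy (x, y))) (at (x, y))"
    using assms by (simp add: C1_grad_def)
  have "((\<lambda>t. (x, t)) has_derivative (\<lambda>h. (0, h))) (at y)"
    by (auto intro!: derivative_eq_intros)
  from has_derivative_compose[OF this F]
  show "((\<lambda>t. F (x, t)) has_real_derivative Fy (x, y)) (at y)"
    by (simp add: has_field_derivative_def mult_commute_abs)
  have "((\<lambda>t. (t, y)) has_derivative (\<lambda>h. (h, 0))) (at x)"
    by (auto intro!: derivative_eq_intros)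
  from has_derivative_compose[OF this F]
  show "((\<lambda>t. F (t, y)) has_real_derivative Fx (x, y)) (at x)"
    by (simp add: has_field_derivative_def mult_commute_abs)
qed

text \<open>The fundamental theorem of calculus on each horizontal or vertical section; its end
  values are zero because the boundary lies outside the open square.\<close>

lemma integral_C1_grad_zero:
  assumes F: "C1_grad F Fx Fy" and z: "\<And>z. z \<notin> Omega \<Longrightarrow> F z = 0"
  shows "(LINT x|MO. Fx x) = 0" "(LINT x|MO. Fy x) = 0"
proof -
  have cont: "continuous_on UNIV Fx" "continuous_on UNIV Fy" using F by (auto simp: C1_grad_def)
  have "integral {-1..1} (\<lambda>y. Fy (x, y)) = F (x, 1) - F (x, -1)" for x
    by (intro integral_unique fundamental_theorem_of_calculus)
      (auto intro!: has_vector_derivative_at_within simp: C1_grad_section_derivative[OF F] simp flip: has_real_derivative_iff_has_vector_derivative intro: has_field_derivative_at_within C1_grad_section_derivative[OF F])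
  then have "integral {-1..1} (\<lambda>y. Fy (x, y)) = 0" for x
    by (simp add: z Omega_def)
  then show "(LINT x|MO. Fy x) = 0"
    unfolding continuous_LINT_eq[OF cont(2)]
    by (subst integral_prod_continuous) (auto intro: continuous_on_subset[OF cont(2)])
  have "integral {-1..1} (\<lambda>x. Fx (x, y)) = F (1, y) - F (-1, y)" for y
    by (intro integral_unique fundamental_theorem_of_calculus)
      (auto intro!: has_vector_derivative_at_within simp: C1_grad_section_derivative[OF F] simp flip: has_real_derivative_iff_has_vector_derivative intro: has_field_derivative_at_within C1_grad_section_derivative[OF F])
  then have "integral {-1..1} (\<lambda>x. Fx (x, y)) = 0" for y
    by (simp add: z Omega_def)
  then show "(LINT x|MO. Fx x) = 0"
    unfolding continuous_LINT_eq[OF cont(1)]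
    by (subst integral_prod_continuous, blast intro: continuous_on_subset[OF cont(1)],
        subst integral_swap_continuous) (auto intro: continuous_on_subset[OF cont(1)])
qed

text \<open>The product of \<open>v\<close> and the test function has continuous partial derivatives
  and vanishes outside the open square, so the integral of each of its partial derivatives is
  zero.\<close>

lemma C1_grad_integration_by_parts:
  assumes "C1_grad v vx vy" "\<psi> \<in> test_functions"
  shows "(LINT x|MO. v x * fst (grad \<psi> x)) = - (LINT x|MO. \<psi> x * vx x)"
    "(LINT x|MO. v x * snd (grad \<psi> x)) = - (LINT x|MO. \<psi> x * vy x)"
proof -
  have \<psi>: "C1_grad \<psi> (\<lambda>z. fst (grad \<psi> z)) (\<lambda>z. snd (grad \<psi> z))" by (rule test_C1_grad[OF assms(2)])
  have z: "\<psi> x = 0" if "x \<notin> Omega" for x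
    using assms(2) by (rule test_functionsE) (use that in blast)
  have c: "continuous_on UNIV v" "continuous_on UNIV \<psi>" by (intro C1_grad_continuous[OF assms(1)] C1_grad_continuous[OF \<psi>])+
  have c': "continuous_on UNIV vx" "continuous_on UNIV vy" "continuous_on UNIV (\<lambda>z. fst (grad \<psi> z))" "continuous_on UNIV (\<lambda>z. snd (grad \<psi> z))"
    by (intro c1D[OF assms(1)] c1D[OF \<psi>])+
  have I: "integrable MO (\<lambda>z. v z * fst (grad \<psi> z))" "integrable MO (\<lambda>z. v z * snd (grad \<psi> z))"
     "integrable MO (\<lambda>z. vx z * \<psi> z)" "integrable MO (\<lambda>z. vy z * \<psi> z)"
    by (intro bdd_meas_integrable bdd_meas_mult bdd_meas_continuous c c')+
  have zz: "z \<notin> Omega \<Longrightarrow> v z * \<psi> z = 0" for z using z by simp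
  from integral_C1_grad_zero[OF C1_grad_mult[OF assms(1) \<psi>] zz] I
  show "(LINT x|MO. v x * fst (grad \<psi> x)) = - (LINT x|MO. \<psi> x * vx x)"
    "(LINT x|MO. v x * snd (grad \<psi> x)) = - (LINT x|MO. \<psi> x * vy x)"
    by (simp_all add: mult.commute)
qed

lemma C1_grad_is_weak_grad:
  assumes "C1_grad v vx vy"
  shows "is_weak_grad v (\<lambda>z. (vx z, vy z))"
proof -
  have c: "continuous_on UNIV v" "continuous_on UNIV vx" "continuous_on UNIV vy"
    by (intro C1_grad_continuous[OF assms] c1D[OF assms])+
  have "(LINT x|MO. v x *\<^sub>R grad \<psi> x) = - (LINT x|MO. \<psi> x *\<^sub>R (vx x, vy x))"
    if \<psi>: "\<psi> \<in> test_functions" for \<psi>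
  proof -
    have c': "continuous_on UNIV \<psi>" "continuous_on UNIV (\<lambda>z. fst (grad \<psi> z))" "continuous_on UNIV (\<lambda>z. snd (grad \<psi> z))"
      by (intro C1_grad_continuous[OF test_C1_grad[OF \<psi>]] c1D[OF test_C1_grad[OF \<psi>]])+
    have pair: "(LINT x|MO. (p x, q x)) = ((LINT x|MO. p x), (LINT x|MO. q x))"
      if "continuous_on UNIV p" "continuous_on UNIV q" for p q :: plane_fun
    proof -
      have I: "integrable MO (\<lambda>x. (p x, q x))"
        by (intro L2_integrable L2_pair bdd_meas_L2 bdd_meas_continuous that)
      show ?thesis
        using integral_bounded_linear[OF bounded_linear_fst I] integral_bounded_linear[OF bounded_linear_snd I]
        by (simp add: prod_eq_iff)
    qed
    have "(LINT x|MO. v x *\<^sub>R grad \<psi> x) = (LINT x|MO. (v x * fst (grad \<psi> x), v x * snd (grad \<psi> x)))"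
      by (simp add: scaleR_prod_def)
    also have "\<dots> = (- (LINT x|MO. \<psi> x * vx x), - (LINT x|MO. \<psi> x * vy x))"
      by (subst pair) (auto intro!: continuous_intros c c' simp: C1_grad_integration_by_parts[OF assms \<psi>])
    also have "\<dots> = - (LINT x|MO. \<psi> x *\<^sub>R (vx x, vy x))"
      by (simp add: pair c c' continuous_on_mult)
    finally show ?thesis .
  qed
  then show ?thesis
    unfolding is_weak_grad_def by (auto intro!: L2_pair bdd_meas_L2 bdd_meas_continuous c)
qed

lemma C1_grad_H1: "C1_grad v vx vy \<Longrightarrow> v \<in> H1"
  unfolding H1_def using C1_grad_is_weak_grad C1_grad_continuous bdd_meas_L2[OF bdd_meas_continuous] by blast

lemma C1_grad_wgrad: "C1_grad v vx vy \<Longrightarrow> AE x in MO. wgrad v x = (vx x, vy x)"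
  by (rule wgrad_AE[OF C1_grad_is_weak_grad])

section \<open>Bilinear forms and functionals on the energy space\<close>

lemma H1_L2: "v \<in> H1 \<Longrightarrow> v \<in> L2"
  by (simp add: H1_def)

lemma wgrad_L2: "v \<in> H1 \<Longrightarrow> wgrad v \<in> L2"
  using wgrad_is_weak_grad by (simp add: is_weak_grad_def)

lemma H1I: "v \<in> L2 \<Longrightarrow> is_weak_grad v g \<Longrightarrow> v \<in> H1"
  unfolding H1_def by blast

lemma integrable_scaleR_grad:
  assumes "v \<in> L2" "\<psi> \<in> test_functions"
  shows "integrable MO (\<lambda>x. v x *\<^sub>R grad \<psi> x)"
proof -
  have "(\<lambda>x. (fst (grad \<psi> x) *\<^sub>R v x, snd (grad \<psi> x) *\<^sub>R v x)) \<in> L2"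
    by (intro L2_pair L2_bdd_meas assms bdd_meas_continuous c1D[OF test_C1_grad[OF assms(2)]])
  then show ?thesis
    using L2_integrable by (simp add: scaleR_prod_def mult.commute)
qed

lemma integrable_test_scaleR: "\<psi> \<in> test_functions \<Longrightarrow> g \<in> L2 \<Longrightarrow> integrable MO (\<lambda>x. \<psi> x *\<^sub>R g x)"
  by (intro L2_integrable L2_bdd_meas test_bdd_meas)

lemma is_weak_grad_add:
  assumes "is_weak_grad v g" "is_weak_grad w h" "v \<in> L2" "w \<in> L2"
  shows "is_weak_grad (\<lambda>x. v x + w x) (\<lambda>x. g x + h x)"
proof -
  have gh: "g \<in> L2" "h \<in> L2" using assms by (simp_all add: is_weak_grad_def)
  show ?thesis
    unfolding is_weak_grad_def
  proof (intro conjI ballI L2_add gh)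
    fix \<psi> assume \<psi>: "\<psi> \<in> test_functions"
    show "(LINT x|MO. (v x + w x) *\<^sub>R grad \<psi> x) = - (LINT x|MO. \<psi> x *\<^sub>R (g x + h x))"
      using assms(1,2) \<psi> unfolding is_weak_grad_def
      by (simp add: scaleR_add_left scaleR_add_right integrable_scaleR_grad integrable_test_scaleR assms gh)
  qed
qed

lemma is_weak_grad_scale:
  assumes "is_weak_grad v g"
  shows "is_weak_grad (\<lambda>x. c * v x) (\<lambda>x. c *\<^sub>R g x)"
proof -
  have gh: "g \<in> L2" using assms by (simp_all add: is_weak_grad_def)
  show ?thesis
    unfolding is_weak_grad_def
  proof (intro conjI ballI L2_scale gh)
    fix \<psi> assume \<psi>: "\<psi> \<in> test_functions"
    have "(LINT x|MO. (c * v x) *\<^sub>R grad \<psi> x) = c *\<^sub>R (LINT x|MO. v x *\<^sub>R grad \<psi> x)"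
      by (simp flip: scaleR_scaleR)
    also have "\<dots> = - (c *\<^sub>R (LINT x|MO. \<psi> x *\<^sub>R g x))"
      using assms \<psi> by (simp add: is_weak_grad_def)
    also have "\<dots> = - (LINT x|MO. c *\<^sub>R (\<psi> x *\<^sub>R g x))"
      by (simp only: integral_scaleR_right)
    finally show "(LINT x|MO. (c * v x) *\<^sub>R grad \<psi> x) = - (LINT x|MO. \<psi> x *\<^sub>R (c *\<^sub>R g x))"
      by (simp only: scaleR_left_commute)
  qed
qed

lemma H1_add: "v \<in> H1 \<Longrightarrow> w \<in> H1 \<Longrightarrow> (\<lambda>x. v x + w x) \<in> H1"
  by (rule H1I[OF L2_add[OF H1_L2 H1_L2] is_weak_grad_add[OF wgrad_is_weak_grad wgrad_is_weak_grad H1_L2 H1_L2]])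

lemma H1_scale: assumes "v \<in> H1" shows "(\<lambda>x. c * v x) \<in> H1"
proof (rule H1I)
  show "(\<lambda>x. c * v x) \<in> L2" using L2_scale[OF H1_L2[OF assms], of c] by simp
qed (rule is_weak_grad_scale[OF wgrad_is_weak_grad[OF assms]])

lemma wgrad_add: "v \<in> H1 \<Longrightarrow> w \<in> H1 \<Longrightarrow> AE x in MO. wgrad (\<lambda>x. v x + w x) x = wgrad v x + wgrad w x"
  by (rule wgrad_AE[OF is_weak_grad_add[OF wgrad_is_weak_grad wgrad_is_weak_grad H1_L2 H1_L2]])

lemma wgrad_scale: "v \<in> H1 \<Longrightarrow> AE x in MO. wgrad (\<lambda>x. c * v x) x = c *\<^sub>R wgrad v x"
  by (rule wgrad_AE[OF is_weak_grad_scale[OF wgrad_is_weak_grad]])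

lemma L2_int_sq_add:
  assumes "f \<in> L2" "g \<in> L2" "h \<in> L2" "AE x in MO. h x = f x + g x"
  shows "(LINT x|MO. (norm (h x))\<^sup>2) \<le> 2 * (LINT x|MO. (norm (f x))\<^sup>2) + 2 * (LINT x|MO. (norm (g x))\<^sup>2)"
proof -
  have "(LINT x|MO. (norm (h x))\<^sup>2) \<le> (LINT x|MO. 2 * (norm (f x))\<^sup>2 + 2 * (norm (g x))\<^sup>2)"
  proof (rule integral_mono_AE)
    show "AE x in MO. (norm (h x))\<^sup>2 \<le> 2 * (norm (f x))\<^sup>2 + 2 * (norm (g x))\<^sup>2"
      using assms(4)
    proof eventually_elim
      fix x assume h: "h x = f x + g x"
      have "(norm (f x + g x))\<^sup>2 \<le> (norm (f x) + norm (g x))\<^sup>2"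
        by (intro power_mono norm_triangle_ineq) simp
      also have "\<dots> \<le> 2 * (norm (f x))\<^sup>2 + 2 * (norm (g x))\<^sup>2"
        using sum_squares_bound[of "norm (f x)" "norm (g x)"] by (simp add: power2_sum)
      finally show "(norm (h x))\<^sup>2 \<le> 2 * (norm (f x))\<^sup>2 + 2 * (norm (g x))\<^sup>2" unfolding h .
    qed
  qed (simp_all add: L2_integrable_norm assms)
  then show ?thesis by (simp add: L2_integrable_norm assms)
qed

text \<open>From |f + g|^2 \<le> 2 |f|^2 + 2 |g|^2, applied to values and gradients. The crude
  factor 2 is good enough for its use, the closure of \<open>H10\<close> under sums, where only
  limits matter.\<close>

lemma H1_norm_add:
  assumes "v \<in> H1" "w \<in> H1"
  shows "H1_norm (\<lambda>x. v x + w x) \<le> 2 * (H1_norm v + H1_norm w)"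
proof -
  define Q where "Q v = (LINT x|MO. (v x)\<^sup>2) + (LINT x|MO. (norm (wgrad v x))\<^sup>2)" for v
  have Q: "H1_norm v = sqrt (Q v)" for v by (simp add: H1_norm_def Q_def)
  have Q0: "0 \<le> Q v" for v by (simp add: Q_def)
  have "Q (\<lambda>x. v x + w x) \<le> 2 * Q v + 2 * Q w"
    using L2_int_sq_add[OF H1_L2[OF assms(1)] H1_L2[OF assms(2)] L2_add[OF H1_L2[OF assms(1)] H1_L2[OF assms(2)]]]
      L2_int_sq_add[OF wgrad_L2[OF assms(1)] wgrad_L2[OF assms(2)] wgrad_L2[OF H1_add[OF assms]] wgrad_add[OF assms]]
    by (simp add: Q_def)
  also have "\<dots> \<le> (2 * (H1_norm v + H1_norm w))\<^sup>2"
  proof -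
    have "2 * a\<^sup>2 + 2 * b\<^sup>2 \<le> (2 * (a + b))\<^sup>2" if "0 \<le> a" "0 \<le> b" for a b :: real
      using mult_nonneg_nonneg[OF that] zero_le_power2[of a] zero_le_power2[of b]
      by (simp add: power2_sum power_mult_distrib)
    from this[of "H1_norm v" "H1_norm w"] show ?thesis using Q0[of v] Q0[of w] by (simp add: Q)
  qed
  finally show ?thesis
    unfolding Q[of "\<lambda>x. v x + w x"] using Q0 by (intro real_le_lsqrt) (auto simp: Q)
qed

lemma H1_norm_scale:
  assumes "v \<in> H1"
  shows "H1_norm (\<lambda>x. c * v x) = \<bar>c\<bar> * H1_norm v"
proof -
  have "(LINT x|MO. (norm (wgrad (\<lambda>x. c * v x) x))\<^sup>2) = (LINT x|MO. c\<^sup>2 * (norm (wgrad v x))\<^sup>2)"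
  proof (rule integral_cong_AE)
    show "AE x in MO. (norm (wgrad (\<lambda>x. c * v x) x))\<^sup>2 = c\<^sup>2 * (norm (wgrad v x))\<^sup>2"
      using wgrad_scale[OF assms, of c] by eventually_elim (simp add: power_mult_distrib)
  qed (use L2_measurable[OF wgrad_L2[OF assms]] L2_measurable[OF wgrad_L2[OF H1_scale[OF assms]]] in auto)
  then have "H1_norm (\<lambda>x. c * v x) = sqrt (c\<^sup>2 * ((LINT x|MO. (v x)\<^sup>2) + (LINT x|MO. (norm (wgrad v x))\<^sup>2)))"
    by (simp add: H1_norm_def power_mult_distrib distrib_left)
  then show ?thesis by (simp add: H1_norm_def real_sqrt_mult)
qed

lemma H1_norm_nonneg: "0 \<le> H1_norm v"
  by (simp add: H1_norm_def)

lemma H10_H1: "v \<in> H10 \<Longrightarrow> v \<in> H1"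
  by (simp add: H10_def)

lemma H10E:
  assumes "v \<in> H10"
  obtains \<psi> where "\<And>n. \<psi> n \<in> test_functions" "(\<lambda>n::nat. H1_norm (\<lambda>x. v x - \<psi> n x)) \<longlonglongrightarrow> 0"
  using assms unfolding H10_def by blast

lemma H10I:
  assumes "v \<in> H1" "\<And>n. \<psi> n \<in> test_functions" "(\<lambda>n::nat. H1_norm (\<lambda>x. v x - \<psi> n x)) \<longlonglongrightarrow> 0"
  shows "v \<in> H10"
  using assms unfolding H10_def by blast

lemma test_H1: "\<psi> \<in> test_functions \<Longrightarrow> \<psi> \<in> H1"
  by (rule C1_grad_H1[OF test_C1_grad])

lemma H1_diff:
  assumes "v \<in> H1" "w \<in> H1"
  shows "(\<lambda>x. v x - w x) \<in> H1"
  using H1_add[OF assms(1) H1_scale[OF assms(2), of "-1"]] by simp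

lemma test_H10: assumes "v \<in> test_functions" shows "v \<in> H10"
proof (rule H10I)
  show "v \<in> H1" by (rule test_H1[OF assms])
  show "v \<in> test_functions" by fact
  have "H1_norm (\<lambda>x. v x - v x) = 0"
    using H1_norm_scale[OF \<open>v \<in> H1\<close>, of 0] by simp
  then show "(\<lambda>n. H1_norm (\<lambda>x. v x - v x)) \<longlonglongrightarrow> 0" by simp
qed

lemma H10_add:
  assumes "v \<in> H10" "w \<in> H10"
  shows "(\<lambda>x. v x + w x) \<in> H10"
proof -
  obtain \<psi> where \<psi>: "\<And>n. \<psi> n \<in> test_functions" "(\<lambda>n::nat. H1_norm (\<lambda>x. v x - \<psi> n x)) \<longlonglongrightarrow> 0"
    using assms(1) by (rule H10E) blast
  obtain \<omega> where \<omega>: "\<And>n. \<omega> n \<in> test_functions" "(\<lambda>n::nat. H1_norm (\<lambda>x. w x - \<omega> n x)) \<longlonglongrightarrow> 0"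
    using assms(2) by (rule H10E) blast
  show ?thesis
  proof (rule H10I)
    show "(\<lambda>x. v x + w x) \<in> H1" by (intro H1_add H10_H1 assms)
    show "(\<lambda>x. \<psi> n x + \<omega> n x) \<in> test_functions" for n by (intro test_functions_add \<psi> \<omega>)
    have lim: "(\<lambda>n. 2 * (H1_norm (\<lambda>x. v x - \<psi> n x) + H1_norm (\<lambda>x. w x - \<omega> n x))) \<longlonglongrightarrow> 2 * (0 + 0)"
      by (intro tendsto_intros \<psi> \<omega>)
    have "H1_norm (\<lambda>x. v x + w x - (\<psi> n x + \<omega> n x)) \<le> 2 * (H1_norm (\<lambda>x. v x - \<psi> n x) + H1_norm (\<lambda>x. w x - \<omega> n x))" for n
      using H1_norm_add[OF H1_diff[OF H10_H1[OF assms(1)] test_H1[OF \<psi>(1)[of n]]] H1_diff[OF H10_H1[OF assms(2)] test_H1[OF \<omega>(1)[of n]]]]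
      by (simp add: algebra_simps)
    then show "(\<lambda>n. H1_norm (\<lambda>x. v x + w x - (\<psi> n x + \<omega> n x))) \<longlonglongrightarrow> 0"
      by (intro tendsto_sandwich[OF _ _ tendsto_const lim[simplified]]) (auto simp: H1_norm_nonneg)
  qed
qed

lemma H10_scale:
  assumes "v \<in> H10"
  shows "(\<lambda>x. c * v x) \<in> H10"
proof -
  obtain \<psi> where \<psi>: "\<And>n. \<psi> n \<in> test_functions" "(\<lambda>n::nat. H1_norm (\<lambda>x. v x - \<psi> n x)) \<longlonglongrightarrow> 0"
    using assms(1) by (rule H10E) blast
  show ?thesis
  proof (rule H10I)
    show "(\<lambda>x. c * v x) \<in> H1" by (intro H1_scale H10_H1 assms)
    show "(\<lambda>x. c * \<psi> n x) \<in> test_functions" for n by (intro test_functions_cmult \<psi>)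
    have lim: "(\<lambda>n. \<bar>c\<bar> * H1_norm (\<lambda>x. v x - \<psi> n x)) \<longlonglongrightarrow> \<bar>c\<bar> * 0"
      by (intro tendsto_intros \<psi>)
    have "H1_norm (\<lambda>x. c * v x - c * \<psi> n x) = \<bar>c\<bar> * H1_norm (\<lambda>x. v x - \<psi> n x)" for n
      using H1_norm_scale[OF H1_diff[OF H10_H1[OF assms(1)] test_H1[OF \<psi>(1)[of n]]], of c]
      by (simp add: algebra_simps)
    then show "(\<lambda>n. H1_norm (\<lambda>x. c * v x - c * \<psi> n x)) \<longlonglongrightarrow> 0"
      using lim by simp
  qed
qed

lemma H10_diff:
  assumes "v \<in> H10" "w \<in> H10"
  shows "(\<lambda>x. v x - w x) \<in> H10"
  using H10_add[OF assms(1) H10_scale[OF assms(2), of "-1"]] by simp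

lemma H10_zero: "(\<lambda>x. 0) \<in> H10"
proof (rule test_H10, rule test_functionsI)
  show "smooth_on UNIV (\<lambda>x. 0)" by (simp add: smooth_on_def Ck_const)
qed (auto intro: compact_empty)

lemma H10_sum:
  assumes "\<And>k. k \<in> F \<Longrightarrow> \<phi> k \<in> H10"
  shows "(\<lambda>x. \<Sum>k\<in>F. c k * \<phi> k x) \<in> H10"
  using assms
proof (induction F rule: infinite_finite_induct)
  case (insert k F)
  then show ?case using H10_add[OF H10_scale[of "\<phi> k" "c k"], of "\<lambda>x. \<Sum>k\<in>F. c k * \<phi> k x"] by simp
qed (auto simp: H10_zero)

section \<open>Symmetric bilinear forms on the energy space and Cauchy-Schwarz\<close>

text \<open>The common algebra of \<open>H10_inner\<close> and \<open>a_form\<close>, stated on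
  representatives because functions equal almost everywhere are not identified.\<close>

definition sym_form :: "(plane_fun \<Rightarrow> plane_fun \<Rightarrow> real) \<Rightarrow> bool" where
  "sym_form B \<longleftrightarrow> (\<forall>u\<in>H10. \<forall>v\<in>H10. B u v = B v u) \<and>
     (\<forall>u\<in>H10. \<forall>v\<in>H10. \<forall>w\<in>H10. B (\<lambda>x. u x + v x) w = B u w + B v w) \<and>
     (\<forall>u\<in>H10. \<forall>w\<in>H10. \<forall>c. B (\<lambda>x. c * u x) w = c * B u w)"

lemma sym_form_sym: "sym_form B \<Longrightarrow> u \<in> H10 \<Longrightarrow> v \<in> H10 \<Longrightarrow> B u v = B v u"
  and sym_form_add: "sym_form B \<Longrightarrow> u \<in> H10 \<Longrightarrow> v \<in> H10 \<Longrightarrow> w \<in> H10 \<Longrightarrow> B (\<lambda>x. u x + v x) w = B u w + B v w"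
  and sym_form_scale: "sym_form B \<Longrightarrow> u \<in> H10 \<Longrightarrow> w \<in> H10 \<Longrightarrow> B (\<lambda>x. c * u x) w = c * B u w"
  unfolding sym_form_def by blast+

lemma sym_form_diff:
  assumes "sym_form B" "u \<in> H10" "v \<in> H10" "w \<in> H10"
  shows "B (\<lambda>x. u x - v x) w = B u w - B v w"
  using sym_form_add[OF assms(1,2) H10_scale[OF assms(3), of "-1"] assms(4)] sym_form_scale[OF assms(1,3,4), of "-1"]
  by simp

lemma sym_form_right:
  assumes "sym_form B" "u \<in> H10" "v \<in> H10" "w \<in> H10"
  shows "B w (\<lambda>x. u x + v x) = B w u + B w v" "B w (\<lambda>x. u x - v x) = B w u - B w v" "B w (\<lambda>x. c * u x) = c * B w u"
  using sym_form_add[OF assms] sym_form_diff[OF assms] sym_form_scale[OF assms(1,2,4), of c]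
    sym_form_sym[OF assms(1,4)] H10_add[OF assms(2,3)] H10_diff[OF assms(2,3)] H10_scale[OF assms(2), of c] assms
  by auto

lemma sym_form_zero: assumes "sym_form B" "w \<in> H10" shows "B (\<lambda>x. 0) w = 0"
  using sym_form_scale[OF assms(1) H10_zero assms(2), of 0] by simp

lemma sym_form_sum:
  assumes "sym_form B" "w \<in> H10" "\<And>k. k \<in> F \<Longrightarrow> \<phi> k \<in> H10"
  shows "B (\<lambda>x. \<Sum>k\<in>F. c k * \<phi> k x) w = (\<Sum>k\<in>F. c k * B (\<phi> k) w)"
  using assms(3)
proof (induction F rule: infinite_finite_induct)
  case (insert k F)
  have "B (\<lambda>x. \<Sum>k\<in>insert k F. c k * \<phi> k x) w = B (\<lambda>x. c k * \<phi> k x + (\<Sum>k\<in>F. c k * \<phi> k x)) w"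
    using insert by simp
  also have "\<dots> = B (\<lambda>x. c k * \<phi> k x) w + B (\<lambda>x. \<Sum>k\<in>F. c k * \<phi> k x) w"
    by (intro sym_form_add[OF assms(1)] H10_scale H10_sum assms(2)) (use insert in auto)
  also have "\<dots> = c k * B (\<phi> k) w + (\<Sum>k\<in>F. c k * B (\<phi> k) w)"
    using insert sym_form_scale[OF assms(1) _ assms(2), of "\<phi> k" "c k"] by simp
  finally show ?case using insert by simp
qed (auto simp: sym_form_zero assms)

lemma sym_form_sum_right:
  assumes "sym_form B" "w \<in> H10" "\<And>k. k \<in> F \<Longrightarrow> \<phi> k \<in> H10"
  shows "B w (\<lambda>x. \<Sum>k\<in>F. c k * \<phi> k x) = (\<Sum>k\<in>F. c k * B w (\<phi> k))"
  using sym_form_sum[OF assms] sym_form_sym[OF assms(1,2) H10_sum[of F \<phi>]] sym_form_sym[OF assms(1,2)] assms(3) by simp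

lemma sym_form_expand:
  assumes "sym_form B" "u \<in> H10" "v \<in> H10"
  shows "B (\<lambda>x. u x + c * v x) (\<lambda>x. u x + c * v x) = B u u + 2 * c * B u v + c\<^sup>2 * B v v"
proof -
  note cv = H10_scale[OF assms(3), of c]
  note s = H10_add[OF assms(2) cv]
  have "B (\<lambda>x. u x + c * v x) (\<lambda>x. u x + c * v x) = B u (\<lambda>x. u x + c * v x) + c * B v (\<lambda>x. u x + c * v x)"
    by (simp only: sym_form_add[OF assms(1,2) cv s] sym_form_scale[OF assms(1,3) s])
  also have "B u (\<lambda>x. u x + c * v x) = B u u + c * B u v"
    by (simp only: sym_form_right(1)[OF assms(1,2) cv assms(2)] sym_form_right(3)[OF assms(1,3,3,2)])
  also have "B v (\<lambda>x. u x + c * v x) = B u v + c * B v v"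
    by (simp only: sym_form_right(1)[OF assms(1,2) cv assms(3)] sym_form_right(3)[OF assms(1,3,3,3)] sym_form_sym[OF assms(1,3,2)])
  finally show ?thesis by (simp add: power2_eq_square algebra_simps)
qed

lemma sym_form_Cauchy_Schwarz:
  assumes "sym_form B" "\<And>v. v \<in> H10 \<Longrightarrow> 0 \<le> B v v" "u \<in> H10" "v \<in> H10"
  shows "\<bar>B u v\<bar> \<le> sqrt (B u u) * sqrt (B v v)"
proof -
  have q: "0 \<le> B u u + 2 * c * B u v + c\<^sup>2 * B v v" for c
    using assms(2)[OF H10_add[OF assms(3) H10_scale[OF assms(4), of c]]] sym_form_expand[OF assms(1,3,4), of c] by simp
  have "(B u v)\<^sup>2 \<le> B u u * B v v"
  proof (cases "B v v = 0")
    case True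
    have "B u v = 0"
    proof (rule ccontr)
      assume "B u v \<noteq> 0"
      \<comment> \<open>When \<open>B v v\<close> is zero the quadratic is affine in c; the chosen c
        gives it the value -1.\<close>
      then show False
        using q[of "- (B u u + 1) / (2 * B u v)"] True by (simp add: field_simps)
    qed
    then show ?thesis using True by simp
  next
    case False
    then have pos: "B v v > 0" using assms(2)[OF assms(4)] by simp
    have "0 \<le> B u u - (B u v)\<^sup>2 / B v v"
      using q[of "- B u v / B v v"] pos by (simp add: power2_eq_square)
    then show ?thesis using pos by (simp add: field_simps)
  qed
  then have "sqrt ((B u v)\<^sup>2) \<le> sqrt (B u u * B v v)" by (rule real_sqrt_le_mono)
  then show ?thesis by (simp add: real_sqrt_mult)
qed

lemma sym_form_H10_inner: "sym_form H10_inner"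
  unfolding sym_form_def
proof (intro conjI ballI allI)
  fix u v w :: plane_fun and c :: real assume u: "u \<in> H10" and w: "w \<in> H10" 
  show "H10_inner u w = H10_inner w u" by (simp add: H10_inner_def inner_commute)
  note L = wgrad_L2[OF H10_H1[OF u]] wgrad_L2[OF H10_H1[OF w]]
  note m = L[THEN L2_measurable]
  show "H10_inner (\<lambda>x. c * u x) w = c * H10_inner u w"
  proof -
    have "H10_inner (\<lambda>x. c * u x) w = (LINT x|MO. c * (wgrad u x \<bullet> wgrad w x))"
      unfolding H10_inner_def
    proof (rule integral_cong_AE)
      show "AE x in MO. wgrad (\<lambda>x. c * u x) x \<bullet> wgrad w x = c * (wgrad u x \<bullet> wgrad w x)"
        using wgrad_scale[OF H10_H1[OF u], of c] by eventually_elim simp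
    qed (use m L2_measurable[OF wgrad_L2[OF H1_scale[OF H10_H1[OF u]]]] in auto)
    then show ?thesis by (simp add: H10_inner_def)
  qed
  assume v: "v \<in> H10"
  note Lv = wgrad_L2[OF H10_H1[OF v]]
  show "H10_inner (\<lambda>x. u x + v x) w = H10_inner u w + H10_inner v w"
  proof -
    have "H10_inner (\<lambda>x. u x + v x) w = (LINT x|MO. wgrad u x \<bullet> wgrad w x + wgrad v x \<bullet> wgrad w x)"
      unfolding H10_inner_def
    proof (rule integral_cong_AE)
      show "AE x in MO. wgrad (\<lambda>x. u x + v x) x \<bullet> wgrad w x = wgrad u x \<bullet> wgrad w x + wgrad v x \<bullet> wgrad w x"
        using wgrad_add[OF H10_H1[OF u] H10_H1[OF v]] by eventually_elim (simp add: inner_add_left)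
    qed (use m L2_measurable[OF Lv] L2_measurable[OF wgrad_L2[OF H1_add[OF H10_H1[OF u] H10_H1[OF v]]]] in auto)
    also have "\<dots> = H10_inner u w + H10_inner v w"
      unfolding H10_inner_def by (rule Bochner_Integration.integral_add; rule L2_inner) (fact L Lv)+
    finally show ?thesis .
  qed
qed

lemma H10_inner_nonneg: "0 \<le> H10_inner v v"
  by (simp add: H10_inner_def)

lemma H10_norm_nonneg: "0 \<le> H10_norm v"
  by (simp add: H10_norm_def H10_inner_nonneg)

lemma H10_norm_sq: "(H10_norm v)\<^sup>2 = H10_inner v v"
  by (simp add: H10_norm_def H10_inner_nonneg)

lemma H10_Cauchy_Schwarz: "u \<in> H10 \<Longrightarrow> v \<in> H10 \<Longrightarrow> \<bar>H10_inner u v\<bar> \<le> H10_norm u * H10_norm v"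
  using sym_form_Cauchy_Schwarz[OF sym_form_H10_inner H10_inner_nonneg] by (simp add: H10_norm_def)

lemma H10_norm_add:
  assumes "u \<in> H10" "v \<in> H10"
  shows "H10_norm (\<lambda>x. u x + v x) \<le> H10_norm u + H10_norm v"
proof -
  have "H10_inner (\<lambda>x. u x + v x) (\<lambda>x. u x + v x) = H10_inner u u + 2 * H10_inner u v + H10_inner v v"
    using sym_form_expand[OF sym_form_H10_inner assms, of 1] by simp
  also have "\<dots> \<le> (H10_norm u + H10_norm v)\<^sup>2"
    using H10_Cauchy_Schwarz[OF assms] by (simp add: power2_sum H10_norm_sq)
  finally show ?thesis
    unfolding H10_norm_def[of "\<lambda>x. u x + v x"] by (intro real_le_lsqrt) (auto simp: H10_norm_nonneg)
qed

lemma H10_norm_scale: "u \<in> H10 \<Longrightarrow> H10_norm (\<lambda>x. c * u x) = \<bar>c\<bar> * H10_norm u"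
  using sym_form_scale[OF sym_form_H10_inner _ H10_scale, of u u c c] sym_form_right(3)[OF sym_form_H10_inner, of u u u c]
  by (simp add: H10_norm_def real_sqrt_mult mult.assoc[symmetric])

lemma H10_norm_diff:
  assumes "u \<in> H10" "v \<in> H10"
  shows "H10_norm (\<lambda>x. u x - v x) \<le> H10_norm u + H10_norm v"
  using H10_norm_add[OF assms(1) H10_scale[OF assms(2), of "-1"]] H10_norm_scale[OF assms(2), of "-1"] by simp

lemma bdd_meas_smooth:
  assumes "smooth_on Omega f" "\<And>x. x \<in> Omega \<Longrightarrow> \<bar>f x\<bar> \<le> B"
  shows "bdd_meas f"
proof -
  have "Ck_on 0 Omega f" using assms(1) unfolding smooth_on_def by (rule spec)
  then have "continuous_on Omega f" by (simp only: Ck_on.simps)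
  then have "f \<in> borel_measurable MO" by (rule continuous_imp_measurable_on_sets_lebesgue) simp
  then show ?thesis using assms(2) unfolding bdd_meas_def by blast
qed

lemma sym_form_a_form:
  assumes "bdd_meas \<nu>" "bdd_meas \<sigma>"
  shows "sym_form (a_form \<nu> \<sigma>)"
  unfolding sym_form_def
proof (intro conjI ballI allI)
  fix u v w :: plane_fun and c :: real assume u: "u \<in> H10" and w: "w \<in> H10" 
  have m\<nu>: "\<nu> \<in> borel_measurable MO" "\<sigma> \<in> borel_measurable MO" using assms by (auto simp: bdd_meas_def)
  show "a_form \<nu> \<sigma> u w = a_form \<nu> \<sigma> w u" by (simp add: a_form_def inner_commute mult.commute)
  note L = wgrad_L2[OF H10_H1[OF u]] wgrad_L2[OF H10_H1[OF w]]
  note m = L[THEN L2_measurable]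
  have I1: "integrable MO (\<lambda>x. \<nu> x * (wgrad u x \<bullet> wgrad w x))" if "u \<in> H10" for u
    by (intro bdd_meas_mult_integrable assms L2_inner L wgrad_L2 H10_H1 that)
  have I2: "integrable MO (\<lambda>x. \<sigma> x * (u x * w x))" if "u \<in> H10" for u
    by (intro bdd_meas_mult_integrable assms L2_mult H1_L2 H10_H1 that w)
  show "a_form \<nu> \<sigma> (\<lambda>x. c * u x) w = c * a_form \<nu> \<sigma> u w"
  proof -
    have "(LINT x|MO. \<nu> x * (wgrad (\<lambda>x. c * u x) x \<bullet> wgrad w x)) = (LINT x|MO. c * (\<nu> x * (wgrad u x \<bullet> wgrad w x)))"
    proof (rule integral_cong_AE)
      show "AE x in MO. \<nu> x * (wgrad (\<lambda>x. c * u x) x \<bullet> wgrad w x) = c * (\<nu> x * (wgrad u x \<bullet> wgrad w x))"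
        using wgrad_scale[OF H10_H1[OF u], of c] by eventually_elim simp
    qed (use m m\<nu> L2_measurable[OF wgrad_L2[OF H1_scale[OF H10_H1[OF u]]]] in auto)
    moreover have "(LINT x|MO. \<sigma> x * (c * u x * w x)) = (LINT x|MO. c * (\<sigma> x * (u x * w x)))"
      by (simp add: mult.left_commute mult.assoc)
    ultimately show ?thesis by (simp add: a_form_def distrib_left)
  qed
  assume v: "v \<in> H10"
  note Lv = wgrad_L2[OF H10_H1[OF v]]
  show "a_form \<nu> \<sigma> (\<lambda>x. u x + v x) w = a_form \<nu> \<sigma> u w + a_form \<nu> \<sigma> v w"
  proof -
    have "(LINT x|MO. \<nu> x * (wgrad (\<lambda>x. u x + v x) x \<bullet> wgrad w x)) = (LINT x|MO. \<nu> x * (wgrad u x \<bullet> wgrad w x) + \<nu> x * (wgrad v x \<bullet> wgrad w x))"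
    proof (rule integral_cong_AE)
      show "AE x in MO. \<nu> x * (wgrad (\<lambda>x. u x + v x) x \<bullet> wgrad w x) = \<nu> x * (wgrad u x \<bullet> wgrad w x) + \<nu> x * (wgrad v x \<bullet> wgrad w x)"
        using wgrad_add[OF H10_H1[OF u] H10_H1[OF v]] by eventually_elim (simp add: inner_add_left distrib_left)
    qed (use m m\<nu> L2_measurable[OF Lv] L2_measurable[OF wgrad_L2[OF H1_add[OF H10_H1[OF u] H10_H1[OF v]]]] in auto)
    moreover have "(LINT x|MO. \<sigma> x * ((u x + v x) * w x)) = (LINT x|MO. \<sigma> x * (u x * w x) + \<sigma> x * (v x * w x))"
      by (simp add: distrib_left distrib_right)
    ultimately show ?thesis using I1[OF u] I1[OF v] I2[OF u] I2[OF v] by (simp add: a_form_def)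
  qed
qed

lemma a_form_nonneg:
  assumes "\<forall>x\<in>Omega. 0 \<le> \<nu> x" "\<forall>x\<in>Omega. 0 \<le> \<sigma> x"
  shows "0 \<le> a_form \<nu> \<sigma> v v"
  unfolding a_form_def using assms by (auto intro!: add_nonneg_nonneg Bochner_Integration.integral_nonneg)

section \<open>Bounded functionals on the energy space\<close>

lemma H10_dual_add: "f \<in> H10_dual \<Longrightarrow> v \<in> H10 \<Longrightarrow> w \<in> H10 \<Longrightarrow> f (\<lambda>x. v x + w x) = f v + f w"
  and H10_dual_scale: "f \<in> H10_dual \<Longrightarrow> v \<in> H10 \<Longrightarrow> f (\<lambda>x. c * v x) = c * f v"
  by (simp_all add: H10_dual_def)

lemma H10_dual_bound:
  assumes "f \<in> H10_dual"
  obtains C where "0 \<le> C" "\<And>v. v \<in> H10 \<Longrightarrow> \<bar>f v\<bar> \<le> C * H10_norm v"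
proof -
  obtain C where C: "\<forall>v\<in>H10. \<bar>f v\<bar> \<le> C * H10_norm v" using assms by (auto simp: H10_dual_def)
  have "\<bar>f v\<bar> \<le> \<bar>C\<bar> * H10_norm v" if "v \<in> H10" for v
    using C that mult_right_mono[OF abs_ge_self H10_norm_nonneg[of v], of C] by fastforce
  then show ?thesis using that[of "\<bar>C\<bar>"] by simp
qed

lemma H10_dual_sum:
  assumes "f \<in> H10_dual" "\<And>k. k \<in> F \<Longrightarrow> \<phi> k \<in> H10"
  shows "f (\<lambda>x. \<Sum>k\<in>F. c k * \<phi> k x) = (\<Sum>k\<in>F. c k * f (\<phi> k))"
proof -
  have z: "f (\<lambda>x. 0) = 0" using H10_dual_scale[OF assms(1) H10_zero, of 0] by simp
  show ?thesis
    using assms(2)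
  proof (induction F rule: infinite_finite_induct)
    case (insert k F)
    have "f (\<lambda>x. \<Sum>k\<in>insert k F. c k * \<phi> k x) = f (\<lambda>x. c k * \<phi> k x + (\<Sum>k\<in>F. c k * \<phi> k x))"
      using insert by simp
    also have "\<dots> = f (\<lambda>x. c k * \<phi> k x) + f (\<lambda>x. \<Sum>k\<in>F. c k * \<phi> k x)"
      by (intro H10_dual_add[OF assms(1)] H10_scale H10_sum) (use insert in auto)
    also have "\<dots> = c k * f (\<phi> k) + (\<Sum>k\<in>F. c k * f (\<phi> k))"
      using insert H10_dual_scale[OF assms(1), of "\<phi> k" "c k"] by simp
    finally show ?case using insert by simp
  qed (auto simp: z)
qed

lemma H10_dual_diff:
  assumes "f \<in> H10_dual" "g \<in> H10_dual"
  shows "(\<lambda>v. f v - g v) \<in> H10_dual"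
proof -
  obtain C where C: "\<And>v. v \<in> H10 \<Longrightarrow> \<bar>f v\<bar> \<le> C * H10_norm v" using H10_dual_bound[OF assms(1)] by blast
  obtain D where D: "\<And>v. v \<in> H10 \<Longrightarrow> \<bar>g v\<bar> \<le> D * H10_norm v" using H10_dual_bound[OF assms(2)] by blast
  have "\<bar>f v - g v\<bar> \<le> (C + D) * H10_norm v" if "v \<in> H10" for v
    using C[OF that] D[OF that] by (simp add: distrib_right)
  then show ?thesis
    unfolding H10_dual_def using H10_dual_add[OF assms(1)] H10_dual_add[OF assms(2)] H10_dual_scale[OF assms(1)] H10_dual_scale[OF assms(2)]
    by (auto simp: right_diff_distrib intro!: exI[of _ "C + D"])
qed

section \<open>Polynomials in two complex variables\<close>

text \<open>Polynomials with real coefficients as functions of two complex variables, with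
  \<open>n\<close> a bound for the total degree. Real coefficients keep values real at real points,
  so that real traces are compatible with products; the degree is the exponent in the growth
  estimate on ellipses.\<close>

inductive poly_fun :: "nat \<Rightarrow> (complex \<Rightarrow> complex \<Rightarrow> complex) \<Rightarrow> bool" where
  poly_fun_const: "poly_fun n (\<lambda>x y. of_real c)"
| poly_fun_X: "poly_fun (Suc n) (\<lambda>x y. x)"
| poly_fun_Y: "poly_fun (Suc n) (\<lambda>x y. y)"
| poly_fun_add: "poly_fun n F \<Longrightarrow> poly_fun n G \<Longrightarrow> poly_fun n (\<lambda>x y. F x y + G x y)"
| poly_fun_mult: "poly_fun n F \<Longrightarrow> poly_fun m G \<Longrightarrow> poly_fun (n + m) (\<lambda>x y. F x y * G x y)"

lemma poly_fun_weaken: assumes "poly_fun n F" "n \<le> m" shows "poly_fun m F"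
  using poly_fun_mult[OF assms(1) poly_fun_const[of "m - n" 1]] assms(2) by simp

lemma poly_fun_swap: "poly_fun n F \<Longrightarrow> poly_fun n (\<lambda>x y. F y x)"
  by (induction rule: poly_fun.induct) (auto intro: poly_fun.intros)

lemma poly_fun_scale: "poly_fun n F \<Longrightarrow> poly_fun n (\<lambda>x y. of_real c * F x y)"
  using poly_fun_mult[OF poly_fun_const[of 0 c], of n F] by simp

lemma poly_fun_diff: "poly_fun n F \<Longrightarrow> poly_fun n G \<Longrightarrow> poly_fun n (\<lambda>x y. F x y - G x y)"
  using poly_fun_add[OF _ poly_fun_scale[of n G "-1"], of F] by simp

lemma poly_fun_sum: "(\<And>k. k \<in> A \<Longrightarrow> poly_fun n (F k)) \<Longrightarrow> poly_fun n (\<lambda>x y. \<Sum>k\<in>A. F k x y)"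
  by (induction A rule: infinite_finite_induct) (use poly_fun_const[of n 0] in \<open>auto intro: poly_fun_add\<close>)

lemma poly_fun_power: "poly_fun n F \<Longrightarrow> poly_fun (k * n) (\<lambda>x y. F x y ^ k)"
  by (induction k) (use poly_fun_const[of _ 1] in \<open>auto intro: poly_fun_mult\<close>)

text \<open>The trace on the real plane. The functions to which it is applied below take real values
  at the real points that matter, so \<open>Re\<close> discards nothing.\<close>

definition restr :: "(complex \<Rightarrow> complex \<Rightarrow> complex) \<Rightarrow> plane_fun" where
  "restr F z = Re (F (of_real (fst z)) (of_real (snd z)))"

lemma poly_fun_real: "poly_fun n F \<Longrightarrow> Im (F (of_real a) (of_real b)) = 0"
  by (induction rule: poly_fun.induct) auto

lemma poly_fun_restr: "poly_fun n F \<Longrightarrow> F (of_real a) (of_real b) = of_real (restr F (a, b))"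
  by (simp add: restr_def poly_fun_real complex_eq_iff)

lemma restr_mult: "poly_fun n F \<Longrightarrow> poly_fun m G \<Longrightarrow> restr (\<lambda>x y. F x y * G x y) = (\<lambda>z. restr F z * restr G z)"
  by (auto simp: restr_def poly_fun_real fun_eq_iff)

lemma restr_add: "restr (\<lambda>x y. F x y + G x y) = (\<lambda>z. restr F z + restr G z)"
  and restr_scale: "restr (\<lambda>x y. of_real c * F x y) = (\<lambda>z. c * restr F z)"
  and restr_sum: "restr (\<lambda>x y. \<Sum>k\<in>A. H k x y) = (\<lambda>z. \<Sum>k\<in>A. restr (H k) z)"
  and restr_X: "restr (\<lambda>x y. x) = fst" and restr_Y: "restr (\<lambda>x y. y) = snd"
  and restr_const: "restr (\<lambda>x y. of_real c) = (\<lambda>z. c)"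
  by (auto simp: restr_def fun_eq_iff)

section \<open>Complex partial derivatives of polynomials\<close>

definition Dx :: "(complex \<Rightarrow> complex \<Rightarrow> complex) \<Rightarrow> complex \<Rightarrow> complex \<Rightarrow> complex" where
  "Dx F x y = deriv (\<lambda>x. F x y) x"

definition Dy :: "(complex \<Rightarrow> complex \<Rightarrow> complex) \<Rightarrow> complex \<Rightarrow> complex \<Rightarrow> complex" where
  "Dy F x y = deriv (\<lambda>y. F x y) y"

text \<open>Differentiability along all complex lines. It contains both partial derivatives and, in
  one formula, the chain rule along the characteristic directions used at the corner.\<close>

definition lines :: "(complex \<Rightarrow> complex \<Rightarrow> complex) \<Rightarrow> (complex \<Rightarrow> complex \<Rightarrow> complex) \<Rightarrow> (complex \<Rightarrow> complex \<Rightarrow> complex) \<Rightarrow> bool" where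
  "lines F Fx Fy \<longleftrightarrow> (\<forall>a b c d t. ((\<lambda>t. F (a + b * t) (c + d * t)) has_field_derivative
      b * Fx (a + b * t) (c + d * t) + d * Fy (a + b * t) (c + d * t)) (at t))"

lemma lines_const: "lines (\<lambda>x y. k) (\<lambda>x y. 0) (\<lambda>x y. 0)"
  and lines_X: "lines (\<lambda>x y. x) (\<lambda>x y. 1) (\<lambda>x y. 0)"
  and lines_Y: "lines (\<lambda>x y. y) (\<lambda>x y. 0) (\<lambda>x y. 1)"
  unfolding lines_def by (auto intro!: derivative_eq_intros)

lemma lines_add: "lines F Fx Fy \<Longrightarrow> lines G Gx Gy \<Longrightarrow> lines (\<lambda>x y. F x y + G x y) (\<lambda>x y. Fx x y + Gx x y) (\<lambda>x y. Fy x y + Gy x y)"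
  unfolding lines_def
  by (intro allI derivative_eq_intros; (elim allE, assumption)?) (simp add: algebra_simps)

lemma lines_mult: "lines F Fx Fy \<Longrightarrow> lines G Gx Gy \<Longrightarrow> lines (\<lambda>x y. F x y * G x y) (\<lambda>x y. F x y * Gx x y + Fx x y * G x y) (\<lambda>x y. F x y * Gy x y + Fy x y * G x y)"
  unfolding lines_def
  by (intro allI derivative_eq_intros; (elim allE, assumption)?) (simp add: algebra_simps)

lemma lines_Dx:
  assumes "lines F Fx Fy"
  shows "((\<lambda>x. F x y) has_field_derivative Fx x y) (at x)" "((\<lambda>y. F x y) has_field_derivative Fy x y) (at y)"
    "Dx F = Fx" "Dy F = Fy"
proof -
  show x: "((\<lambda>x. F x y) has_field_derivative Fx x y) (at x)" for x y
    using assms[unfolded lines_def, rule_format, of 0 1 y 0 x] by simp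
  show y: "((\<lambda>y. F x y) has_field_derivative Fy x y) (at y)" for x y
    using assms[unfolded lines_def, rule_format, of x 0 0 1 y] by simp
  show "Dx F = Fx" "Dy F = Fy"
    using DERIV_imp_deriv[OF x] DERIV_imp_deriv[OF y] by (auto simp: fun_eq_iff Dx_def Dy_def)
qed

lemma restr_01: "restr (\<lambda>x y. 0) = (\<lambda>z. 0)" "restr (\<lambda>x y. 1) = (\<lambda>z. 1)"
  by (auto simp: restr_def fun_eq_iff)

lemma C1_grad_basic: "C1_grad (\<lambda>z. c) (\<lambda>z. 0) (\<lambda>z. 0)" "C1_grad fst (\<lambda>z. 1) (\<lambda>z. 0)" "C1_grad snd (\<lambda>z. 0) (\<lambda>z. 1)"
  unfolding C1_grad_def by (auto intro!: derivative_eq_intros continuous_intros)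

lemma C1_grad_add:
  assumes "C1_grad u ux uy" "C1_grad v vx vy"
  shows "C1_grad (\<lambda>z. u z + v z) (\<lambda>z. ux z + vx z) (\<lambda>z. uy z + vy z)"
  unfolding C1_grad_def
proof (intro conjI allI)
  show "((\<lambda>z. u z + v z) has_derivative (\<lambda>h. fst h * (ux z + vx z) + snd h * (uy z + vy z))) (at z)" for z
    using has_derivative_add[OF c1D(1)[OF assms(1)] c1D(1)[OF assms(2)]]
    by (rule has_derivative_eq_rhs) (auto simp: algebra_simps)
qed (intro continuous_intros c1D[OF assms(1)] c1D[OF assms(2)])+

text \<open>All partial derivatives of a polynomial function in one induction; the mixed one is
  shared, which is its symmetry.\<close>

lemma poly_fun_derivs_ex:
  "poly_fun n F \<Longrightarrow> \<exists>Fx Fy Fxx Fxy Fyy. poly_fun n Fx \<and> poly_fun n Fy \<and> poly_fun n Fxx \<and> poly_fun n Fxy \<and> poly_fun n Fyy \<and>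
     lines F Fx Fy \<and> lines Fx Fxx Fxy \<and> lines Fy Fxy Fyy \<and> C1_grad (restr F) (restr Fx) (restr Fy)"
proof (induction rule: poly_fun.induct)
  case (poly_fun_const n c)
  have "C1_grad (restr (\<lambda>x y. of_real c)) (restr (\<lambda>x y. 0)) (restr (\<lambda>x y. 0))"
    unfolding restr_01 restr_const restr_X restr_Y by (rule C1_grad_basic)
  moreover have "poly_fun n (\<lambda>x y. 0)" using poly_fun.poly_fun_const[of n 0] by simp
  ultimately show ?case
    by - (rule exI[of _ "\<lambda>x y. 0"], rule exI[of _ "\<lambda>x y. 0"], rule exI[of _ "\<lambda>x y. 0"], rule exI[of _ "\<lambda>x y. 0"], rule exI[of _ "\<lambda>x y. 0"],
      intro conjI; (assumption | rule lines_const))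
next
  case (poly_fun_X n)
  have "C1_grad (restr (\<lambda>x y. x)) (restr (\<lambda>x y. 1)) (restr (\<lambda>x y. 0))"
    unfolding restr_01 restr_const restr_X restr_Y by (rule C1_grad_basic)
  moreover have "poly_fun (Suc n) (\<lambda>x y. 0)" "poly_fun (Suc n) (\<lambda>x y. 1)" using poly_fun.poly_fun_const[of "Suc n" 0] poly_fun.poly_fun_const[of "Suc n" 1] by auto
  ultimately show ?case
    by - (rule exI[of _ "\<lambda>x y. 1"], rule exI[of _ "\<lambda>x y. 0"], rule exI[of _ "\<lambda>x y. 0"], rule exI[of _ "\<lambda>x y. 0"], rule exI[of _ "\<lambda>x y. 0"],
      intro conjI; (assumption | rule lines_const lines_X))
next
  case (poly_fun_Y n)
  have "C1_grad (restr (\<lambda>x y. y)) (restr (\<lambda>x y. 0)) (restr (\<lambda>x y. 1))"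
    unfolding restr_01 restr_const restr_X restr_Y by (rule C1_grad_basic)
  moreover have "poly_fun (Suc n) (\<lambda>x y. 0)" "poly_fun (Suc n) (\<lambda>x y. 1)" using poly_fun.poly_fun_const[of "Suc n" 0] poly_fun.poly_fun_const[of "Suc n" 1] by auto
  ultimately show ?case
    by - (rule exI[of _ "\<lambda>x y. 0"], rule exI[of _ "\<lambda>x y. 1"], rule exI[of _ "\<lambda>x y. 0"], rule exI[of _ "\<lambda>x y. 0"], rule exI[of _ "\<lambda>x y. 0"],
      intro conjI; (assumption | rule lines_const lines_Y))
next
  case (poly_fun_add n F G)
  from poly_fun_add.IH(1) obtain Fx Fy Fxx Fxy Fyy where
    F: "poly_fun n Fx" "poly_fun n Fy" "poly_fun n Fxx" "poly_fun n Fxy" "poly_fun n Fyy" "lines F Fx Fy" "lines Fx Fxx Fxy" "lines Fy Fxy Fyy" "C1_grad (restr F) (restr Fx) (restr Fy)"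
    by (elim exE conjE)
  from poly_fun_add.IH(2) obtain Gx Gy Gxx Gxy Gyy where
    G: "poly_fun n Gx" "poly_fun n Gy" "poly_fun n Gxx" "poly_fun n Gxy" "poly_fun n Gyy" "lines G Gx Gy" "lines Gx Gxx Gxy" "lines Gy Gxy Gyy" "C1_grad (restr G) (restr Gx) (restr Gy)"
    by (elim exE conjE)
  show ?case
    by (rule exI[of _ "\<lambda>x y. Fx x y + Gx x y"], rule exI[of _ "\<lambda>x y. Fy x y + Gy x y"],
        rule exI[of _ "\<lambda>x y. Fxx x y + Gxx x y"], rule exI[of _ "\<lambda>x y. Fxy x y + Gxy x y"],
        rule exI[of _ "\<lambda>x y. Fyy x y + Gyy x y"], unfold restr_add, intro conjI poly_fun.poly_fun_add lines_add C1_grad_add F G)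
next
  case (poly_fun_mult n F m G)
  from poly_fun_mult.IH(1) obtain Fx Fy Fxx Fxy Fyy where
    F: "poly_fun n Fx" "poly_fun n Fy" "poly_fun n Fxx" "poly_fun n Fxy" "poly_fun n Fyy" "lines F Fx Fy" "lines Fx Fxx Fxy" "lines Fy Fxy Fyy" "C1_grad (restr F) (restr Fx) (restr Fy)"
    by (elim exE conjE)
  from poly_fun_mult.IH(2) obtain Gx Gy Gxx Gxy Gyy where
    G: "poly_fun m Gx" "poly_fun m Gy" "poly_fun m Gxx" "poly_fun m Gxy" "poly_fun m Gyy" "lines G Gx Gy" "lines Gx Gxx Gxy" "lines Gy Gxy Gyy" "C1_grad (restr G) (restr Gx) (restr Gy)"
    by (elim exE conjE)
  note FG = poly_fun_mult.hyps
  let ?x = "\<lambda>x y. F x y * Gx x y + Fx x y * G x y"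
  let ?y = "\<lambda>x y. F x y * Gy x y + Fy x y * G x y"
  let ?xx = "\<lambda>x y. (F x y * Gxx x y + Fx x y * Gx x y) + (Fx x y * Gx x y + Fxx x y * G x y)"
  let ?xy = "\<lambda>x y. (F x y * Gxy x y + Fy x y * Gx x y) + (Fx x y * Gy x y + Fxy x y * G x y)"
  let ?yy = "\<lambda>x y. (F x y * Gyy x y + Fy x y * Gy x y) + (Fy x y * Gy x y + Fyy x y * G x y)"
  have "lines ?x ?xx ?xy"
    by (intro lines_add lines_mult F G)
  moreover have "lines ?y (\<lambda>x y. (F x y * Gxy x y + Fx x y * Gy x y) + (Fy x y * Gx x y + Fxy x y * G x y)) ?yy"
    by (intro lines_add lines_mult F G)
  then have "lines ?y ?xy ?yy" by (simp add: add_ac)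
  moreover have "C1_grad (restr (\<lambda>x y. F x y * G x y)) (restr ?x) (restr ?y)"
    unfolding restr_add restr_mult[OF FG] restr_mult[OF FG(1) G(1)] restr_mult[OF FG(1) G(2)] restr_mult[OF F(1) FG(2)] restr_mult[OF F(2) FG(2)]
    by (rule C1_grad_mult[OF F(9) G(9)])
  moreover have "lines (\<lambda>x y. F x y * G x y) ?x ?y" by (intro lines_mult F G)
  moreover have "poly_fun (n + m) ?x" "poly_fun (n + m) ?y" "poly_fun (n + m) ?xx" "poly_fun (n + m) ?xy" "poly_fun (n + m) ?yy"
    by (intro poly_fun.poly_fun_add poly_fun.poly_fun_mult F G FG)+
  ultimately show ?case
    by - (rule exI[of _ ?x], rule exI[of _ ?y], rule exI[of _ ?xx], rule exI[of _ ?xy], rule exI[of _ ?yy],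
      intro conjI; assumption)
qed

lemma poly_fun_derivs:
  assumes "poly_fun n F"
  shows "poly_fun n (Dx F)" "poly_fun n (Dy F)" "lines F (Dx F) (Dy F)" "C1_grad (restr F) (restr (Dx F)) (restr (Dy F))"
    "Dx (Dy F) = Dy (Dx F)"
proof -
  obtain Fx Fy Fxx Fxy Fyy where F: "poly_fun n Fx" "poly_fun n Fy" "lines F Fx Fy" "lines Fx Fxx Fxy" "lines Fy Fxy Fyy" "C1_grad (restr F) (restr Fx) (restr Fy)"
    using poly_fun_derivs_ex[OF assms] by (elim exE conjE)
  note e = lines_Dx(3,4)[OF F(3)] lines_Dx(3,4)[OF F(4)] lines_Dx(3,4)[OF F(5)]
  show "poly_fun n (Dx F)" "poly_fun n (Dy F)" "lines F (Dx F) (Dy F)" "C1_grad (restr F) (restr (Dx F)) (restr (Dy F))"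
    "Dx (Dy F) = Dy (Dx F)"
    unfolding e by (simp_all add: F)
qed

lemma poly_fun_continuous: "poly_fun n F \<Longrightarrow> continuous_on A (\<lambda>z. F (fst z) (snd z))"
  by (induction rule: poly_fun.induct) (auto intro!: continuous_intros)

lemma poly_fun_holomorphic: "poly_fun n F \<Longrightarrow> (\<lambda>x. F x y) holomorphic_on A" "poly_fun n F \<Longrightarrow> (\<lambda>y. F x y) holomorphic_on A"
  using lines_Dx(1,2)[OF poly_fun_derivs(3)] field_differentiable_at_within
  unfolding holomorphic_on_def field_differentiable_def by blast+

lemma poly_fun_bounded:
  assumes "poly_fun n F" "bounded A" "bounded B"
  obtains M where "0 \<le> M" "\<And>x y. x \<in> A \<Longrightarrow> y \<in> B \<Longrightarrow> norm (F x y) \<le> M"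
proof -
  have "compact (closure A \<times> closure B)" using assms by (intro compact_Times) (auto simp: compact_closure)
  then have "bounded ((\<lambda>z. F (fst z) (snd z)) ` (closure A \<times> closure B))"
    by (intro compact_imp_bounded compact_continuous_image poly_fun_continuous[OF assms(1)])
  then obtain M where M: "\<forall>w\<in>(\<lambda>z. F (fst z) (snd z)) ` (closure A \<times> closure B). norm w \<le> M"
    unfolding bounded_iff by blast
  have "norm (F x y) \<le> \<bar>M\<bar>" if "x \<in> A" "y \<in> B" for x y
  proof -
    have "(x, y) \<in> closure A \<times> closure B" using that closure_subset by auto
    then have "norm (F x y) \<le> M" using M by force
    then show ?thesis by simp
  qed
  then show ?thesis using that[of "\<bar>M\<bar>"] by simp
qed

lemma poly_fun_smooth: "poly_fun n F \<Longrightarrow> smooth_on UNIV (restr F)"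
proof (induction rule: poly_fun.induct)
  case (poly_fun_mult n F m G)
  then show ?case using smooth_on_lincomb(2) by (simp add: restr_mult)
next
  case (poly_fun_add n F G)
  then show ?case using smooth_on_lincomb(1) by (simp add: restr_add)
qed (auto simp: restr_const restr_X restr_Y smooth_on_def Ck_const intro: Ck_linear bounded_linear_fst bounded_linear_snd)

section \<open>Growth of polynomials on Bernstein ellipses\<close>

text \<open>The factor v^n clears the pole of order at most n at v = 0. The result is entire, so
  that the maximum principle can be used in the whole unit disc.\<close>

lemma poly_fun_Joukowski:
  "poly_fun n F \<Longrightarrow> \<exists>Q. Q holomorphic_on UNIV \<and> (\<forall>v. v \<noteq> 0 \<longrightarrow> Q v = v ^ n * F ((v + 1 / v) / 2) y)"
proof (induction rule: poly_fun.induct)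
  case (poly_fun_const n c)
  show ?case by (rule exI[of _ "\<lambda>v. v ^ n * of_real c"]) (auto intro!: holomorphic_intros)
next
  case (poly_fun_X n)
  show ?case by (rule exI[of _ "\<lambda>v. v ^ n * ((v ^ 2 + 1) / 2)"])
      (auto intro!: holomorphic_intros simp: field_simps power2_eq_square)
next
  case (poly_fun_Y n)
  show ?case by (rule exI[of _ "\<lambda>v. v ^ Suc n * y"]) (auto intro!: holomorphic_intros)
next
  case (poly_fun_add n F G)
  then obtain P Q where "P holomorphic_on UNIV" "\<forall>v. v \<noteq> 0 \<longrightarrow> P v = v ^ n * F ((v + 1 / v) / 2) y"
    "Q holomorphic_on UNIV" "\<forall>v. v \<noteq> 0 \<longrightarrow> Q v = v ^ n * G ((v + 1 / v) / 2) y" by blast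
  then show ?case by (intro exI[of _ "\<lambda>v. P v + Q v"]) (auto intro!: holomorphic_intros simp: distrib_left)
next
  case (poly_fun_mult n F m G)
  then obtain P Q where "P holomorphic_on UNIV" "\<forall>v. v \<noteq> 0 \<longrightarrow> P v = v ^ n * F ((v + 1 / v) / 2) y"
    "Q holomorphic_on UNIV" "\<forall>v. v \<noteq> 0 \<longrightarrow> Q v = v ^ m * G ((v + 1 / v) / 2) y" by blast
  then show ?case by (intro exI[of _ "\<lambda>v. P v * Q v"]) (auto intro!: holomorphic_intros simp: power_add)
qed

text \<open>A Bernstein--Walsh inequality, by the maximum principle for \<open>v\<^sup>n F((v + 1/v)/2)\<close> in the unit disc.\<close>

lemma poly_fun_Walsh1:
  assumes F: "poly_fun n F" and M: "\<And>t. \<bar>t\<bar> \<le> 1 \<Longrightarrow> norm (F (of_real t) y) \<le> M"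
    and v: "v \<noteq> 0" "norm v \<le> 1"
  shows "norm (F ((v + 1 / v) / 2) y) \<le> M * (1 / norm v) ^ n"
proof -
  obtain Q where Q: "Q holomorphic_on UNIV" "\<And>v. v \<noteq> 0 \<Longrightarrow> Q v = v ^ n * F ((v + 1 / v) / 2) y"
    using poly_fun_Joukowski[OF F] by blast
  have "norm (Q v) \<le> M"
  proof (rule maximum_modulus_frontier[of Q "cball 0 1"])
    show "Q holomorphic_on interior (cball 0 1)" "continuous_on (closure (cball 0 1)) Q"
      using Q(1) holomorphic_on_subset holomorphic_on_imp_continuous_on continuous_on_subset by blast+
    show "norm (Q z) \<le> M" if "z \<in> frontier (cball 0 1)" for z
    proof -
      have z: "norm z = 1" "z \<noteq> 0" using that by (auto simp: frontier_cball)
      then have "1 / z = cnj z"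
        using complex_div_cnj[of 1 z] by simp
      then have "(z + 1 / z) / 2 = of_real (Re z)" by (simp add: complex_add_cnj)
      moreover have "\<bar>Re z\<bar> \<le> 1" using abs_Re_le_cmod[of z] z by simp
      ultimately show ?thesis using Q(2)[OF z(2)] M[of "Re z"] z by (simp add: norm_mult norm_power)
    qed
  qed (use v in auto)
  then show ?thesis
    using Q(2)[OF v(1)] v by (simp add: norm_mult norm_power field_simps)
qed

text \<open>The interior of the Bernstein ellipse with foci \<open>\<plusminus>1\<close> whose semi-axes sum to \<open>R\<close>.\<close>

definition ellipse :: "real \<Rightarrow> complex set" where
  "ellipse R = {z. norm (z - 1) + norm (z + 1) < R + 1 / R}"

lemma open_ellipse: "open (ellipse R)"
  unfolding ellipse_def by (intro open_Collect_less continuous_intros)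

lemma convex_ellipse: "convex (ellipse R)"
proof (rule convexI)
  fix x y :: complex and u v :: real assume xy: "x \<in> ellipse R" "y \<in> ellipse R" and uv: "0 \<le> u" "0 \<le> v" "u + v = 1"
  have e: "norm (u *\<^sub>R x + v *\<^sub>R y + c) \<le> u * norm (x + c) + v * norm (y + c)" for c :: complex
  proof -
    have "u *\<^sub>R x + v *\<^sub>R y + c = u *\<^sub>R (x + c) + v *\<^sub>R (y + c)"
      using uv(3) by (simp add: scaleR_add_right flip: scaleR_add_left)
    then show ?thesis using norm_triangle_ineq[of "u *\<^sub>R (x + c)" "v *\<^sub>R (y + c)"] uv by simp
  qed
  let ?S = "R + 1 / R"
  have "norm (u *\<^sub>R x + v *\<^sub>R y - 1) + norm (u *\<^sub>R x + v *\<^sub>R y + 1)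
      \<le> u * (norm (x - 1) + norm (x + 1)) + v * (norm (y - 1) + norm (y + 1))"
    using e[of "-1"] e[of 1] by (simp add: algebra_simps)
  also have "\<dots> < ?S"
    using xy uv convex_bound_lt[of "norm (x - 1) + norm (x + 1)" ?S "norm (y - 1) + norm (y + 1)" u v]
    by (simp add: ellipse_def)
  finally show "u *\<^sub>R x + v *\<^sub>R y \<in> ellipse R" by (simp add: ellipse_def)
qed

lemma connected_ellipse: "connected (ellipse R)"
  by (rule convex_connected[OF convex_ellipse])

lemma bounded_ellipse: "bounded (ellipse R)"
proof -
  have "ellipse R \<subseteq> ball 1 (R + 1 / R)"
  proof
    fix z assume "z \<in> ellipse R"
    then show "z \<in> ball 1 (R + 1 / R)"
      using norm_ge_zero[of "z + 1"] norm_minus_commute[of 1 z] by (simp add: ellipse_def dist_norm del: norm_ge_zero) 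
  qed
  then show ?thesis using bounded_ball bounded_subset by blast
qed

lemma joukowski_gt_2: "1 < R \<Longrightarrow> 2 < R + 1 / (R::real)"
proof -
  assume "1 < R"
  then have "0 < (R - 1)\<^sup>2 / R" by simp
  also have "(R - 1)\<^sup>2 / R = R + 1 / R - 2" using \<open>1 < R\<close> by (simp add: field_simps power2_eq_square)
  finally show ?thesis by simp
qed

lemma joukowski_strict_mono:
  assumes "1 \<le> R'" "R' < R"
  shows "R' + 1 / R' < R + 1 / (R::real)"
proof -
  have "1 * R \<le> R' * R"
    using assms by (intro mult_right_mono) auto
  then have "1 < R' * R" using assms by linarith
  then have "0 < (R - R') * (R' * R - 1) / (R * R')" using assms by simp
  also have "\<dots> = R + 1 / R - (R' + 1 / R')" using assms by (simp add: field_simps)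
  finally show ?thesis by simp
qed

lemma real_in_ellipse: "1 < R \<Longrightarrow> \<bar>t\<bar> \<le> 1 \<Longrightarrow> of_real t \<in> ellipse R"
proof -
  assume "1 < R" "\<bar>t\<bar> \<le> 1"
  have "norm (complex_of_real t - 1) = 1 - t" "norm (complex_of_real t + 1) = t + 1"
    using \<open>\<bar>t\<bar> \<le> 1\<close> norm_of_real[of "t - 1", where 'a = complex] norm_of_real[of "t + 1", where 'a = complex] by auto
  then show ?thesis using joukowski_gt_2[OF \<open>1 < R\<close>] by (simp add: ellipse_def)
qed

text \<open>The point -1 is a focus, and moving away from it by \<xi> raises the sum of the focal
  distances by at most twice the norm of \<xi>. This is the complex room available around the
  corner.\<close>

lemma near_corner_in_ellipse: "2 + 2 * norm \<xi> < R + 1 / R \<Longrightarrow> - 1 + \<xi> \<in> ellipse R"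
  using norm_triangle_ineq[of \<xi> "-2"] by (simp add: ellipse_def)

lemma ellipse_mono: "1 \<le> R' \<Longrightarrow> R' \<le> R \<Longrightarrow> ellipse R' \<subseteq> ellipse R"
  using joukowski_strict_mono[of R' R] by (cases "R' = R") (auto simp: ellipse_def)

text \<open>A displacement changes the sum of the two focal distances by at most twice its length,
  hence the radius is half the gap. It is the radius for all Cauchy estimates on ellipses.\<close>

lemma cball_ellipse:
  assumes "z \<in> ellipse R'"
  shows "cball z ((R + 1 / R - (R' + 1 / R')) / 2) \<subseteq> ellipse R"
proof
  fix w assume w: "w \<in> cball z ((R + 1 / R - (R' + 1 / R')) / 2)"
  have "norm (w - 1) \<le> norm (z - 1) + norm (w - z)" "norm (w + 1) \<le> norm (z + 1) + norm (w - z)"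
    using norm_triangle_ineq[of "z - 1" "w - z"] norm_triangle_ineq[of "z + 1" "w - z"] by (simp_all add: algebra_simps)
  then show "w \<in> ellipse R" using w assms by (simp add: ellipse_def dist_norm norm_minus_commute field_simps)
qed

text \<open>The two solutions z + s and z - s with s^2 = z^2 - 1 have product 1, so one of them lies
  in the closed unit disc. For it the sum of the focal distances of z is |v| + 1/|v|, and R + 1/R is
  increasing for R \<ge> 1.\<close>

lemma ellipse_Joukowski:
  assumes "z \<in> ellipse R" "1 < R"
  obtains v where "v \<noteq> 0" "norm v \<le> 1" "z = (v + 1 / v) / 2" "1 / norm v \<le> R"
proof -
  define s where "s = csqrt (z\<^sup>2 - 1)"
  have s: "s\<^sup>2 = z\<^sup>2 - 1" by (simp add: s_def)
  have prod: "(z + s) * (z - s) = 1" using s by (simp add: algebra_simps power2_eq_square)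
  define v where "v = (if norm (z + s) \<le> 1 then z + s else z - s)"
  have v0: "v \<noteq> 0" using prod by (auto simp: v_def)
  have "2 * z - (z + s) = z - s" "2 * z - (z - s) = z + s" by simp_all
  then have "v * (2 * z - v) = 1" using prod by (simp only: v_def mult.commute split: if_split) simp
  then have inv: "1 / v = 2 * z - v" using v0 by (simp add: field_simps)
  have n1: "norm v \<le> 1"
  proof (cases "norm (z + s) \<le> 1")
    case False
    have "norm (z + s) * norm (z - s) = 1" using prod by (metis norm_mult norm_one)
    moreover have "1 * norm (z - s) \<le> norm (z + s) * norm (z - s)"
      using False by (intro mult_right_mono) auto
    ultimately have "norm (z - s) \<le> 1" by simp
    then show ?thesis using False by (simp add: v_def)
  qed (simp add: v_def)
  have z: "z = (v + 1 / v) / 2" using inv by simp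
  have "norm (z - 1) = (norm (v - 1))\<^sup>2 / (2 * norm v)"
  proof -
    have "z - 1 = (v - 1)\<^sup>2 / (2 * v)" unfolding z using v0 by (simp add: field_simps power2_eq_square)
    then show ?thesis by (simp add: norm_divide norm_mult norm_power)
  qed
  moreover have "norm (z + 1) = (norm (v + 1))\<^sup>2 / (2 * norm v)"
  proof -
    have "z + 1 = (v + 1)\<^sup>2 / (2 * v)" unfolding z using v0 by (simp add: field_simps power2_eq_square)
    then show ?thesis by (simp add: norm_divide norm_mult norm_power)
  qed
  moreover have "(norm (v - 1))\<^sup>2 + (norm (v + 1))\<^sup>2 = 2 * (norm v)\<^sup>2 + 2"
    unfolding cmod_power2 by (simp add: power2_eq_square algebra_simps)
  ultimately have "norm (z - 1) + norm (z + 1) = (2 * (norm v)\<^sup>2 + 2) / (2 * norm v)"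
    by (simp flip: add_divide_distrib)
  also have "\<dots> = 1 / norm v + 1 / (1 / norm v)" using v0 by (simp add: field_simps power2_eq_square)
  finally have lt: "1 / norm v + 1 / (1 / norm v) < R + 1 / R" using assms(1) by (simp add: ellipse_def)
  have "1 / norm v \<le> R"
  proof (rule ccontr)
    assume "\<not> 1 / norm v \<le> R"
    then show False using joukowski_strict_mono[of R "1 / norm v"] lt assms(2) by simp
  qed
  then show ?thesis using that v0 n1 z by blast
qed

text \<open>The one-variable estimate is applied first in x and then in y. The total degree bounds
  the degree in each variable separately, which produces the exponent 2n.\<close>

lemma poly_fun_Walsh:
  assumes F: "poly_fun n F" and M: "\<And>s t. \<bar>s\<bar> \<le> 1 \<Longrightarrow> \<bar>t\<bar> \<le> 1 \<Longrightarrow> norm (F (of_real s) (of_real t)) \<le> M"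
    and xy: "x \<in> ellipse R" "y \<in> ellipse R" and R: "1 < R"
  shows "norm (F x y) \<le> M * R ^ (2 * n)"
proof -
  have M0: "0 \<le> M" using M[of 0 0] norm_ge_zero order_trans by (metis abs_zero zero_le_one)
  have 1: "norm (F x (of_real t)) \<le> M * R ^ n" if t: "\<bar>t\<bar> \<le> 1" for t
  proof -
    obtain v where v: "v \<noteq> 0" "norm v \<le> 1" "x = (v + 1 / v) / 2" "1 / norm v \<le> R"
      using ellipse_Joukowski[OF xy(1) R] by blast
    have "norm (F x (of_real t)) \<le> M * (1 / norm v) ^ n"
      unfolding v(3) by (rule poly_fun_Walsh1[OF F _ v(1,2)]) (rule M[OF _ t])
    also have "\<dots> \<le> M * R ^ n" by (intro mult_left_mono power_mono v M0) simp
    finally show ?thesis .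
  qed
  obtain v where v: "v \<noteq> 0" "norm v \<le> 1" "y = (v + 1 / v) / 2" "1 / norm v \<le> R"
    using ellipse_Joukowski[OF xy(2) R] by blast
  have "norm (F x y) \<le> (M * R ^ n) * (1 / norm v) ^ n"
    unfolding v(3) by (rule poly_fun_Walsh1[OF poly_fun_swap[OF F] _ v(1,2)]) (rule 1)
  also have "\<dots> \<le> (M * R ^ n) * R ^ n"
    using R by (intro mult_left_mono power_mono v mult_nonneg_nonneg M0) auto
  finally show ?thesis by (simp add: mult_2 power_add mult.assoc)
qed

lemma deriv_bound_ellipse:
  assumes "f holomorphic_on ellipse R" "\<And>z. z \<in> ellipse R \<Longrightarrow> norm (f z) \<le> M" "z \<in> ellipse R'" "1 \<le> R'" "R' < R"
  shows "norm (deriv f z) \<le> M / ((R + 1 / R - (R' + 1 / R')) / 2)"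
proof -
  let ?d = "(R + 1 / R - (R' + 1 / R')) / 2"
  have d: "0 < ?d" using joukowski_strict_mono[OF assms(4,5)] by simp
  have sub: "cball z ?d \<subseteq> ellipse R" by (rule cball_ellipse[OF assms(3)])
  have "norm ((deriv ^^ 1) f z) \<le> fact 1 * M / ?d ^ 1"
  proof (rule Cauchy_inequality)
    show "f holomorphic_on ball z ?d"
      by (rule holomorphic_on_subset[OF assms(1)]) (use sub ball_subset_cball in blast)
    show "continuous_on (cball z ?d) f"
      by (rule continuous_on_subset[OF holomorphic_on_imp_continuous_on[OF assms(1)] sub])
    show "norm (f x) \<le> M" if "norm (z - x) = ?d" for x
      by (rule assms(2)) (use sub that in \<open>auto simp: dist_norm\<close>)
  qed (rule d)
  then show ?thesis by simp
qed

section \<open>Geometrically convergent polynomial expansions\<close>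

text \<open>A substitute for holomorphy in two variables: an expansion in polynomials dominated by a
  geometric series on a product of ellipses. Keeping the terms \<open>g\<close> visible lets exact
  identities and boundary zeros of polynomials pass to the sum term by term.\<close>

definition poly_series :: "real \<Rightarrow> (nat \<Rightarrow> complex \<Rightarrow> complex \<Rightarrow> complex) \<Rightarrow> (complex \<Rightarrow> complex \<Rightarrow> complex) \<Rightarrow> bool" where
  "poly_series R g F \<longleftrightarrow> (\<forall>d. \<exists>n. poly_fun n (g d)) \<and>
     (\<exists>C q. 0 \<le> C \<and> 0 \<le> q \<and> q < 1 \<and> (\<forall>d. \<forall>x\<in>ellipse R. \<forall>y\<in>ellipse R. norm (g d x y) \<le> C * q ^ d)) \<and>
     (\<forall>x\<in>ellipse R. \<forall>y\<in>ellipse R. (\<lambda>d. g d x y) sums F x y)"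

lemma poly_series_PFD: "poly_series R g F \<Longrightarrow> \<exists>n. poly_fun n (g d)"
  unfolding poly_series_def by blast

lemma poly_series_sums: "poly_series R g F \<Longrightarrow> x \<in> ellipse R \<Longrightarrow> y \<in> ellipse R \<Longrightarrow> (\<lambda>d. g d x y) sums F x y"
  unfolding poly_series_def by blast

lemma poly_series_bound:
  assumes "poly_series R g F"
  obtains C q where "0 \<le> C" "0 \<le> q" "q < 1" "\<And>d x y. x \<in> ellipse R \<Longrightarrow> y \<in> ellipse R \<Longrightarrow> norm (g d x y) \<le> C * q ^ d"
  using assms unfolding poly_series_def by blast

lemma poly_series_I:
  assumes "\<And>d. \<exists>n. poly_fun n (g d)" "0 \<le> C" "0 \<le> q" "q < 1"
    "\<And>d x y. x \<in> ellipse R \<Longrightarrow> y \<in> ellipse R \<Longrightarrow> norm (g d x y) \<le> C * q ^ d"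
    "\<And>x y. x \<in> ellipse R \<Longrightarrow> y \<in> ellipse R \<Longrightarrow> (\<lambda>d. g d x y) sums F x y"
  shows "poly_series R g F"
  using assms unfolding poly_series_def by blast

lemma poly_series_suminf:
  assumes "\<And>d. \<exists>n. poly_fun n (g d)" "0 \<le> C" "0 \<le> q" "q < 1"
    "\<And>d x y. x \<in> ellipse R \<Longrightarrow> y \<in> ellipse R \<Longrightarrow> norm (g d x y) \<le> C * q ^ d"
  shows "poly_series R g (\<lambda>x y. suminf (\<lambda>d. g d x y))"
proof (rule poly_series_I[OF assms])
  fix x y assume "x \<in> ellipse R" "y \<in> ellipse R"
  have "summable (\<lambda>d. g d x y)"
    by (rule summable_comparison_test'[of "\<lambda>d. C * q ^ d"])
      (use assms \<open>x \<in> ellipse R\<close> \<open>y \<in> ellipse R\<close> in \<open>auto intro: summable_mult summable_geometric\<close>)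
  then show "(\<lambda>d. g d x y) sums suminf (\<lambda>d. g d x y)" by (rule summable_sums)
qed

lemma poly_series_mono: assumes "poly_series R g F" "1 \<le> R'" "R' \<le> R" shows "poly_series R' g F"
proof -
  have "ellipse R' \<subseteq> ellipse R" by (rule ellipse_mono[OF assms(2,3)])
  obtain C q where Cq: "0 \<le> C" "0 \<le> q" "q < 1" "\<And>d x y. x \<in> ellipse R \<Longrightarrow> y \<in> ellipse R \<Longrightarrow> norm (g d x y) \<le> C * q ^ d"
    using poly_series_bound[OF assms(1)] by blast
  show ?thesis
    by (rule poly_series_I[OF poly_series_PFD[OF assms(1)] Cq(1-3)];
        (rule Cq(4) | rule poly_series_sums[OF assms(1)]); rule subsetD[OF \<open>ellipse R' \<subseteq> ellipse R\<close>], assumption)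
qed

lemma poly_series_add:
  assumes "poly_series R g F" "poly_series R h G"
  shows "poly_series R (\<lambda>d x y. g d x y + h d x y) (\<lambda>x y. F x y + G x y)"
proof -
  obtain C q where Cq: "0 \<le> C" "0 \<le> q" "q < 1" "\<And>d x y. x \<in> ellipse R \<Longrightarrow> y \<in> ellipse R \<Longrightarrow> norm (g d x y) \<le> C * q ^ d"
    using poly_series_bound[OF assms(1)] by blast
  obtain D p where Dp: "0 \<le> D" "0 \<le> p" "p < 1" "\<And>d x y. x \<in> ellipse R \<Longrightarrow> y \<in> ellipse R \<Longrightarrow> norm (h d x y) \<le> D * p ^ d"
    using poly_series_bound[OF assms(2)] by blast
  show ?thesis
  proof (rule poly_series_I)
    fix d
    obtain n m where "poly_fun n (g d)" "poly_fun m (h d)" using poly_series_PFD[OF assms(1)] poly_series_PFD[OF assms(2)] by blast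
    then have "poly_fun (max n m) (\<lambda>x y. g d x y + h d x y)" by (intro poly_fun_add) (auto intro: poly_fun_weaken)
    then show "\<exists>n. poly_fun n (\<lambda>x y. g d x y + h d x y)" by blast
    fix x y assume xy: "x \<in> ellipse R" "y \<in> ellipse R"
    have "norm (g d x y + h d x y) \<le> C * q ^ d + D * p ^ d"
      using Cq(4)[OF xy] Dp(4)[OF xy] by (intro norm_triangle_mono)
    also have "\<dots> \<le> C * (max q p) ^ d + D * (max q p) ^ d"
      using Cq Dp by (intro add_mono mult_left_mono power_mono) auto
    finally show "norm (g d x y + h d x y) \<le> (C + D) * (max q p) ^ d" by (simp add: distrib_right)
  qed (use Cq Dp in \<open>auto intro: sums_add poly_series_sums[OF assms(1)] poly_series_sums[OF assms(2)]\<close>)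
qed

lemma poly_series_mult:
  assumes "poly_series R g F" "poly_fun m P"
  shows "poly_series R (\<lambda>d x y. P x y * g d x y) (\<lambda>x y. P x y * F x y)"
proof -
  obtain C q where Cq: "0 \<le> C" "0 \<le> q" "q < 1" "\<And>d x y. x \<in> ellipse R \<Longrightarrow> y \<in> ellipse R \<Longrightarrow> norm (g d x y) \<le> C * q ^ d"
    using poly_series_bound[OF assms(1)] by blast
  obtain M where M: "0 \<le> M" "\<And>x y. x \<in> ellipse R \<Longrightarrow> y \<in> ellipse R \<Longrightarrow> norm (P x y) \<le> M"
    using poly_fun_bounded[OF assms(2) bounded_ellipse bounded_ellipse] by blast
  show ?thesis
  proof (rule poly_series_I)
    fix d
    show "\<exists>n. poly_fun n (\<lambda>x y. P x y * g d x y)" using poly_series_PFD[OF assms(1)] poly_fun_mult[OF assms(2)] by blast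
    fix x y assume xy: "x \<in> ellipse R" "y \<in> ellipse R"
    show "norm (P x y * g d x y) \<le> (M * C) * q ^ d"
      using mult_mono[OF M(2)[OF xy] Cq(4)[OF xy, of d]] M(1) by (simp add: norm_mult mult.assoc)
  qed (use Cq M in \<open>auto intro: sums_mult poly_series_sums[OF assms(1)]\<close>)
qed

lemma poly_series_scale: "poly_series R g F \<Longrightarrow> poly_series R (\<lambda>d x y. of_real c * g d x y) (\<lambda>x y. of_real c * F x y)"
  by (rule poly_series_mult[OF _ poly_fun_const[of 0]])

lemma poly_series_diff: "poly_series R g F \<Longrightarrow> poly_series R h G \<Longrightarrow> poly_series R (\<lambda>d x y. g d x y - h d x y) (\<lambda>x y. F x y - G x y)"
  using poly_series_add[OF _ poly_series_scale[of R h G "-1"], of g F] by simp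

lemma poly_series_poly_fun:
  assumes "poly_fun n P"
  shows "poly_series R (\<lambda>d x y. if d = 0 then P x y else 0) P"
proof -
  obtain M where M: "0 \<le> M" "\<And>x y. x \<in> ellipse R \<Longrightarrow> y \<in> ellipse R \<Longrightarrow> norm (P x y) \<le> M"
    using poly_fun_bounded[OF assms bounded_ellipse bounded_ellipse] by blast
  show ?thesis
  proof (rule poly_series_I[of _ M 0])
    show "\<exists>n. poly_fun n (\<lambda>x y. if d = 0 then P x y else 0)" for d
      using assms poly_fun_const[of 0 0] by (cases "d = 0") auto
    show "(\<lambda>d. if d = 0 then P x y else 0) sums P x y" for x y
      using sums_single[of 0 "\<lambda>_. P x y"] by simp
  qed (use M in \<open>auto simp: power_0_left\<close>)
qed

lemma poly_series_swap:
  assumes "poly_series R g F"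
  shows "poly_series R (\<lambda>d x y. g d y x) (\<lambda>x y. F y x)"
proof -
  obtain C q where Cq: "0 \<le> C" "0 \<le> q" "q < 1" "\<And>d x y. x \<in> ellipse R \<Longrightarrow> y \<in> ellipse R \<Longrightarrow> norm (g d x y) \<le> C * q ^ d"
    using poly_series_bound[OF assms(1)] by blast
  show ?thesis
    by (rule poly_series_I[OF _ Cq(1-3)]) (use Cq(4) poly_series_sums[OF assms] poly_series_PFD[OF assms] poly_fun_swap in blast)+
qed

lemma poly_series_uniform:
  assumes "poly_series R g F"
  shows "uniform_limit (ellipse R \<times> ellipse R) (\<lambda>n z. \<Sum>d<n. g d (fst z) (snd z)) (\<lambda>z. F (fst z) (snd z)) sequentially"
proof -
  obtain C q where Cq: "0 \<le> C" "0 \<le> q" "q < 1" "\<And>d x y. x \<in> ellipse R \<Longrightarrow> y \<in> ellipse R \<Longrightarrow> norm (g d x y) \<le> C * q ^ d"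
    using poly_series_bound[OF assms(1)] by blast
  have "uniform_limit (ellipse R \<times> ellipse R) (\<lambda>n z. \<Sum>d<n. g d (fst z) (snd z)) (\<lambda>z. suminf (\<lambda>d. g d (fst z) (snd z))) sequentially"
    by (rule Weierstrass_m_test[where M = "\<lambda>d. C * q ^ d"])
      (use Cq in \<open>auto intro!: summable_mult summable_geometric\<close>)
  moreover have "suminf (\<lambda>d. g d (fst z) (snd z)) = F (fst z) (snd z)" if "z \<in> ellipse R \<times> ellipse R" for z
    using poly_series_sums[OF assms, of "fst z" "snd z"] that by (auto simp: sums_iff)
  then have "uniform_limit (ellipse R \<times> ellipse R) (\<lambda>n z. \<Sum>d<n. g d (fst z) (snd z)) (\<lambda>z. suminf (\<lambda>d. g d (fst z) (snd z))) sequentially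
      \<longleftrightarrow> uniform_limit (ellipse R \<times> ellipse R) (\<lambda>n z. \<Sum>d<n. g d (fst z) (snd z)) (\<lambda>z. F (fst z) (snd z)) sequentially"
    by (intro uniform_limit_cong') simp_all
  ultimately show ?thesis by blast
qed

lemma poly_series_continuous:
  assumes "poly_series R g F"
  shows "continuous_on (ellipse R \<times> ellipse R) (\<lambda>z. F (fst z) (snd z))"
proof (rule uniform_limit_theorem[OF _ poly_series_uniform[OF assms]])
  have "continuous_on A (\<lambda>z. g d (fst z) (snd z))" for A d
    using poly_series_PFD[OF assms, of d] poly_fun_continuous by blast
  then show "\<forall>\<^sub>F n in sequentially. continuous_on (ellipse R \<times> ellipse R) (\<lambda>z. \<Sum>d<n. g d (fst z) (snd z))"
    by (intro always_eventually allI continuous_on_sum)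
qed simp

text \<open>Cauchy's estimate keeps the ratio q but needs a strictly smaller ellipse. Each
  differentiation therefore consumes some room, which is why a decreasing chain of radii is used
  below.\<close>

lemma poly_series_Dx_bound:
  assumes "poly_series R g F" "1 \<le> R'" "R' < R"
  obtains C q where "0 \<le> C" "0 \<le> q" "q < 1"
    "\<And>d x y. x \<in> ellipse R' \<Longrightarrow> y \<in> ellipse R' \<Longrightarrow> norm (Dx (g d) x y) \<le> C * q ^ d"
proof -
  obtain C q where Cq: "0 \<le> C" "0 \<le> q" "q < 1" "\<And>d x y. x \<in> ellipse R \<Longrightarrow> y \<in> ellipse R \<Longrightarrow> norm (g d x y) \<le> C * q ^ d"
    using poly_series_bound[OF assms(1)] by blast
  let ?d = "(R + 1 / R - (R' + 1 / R')) / 2"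
  have d: "0 < ?d" using joukowski_strict_mono[OF assms(2,3)] by simp
  have "norm (Dx (g d) x y) \<le> (C / ?d) * q ^ d" if "x \<in> ellipse R'" "y \<in> ellipse R'" for d x y
  proof -
    have "y \<in> ellipse R" using that ellipse_mono[of R' R] assms by auto
    obtain n where "poly_fun n (g d)" using poly_series_PFD[OF assms(1)] by blast
    then have "norm (deriv (\<lambda>x. g d x y) x) \<le> (C * q ^ d) / ?d"
      by (intro deriv_bound_ellipse[OF poly_fun_holomorphic(1)]) (use Cq(4) \<open>y \<in> ellipse R\<close> that assms in auto)
    then show ?thesis by (simp only: Dx_def times_divide_eq_left)
  qed
  then show ?thesis using that[of "C / ?d" q] Cq d by simp
qed

lemma poly_series_Dy_bound:
  assumes "poly_series R g F" "1 \<le> R'" "R' < R"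
  obtains C q where "0 \<le> C" "0 \<le> q" "q < 1"
    "\<And>d x y. x \<in> ellipse R' \<Longrightarrow> y \<in> ellipse R' \<Longrightarrow> norm (Dy (g d) x y) \<le> C * q ^ d"
proof -
  have eq: "Dx (\<lambda>x y. g d y x) x y = Dy (g d) y x" for d x y by (simp add: Dx_def Dy_def)
  obtain C q where Cq: "0 \<le> C" "0 \<le> q" "q < 1"
    "\<And>d x y. x \<in> ellipse R' \<Longrightarrow> y \<in> ellipse R' \<Longrightarrow> norm (Dx (\<lambda>x y. g d y x) x y) \<le> C * q ^ d"
    by (rule poly_series_Dx_bound[OF poly_series_swap[OF assms(1)] assms(2,3)]) blast
  show ?thesis
    by (rule that[OF Cq(1-3)]) (use Cq(4) in \<open>simp add: eq\<close>)
qed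

text \<open>Termwise differentiation along a complex line. The parameters whose points stay in the
  smaller ellipse form an open convex set \<open>S\<close>, on which the differentiated series is
  dominated by two geometric series.\<close>

lemma poly_series_chain_suminf:
  assumes "poly_series R g F" "1 \<le> R'" "R' < R" "a + b * t0 \<in> ellipse R'" "c + e * t0 \<in> ellipse R'"
  shows "((\<lambda>t. F (a + b * t) (c + e * t)) has_field_derivative
     b * suminf (\<lambda>d. Dx (g d) (a + b * t0) (c + e * t0)) + e * suminf (\<lambda>d. Dy (g d) (a + b * t0) (c + e * t0))) (at t0)"
proof -
  have sub: "ellipse R' \<subseteq> ellipse R" using assms ellipse_mono by simp
  obtain C q where Cq: "0 \<le> C" "0 \<le> q" "q < 1" "\<And>d x y. x \<in> ellipse R' \<Longrightarrow> y \<in> ellipse R' \<Longrightarrow> norm (Dx (g d) x y) \<le> C * q ^ d"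
    using poly_series_Dx_bound[OF assms(1-3)] by blast
  obtain D p where Dp: "0 \<le> D" "0 \<le> p" "p < 1" "\<And>d x y. x \<in> ellipse R' \<Longrightarrow> y \<in> ellipse R' \<Longrightarrow> norm (Dy (g d) x y) \<le> D * p ^ d"
    using poly_series_Dy_bound[OF assms(1-3)] by blast
  let ?g = "\<lambda>d t. g d (a + b * t) (c + e * t)"
  let ?gx = "\<lambda>d t. Dx (g d) (a + b * t) (c + e * t)"
  let ?gy = "\<lambda>d t. Dy (g d) (a + b * t) (c + e * t)"
  define S where "S = {t. a + b * t \<in> ellipse R' \<and> c + e * t \<in> ellipse R'}"
  have S_eq: "S = (\<lambda>t. a + b * t) -` ellipse R' \<inter> (\<lambda>t. c + e * t) -` ellipse R'" by (auto simp: S_def)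
  have "open S" unfolding S_eq
    by (intro open_Int open_vimage open_ellipse continuous_intros)
  have "convex S"
  proof (rule convexI)
    fix x y and u v :: real assume *: "x \<in> S" "y \<in> S" "0 \<le> u" "0 \<le> v" "u + v = 1"
    have eq: "k + l * (u *\<^sub>R x + v *\<^sub>R y) = u *\<^sub>R (k + l * x) + v *\<^sub>R (k + l * y)" for k l
    proof -
      have "k = u *\<^sub>R k + v *\<^sub>R k" using *(5) by (simp flip: scaleR_add_left)
      then show ?thesis by (simp add: algebra_simps)
    qed
    show "u *\<^sub>R x + v *\<^sub>R y \<in> S"
      using * convexD[OF convex_ellipse] unfolding S_def mem_Collect_eq eq by blast
  qed
  have t0: "t0 \<in> S" using assms by (simp add: S_def)
  have dg: "(?g d has_field_derivative b * ?gx d t + e * ?gy d t) (at t)" for d t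
    using poly_series_PFD[OF assms(1), of d] poly_fun_derivs(3) unfolding lines_def by blast
  have sx: "summable (\<lambda>d. ?gx d t)" and sy: "summable (\<lambda>d. ?gy d t)" if "t \<in> S" for t
  proof -
    show "summable (\<lambda>d. ?gx d t)"
      by (rule summable_comparison_test'[of "\<lambda>d. C * q ^ d"])
        (use Cq that in \<open>auto simp: S_def intro: summable_mult summable_geometric\<close>)
    show "summable (\<lambda>d. ?gy d t)"
      by (rule summable_comparison_test'[of "\<lambda>d. D * p ^ d"])
        (use Dp that in \<open>auto simp: S_def intro: summable_mult summable_geometric\<close>)
  qed
  have "((\<lambda>t. suminf (\<lambda>d. ?g d t)) has_field_derivative suminf (\<lambda>d. b * ?gx d t0 + e * ?gy d t0)) (at t0)"
  proof (rule has_field_derivative_series'(2)[OF \<open>convex S\<close> _ _ t0])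
    show "(?g d has_field_derivative b * ?gx d t + e * ?gy d t) (at t within S)" for d t
      using dg by (rule has_field_derivative_at_within)
    show "uniformly_convergent_on S (\<lambda>n t. \<Sum>d<n. b * ?gx d t + e * ?gy d t)"
    proof (rule Weierstrass_m_test'[where M = "\<lambda>d. norm b * (C * q ^ d) + norm e * (D * p ^ d)"])
      show "norm (b * ?gx d t + e * ?gy d t) \<le> norm b * (C * q ^ d) + norm e * (D * p ^ d)" if "t \<in> S" for d t
        using that Cq(4) Dp(4) by (intro norm_triangle_mono) (auto simp: S_def norm_mult intro!: mult_left_mono)
      show "summable (\<lambda>d. norm b * (C * q ^ d) + norm e * (D * p ^ d))"
        using Cq Dp by (intro summable_add summable_mult summable_geometric) auto
    qed
    show "summable (\<lambda>d. ?g d t0)"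
      using poly_series_sums[OF assms(1)] assms(4,5) sub by (auto simp: sums_iff)
    show "t0 \<in> interior S" using t0 \<open>open S\<close> by (simp add: interior_open)
  qed
  moreover have "suminf (\<lambda>d. b * ?gx d t0 + e * ?gy d t0) = b * suminf (\<lambda>d. ?gx d t0) + e * suminf (\<lambda>d. ?gy d t0)"
    using sx[OF t0] sy[OF t0] by (simp add: suminf_add[symmetric] suminf_mult summable_mult)
  ultimately have "((\<lambda>t. suminf (\<lambda>d. ?g d t)) has_field_derivative b * suminf (\<lambda>d. ?gx d t0) + e * suminf (\<lambda>d. ?gy d t0)) (at t0)"
    by simp
  then show ?thesis
  proof (rule has_field_derivative_transform_within_open[OF _ \<open>open S\<close> t0])
    show "suminf (\<lambda>d. ?g d t) = F (a + b * t) (c + e * t)" if "t \<in> S" for t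
      using poly_series_sums[OF assms(1)] that sub by (auto simp: S_def sums_iff)
  qed
qed

lemma poly_series_Dx:
  assumes "poly_series R g F" "1 \<le> R'" "R' < R"
  shows "poly_series R' (\<lambda>d. Dx (g d)) (Dx F)"
proof -
  obtain C q where Cq: "0 \<le> C" "0 \<le> q" "q < 1" "\<And>d x y. x \<in> ellipse R' \<Longrightarrow> y \<in> ellipse R' \<Longrightarrow> norm (Dx (g d) x y) \<le> C * q ^ d"
    using poly_series_Dx_bound[OF assms] by blast
  have poly_fun: "\<exists>n. poly_fun n (Dx (g d))" for d using poly_series_PFD[OF assms(1), of d] poly_fun_derivs(1) by blast
  have "poly_series R' (\<lambda>d. Dx (g d)) (\<lambda>x y. suminf (\<lambda>d. Dx (g d) x y))"
    by (rule poly_series_suminf[OF poly_fun Cq])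
  moreover have "suminf (\<lambda>d. Dx (g d) x y) = Dx F x y" if "x \<in> ellipse R'" "y \<in> ellipse R'" for x y
    using DERIV_imp_deriv[OF poly_series_chain_suminf[OF assms, of 0 1 x y 0]] that by (simp add: Dx_def)
  ultimately show ?thesis unfolding poly_series_def by simp
qed

lemma poly_series_Dy:
  assumes "poly_series R g F" "1 \<le> R'" "R' < R"
  shows "poly_series R' (\<lambda>d. Dy (g d)) (Dy F)"
  using poly_series_swap[OF poly_series_Dx[OF poly_series_swap[OF assms(1)] assms(2,3)]] unfolding Dx_def Dy_def .

lemma poly_series_chain:
  assumes "poly_series R g F" "1 \<le> R'" "R' < R" "a + b * t0 \<in> ellipse R'" "c + e * t0 \<in> ellipse R'"
  shows "((\<lambda>t. F (a + b * t) (c + e * t)) has_field_derivative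
     b * Dx F (a + b * t0) (c + e * t0) + e * Dy F (a + b * t0) (c + e * t0)) (at t0)"
  using poly_series_chain_suminf[OF assms] poly_series_sums[OF poly_series_Dx[OF assms(1-3)] assms(4,5)] poly_series_sums[OF poly_series_Dy[OF assms(1-3)] assms(4,5)]
  by (simp add: sums_iff)

lemma poly_series_holomorphic:
  assumes "poly_series R g F" "1 \<le> R'" "R' < R"
  shows "y \<in> ellipse R' \<Longrightarrow> (\<lambda>x. F x y) holomorphic_on ellipse R'" "x \<in> ellipse R' \<Longrightarrow> (\<lambda>y. F x y) holomorphic_on ellipse R'"
proof -
  assume y: "y \<in> ellipse R'"
  show "(\<lambda>x. F x y) holomorphic_on ellipse R'"
    unfolding holomorphic_on_def field_differentiable_def
  proof
    fix x assume "x \<in> ellipse R'"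
    then have "((\<lambda>x. F x y) has_field_derivative Dx F x y) (at x)"
      using poly_series_chain[OF assms, of 0 1 x y 0] y by simp
    then show "\<exists>f'. ((\<lambda>x. F x y) has_field_derivative f') (at x within ellipse R')"
      using has_field_derivative_at_within by blast
  qed
next
  assume x: "x \<in> ellipse R'"
  show "(\<lambda>y. F x y) holomorphic_on ellipse R'"
    unfolding holomorphic_on_def field_differentiable_def
  proof
    fix y assume "y \<in> ellipse R'"
    then have "((\<lambda>y. F x y) has_field_derivative Dy F x y) (at y)"
      using poly_series_chain[OF assms, of x 0 y 0 1] x by simp
    then show "\<exists>f'. ((\<lambda>y. F x y) has_field_derivative f') (at y within ellipse R')"
      using has_field_derivative_at_within by blast
  qed
qed

lemma poly_series_restr:
  assumes "poly_series R g F" "1 < R" "\<bar>a\<bar> \<le> 1" "\<bar>b\<bar> \<le> 1"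
  shows "F (of_real a) (of_real b) = of_real (restr F (a, b))"
proof -
  have "(\<lambda>d. Im (g d (of_real a) (of_real b))) sums Im (F (of_real a) (of_real b))"
    by (intro sums_Im poly_series_sums[OF assms(1)] real_in_ellipse assms)
  moreover have "Im (g d (of_real a) (of_real b)) = 0" for d
  proof -
    obtain n where "poly_fun n (g d)" using poly_series_PFD[OF assms(1)] by blast
    then show ?thesis by (rule poly_fun_real)
  qed
  ultimately have "Im (F (of_real a) (of_real b)) = 0"
    using sums_unique2[OF _ sums_zero, of "Im (F (of_real a) (of_real b))"] by simp
  then show ?thesis by (simp add: restr_def complex_eq_iff)
qed

section \<open>Uniqueness: the identity theorem and moment problems\<close>

text \<open>One-variable analytic continuation twice: in y for each fixed point of \<open>A\<close>,
  then in x for the given y.\<close>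

lemma identity_ellipse:
  assumes hx: "\<And>y. y \<in> ellipse R \<Longrightarrow> (\<lambda>x. F x y) holomorphic_on ellipse R"
    and hy: "\<And>x. x \<in> ellipse R \<Longrightarrow> (\<lambda>y. F x y) holomorphic_on ellipse R"
    and AB: "A \<subseteq> ellipse R" "B \<subseteq> ellipse R" "\<alpha> \<in> ellipse R" "\<beta> \<in> ellipse R" "\<alpha> islimpt A" "\<beta> islimpt B"
    and zero: "\<And>x y. x \<in> A \<Longrightarrow> y \<in> B \<Longrightarrow> F x y = 0"
    and xy: "x \<in> ellipse R" "y \<in> ellipse R"
  shows "F x y = 0"
proof -
  have "F a y = 0" if "a \<in> A" for a
    by (rule analytic_continuation[OF hy open_ellipse connected_ellipse AB(2,4,6) zero[OF that] xy(2)]) (use that AB(1) in auto)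
  then show ?thesis
    by (rule analytic_continuation[OF hx[OF xy(2)] open_ellipse connected_ellipse AB(1,3,5) _ xy(1)])
qed

text \<open>By Weierstrass \<open>h\<close> is a uniform limit of polynomials. It is orthogonal to
  all of them, hence to itself, and the integral of its square vanishes.\<close>

lemma moment_real:
  fixes h :: "real \<Rightarrow> real"
  assumes "a < b" "continuous_on {a..b} h" "\<And>k. integral {a..b} (\<lambda>t. t ^ k * h t) = 0" "t \<in> {a..b}"
  shows "h t = 0"
proof -
  have int: "(\<lambda>t. p t * h t) integrable_on {a..b}" if "continuous_on {a..b} p" for p
    by (intro integrable_continuous_real continuous_intros assms that)
  have *: "\<bar>integral {a..b} (\<lambda>t. h t * h t)\<bar> \<le> e * integral {a..b} (\<lambda>t. \<bar>h t\<bar>)" if "0 < e" for e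
  proof -
    obtain p where p: "real_polynomial_function p" "\<And>t. t \<in> {a..b} \<Longrightarrow> \<bar>h t - p t\<bar> < e"
      using Stone_Weierstrass_real_polynomial_function[OF compact_Icc assms(2) \<open>0 < e\<close>] by blast
    obtain c n where c: "p = (\<lambda>x. \<Sum>i\<le>n. c i * x ^ i)"
      using p(1) real_polynomial_function_iff_sum by blast
    have "integral {a..b} (\<lambda>t. p t * h t) = (\<Sum>i\<le>n. integral {a..b} (\<lambda>t. c i * (t ^ i * h t)))"
      unfolding c sum_distrib_right
      by (subst integral_sum[symmetric]) (auto simp: mult.assoc intro!: integrable_on_mult_right int continuous_intros)
    also have "\<dots> = 0" using assms(3) by simp
    finally have p0: "integral {a..b} (\<lambda>t. p t * h t) = 0" .
    have cp: "continuous_on {a..b} p" unfolding c by (intro continuous_intros)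
    have "integral {a..b} (\<lambda>t. h t * h t) = integral {a..b} (\<lambda>t. h t * h t) - integral {a..b} (\<lambda>t. p t * h t)"
      using p0 by simp
    also have "\<dots> = integral {a..b} (\<lambda>t. (h t - p t) * h t)"
      by (subst integral_diff[symmetric]) (auto intro: int cp assms simp: left_diff_distrib)
    also have "\<bar>\<dots>\<bar> \<le> integral {a..b} (\<lambda>t. e * \<bar>h t\<bar>)"
    proof (rule integral_norm_bound_integral[where f = "\<lambda>t. (h t - p t) * h t", unfolded real_norm_def])
      show "(\<lambda>t. (h t - p t) * h t) integrable_on {a..b}" by (intro int continuous_intros assms cp)
      show "(\<lambda>t. e * \<bar>h t\<bar>) integrable_on {a..b}"
        by (intro integrable_continuous_real continuous_intros assms)
      show "\<bar>(h t - p t) * h t\<bar> \<le> e * \<bar>h t\<bar>" if "t \<in> {a..b}" for t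
        using p(2)[OF that] by (auto simp: abs_mult intro!: mult_right_mono)
    qed
    finally show ?thesis by simp
  qed
  define I where "I = integral {a..b} (\<lambda>t. \<bar>h t\<bar>)"
  have I: "0 \<le> I" unfolding I_def
    by (rule Henstock_Kurzweil_Integration.integral_nonneg) (simp_all add: integrable_continuous_real continuous_on_rabs assms(2))
  have "\<bar>integral {a..b} (\<lambda>t. h t * h t)\<bar> \<le> e" if "0 < e" for e
  proof -
    have "0 < e / (I + 1)" using I that by simp
    then have "\<bar>integral {a..b} (\<lambda>t. h t * h t)\<bar> \<le> e / (I + 1) * I" unfolding I_def by (rule *)
    also have "\<dots> \<le> e" using I that by (simp add: field_simps)
    finally show ?thesis .
  qed
  then have "integral {a..b} (\<lambda>t. h t * h t) = 0"
    by (rule dense_eq0_I)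
  moreover have "continuous_on {a..b} (\<lambda>t. h t * h t)" by (intro continuous_intros assms(2))
  ultimately have "h t * h t = 0"
    using integral_eq_0_iff[of a b "\<lambda>t. h t * h t"] assms(1,4) by simp
  then show ?thesis by simp
qed

lemma moment_complex:
  fixes h :: "real \<Rightarrow> complex"
  assumes "a < b" "continuous_on {a..b} h" "\<And>k. integral {a..b} (\<lambda>t. of_real t ^ k * h t) = 0" "t \<in> {a..b}"
  shows "h t = 0"
proof -
  have int: "(\<lambda>t. of_real t ^ k * h t) integrable_on {a..b}" for k
    by (intro integrable_continuous_real continuous_intros assms)
  have "integral {a..b} (\<lambda>t. t ^ k * Re (h t)) = 0" "integral {a..b} (\<lambda>t. t ^ k * Im (h t)) = 0" for k
  proof -
    have "integral {a..b} (\<lambda>t. Re (of_real t ^ k * h t)) = Re (integral {a..b} (\<lambda>t. of_real t ^ k * h t))"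
      "integral {a..b} (\<lambda>t. Im (of_real t ^ k * h t)) = Im (integral {a..b} (\<lambda>t. of_real t ^ k * h t))"
      using integral_linear[OF int bounded_linear_Re] integral_linear[OF int bounded_linear_Im] by (simp_all add: o_def)
    then show "integral {a..b} (\<lambda>t. t ^ k * Re (h t)) = 0" "integral {a..b} (\<lambda>t. t ^ k * Im (h t)) = 0"
      using assms(3) by (simp_all flip: of_real_power)
  qed
  then have "Re (h t) = 0" "Im (h t) = 0"
    using moment_real[OF assms(1) _ _ assms(4), of "\<lambda>t. Re (h t)"] moment_real[OF assms(1) _ _ assms(4), of "\<lambda>t. Im (h t)"]
      continuous_on_Re[OF assms(2)] continuous_on_Im[OF assms(2)] by blast+
  then show ?thesis by (simp add: complex_eq_iff)
qed

section \<open>Moment conditions at a corner\<close>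

text \<open>Characteristic coordinates at the corner \<open>(-1, -1)\<close>: \<open>z = (x + 1) + \<i>(y + 1)\<close> and
  \<open>w = (x + 1) - \<i>(y + 1)\<close>, both taken real, so that the Laplacian becomes \<open>4 \<partial>\<^sub>z\<partial>\<^sub>w\<close>.\<close>

definition Ph1 :: "real \<Rightarrow> real \<Rightarrow> complex" where
  "Ph1 z w = - 1 + (of_real z + of_real w) / 2"

definition Ph2 :: "real \<Rightarrow> real \<Rightarrow> complex" where
  "Ph2 z w = - 1 - \<i> * (of_real z - of_real w) / 2"

definition Lap :: "(complex \<Rightarrow> complex \<Rightarrow> complex) \<Rightarrow> complex \<Rightarrow> complex \<Rightarrow> complex" where
  "Lap F x y = Dx (Dx F) x y + Dy (Dy F) x y"

text \<open>The surface of integration is not real: x + 1 and \<i>(y + 1) are the real quantities on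
  it, and in these the square of side 2s is the diamond where their absolute values sum to at most
  s. The constant Jacobian is left out, since only the vanishing of such integrals matters.\<close>

definition diamond_int :: "real \<Rightarrow> (complex \<Rightarrow> complex \<Rightarrow> complex) \<Rightarrow> complex" where
  "diamond_int s F = integral (cbox (-s, -s) (s, s)) (\<lambda>p. F (Ph1 (fst p) (snd p)) (Ph2 (fst p) (snd p)))"

text \<open>On the diamond both complex coordinates differ from -1 by at most s in norm, so this
  puts the whole diamond inside the product of ellipses.\<close>

definition small :: "real \<Rightarrow> real \<Rightarrow> bool" where
  "small R s \<longleftrightarrow> 0 < s \<and> 2 + 2 * s < R + 1 / R"

lemma Ph_in_ellipse:
  assumes "small R s" "\<bar>z\<bar> \<le> s" "\<bar>w\<bar> \<le> s"
  shows "Ph1 z w \<in> ellipse R" "Ph2 z w \<in> ellipse R"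
proof -
  have n: "norm (of_real z + of_real w :: complex) \<le> 2 * s" "norm (of_real z - of_real w :: complex) \<le> 2 * s"
    using norm_triangle_ineq[of "of_real z :: complex" "of_real w"] norm_triangle_ineq4[of "of_real z :: complex" "of_real w"] assms
    by auto
  then show "Ph1 z w \<in> ellipse R"
    unfolding Ph1_def using assms(1) by (intro near_corner_in_ellipse) (simp add: small_def norm_divide)
  have "- 1 + (- \<i> * (of_real z - of_real w) / 2) \<in> ellipse R"
    using n assms(1) by (intro near_corner_in_ellipse) (simp add: small_def norm_divide norm_mult)
  then show "Ph2 z w \<in> ellipse R" by (simp add: Ph2_def)
qed

lemma continuous_Ph:
  "continuous_on A (\<lambda>p. Ph1 (fst p) (snd p))" "continuous_on A (\<lambda>p. Ph2 (fst p) (snd p))"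
  unfolding Ph1_def Ph2_def by (intro continuous_intros; simp)+

lemma mem_cbox_s: "p \<in> cbox (-s, -s) (s, s) \<longleftrightarrow> \<bar>fst p\<bar> \<le> s \<and> \<bar>snd p\<bar> \<le> s" for p :: "real \<times> real"
  by (auto simp: mem_cbox_pair abs_le_iff)

definition dcont :: "real \<Rightarrow> (complex \<Rightarrow> complex \<Rightarrow> complex) \<Rightarrow> bool" where
  "dcont s F \<longleftrightarrow> continuous_on (cbox (-s, -s) (s, s)) (\<lambda>p. F (Ph1 (fst p) (snd p)) (Ph2 (fst p) (snd p)))"

lemma poly_series_dcont:
  assumes "poly_series R g F" "small R s"
  shows "dcont s F"
proof -
  have "continuous_on (cbox (-s, -s) (s, s)) (\<lambda>p. (\<lambda>z. F (fst z) (snd z)) (Ph1 (fst p) (snd p), Ph2 (fst p) (snd p)))"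
    by (rule continuous_on_compose2[OF poly_series_continuous[OF assms(1)]])
      (use Ph_in_ellipse[OF assms(2)] in \<open>auto simp: mem_cbox_s intro!: continuous_on_Pair continuous_Ph\<close>)
  then show ?thesis by (simp add: dcont_def)
qed

lemma poly_fun_dcont: assumes "poly_fun n F" shows "dcont s F"
proof -
  have "continuous_on (cbox (-s, -s) (s, s)) (\<lambda>p. (\<lambda>z. F (fst z) (snd z)) (Ph1 (fst p) (snd p), Ph2 (fst p) (snd p)))"
    by (rule continuous_on_compose2[OF poly_fun_continuous[OF assms, of UNIV]])
      (auto intro!: continuous_on_Pair continuous_Ph)
  then show ?thesis by (simp add: dcont_def)
qed

lemma dcont_add: "dcont s F \<Longrightarrow> dcont s G \<Longrightarrow> dcont s (\<lambda>x y. F x y + G x y)"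
  and dcont_diff: "dcont s F \<Longrightarrow> dcont s G \<Longrightarrow> dcont s (\<lambda>x y. F x y - G x y)"
  and dcont_mult: "dcont s F \<Longrightarrow> dcont s G \<Longrightarrow> dcont s (\<lambda>x y. F x y * G x y)"
  and dcont_const: "dcont s (\<lambda>x y. c)"
  unfolding dcont_def by (intro continuous_intros; assumption)+

lemma diamond_int_add: "dcont s F \<Longrightarrow> dcont s G \<Longrightarrow> diamond_int s (\<lambda>x y. F x y + G x y) = diamond_int s F + diamond_int s G"
  and diamond_int_diff: "dcont s F \<Longrightarrow> dcont s G \<Longrightarrow> diamond_int s (\<lambda>x y. F x y - G x y) = diamond_int s F - diamond_int s G"
  unfolding dcont_def diamond_int_def
  by (intro Henstock_Kurzweil_Integration.integral_add Henstock_Kurzweil_Integration.integral_diff integrable_continuous; assumption)+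

lemma diamond_int_cmult: "diamond_int s (\<lambda>x y. c * F x y) = c * diamond_int s F"
  unfolding diamond_int_def by (rule integral_mult_right)

lemma diamond_int_sum:
  assumes "\<And>k. k \<in> A \<Longrightarrow> dcont s (F k)"
  shows "diamond_int s (\<lambda>x y. \<Sum>k\<in>A. F k x y) = (\<Sum>k\<in>A. diamond_int s (F k))"
proof (cases "finite A")
  case True
  then show ?thesis using assms unfolding diamond_int_def dcont_def
    by (intro Henstock_Kurzweil_Integration.integral_sum integrable_continuous)
qed (simp add: diamond_int_def)

lemma diamond_int_iterated:
  assumes "dcont s F"
  shows "diamond_int s F = integral {-s..s} (\<lambda>z. integral {-s..s} (\<lambda>w. F (Ph1 z w) (Ph2 z w)))"
  using integral_prod_continuous[OF assms[unfolded dcont_def]] by (simp add: diamond_int_def)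

lemma poly_series_diamond_int_zero:
  assumes "poly_series R g F" "small R s" "\<And>d. diamond_int s (g d) = 0"
  shows "diamond_int s F = 0"
proof -
  let ?C = "cbox (-s, -s) (s, s) :: (real \<times> real) set"
  let ?P = "\<lambda>p. (Ph1 (fst p) (snd p), Ph2 (fst p) (snd p))"
  have gc: "dcont s (g d)" for d
  proof -
    obtain n where "poly_fun n (g d)" using poly_series_PFD[OF assms(1)] by blast
    then show ?thesis by (rule poly_fun_dcont)
  qed
  have "uniform_limit ?C (\<lambda>n p. \<Sum>d<n. g d (fst (?P p)) (snd (?P p))) (\<lambda>p. F (fst (?P p)) (snd (?P p))) sequentially"
    by (rule uniform_limit_compose'[OF poly_series_uniform[OF assms(1)]])
      (use Ph_in_ellipse[OF assms(2)] in \<open>auto simp: mem_cbox_s\<close>)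
  then have ul: "uniform_limit ?C (\<lambda>n p. \<Sum>d<n. g d (Ph1 (fst p) (snd p)) (Ph2 (fst p) (snd p))) (\<lambda>p. F (Ph1 (fst p) (snd p)) (Ph2 (fst p) (snd p))) sequentially"
    by simp
  have cs: "continuous_on ?C (\<lambda>p. \<Sum>d<n. g d (Ph1 (fst p) (snd p)) (Ph2 (fst p) (snd p)))" for n
    by (intro continuous_on_sum gc[unfolded dcont_def])
  obtain I J where IJ: "\<And>n. ((\<lambda>p. \<Sum>d<n. g d (Ph1 (fst p) (snd p)) (Ph2 (fst p) (snd p))) has_integral I n) ?C"
     "((\<lambda>p. F (Ph1 (fst p) (snd p)) (Ph2 (fst p) (snd p))) has_integral J) ?C" "I \<longlonglongrightarrow> J"
    by (rule uniform_limit_integral_cbox[OF ul cs trivial_limit_sequentially]) blast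
  have "I n = 0" for n
    using integral_unique[OF IJ(1)[of n]] diamond_int_sum[of "{..<n}" s g] gc assms(3) by (simp add: diamond_int_def)
  then have "I = (\<lambda>n. 0)" by auto
  then have "J = 0" using IJ(3) by (simp add: LIMSEQ_const_iff)
  then show ?thesis using integral_unique[OF IJ(2)] by (simp add: diamond_int_def)
qed

lemma poly_fun_Lap: "poly_fun n F \<Longrightarrow> poly_fun n (Lap F)"
  unfolding Lap_def by (intro poly_fun_add poly_fun_derivs)

text \<open>In characteristic coordinates the integral of \<open>4 \<partial>\<^sub>z\<partial>\<^sub>w F\<close> over a square is a combination of the four
  corner values, and those lie on the two edges \<open>x = -1\<close> and \<open>y = -1\<close>.\<close>

lemma diamond_poly_fun:
  assumes F: "poly_fun n F" and z: "\<And>y. F (-1) y = 0" "\<And>x. F x (-1) = 0" and s: "0 < s"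
  shows "diamond_int s (Lap F) = 0"
proof -
  note d1 = poly_fun_derivs[OF F]
  note d2 = poly_fun_derivs[OF d1(1)] and d3 = poly_fun_derivs[OF d1(2)]
  \<comment> \<open>Since \<partial>z = (\<partial>x - \<i> \<partial>y) / 2 and \<partial>w =
    (\<partial>x + \<i> \<partial>y) / 2, the function \<open>H\<close> is the z-derivative of
    \<open>K\<close> = 4F and its w-derivative is the Laplacian of F.\<close>
  define H where "H z w = 2 * (Dx F (Ph1 z w) (Ph2 z w) - \<i> * Dy F (Ph1 z w) (Ph2 z w))" for z w
  define K where "K z w = 4 * F (Ph1 z w) (Ph2 z w)" for z w
  have P: "Ph1 z w = (- 1 + of_real z / 2) + (1 / 2) * of_real w" "Ph2 z w = (- 1 - \<i> * of_real z / 2) + (\<i> / 2) * of_real w"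
     and P': "Ph1 z w = (- 1 + of_real w / 2) + (1 / 2) * of_real z" "Ph2 z w = (- 1 + \<i> * of_real w / 2) + (- \<i> / 2) * of_real z" for z w
    by (simp_all add: Ph1_def Ph2_def field_simps)
  have H: "((\<lambda>w. H z w) has_vector_derivative Lap F (Ph1 z w) (Ph2 z w)) (at w within A)" for z w A
  proof -
    let ?t = "of_real w :: complex"
    have "((\<lambda>t. 2 * (Dx F ((- 1 + of_real z / 2) + (1 / 2) * t) ((- 1 - \<i> * of_real z / 2) + (\<i> / 2) * t)
         - \<i> * Dy F ((- 1 + of_real z / 2) + (1 / 2) * t) ((- 1 - \<i> * of_real z / 2) + (\<i> / 2) * t)))
       has_field_derivative 2 * (((1/2) * Dx (Dx F) (Ph1 z w) (Ph2 z w) + (\<i>/2) * Dy (Dx F) (Ph1 z w) (Ph2 z w))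
         - \<i> * ((1/2) * Dx (Dy F) (Ph1 z w) (Ph2 z w) + (\<i>/2) * Dy (Dy F) (Ph1 z w) (Ph2 z w)))) (at ?t)"
      unfolding P
      by (intro DERIV_cmult DERIV_diff d2(3)[unfolded lines_def, rule_format] d3(3)[unfolded lines_def, rule_format])
    from has_vector_derivative_real_field[OF this]
    show ?thesis unfolding H_def P[symmetric]
      by (rule has_vector_derivative_eq_rhs) (simp add: Lap_def d1(5) algebra_simps)
  qed
  have K: "((\<lambda>z. K z w) has_vector_derivative H z w) (at z within A)" for z w A
  proof -
    let ?t = "of_real z :: complex"
    have "((\<lambda>t. 4 * F ((- 1 + of_real w / 2) + (1 / 2) * t) ((- 1 + \<i> * of_real w / 2) + (- \<i> / 2) * t))
       has_field_derivative 4 * ((1/2) * Dx F (Ph1 z w) (Ph2 z w) + (- \<i>/2) * Dy F (Ph1 z w) (Ph2 z w))) (at ?t)"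
      unfolding P'
      by (intro DERIV_cmult d1(3)[unfolded lines_def, rule_format])
    from has_vector_derivative_real_field[OF this]
    show ?thesis unfolding K_def P'[symmetric]
      by (rule has_vector_derivative_eq_rhs) (simp add: H_def algebra_simps)
  qed
  have "diamond_int s (Lap F) = integral {-s..s} (\<lambda>z. integral {-s..s} (\<lambda>w. Lap F (Ph1 z w) (Ph2 z w)))"
    by (rule diamond_int_iterated[OF poly_fun_dcont[OF poly_fun_Lap[OF F]]])
  also have "\<dots> = integral {-s..s} (\<lambda>z. H z s - H z (-s))"
    using s by (intro Henstock_Kurzweil_Integration.integral_cong integral_unique fundamental_theorem_of_calculus H) auto
  also have "\<dots> = (K s s - K s (-s)) - (K (-s) s - K (-s) (-s))"
    using s by (intro integral_unique fundamental_theorem_of_calculus has_vector_derivative_diff K) auto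
  also have "\<dots> = 0" by (simp add: K_def Ph1_def Ph2_def z)
  finally show ?thesis .
qed

lemma poly_series_Lap:
  assumes "poly_series R g F" "1 \<le> R1" "R1 < R2" "R2 < R"
  shows "poly_series R1 (\<lambda>d. Lap (g d)) (Lap F)"
  unfolding Lap_def
  by (intro poly_series_add poly_series_Dx[OF poly_series_Dx[OF assms(1)]] poly_series_Dy[OF poly_series_Dy[OF assms(1)]]) (use assms in auto)

text \<open>Every single term of the expansion vanishes on both edges, so each contributes zero, and
  uniform convergence on the diamond carries this to the sum.\<close>

lemma diamond_poly_series:
  assumes "poly_series R g F" "1 < R1" "R1 < R" "small R1 s"
    "\<And>d y. g d (-1) y = 0" "\<And>d x. g d x (-1) = 0"
  shows "diamond_int s (Lap F) = 0"
proof (rule poly_series_diamond_int_zero)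
  show "poly_series R1 (\<lambda>d. Lap (g d)) (Lap F)"
    by (rule poly_series_Lap[OF assms(1), of R1 "(R1 + R) / 2"]) (use assms in auto)
  fix d
  obtain n where "poly_fun n (g d)" using poly_series_PFD[OF assms(1)] by blast
  then show "diamond_int s (Lap (g d)) = 0"
    by (rule diamond_poly_fun) (use assms in \<open>auto simp: small_def\<close>)
qed fact

text \<open>Polynomials in \<open>z\<close> and \<open>w\<close> have complex coefficients in \<open>x\<close> and \<open>y\<close>.\<close>

definition cpoly_fun :: "(complex \<Rightarrow> complex \<Rightarrow> complex) \<Rightarrow> bool" where
  "cpoly_fun P \<longleftrightarrow> (\<exists>n m P1 P2. poly_fun n P1 \<and> poly_fun m P2 \<and> P = (\<lambda>x y. P1 x y + \<i> * P2 x y))"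

lemma cpoly_fun_mult:
  assumes "cpoly_fun P" "cpoly_fun Q"
  shows "cpoly_fun (\<lambda>x y. P x y * Q x y)"
proof -
  obtain n m P1 P2 where P: "poly_fun n P1" "poly_fun m P2" "P = (\<lambda>x y. P1 x y + \<i> * P2 x y)" using assms(1) by (auto simp: cpoly_fun_def)
  obtain k l Q1 Q2 where Q: "poly_fun k Q1" "poly_fun l Q2" "Q = (\<lambda>x y. Q1 x y + \<i> * Q2 x y)" using assms(2) by (auto simp: cpoly_fun_def)
  define N where "N = n + m + k + l"
  have w: "poly_fun N P1" "poly_fun N P2" "poly_fun N Q1" "poly_fun N Q2"
    using P Q by (auto intro: poly_fun_weaken simp: N_def)
  have "poly_fun (N + N) (\<lambda>x y. P1 x y * Q1 x y - P2 x y * Q2 x y)" "poly_fun (N + N) (\<lambda>x y. P1 x y * Q2 x y + P2 x y * Q1 x y)"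
    by (intro poly_fun_diff poly_fun_add poly_fun_mult w)+
  moreover have "(\<lambda>x y. P x y * Q x y) = (\<lambda>x y. (P1 x y * Q1 x y - P2 x y * Q2 x y) + \<i> * (P1 x y * Q2 x y + P2 x y * Q1 x y))"
    unfolding P Q by (auto simp: fun_eq_iff algebra_simps)
  ultimately show ?thesis unfolding cpoly_fun_def by blast
qed

lemma cpoly_fun_power: assumes "cpoly_fun P" shows "cpoly_fun (\<lambda>x y. P x y ^ k)"
proof (induction k)
  case 0
  have "poly_fun 0 (\<lambda>x y. 1)" "poly_fun 0 (\<lambda>x y. 0)" using poly_fun_const[of 0 1] poly_fun_const[of 0 0] by simp_all
  then show ?case unfolding cpoly_fun_def by (intro exI[of _ 0] exI[of _ "\<lambda>x y. 1"] exI[of _ "\<lambda>x y. 0"]) simp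
next
  case (Suc k)
  then show ?case using cpoly_fun_mult[OF assms Suc] by simp
qed

definition Zc :: "complex \<Rightarrow> complex \<Rightarrow> complex" where "Zc x y = (x + 1) + \<i> * (y + 1)"
definition Wc :: "complex \<Rightarrow> complex \<Rightarrow> complex" where "Wc x y = (x + 1) - \<i> * (y + 1)"

lemma Zc_Wc_Ph: "Zc (Ph1 z w) (Ph2 z w) = of_real z" "Wc (Ph1 z w) (Ph2 z w) = of_real w"
  by (simp_all add: Zc_def Wc_def Ph1_def Ph2_def field_simps)

lemma cpoly_fun_Zc_Wc: "cpoly_fun Zc" "cpoly_fun Wc"
proof -
  have 1: "poly_fun (Suc 0) (\<lambda>x y. x + 1)" "poly_fun (Suc 0) (\<lambda>x y. y + 1)" "poly_fun (Suc 0) (\<lambda>x y. - (y + 1))"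
    using poly_fun_add[OF poly_fun_X[of 0] poly_fun_const[of "Suc 0" 1]] poly_fun_add[OF poly_fun_Y[of 0] poly_fun_const[of "Suc 0" 1]]
      poly_fun_scale[OF poly_fun_add[OF poly_fun_Y[of 0] poly_fun_const[of "Suc 0" 1]], of "-1"] by simp_all
  have "Zc = (\<lambda>x y. (x + 1) + \<i> * (y + 1))" "Wc = (\<lambda>x y. (x + 1) + \<i> * (- (y + 1)))"
    by (auto simp: Zc_def Wc_def fun_eq_iff algebra_simps)
  then show "cpoly_fun Zc" "cpoly_fun Wc" unfolding cpoly_fun_def using 1 by blast+
qed

lemma lines_ZW:
  assumes f: "\<And>t. (f has_field_derivative f' t) (at t)" and g: "\<And>t. (g has_field_derivative g' t) (at t)"
  shows "lines (\<lambda>x y. f (Zc x y) * g (Wc x y)) (\<lambda>x y. f (Zc x y) * g' (Wc x y) + f' (Zc x y) * g (Wc x y))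
     (\<lambda>x y. - \<i> * (f (Zc x y) * g' (Wc x y)) + \<i> * (f' (Zc x y) * g (Wc x y)))"
proof -
  have 1: "lines (\<lambda>x y. f (Zc x y)) (\<lambda>x y. f' (Zc x y)) (\<lambda>x y. \<i> * f' (Zc x y))"
    unfolding lines_def Zc_def
    by (intro allI DERIV_chain2[OF f, THEN DERIV_cong]) (auto intro!: derivative_eq_intros simp: algebra_simps)
  have 2: "lines (\<lambda>x y. g (Wc x y)) (\<lambda>x y. g' (Wc x y)) (\<lambda>x y. - \<i> * g' (Wc x y))"
    unfolding lines_def Wc_def
    by (intro allI DERIV_chain2[OF g, THEN DERIV_cong]) (auto intro!: derivative_eq_intros simp: algebra_simps)
  from lines_mult[OF 1 2] show ?thesis by (simp add: algebra_simps)
qed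

lemma lines_cmult: "lines F Fx Fy \<Longrightarrow> lines (\<lambda>x y. k * F x y) (\<lambda>x y. k * Fx x y) (\<lambda>x y. k * Fy x y)"
  using lines_mult[OF lines_const[of k], of F Fx Fy] by simp

lemma ZW_derivs:
  assumes f: "\<And>t. (f has_field_derivative f' t) (at t)" "\<And>t. (f' has_field_derivative f'' t) (at t)"
    and g: "\<And>t. (g has_field_derivative g' t) (at t)" "\<And>t. (g' has_field_derivative g'' t) (at t)"
  defines "Q \<equiv> (\<lambda>x y. f (Zc x y) * g (Wc x y))"
  shows "Dx Q = (\<lambda>x y. f (Zc x y) * g' (Wc x y) + f' (Zc x y) * g (Wc x y))"
    "Dy Q = (\<lambda>x y. - \<i> * (f (Zc x y) * g' (Wc x y)) + \<i> * (f' (Zc x y) * g (Wc x y)))"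
    "Lap Q = (\<lambda>x y. 4 * (f' (Zc x y) * g' (Wc x y)))"
proof -
  show x: "Dx Q = (\<lambda>x y. f (Zc x y) * g' (Wc x y) + f' (Zc x y) * g (Wc x y))"
   and y: "Dy Q = (\<lambda>x y. - \<i> * (f (Zc x y) * g' (Wc x y)) + \<i> * (f' (Zc x y) * g (Wc x y)))"
    unfolding Q_def using lines_Dx(3,4)[OF lines_ZW[OF f(1) g(1)]] by simp_all
  note l1 = lines_ZW[OF f(1) g(2)] and l2 = lines_ZW[OF f(2) g(1)]
  note xx = lines_Dx(3)[OF lines_add[OF l1 l2]]
  note yy = lines_Dx(4)[OF lines_add[OF lines_cmult[OF l1, of "-\<i>"] lines_cmult[OF l2, of \<i>]]]
  show "Lap Q = (\<lambda>x y. 4 * (f' (Zc x y) * g' (Wc x y)))"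
    unfolding Lap_def x y xx yy by (auto simp: fun_eq_iff algebra_simps)
qed

text \<open>The hypothesis says weakly that \<open>h0\<close> is the derivative of
  \<open>h1\<close>, with no boundary terms left over. Let H be the primitive of \<open>h0\<close>
  that vanishes at -s; the case m = 0 gives H(s) = 0. Integration by parts gives the same identities
  for H, so \<open>h1\<close> - H has vanishing moments, \<open>h1\<close> equals H, and its end
  value is zero.\<close>

lemma end_value_zero:
  fixes h0 h1 :: "real \<Rightarrow> complex"
  assumes s: "0 < s" and c: "continuous_on {-s..s} h0" "continuous_on {-s..s} h1"
    and I: "\<And>m. integral {-s..s} (\<lambda>z. of_real z ^ m * h0 z + of_nat m * of_real z ^ (m - 1) * h1 z) = 0"
  shows "h1 s = 0"
proof -
  define H where "H z = integral {-s..z} h0" for z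
  have H: "(H has_vector_derivative h0 z) (at z within {-s..s})" if "z \<in> {-s..s}" for z
    unfolding H_def by (rule integral_has_vector_derivative[OF c(1) that])
  have cH: "continuous_on {-s..s} H"
    using H has_vector_derivative_continuous continuous_on_eq_continuous_within by blast
  have Hs: "H s = 0" using I[of 0] by (simp add: H_def)
  have pd: "((\<lambda>z. of_real z ^ m :: complex) has_vector_derivative of_nat m * of_real z ^ (m - 1)) (at z within A)" for z :: real and m A
    by (rule has_vector_derivative_real_field) (auto intro!: derivative_eq_intros)
  have 1: "integral {-s..s} (\<lambda>z. of_real z ^ m * h0 z + of_nat m * of_real z ^ (m - 1) * H z) = 0" for m
  proof -
    have "((\<lambda>z. of_real z ^ m * h0 z + of_nat m * of_real z ^ (m - 1) * H z) has_integral
        of_real s ^ m * H s - of_real (-s) ^ m * H (-s)) {-s..s}"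
      by (intro fundamental_theorem_of_calculus has_vector_derivative_mult pd H) (use s in auto)
    then show ?thesis using Hs by (simp add: integral_unique) (simp add: H_def)
  qed
  have "integral {-s..s} (\<lambda>z. of_real z ^ k * (h1 z - H z)) = 0" for k
  proof -
    have "integral {-s..s} (\<lambda>z. of_nat (Suc k) * (of_real z ^ k * (h1 z - H z))) =
       integral {-s..s} (\<lambda>z. (of_real z ^ Suc k * h0 z + of_nat (Suc k) * of_real z ^ (Suc k - 1) * h1 z) -
          (of_real z ^ Suc k * h0 z + of_nat (Suc k) * of_real z ^ (Suc k - 1) * H z))"
      by (intro Henstock_Kurzweil_Integration.integral_cong) (simp add: algebra_simps)
    also have "\<dots> = 0"
    proof -
      have i: "(\<lambda>z. of_real z ^ Suc k * h0 z + of_nat (Suc k) * of_real z ^ (Suc k - 1) * h1 z) integrable_on {-s..s}"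
        "(\<lambda>z. of_real z ^ Suc k * h0 z + of_nat (Suc k) * of_real z ^ (Suc k - 1) * H z) integrable_on {-s..s}"
        by (intro integrable_continuous_real continuous_intros c cH)+
      show ?thesis unfolding Henstock_Kurzweil_Integration.integral_diff[OF i] I 1 by simp
    qed
    finally show ?thesis
      by (simp only: integral_mult_right mult_eq_0_iff of_nat_eq_0_iff nat.distinct simp_thms)
  qed
  then have "h1 s - H s = 0"
    using s by (intro moment_complex[of "-s" s "\<lambda>z. h1 z - H z"] continuous_intros c cH) auto
  then show ?thesis using Hs by simp
qed

lemma dcont_section:
  assumes "dcont s F" "\<bar>z\<bar> \<le> s"
  shows "continuous_on {-s..s} (\<lambda>w. F (Ph1 z w) (Ph2 z w))"
proof -
  have "continuous_on {-s..s} (\<lambda>w. (\<lambda>p. F (Ph1 (fst p) (snd p)) (Ph2 (fst p) (snd p))) (z, w))"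
    by (rule continuous_on_compose2[OF assms(1)[unfolded dcont_def]])
      (use assms(2) in \<open>auto intro!: continuous_intros simp: mem_cbox_s abs_le_iff\<close>)
  then show ?thesis by simp
qed

lemma dcont_param:
  assumes "dcont s F"
  shows "continuous_on {-s..s} (\<lambda>z. integral {-s..s} (\<lambda>w. F (Ph1 z w) (Ph2 z w)))"
proof -
  have "{-s..s} \<times> cbox (-s) s = cbox (-s, -s) (s, s)" by (simp add: cbox_Pair_eq)
  then have "continuous_on ({-s..s} \<times> cbox (-s) s) (\<lambda>(z, w). F (Ph1 z w) (Ph2 z w))"
    using assms by (simp add: dcont_def case_prod_unfold)
  from integral_continuous_on_param[OF this] show ?thesis by simp
qed

text \<open>The condition is linear in the multiplier, so it passes from real coefficients to
  complex ones. This is what allows monomials in z and w as multipliers.\<close>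

lemma diamond_int_cpoly_fun_zero:
  assumes V: "\<And>n P. poly_fun n P \<Longrightarrow> diamond_int s (\<lambda>x y. P x y * F0 x y + Dx P x y * F1 x y + Dy P x y * F2 x y + Lap P x y * F3 x y) = 0"
    and c: "dcont s F0" "dcont s F1" "dcont s F2" "dcont s F3" and Q: "cpoly_fun Q"
  shows "diamond_int s (\<lambda>x y. Q x y * F0 x y + Dx Q x y * F1 x y + Dy Q x y * F2 x y + Lap Q x y * F3 x y) = 0"
proof -
  obtain n m P1 P2 where P: "poly_fun n P1" "poly_fun m P2" "Q = (\<lambda>x y. P1 x y + \<i> * P2 x y)" using Q by (auto simp: cpoly_fun_def)
  note l1 = poly_fun_derivs(3)[OF P(1)] and l2 = poly_fun_derivs(3)[OF P(2)]
  note l11 = poly_fun_derivs(3)[OF poly_fun_derivs(1)[OF P(1)]] and l12 = poly_fun_derivs(3)[OF poly_fun_derivs(2)[OF P(1)]]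
  note l21 = poly_fun_derivs(3)[OF poly_fun_derivs(1)[OF P(2)]] and l22 = poly_fun_derivs(3)[OF poly_fun_derivs(2)[OF P(2)]]
  have dx: "Dx Q = (\<lambda>x y. Dx P1 x y + \<i> * Dx P2 x y)" and dy: "Dy Q = (\<lambda>x y. Dy P1 x y + \<i> * Dy P2 x y)"
    unfolding P(3) using lines_Dx(3,4)[OF lines_add[OF l1 lines_cmult[OF l2, of \<i>]]] by simp_all
  have lap: "Lap Q = (\<lambda>x y. Lap P1 x y + \<i> * Lap P2 x y)"
    unfolding Lap_def dx dy
    using lines_Dx(3)[OF lines_add[OF l11 lines_cmult[OF l21, of \<i>]]] lines_Dx(4)[OF lines_add[OF l12 lines_cmult[OF l22, of \<i>]]]
    by (simp add: fun_eq_iff algebra_simps)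
  let ?E = "\<lambda>P x y. P x y * F0 x y + Dx P x y * F1 x y + Dy P x y * F2 x y + Lap P x y * F3 x y"
  have dE: "dcont s (?E P)" if "poly_fun n P" for n P
    by (intro dcont_add dcont_mult c poly_fun_dcont[OF that] poly_fun_dcont[OF poly_fun_derivs(1)[OF that]] poly_fun_dcont[OF poly_fun_derivs(2)[OF that]] poly_fun_dcont[OF poly_fun_Lap[OF that]])
  have "?E Q = (\<lambda>x y. ?E P1 x y + \<i> * ?E P2 x y)"
    unfolding dx dy lap unfolding P(3) by (auto simp: fun_eq_iff algebra_simps)
  then have "diamond_int s (?E Q) = diamond_int s (?E P1) + \<i> * diamond_int s (?E P2)"
    using diamond_int_add[OF dE[OF P(1)] dcont_mult[OF dcont_const[of s \<i>] dE[OF P(2)]]] by (simp add: diamond_int_cmult)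
  then show ?thesis using V[OF P(1)] V[OF P(2)] by simp
qed

lemma power_deriv: "((\<lambda>t::complex. t ^ m) has_field_derivative of_nat m * t ^ (m - 1)) (at t)"
  by (auto intro!: derivative_eq_intros)

lemma power_deriv2: "((\<lambda>t::complex. of_nat m * t ^ (m - 1)) has_field_derivative of_nat m * (of_nat (m - 1) * t ^ (m - 1 - 1))) (at t)"
  by (intro DERIV_cmult power_deriv)

text \<open>For the multiplier z^m w^k the integrand becomes z^m \<open>A0\<close> + m z^(m-1)
  \<open>A1\<close>. After integration over w this is the situation of \<open>end_value_zero\<close>
  in the variable z, for every m, and the end value of the integral of \<open>A1\<close> at z = s is
  the claim.\<close>

lemma corner_moments:
  assumes s: "0 < s"
    and V: "\<And>n P. poly_fun n P \<Longrightarrow> diamond_int s (\<lambda>x y. P x y * F0 x y + Dx P x y * F1 x y + Dy P x y * F2 x y + Lap P x y * F3 x y) = 0"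
    and c: "dcont s F0" "dcont s F1" "dcont s F2" "dcont s F3"
  shows "integral {-s..s} (\<lambda>w. of_real w ^ k * (F1 (Ph1 s w) (Ph2 s w) + \<i> * F2 (Ph1 s w) (Ph2 s w))
     + of_nat k * of_real w ^ (k - 1) * (4 * F3 (Ph1 s w) (Ph2 s w))) = 0"
proof -
  define A0 where "A0 x y = Wc x y ^ k * F0 x y + of_nat k * Wc x y ^ (k - 1) * (F1 x y - \<i> * F2 x y)" for x y
  define A1 where "A1 x y = Wc x y ^ k * (F1 x y + \<i> * F2 x y) + of_nat k * Wc x y ^ (k - 1) * (4 * F3 x y)" for x y
  have cW: "dcont s (\<lambda>x y. Wc x y ^ j)" "dcont s (\<lambda>x y. Zc x y ^ j)" for j
    unfolding dcont_def Zc_Wc_Ph by (intro continuous_intros)+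
  have cA: "dcont s A0" "dcont s A1" unfolding A0_def A1_def
    by (intro dcont_add dcont_diff dcont_mult dcont_const cW c)+
  have "(\<lambda>z. integral {-s..s} (\<lambda>w. A1 (Ph1 z w) (Ph2 z w))) s = 0"
  proof (rule end_value_zero[OF s dcont_param[OF cA(1)] dcont_param[OF cA(2)]])
    fix m
    let ?Q = "\<lambda>x y. Zc x y ^ m * Wc x y ^ k"
    note d = ZW_derivs[OF power_deriv[of m] power_deriv2[of m] power_deriv[of k] power_deriv2[of k]]
    let ?B = "\<lambda>x y. Zc x y ^ m * A0 x y + of_nat m * Zc x y ^ (m - 1) * A1 x y"
    have cB: "dcont s ?B" by (intro dcont_add dcont_mult dcont_const cW cA)
    have "cpoly_fun ?Q" by (intro cpoly_fun_mult cpoly_fun_power cpoly_fun_Zc_Wc)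
    from diamond_int_cpoly_fun_zero[OF V c this]
    have "diamond_int s ?B = 0"
      unfolding d A0_def A1_def by (simp add: algebra_simps)
    then have "integral {-s..s} (\<lambda>z. integral {-s..s} (\<lambda>w. ?B (Ph1 z w) (Ph2 z w))) = 0"
      unfolding diamond_int_iterated[OF cB] .
    moreover have eq: "integral {-s..s} (\<lambda>w. ?B (Ph1 z w) (Ph2 z w)) = of_real z ^ m * integral {-s..s} (\<lambda>w. A0 (Ph1 z w) (Ph2 z w))
       + of_nat m * of_real z ^ (m - 1) * integral {-s..s} (\<lambda>w. A1 (Ph1 z w) (Ph2 z w))" if "z \<in> {-s..s}" for z
    proof -
      have "(\<lambda>w. A0 (Ph1 z w) (Ph2 z w)) integrable_on {-s..s}" "(\<lambda>w. A1 (Ph1 z w) (Ph2 z w)) integrable_on {-s..s}"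
        by (intro integrable_continuous_real dcont_section cA; use that in auto)+
      then show ?thesis
        unfolding Zc_Wc_Ph by (simp add: Henstock_Kurzweil_Integration.integral_add integrable_on_mult_right)
    qed
    ultimately show "integral {-s..s} (\<lambda>z. of_real z ^ m * integral {-s..s} (\<lambda>w. A0 (Ph1 z w) (Ph2 z w))
       + of_nat m * of_real z ^ (m - 1) * integral {-s..s} (\<lambda>w. A1 (Ph1 z w) (Ph2 z w))) = 0"
      by (subst Henstock_Kurzweil_Integration.integral_cong[OF eq[symmetric]]) simp_all
  qed
  then show ?thesis unfolding A1_def Zc_Wc_Ph by simp
qed

text \<open>The points of the diamond include a product of segments, so vanishing there propagates.\<close>

lemma identity_from_corner:
  assumes hx: "\<And>y. y \<in> ellipse R \<Longrightarrow> (\<lambda>x. F x y) holomorphic_on ellipse R"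
    and hy: "\<And>x. x \<in> ellipse R \<Longrightarrow> (\<lambda>y. F x y) holomorphic_on ellipse R"
    and s: "small R s"
    and z: "\<And>z w. 0 < z \<Longrightarrow> z \<le> s \<Longrightarrow> \<bar>w\<bar> \<le> z \<Longrightarrow> F (Ph1 z w) (Ph2 z w) = 0"
    and xy: "x \<in> ellipse R" "y \<in> ellipse R"
  shows "F x y = 0"
proof -
  define A where "A = (\<lambda>t. - 1 + of_real t :: complex) ` {0<..s/2}"
  define B where "B = (\<lambda>t. - 1 - \<i> * of_real t :: complex) ` {0<..s/2}"
  have s0: "0 < s" using s by (simp add: small_def)
  have AE: "A \<subseteq> ellipse R"
    unfolding A_def by (intro image_subsetI near_corner_in_ellipse) (use s in \<open>simp add: small_def\<close>)
  have "- 1 + (- (\<i> * of_real t)) \<in> ellipse R" if "0 < t" "t \<le> s / 2" for t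
    by (rule near_corner_in_ellipse) (use s that in \<open>simp add: small_def norm_mult\<close>)
  then have BE: "B \<subseteq> ellipse R" unfolding B_def by (intro image_subsetI) simp
  have "(-1::complex) \<in> ellipse R" using near_corner_in_ellipse[of 0 R] s by (simp add: small_def)
  have lim: "(- 1::complex) islimpt (\<lambda>t. - 1 + c * of_real t) ` {0<..s/2}" if "norm c = 1" for c
    unfolding islimpt_approachable
  proof (intro allI impI)
    fix e :: real assume e: "0 < e"
    define t where "t = min (s / 2) (e / 2)"
    have t: "0 < t" "t \<le> s / 2" "t < e" using e s0 by (auto simp: t_def)
    have "c \<noteq> 0" using that by auto
    then show "\<exists>x'\<in>(\<lambda>t. - 1 + c * of_real t) ` {0<..s/2}. x' \<noteq> - 1 \<and> dist x' (- 1) < e"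
      using t that by (intro bexI[of _ "- 1 + c * of_real t"]) (auto simp: dist_norm norm_mult)
  qed
  show ?thesis
  proof (rule identity_ellipse[OF hx hy AE BE \<open>-1 \<in> ellipse R\<close> \<open>-1 \<in> ellipse R\<close> _ _ _ xy])
    show "(- 1) islimpt A" "(- 1) islimpt B" using lim[of 1] lim[of "-\<i>"] by (simp_all add: A_def B_def)
    fix a b assume "a \<in> A" "b \<in> B"
    then obtain t u where tu: "0 < t" "t \<le> s / 2" "a = - 1 + of_real t" "0 < u" "u \<le> s / 2" "b = - 1 - \<i> * of_real u"
      by (auto simp: A_def B_def)
    have "a = Ph1 (t + u) (t - u)" "b = Ph2 (t + u) (t - u)"
      unfolding tu by (simp_all add: Ph1_def Ph2_def field_simps)
    then show "F a b = 0" using z[of "t + u" "t - u"] tu by simp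
  qed
qed

lemma small_exists: assumes "1 < R" obtains s where "small R s"
proof -
  have "small R ((R + 1 / R - 2) / 4)" using joukowski_gt_2[OF assms] by (simp add: small_def field_simps)
  then show ?thesis using that by blast
qed

lemma small_mono: "small R s \<Longrightarrow> 0 < t \<Longrightarrow> t \<le> s \<Longrightarrow> small R t"
  by (auto simp: small_def)

text \<open>The term with 4 \<open>F3\<close> in \<open>corner_moments\<close> is integrated by
  parts in w; its boundary terms vanish because the ends of the segment lie on the edges. Half the
  w-derivative factor of \<open>F3\<close> turns 4 into 2, and what remains says that all moments of
  the difference of the two sides over the segment vanish. Since the side length may be any small
  number, the difference vanishes on all these segments, and analyticity spreads it.\<close>

lemma corner_first_order:
  assumes R: "1 < R1" "R1 < R2" "R2 < R"
    and poly_series: "poly_series R g0 F0" "poly_series R g1 F1" "poly_series R g2 F2" "poly_series R g3 F3"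
    and V: "\<And>s n P. small R1 s \<Longrightarrow> poly_fun n P \<Longrightarrow> diamond_int s (\<lambda>x y. P x y * F0 x y + Dx P x y * F1 x y + Dy P x y * F2 x y + Lap P x y * F3 x y) = 0"
    and bd: "\<And>y. y \<in> ellipse R \<Longrightarrow> F3 (-1) y = 0" "\<And>x. x \<in> ellipse R \<Longrightarrow> F3 x (-1) = 0"
    and xy: "x \<in> ellipse R1" "y \<in> ellipse R1"
  shows "F1 x y + \<i> * F2 x y = 2 * (Dx F3 x y + \<i> * Dy F3 x y)"
proof -
  have sub: "ellipse R1 \<subseteq> ellipse R2" "ellipse R2 \<subseteq> ellipse R" "ellipse R1 \<subseteq> ellipse R" using R by (intro ellipse_mono; simp)+
  have AS3: "poly_series R2 (\<lambda>d. Dx (g3 d)) (Dx F3)" "poly_series R2 (\<lambda>d. Dy (g3 d)) (Dy F3)"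
    using poly_series_Dx[OF poly_series(4)] poly_series_Dy[OF poly_series(4)] R by auto
  define Z where "Z x y = F1 x y + \<i> * F2 x y - 2 * (Dx F3 x y + \<i> * Dy F3 x y)" for x y
  obtain s where s: "small R1 s" using small_exists[OF R(1)] by blast
  have "Z x y = 0"
  proof (rule identity_from_corner[OF _ _ s _ xy])
    show "(\<lambda>x. Z x y) holomorphic_on ellipse R1" if "y \<in> ellipse R1" for y
      unfolding Z_def using R that sub
      by (intro holomorphic_intros poly_series_holomorphic(1)[OF poly_series(2)] poly_series_holomorphic(1)[OF poly_series(3)] poly_series_holomorphic(1)[OF AS3(1)] poly_series_holomorphic(1)[OF AS3(2)]) auto
    show "(\<lambda>y. Z x y) holomorphic_on ellipse R1" if "x \<in> ellipse R1" for x
      unfolding Z_def using R that sub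
      by (intro holomorphic_intros poly_series_holomorphic(2)[OF poly_series(2)] poly_series_holomorphic(2)[OF poly_series(3)] poly_series_holomorphic(2)[OF AS3(1)] poly_series_holomorphic(2)[OF AS3(2)]) auto
    fix z w :: real assume z: "0 < z" "z \<le> s" and w: "\<bar>w\<bar> \<le> z"
    have sz1: "small R1 z" by (rule small_mono[OF s z])
    have sz: "small R z" "small R2 z"
      using sz1 joukowski_strict_mono[of R1 R] joukowski_strict_mono[of R1 R2] R by (auto simp: small_def)
    have c: "dcont z F0" "dcont z F1" "dcont z F2" "dcont z F3" "dcont z (Dx F3)" "dcont z (Dy F3)"
      using poly_series_dcont poly_series AS3 sz by blast+
    have "integral {-z..z} (\<lambda>w. of_real w ^ k * Z (Ph1 z w) (Ph2 z w)) = 0" for k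
    proof -
      let ?N = "\<lambda>w. F3 (Ph1 z w) (Ph2 z w)"
      let ?N' = "\<lambda>w. (Dx F3 (Ph1 z w) (Ph2 z w) + \<i> * Dy F3 (Ph1 z w) (Ph2 z w)) / 2"
      have P: "Ph1 z w = (- 1 + of_real z / 2) + (1 / 2) * of_real w" "Ph2 z w = (- 1 - \<i> * of_real z / 2) + (\<i> / 2) * of_real w" for w
        by (simp_all add: Ph1_def Ph2_def field_simps)
      have N: "(?N has_vector_derivative ?N' w) (at w within {-z..z})" if "w \<in> {-z..z}" for w
      proof -
        have "Ph1 z w \<in> ellipse R2" "Ph2 z w \<in> ellipse R2" using Ph_in_ellipse[OF sz(2), of z w] that z by auto
        then have "((\<lambda>t. F3 ((- 1 + of_real z / 2) + (1 / 2) * t) ((- 1 - \<i> * of_real z / 2) + (\<i> / 2) * t)) has_field_derivative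
          (1/2) * Dx F3 (Ph1 z w) (Ph2 z w) + (\<i>/2) * Dy F3 (Ph1 z w) (Ph2 z w)) (at (of_real w))"
          unfolding P using R by (intro poly_series_chain[OF poly_series(4)]) auto
        from has_vector_derivative_real_field[OF this]
        show ?thesis unfolding P[symmetric]
          by (rule has_vector_derivative_eq_rhs) (simp add: field_simps)
      qed
      have pd: "((\<lambda>z. of_real z ^ m :: complex) has_vector_derivative of_nat m * of_real z ^ (m - 1)) (at z within A)" for z :: real and m A
        by (rule has_vector_derivative_real_field) (rule power_deriv)
      \<comment> \<open>The end w = z has y = -1 and the end w = -z has x = -1, while the other
        coordinate is in general complex there at first sight; this is why \<open>bd\<close> is
        required on the whole ellipse.\<close>
      have ends: "?N z = 0" "?N (-z) = 0"
        using bd Ph_in_ellipse[OF sz(1), of z z] Ph_in_ellipse[OF sz(1), of z "-z"] z by (simp_all add: Ph1_def Ph2_def)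
      have "((\<lambda>w. of_real w ^ k * ?N' w + of_nat k * of_real w ^ (k - 1) * ?N w) has_integral
          of_real z ^ k * ?N z - of_real (-z) ^ k * ?N (-z)) {-z..z}"
        by (intro fundamental_theorem_of_calculus has_vector_derivative_mult pd N) (use z in auto)
      then have "integral {-z..z} (\<lambda>w. of_real w ^ k * ?N' w + of_nat k * of_real w ^ (k - 1) * ?N w) = 0"
        using ends by (simp add: integral_unique)
      then have 1: "integral {-z..z} (\<lambda>w. 4 * (of_real w ^ k * ?N' w + of_nat k * of_real w ^ (k - 1) * ?N w)) = 0"
        by (simp only: integral_mult_right mult_zero_right)
      have 2: "integral {-z..z} (\<lambda>w. of_real w ^ k * (F1 (Ph1 z w) (Ph2 z w) + \<i> * F2 (Ph1 z w) (Ph2 z w))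
         + of_nat k * of_real w ^ (k - 1) * (4 * ?N w)) = 0"
        by (rule corner_moments[OF z(1) V[OF sz1] c(1-4)])
      have "integral {-z..z} (\<lambda>w. of_real w ^ k * Z (Ph1 z w) (Ph2 z w)) =
        integral {-z..z} (\<lambda>w. (of_real w ^ k * (F1 (Ph1 z w) (Ph2 z w) + \<i> * F2 (Ph1 z w) (Ph2 z w)) + of_nat k * of_real w ^ (k - 1) * (4 * ?N w))
          - 4 * (of_real w ^ k * ?N' w + of_nat k * of_real w ^ (k - 1) * ?N w))"
        by (intro Henstock_Kurzweil_Integration.integral_cong) (simp add: Z_def field_simps)
      also have "\<dots> = 0"
      proof -
        have zz: "\<bar>z\<bar> \<le> z" using z by simp
        have i: "(\<lambda>w. of_real w ^ k * (F1 (Ph1 z w) (Ph2 z w) + \<i> * F2 (Ph1 z w) (Ph2 z w)) + of_nat k * of_real w ^ (k - 1) * (4 * ?N w)) integrable_on {-z..z}"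
          "(\<lambda>w. 4 * (of_real w ^ k * ?N' w + of_nat k * of_real w ^ (k - 1) * ?N w)) integrable_on {-z..z}"
          by (intro integrable_continuous_real continuous_intros dcont_section c zz; simp)+
        show ?thesis unfolding Henstock_Kurzweil_Integration.integral_diff[OF i] 1 2 by simp
      qed
      finally show ?thesis .
    qed
    moreover have "continuous_on {-z..z} (\<lambda>w. Z (Ph1 z w) (Ph2 z w))"
      unfolding Z_def using z by (intro continuous_intros dcont_section c) auto
    ultimately show "Z (Ph1 z w) (Ph2 z w) = 0"
      using z w by (intro moment_complex[of "-z" z "\<lambda>w. Z (Ph1 z w) (Ph2 z w)"]) auto
  qed
  then show ?thesis by (simp add: Z_def)
qed

text \<open>Without derivatives of the multiplier, testing with z^m w^k gives all double moments of
  S over the square. Solving the moment problem in z and then in w makes S vanish there.\<close>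

lemma corner_zero_order:
  assumes R: "1 < R1" "R1 < R" and S: "poly_series R g S"
    and s: "small R1 s" and V: "\<And>n P. poly_fun n P \<Longrightarrow> diamond_int s (\<lambda>x y. P x y * S x y) = 0"
    and xy: "x \<in> ellipse R1" "y \<in> ellipse R1"
  shows "S x y = 0"
proof (rule identity_from_corner[OF _ _ s _ xy])
  have sub: "ellipse R1 \<subseteq> ellipse R" using R by (intro ellipse_mono) auto
  show "(\<lambda>x. S x y) holomorphic_on ellipse R1" if "y \<in> ellipse R1" for y
    using R that by (intro poly_series_holomorphic(1)[OF S]) auto
  show "(\<lambda>y. S x y) holomorphic_on ellipse R1" if "x \<in> ellipse R1" for x
    using R that by (intro poly_series_holomorphic(2)[OF S]) auto
  fix z w :: real assume z: "0 < z" "z \<le> s" and w: "\<bar>w\<bar> \<le> z"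
  have s': "small R s" using s joukowski_strict_mono[of R1 R] R by (auto simp: small_def)
  have c: "dcont s S" by (rule poly_series_dcont[OF S s'])
  have cW: "dcont s (\<lambda>x y. Wc x y ^ j)" "dcont s (\<lambda>x y. Zc x y ^ j)" for j
    unfolding dcont_def Zc_Wc_Ph by (intro continuous_intros)+
  have s0: "0 < s" using s by (simp add: small_def)
  have "integral {-s..s} (\<lambda>w. of_real w ^ k * S (Ph1 t w) (Ph2 t w)) = 0" if "t \<in> {-s..s}" for k t
  proof (rule moment_complex[OF _ _ _ that, where h = "\<lambda>z. integral {-s..s} (\<lambda>w. of_real w ^ k * S (Ph1 z w) (Ph2 z w))"])
    let ?A = "\<lambda>x y. Wc x y ^ k * S x y"
    have cA: "dcont s ?A" by (intro dcont_mult cW c)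
    show "continuous_on {-s..s} (\<lambda>z. integral {-s..s} (\<lambda>w. of_real w ^ k * S (Ph1 z w) (Ph2 z w)))"
      using dcont_param[OF cA] by (simp add: Zc_Wc_Ph)
    fix m
    let ?Q = "\<lambda>x y. Zc x y ^ m * Wc x y ^ k"
    have "cpoly_fun ?Q" by (intro cpoly_fun_mult cpoly_fun_power cpoly_fun_Zc_Wc)
    from diamond_int_cpoly_fun_zero[where ?F0.0 = S and ?F1.0 = "\<lambda>x y. 0" and ?F2.0 = "\<lambda>x y. 0" and ?F3.0 = "\<lambda>x y. 0", OF _ c dcont_const dcont_const dcont_const this] V
    have "diamond_int s (\<lambda>x y. ?Q x y * S x y) = 0" by simp
    then have "integral {-s..s} (\<lambda>z. integral {-s..s} (\<lambda>w. of_real z ^ m * (of_real w ^ k * S (Ph1 z w) (Ph2 z w)))) = 0"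
      by (subst (asm) diamond_int_iterated) (auto intro!: dcont_mult cW c simp: Zc_Wc_Ph mult.assoc)
    then show "integral {-s..s} (\<lambda>z. of_real z ^ m * integral {-s..s} (\<lambda>w. of_real w ^ k * S (Ph1 z w) (Ph2 z w))) = 0"
      by simp
  qed (use s0 in simp)
  then show "S (Ph1 z w) (Ph2 z w) = 0"
    using z w s0 by (intro moment_complex[of "-s" s "\<lambda>w. S (Ph1 z w) (Ph2 z w)"] dcont_section[OF c]) auto
qed

declare split_paired_All [simp del] split_paired_Ex [simp del]

lemma upto_index_subset: "upto_index k \<subseteq> KK"
  by (auto simp: upto_index_def)

lemma upto_KK: "m \<in> upto_index k \<Longrightarrow> m \<in> KK"
  using upto_index_subset by blast

lemma finite_total_deg: "finite {m::index. total_deg m \<le> n}"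
  by (rule finite_subset[of _ "{..n} \<times> {..n}"]) (auto simp: total_deg_def)

section \<open>The Gram--Schmidt basis\<close>

lemma finite_upto_index: "finite (upto_index k)"
  by (rule finite_subset[OF _ finite_total_deg[of "total_deg k"]]) (auto simp: upto_index_def)

lemma self_upto_index: "k \<in> KK \<Longrightarrow> k \<in> upto_index k"
  by (auto simp: upto_index_def same_family_def)

lemma upto_index_trans: "m \<in> upto_index k \<Longrightarrow> upto_index m \<subseteq> upto_index k"
  by (auto simp: upto_index_def same_family_def)

lemma upto_index_antisym: "m \<in> upto_index k \<Longrightarrow> k \<in> upto_index m \<Longrightarrow> m = k"
  by (auto simp: upto_index_def total_deg_def prod_eq_iff)

lemma upto_index_card:
  assumes "m \<in> upto_index k" "m \<noteq> k" "k \<in> KK"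
  shows "card (upto_index m) < card (upto_index k)"
proof (rule psubset_card_mono[OF finite_upto_index])
  show "upto_index m \<subset> upto_index k"
    using upto_index_trans[OF assms(1)] upto_index_antisym[OF assms(1)] self_upto_index[OF assms(3)] assms(2) by blast
qed

lemma infsum_KK_eq:
  assumes "finite F" "F \<subseteq> KK" "\<And>k. k \<in> KK \<Longrightarrow> k \<notin> F \<Longrightarrow> f k = 0"
  shows "(\<Sum>\<^sub>\<infinity>k\<in>KK. f k) = (\<Sum>k\<in>F. f k :: real)"
proof -
  have "(\<Sum>\<^sub>\<infinity>k\<in>KK. f k) = (\<Sum>\<^sub>\<infinity>k\<in>F. f k)"
    by (rule infsum_cong_neutral) (use assms in auto)
  then show ?thesis using assms(1) by simp
qed

text \<open>The infimum defining \<open>op_norm\<close> is itself a bound: after division by the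
  norm of x, that quotient is a lower bound of the set of all bounds.\<close>

lemma op_norm_bound:
  assumes "op_bounded I M" "x \<in> ell2 I"
  shows "mat_vec I M x \<in> ell2 I" "ell2_norm I (mat_vec I M x) \<le> op_norm I M * ell2_norm I x"
proof -
  obtain C0 where C0: "op_bound I M C0" using assms(1) by (auto simp: op_bounded_def)
  then show "mat_vec I M x \<in> ell2 I" using assms(2) by (simp add: op_bound_def)
  have b: "ell2_norm I (mat_vec I M x) \<le> C * ell2_norm I x" if "op_bound I M C" for C
    using that assms(2) by (simp add: op_bound_def)
  show "ell2_norm I (mat_vec I M x) \<le> op_norm I M * ell2_norm I x"
  proof (cases "ell2_norm I x = 0")
    case True
    then show ?thesis using b[OF C0] by simp
  next
    case False
    then have p: "0 < ell2_norm I x" by (simp add: ell2_norm_def infsum_nonneg order_less_le)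
    have "ell2_norm I (mat_vec I M x) / ell2_norm I x \<le> op_norm I M"
      unfolding op_norm_def
      by (rule cInf_greatest) (use C0 b p in \<open>auto simp: divide_le_eq\<close>)
    then show ?thesis using p by (simp add: divide_le_eq)
  qed
qed

lemma ell2_finite_sum:
  assumes "x \<in> ell2 I" "finite F" "F \<subseteq> I"
  shows "(\<Sum>i\<in>F. (x i)\<^sup>2) \<le> (ell2_norm I x)\<^sup>2"
proof -
  have s: "(\<lambda>i. (x i)\<^sup>2) summable_on I" using assms(1) by (simp add: ell2_def)
  have "(\<Sum>i\<in>F. (x i)\<^sup>2) \<le> (\<Sum>\<^sub>\<infinity>i\<in>I. (x i)\<^sup>2)"
    by (rule finite_sum_le_infsum[OF s assms(2,3)]) simp
  then show ?thesis by (simp add: ell2_norm_def infsum_nonneg)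
qed

lemma ell2_finite_support:
  assumes "finite F" "F \<subseteq> KK" "\<And>k. k \<notin> F \<Longrightarrow> x k = 0"
  shows "x \<in> ell2 KK" "ell2_norm KK x = sqrt (\<Sum>k\<in>F. (x k)\<^sup>2)"
proof -
  have "(\<lambda>k. (x k)\<^sup>2) summable_on F" using assms(1) by simp
  then have "(\<lambda>k. (x k)\<^sup>2) summable_on KK"
    by (rule summable_on_cong_neutral[THEN iffD1, rotated 3]) (use assms in auto)
  then show "x \<in> ell2 KK" by (simp add: ell2_def)
  show "ell2_norm KK x = sqrt (\<Sum>k\<in>F. (x k)\<^sup>2)"
    unfolding ell2_norm_def by (subst infsum_KK_eq[OF assms(1,2)]) (use assms(3) in auto)
qed

locale gs_basis =
  fixes G L :: index_matrix and pmax :: nat and t :: real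
  assumes gs: "is_gram_schmidt G" and inv: "is_inverse_transpose G L"
    and basis_H10: "\<And>k. k \<in> KK \<Longrightarrow> basis_fun (thresholded pmax t G) k \<in> H10"
begin

abbreviation Gt where "Gt \<equiv> thresholded pmax t G"
abbreviation E where "E \<equiv> (\<lambda>m k. Gt m k - G m k)"

lemma G_diag: "k \<in> KK \<Longrightarrow> 0 < G k k"
  using gs by (simp add: is_gram_schmidt_def)

lemma G_upper: "m \<in> KK \<Longrightarrow> k \<in> KK \<Longrightarrow> m \<notin> upto_index k \<Longrightarrow> G m k = 0"
  using gs unfolding is_gram_schmidt_def upper_triangular_def by blast

lemma L_upper: "m \<in> KK \<Longrightarrow> k \<in> KK \<Longrightarrow> m \<notin> upto_index k \<Longrightarrow> L k m = 0"
  using inv unfolding is_inverse_transpose_def upper_triangular_def mat_transp_def by blast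

lemma Gt_diag: "Gt k k = G k k"
  by (simp add: thresholded_def)

text \<open>Boundary values are obtained from the assumed basis rather than by approximating
  polynomials with test functions. The thresholded matrix is triangular with the positive diagonal
  of \<open>G\<close>, so each \<open>eta k\<close> is a combination of its basis function and
  earlier ones.\<close>

lemma eta_H10: "k \<in> KK \<Longrightarrow> eta k \<in> H10"
proof (induction "card (upto_index k)" arbitrary: k rule: less_induct)
  case less
  define S where "S = upto_index k - {k}"
  have IH: "eta m \<in> H10" if "m \<in> S" for m
    using that by (intro less.hyps) (auto simp: S_def intro!: upto_index_card less.prems intro: upto_KK)
  have k: "k \<in> upto_index k" by (rule self_upto_index[OF less.prems])
  have "basis_fun Gt k x = G k k * eta k x + (\<Sum>m\<in>S. Gt m k * eta m x)" for x
    unfolding basis_fun_def S_def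
    by (subst sum.remove[OF finite_upto_index k]) (simp add: Gt_diag)
  then have "eta k = (\<lambda>x. (1 / G k k) * (basis_fun Gt k x - (\<Sum>m\<in>S. Gt m k * eta m x)))"
    using G_diag[OF less.prems] by (auto simp: fun_eq_iff)
  moreover have "(\<lambda>x. (1 / G k k) * (basis_fun Gt k x - (\<Sum>m\<in>S. Gt m k * eta m x))) \<in> H10"
    by (intro H10_scale H10_diff basis_H10 less.prems H10_sum IH)
  ultimately show ?case by simp
qed

lemma gs_H10: "k \<in> KK \<Longrightarrow> basis_fun M k \<in> H10"
  unfolding basis_fun_def[abs_def] by (intro H10_sum eta_H10 upto_KK)

lemma basis_fun_inner:
  assumes "i \<in> KK" "j \<in> KK"
  shows "H10_inner (basis_fun M i) (basis_fun M' j) = (\<Sum>l\<in>upto_index j. \<Sum>m\<in>upto_index i. M m i * M' l j * H10_inner (eta m) (eta l))"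
proof -
  have e: "\<And>k. k \<in> upto_index i \<Longrightarrow> eta k \<in> H10" "\<And>k. k \<in> upto_index j \<Longrightarrow> eta k \<in> H10"
    by (intro eta_H10 upto_KK; assumption)+
  have "H10_inner (basis_fun M i) (basis_fun M' j) = (\<Sum>l\<in>upto_index j. M' l j * H10_inner (basis_fun M i) (eta l))"
    unfolding basis_fun_def[of M' j, abs_def] by (rule sym_form_sum_right[OF sym_form_H10_inner gs_H10[OF assms(1)] e(2)])
  also have "\<dots> = (\<Sum>l\<in>upto_index j. M' l j * (\<Sum>m\<in>upto_index i. M m i * H10_inner (eta m) (eta l)))"
  proof (rule sum.cong[OF refl])
    fix l assume "l \<in> upto_index j"
    then have "H10_inner (basis_fun M i) (eta l) = (\<Sum>m\<in>upto_index i. M m i * H10_inner (eta m) (eta l))"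
      unfolding basis_fun_def[of M i, abs_def] by (intro sym_form_sum[OF sym_form_H10_inner e(2) e(1)])
    then show "M' l j * H10_inner (basis_fun M i) (eta l) = M' l j * (\<Sum>m\<in>upto_index i. M m i * H10_inner (eta m) (eta l))"
      by simp
  qed
  finally show ?thesis by (simp add: sum_distrib_left mult_ac)
qed

lemma gs_orthonormal_family:
  assumes "i \<in> KK" "j \<in> KK" "same_family i j"
  shows "H10_inner (basis_fun G i) (basis_fun G j) = (if i = j then 1 else 0)"
proof -
  have 1: "mat_mult KK (mat_transp G) gram i l = (\<Sum>m\<in>upto_index i. G m i * gram m l)" for l
    unfolding mat_mult_def mat_transp_def
    by (rule infsum_KK_eq[OF finite_upto_index upto_index_subset]) (use G_upper assms in auto)
  have "mat_mult KK (mat_mult KK (mat_transp G) gram) G i j = (\<Sum>l\<in>upto_index j. (\<Sum>m\<in>upto_index i. G m i * gram m l) * G l j)"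
    unfolding mat_mult_def[of KK "mat_mult KK (mat_transp G) gram"] 1
    by (rule infsum_KK_eq[OF finite_upto_index upto_index_subset]) (use G_upper assms in auto)
  also have "\<dots> = (\<Sum>l\<in>upto_index j. \<Sum>m\<in>upto_index i. G m i * G l j * H10_inner (eta m) (eta l))"
    unfolding sum_distrib_right
  proof (intro sum.cong[OF refl])
    fix l m assume "l \<in> upto_index j" "m \<in> upto_index i"
    then have "same_family m l" using assms(3) by (auto simp: upto_index_def same_family_def)
    then show "G m i * gram m l * G l j = G m i * G l j * H10_inner (eta m) (eta l)"
      by (simp add: gram_def)
  qed
  also have "\<dots> = H10_inner (basis_fun G i) (basis_fun G j)" by (rule basis_fun_inner[OF assms(1,2), symmetric])
  finally show ?thesis
    using gs assms unfolding is_gram_schmidt_def is_identity_def by simp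
qed

lemma GL_identity:
  assumes "i \<in> KK" "j \<in> KK"
  shows "(\<Sum>l\<in>upto_index j. G i l * L j l) = (if i = j then 1 else 0)"
proof -
  have "mat_mult KK G (mat_transp L) i j = (\<Sum>l\<in>upto_index j. G i l * L j l)"
    unfolding mat_mult_def mat_transp_def
    by (rule infsum_KK_eq[OF finite_upto_index upto_index_subset]) (use L_upper assms in auto)
  then show ?thesis using inv assms unfolding is_inverse_transpose_def is_identity_def by simp
qed

lemma eta_expansion:
  assumes "j \<in> KK"
  shows "eta j x = (\<Sum>l\<in>upto_index j. L j l * basis_fun G l x)"
proof -
  have "basis_fun G l x = (\<Sum>i\<in>upto_index j. G i l * eta i x)" if "l \<in> upto_index j" for l
    unfolding basis_fun_def
  proof (intro sum.mono_neutral_left finite_upto_index upto_index_trans[OF that] ballI)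
    fix i assume "i \<in> upto_index j - upto_index l"
    then show "G i l * eta i x = 0" using G_upper[of i l] upto_KK[of i j] upto_KK[OF that] by auto
  qed
  then have "(\<Sum>l\<in>upto_index j. L j l * basis_fun G l x) = (\<Sum>l\<in>upto_index j. L j l * (\<Sum>i\<in>upto_index j. G i l * eta i x))"
    by simp
  also have "\<dots> = (\<Sum>i\<in>upto_index j. (\<Sum>l\<in>upto_index j. G i l * L j l) * eta i x)"
    unfolding sum_distrib_left sum_distrib_right
    by (subst sum.swap) (simp add: mult_ac)
  also have "\<dots> = (\<Sum>i\<in>upto_index j. (if i = j then 1 else 0) * eta i x)"
  proof (rule sum.cong[OF refl])
    fix i assume "i \<in> upto_index j"
    then show "(\<Sum>l\<in>upto_index j. G i l * L j l) * eta i x = (if i = j then 1 else 0) * eta i x"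
      using GL_identity[OF upto_KK[of i j] assms] by simp
  qed
  also have "\<dots> = eta j x"
    using self_upto_index[OF assms] by (simp add: if_distrib[of "\<lambda>c. c * _"] sum.delta finite_upto_index cong: if_cong)
  finally show ?thesis by simp
qed

lemma L_diag: assumes "k \<in> KK" shows "G k k * L k k = 1"
proof -
  have "(\<Sum>l\<in>upto_index k. G k l * L k l) = (\<Sum>l\<in>{k}. G k l * L k l)"
  proof (rule sum.mono_neutral_right)
    show "\<forall>i\<in>upto_index k - {k}. G k i * L k i = 0"
    proof
      fix i assume i: "i \<in> upto_index k - {k}"
      then have "k \<notin> upto_index i" using upto_index_antisym[of i k] by blast
      then show "G k i * L k i = 0" using G_upper[OF assms upto_KK[of i k]] i by simp
    qed
  qed (use self_upto_index[OF assms] finite_upto_index in auto)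
  then show ?thesis using GL_identity[OF assms assms] by simp
qed

text \<open>If the norm were zero, division by zero would make \<open>eta k\<close> the zero
  function. But its component along the k-th Gram-Schmidt function is \<open>L k k\<close>, the
  reciprocal of \<open>G k k\<close>.\<close>

lemma eta_tensor_norm_nonzero: assumes "k \<in> KK" shows "H10_norm (eta_tensor k) \<noteq> 0"
proof
  assume "H10_norm (eta_tensor k) = 0"
  then have "eta k = (\<lambda>x. 0)" by (simp add: eta_def[abs_def])
  then have "H10_inner (eta k) (basis_fun G k) = 0"
    using sym_form_zero[OF sym_form_H10_inner gs_H10[OF assms]] by simp
  moreover have "H10_inner (eta k) (basis_fun G k) = (\<Sum>l\<in>upto_index k. L k l * H10_inner (basis_fun G l) (basis_fun G k))"
  proof -
    have "eta k = (\<lambda>x. \<Sum>l\<in>upto_index k. L k l * basis_fun G l x)" using eta_expansion[OF assms] by auto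
    moreover have "H10_inner (\<lambda>x. \<Sum>l\<in>upto_index k. L k l * basis_fun G l x) (basis_fun G k) = (\<Sum>l\<in>upto_index k. L k l * H10_inner (basis_fun G l) (basis_fun G k))"
      by (rule sym_form_sum[OF sym_form_H10_inner gs_H10[OF assms] gs_H10[OF upto_KK]])
    ultimately show ?thesis by simp
  qed
  moreover have "\<dots> = (\<Sum>l\<in>upto_index k. L k l * (if l = k then 1 else 0))"
    using gs_orthonormal_family assms upto_index_subset by (intro sum.cong[OF refl]) (auto simp: upto_index_def)
  moreover have "\<dots> = L k k"
    using self_upto_index[OF assms] by (simp add: sum.delta finite_upto_index if_distrib cong: if_cong)
  ultimately have "L k k = 0" by simp
  then show False using L_diag[OF assms] by simp
qed

text \<open>Column k holds the coefficients, in the Gram-Schmidt basis, of the perturbation that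
  thresholding makes to the k-th function.\<close>

definition M :: index_matrix where "M = mat_mult KK (mat_transp L) E"

lemma M_eq: "k \<in> KK \<Longrightarrow> j \<in> KK \<Longrightarrow> M j k = (\<Sum>m\<in>upto_index k. L m j * E m k)"
  unfolding M_def mat_mult_def mat_transp_def
  by (rule infsum_KK_eq[OF finite_upto_index upto_index_subset]) (use G_upper in \<open>auto simp: thresholded_def\<close>)

text \<open>Thresholding keeps the diagonal, so \<open>E\<close> is strictly upper triangular, and
  its product with the upper triangular transpose of \<open>L\<close> stays so.\<close>

lemma M_diag: assumes "k \<in> KK" shows "M k k = 0"
  unfolding M_eq[OF assms assms]
proof (intro sum.neutral ballI)
  fix m assume m: "m \<in> upto_index k"
  show "L m k * E m k = 0"
  proof (cases "m = k")
    case False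
    then have "k \<notin> upto_index m" "m \<in> KK" using upto_index_antisym[OF m] m upto_index_subset by blast+
    then show ?thesis using L_upper[OF assms] by simp
  qed (simp add: Gt_diag)
qed

lemma basis_expansion:
  assumes k: "k \<in> KK"
  shows "basis_fun Gt k x = (\<Sum>j\<in>upto_index k. ((if j = k then 1 else 0) + M j k) * basis_fun G j x)"
proof -
  have "basis_fun Gt k x = basis_fun G k x + (\<Sum>m\<in>upto_index k. E m k * eta m x)"
    by (simp add: basis_fun_def basis_fun_def left_diff_distrib sum_subtractf)
  also have "(\<Sum>m\<in>upto_index k. E m k * eta m x) = (\<Sum>m\<in>upto_index k. E m k * (\<Sum>j\<in>upto_index k. L m j * basis_fun G j x))"
  proof (intro sum.cong refl arg_cong2[of _ _ _ _ "(*)"])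
    fix m assume m: "m \<in> upto_index k"
    then have "m \<in> KK" using upto_index_subset by blast
    show "eta m x = (\<Sum>j\<in>upto_index k. L m j * basis_fun G j x)"
      unfolding eta_expansion[OF \<open>m \<in> KK\<close>]
    proof (intro sum.mono_neutral_left finite_upto_index upto_index_trans[OF m] ballI)
      fix i assume "i \<in> upto_index k - upto_index m"
      then show "L m i * basis_fun G i x = 0" using L_upper[of i m] upto_KK[of i k] \<open>m \<in> KK\<close> by auto
    qed
  qed
  also have "\<dots> = (\<Sum>j\<in>upto_index k. (\<Sum>m\<in>upto_index k. L m j * E m k) * basis_fun G j x)"
    unfolding sum_distrib_left sum_distrib_right by (subst sum.swap) (simp add: mult_ac)
  also have "\<dots> = (\<Sum>j\<in>upto_index k. M j k * basis_fun G j x)"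
  proof (rule sum.cong[OF refl])
    fix j assume "j \<in> upto_index k"
    then show "(\<Sum>m\<in>upto_index k. L m j * E m k) * basis_fun G j x = M j k * basis_fun G j x"
      using M_eq[OF k upto_KK[of j k]] by simp
  qed
  also have "basis_fun G k x = (\<Sum>j\<in>upto_index k. (if j = k then 1 else 0) * basis_fun G j x)"
    using self_upto_index[OF k] by (simp add: sum.delta finite_upto_index if_distrib[of "\<lambda>c. c * _"] cong: if_cong)
  finally show ?thesis by (simp add: distrib_right sum.distrib)
qed

text \<open>Parseval in the Gram-Schmidt basis. As \<open>M\<close> has zero diagonal, the
  unperturbed function and the perturbation are orthogonal and no cross term appears; this is where
  the form 1 + ... of the weights comes from.\<close>

lemma basis_norm:
  assumes k: "k \<in> KK"
  shows "(H10_norm (basis_fun Gt k))\<^sup>2 = 1 + (\<Sum>j\<in>upto_index k. (M j k)\<^sup>2)"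
proof -
  let ?c = "\<lambda>j. (if j = k then 1 else 0) + M j k"
  have eq: "basis_fun Gt k = (\<lambda>x. \<Sum>j\<in>upto_index k. ?c j * basis_fun G j x)" using basis_expansion[OF k] by auto
  have p: "\<And>j. j \<in> upto_index k \<Longrightarrow> basis_fun G j \<in> H10" using gs_H10 upto_index_subset by blast
  have "H10_inner (basis_fun Gt k) (basis_fun Gt k) = (\<Sum>j\<in>upto_index k. ?c j * H10_inner (basis_fun G j) (basis_fun Gt k))"
    by (subst (1) eq) (rule sym_form_sum[OF sym_form_H10_inner basis_H10[OF k] p])
  also have "\<dots> = (\<Sum>j\<in>upto_index k. ?c j * ?c j)"
  proof (intro sum.cong refl arg_cong2[of _ _ _ _ "(*)"])
    fix j assume j: "j \<in> upto_index k"
    have "H10_inner (basis_fun G j) (basis_fun Gt k) = (\<Sum>i\<in>upto_index k. ?c i * H10_inner (basis_fun G j) (basis_fun G i))"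
      unfolding eq by (rule sym_form_sum_right[OF sym_form_H10_inner p[OF j] p])
    also have "\<dots> = (\<Sum>i\<in>upto_index k. ?c i * (if j = i then 1 else 0))"
    proof (intro sum.cong refl arg_cong2[of _ _ _ _ "(*)"])
      fix i assume i: "i \<in> upto_index k"
      show "H10_inner (basis_fun G j) (basis_fun G i) = (if j = i then 1 else 0)"
        by (rule gs_orthonormal_family) (use i j in \<open>auto simp: upto_index_def same_family_def\<close>)
    qed
    also have "\<dots> = ?c j" using j by (simp add: sum.delta' finite_upto_index if_distrib[of "\<lambda>z. _ * z"] cong: if_cong)
    finally show "H10_inner (basis_fun G j) (basis_fun Gt k) = ?c j" .
  qed
  also have "\<dots> = (\<Sum>j\<in>upto_index k. (if j = k then 1 else 0) + (M j k)\<^sup>2)"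
    using M_diag[OF k] by (intro sum.cong[OF refl]) (auto simp: power2_eq_square)
  also have "\<dots> = 1 + (\<Sum>j\<in>upto_index k. (M j k)\<^sup>2)"
    using self_upto_index[OF k] by (simp add: sum.distrib sum.delta finite_upto_index)
  finally show ?thesis by (simp add: H10_norm_sq)
qed

end

lemma op_norm_column:
  assumes "op_bounded KK M" "k \<in> KK" "finite F" "F \<subseteq> KK"
  shows "(\<Sum>j\<in>F. (M j k)\<^sup>2) \<le> (op_norm KK M)\<^sup>2"
proof -
  define e where "e j = (if j = k then 1 else 0 :: real)" for j
  have e: "e \<in> ell2 KK" "ell2_norm KK e = 1"
    using ell2_finite_support[of "{k}" e] assms(2) by (simp_all add: e_def)
  have mv: "mat_vec KK M e = (\<lambda>i. M i k)"
    using infsum_KK_eq[of "{k}" "\<lambda>j. M i j * e j" for i] assms(2) by (auto simp: mat_vec_def e_def)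
  note b = op_norm_bound[OF assms(1) e(1), unfolded mv e(2)]
  have "(\<Sum>j\<in>F. (M j k)\<^sup>2) \<le> (ell2_norm KK (\<lambda>i. M i k))\<^sup>2" by (rule ell2_finite_sum[OF b(1) assms(3,4)])
  also have "\<dots> \<le> (op_norm KK M)\<^sup>2"
    using b(2) by (intro power_mono) (simp_all add: ell2_norm_def infsum_nonneg)
  finally show ?thesis .
qed

section \<open>Complex extension and parity of the one-dimensional basis polynomials\<close>

fun legC :: "nat \<Rightarrow> complex \<Rightarrow> complex" where
  "legC 0 z = 1"
| "legC (Suc 0) z = z"
| "legC (Suc (Suc n)) z =
     of_real (1 / (real n + 2)) * (of_real (2 * real n + 3) * (z * legC (Suc n) z) - of_real (real n + 1) * legC n z)"

lemma legC_of_real: "legC k (of_real x) = of_real (legendre k x)"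
  by (induction k rule: legC.induct[where ?P = "\<lambda>k z. legC k (of_real x) = of_real (legendre k x)"]) (auto simp: field_simps)

text \<open>Explicit real coefficients in one variable, because primitives are formed coefficient by
  coefficient.\<close>

definition poly1 :: "nat \<Rightarrow> (complex \<Rightarrow> complex) \<Rightarrow> bool" where
  "poly1 n f \<longleftrightarrow> (\<exists>c::nat \<Rightarrow> real. \<forall>z. f z = (\<Sum>i\<le>n. of_real (c i) * z ^ i))"

lemma poly1_weaken:
  assumes "poly1 n f" "n \<le> m"
  shows "poly1 m f"
proof -
  obtain c where c: "\<And>z. f z = (\<Sum>i\<le>n. of_real (c i) * z ^ i)" using assms(1) by (auto simp: poly1_def)
  have "f z = (\<Sum>i\<le>m. of_real (if i \<le> n then c i else 0) * z ^ i)" for z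
    unfolding c using assms(2) by (intro sum.mono_neutral_cong_left) auto
  then show ?thesis unfolding poly1_def by (intro exI[of _ "\<lambda>i. if i \<le> n then c i else 0"] allI)
qed

lemma poly1_lin:
  assumes "poly1 n f" "poly1 n g"
  shows "poly1 n (\<lambda>z. of_real a * f z + of_real b * g z)"
proof -
  obtain c where c: "\<And>z. f z = (\<Sum>i\<le>n. of_real (c i) * z ^ i)" using assms(1) by (auto simp: poly1_def)
  obtain d where d: "\<And>z. g z = (\<Sum>i\<le>n. of_real (d i) * z ^ i)" using assms(2) by (auto simp: poly1_def)
  show ?thesis unfolding poly1_def c d
    by (rule exI[of _ "\<lambda>i. a * c i + b * d i"]) (simp add: sum_distrib_left sum.distrib algebra_simps)
qed

lemma poly1_times:
  assumes "poly1 n f"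
  shows "poly1 (Suc n) (\<lambda>z. z * f z)"
proof -
  obtain c where c: "\<And>z. f z = (\<Sum>i\<le>n. of_real (c i) * z ^ i)" using assms(1) by (auto simp: poly1_def)
  have "z * f z = (\<Sum>i\<le>Suc n. of_real (if i = 0 then 0 else c (i - 1)) * z ^ i)" for z
    by (subst sum.atMost_Suc_shift) (simp add: c sum_distrib_left mult_ac)
  then show ?thesis unfolding poly1_def by (intro exI[of _ "\<lambda>i. if i = 0 then 0 else c (i - 1)"] allI)
qed

lemma poly1_legC: "poly1 k (legC k)"
proof (induction k rule: less_induct)
  case (less k)
  show ?case
  proof -
    consider (1) "k = 0" | (2) "k = Suc 0" | (3) n where "k = Suc (Suc n)"
      by (metis nat.exhaust)
    then show ?thesis
  proof cases
    case 1
    then show ?thesis unfolding poly1_def by (intro exI[of _ "\<lambda>_. 1"]) simp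
  next
    case 2
    then show ?thesis unfolding poly1_def by (intro exI[of _ "\<lambda>i. if i = 1 then 1 else 0"]) simp
  next
    case (3 n)
    define c where "c = 1 / (real n + 2)"
    have "poly1 k (\<lambda>z. of_real (c * (2 * real n + 3)) * (z * legC (Suc n) z) + of_real (- (c * (real n + 1))) * legC n z)"
      by (intro poly1_lin) (use 3 less.IH poly1_times[of "Suc n" "legC (Suc n)"] poly1_weaken[of n "legC n"] in auto)
    moreover have "(\<lambda>z. of_real (c * (2 * real n + 3)) * (z * legC (Suc n) z) + of_real (- (c * (real n + 1))) * legC n z) = legC k"
      unfolding 3 by (rule ext) (simp add: algebra_simps flip: c_def)
    ultimately show ?thesis by simp
  qed
  qed
qed

definition etaC :: "nat \<Rightarrow> complex \<Rightarrow> complex" where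
  "etaC k z = of_real (1 / sqrt (4 * real k - 2)) * legC (k - 2) z + of_real (- 1 / sqrt (4 * real k - 2)) * legC k z"

lemma poly1_etaC: "poly1 k (etaC k)"
  unfolding etaC_def[abs_def] by (intro poly1_lin poly1_legC poly1_weaken[OF poly1_legC]) simp

lemma etaC_of_real: "etaC k (of_real x) = of_real (eta1 k x)"
  by (simp add: etaC_def eta1_def legC_of_real diff_divide_distrib)

lemma poly1_poly_fun: assumes "poly1 n f" shows "poly_fun n (\<lambda>x y. f x)" "poly_fun n (\<lambda>x y. f y)"
proof -
  obtain c where c: "\<And>z. f z = (\<Sum>i\<le>n. of_real (c i) * z ^ i)" using assms(1) by (auto simp: poly1_def)
  show "poly_fun n (\<lambda>x y. f x)" unfolding c
  proof (intro poly_fun_sum poly_fun_scale)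
    fix i assume "i \<in> {..n}"
    then show "poly_fun n (\<lambda>x y. x ^ i)" using poly_fun_weaken[OF poly_fun_power[OF poly_fun_X[of 0], of i], of n] by simp
  qed
  then show "poly_fun n (\<lambda>x y. f y)" using poly_fun_swap by force
qed

lemma poly1_primitive:
  assumes "poly1 n f"
  shows "\<exists>p. poly1 (Suc n) p \<and> (\<forall>z. (p has_field_derivative f z) (at z)) \<and> p (-1) = 0"
proof -
  obtain c where c: "\<And>z. f z = (\<Sum>i\<le>n. of_real (c i) * z ^ i)" using assms(1) by (auto simp: poly1_def)
  define q where "q z = (\<Sum>i\<le>n. of_real (c i / real (Suc i)) * z ^ Suc i)" for z :: complex
  have eq: "q = (\<lambda>z. z * (\<Sum>i\<le>n. of_real (c i / real (Suc i)) * z ^ i))"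
    by (rule ext) (simp add: q_def sum_distrib_left mult_ac)
  have "poly1 n (\<lambda>z. \<Sum>i\<le>n. of_real (c i / real (Suc i)) * z ^ i)"
    unfolding poly1_def by (rule exI[of _ "\<lambda>i. c i / real (Suc i)"]) simp
  then have q: "poly1 (Suc n) q" unfolding eq by (rule poly1_times)
  have qd: "(q has_field_derivative f z) (at z)" for z
    unfolding q_def[abs_def] c
    by (auto intro!: derivative_eq_intros sum.cong simp del: power_Suc of_nat_Suc)
  have Im: "q (-1) = of_real (Re (q (-1)))"
    using poly_fun_restr[OF poly1_poly_fun(1)[OF q], of "-1" 0] by (simp add: restr_def)
  have one: "poly1 (Suc n) (\<lambda>z. 1)" unfolding poly1_def
  proof (intro exI[of _ "\<lambda>i. if i = 0 then 1 else 0"] allI)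
    fix z :: complex
    have "(\<Sum>i\<le>Suc n. of_real (if i = 0 then 1 else 0) * z ^ i) = (\<Sum>i\<le>Suc n. if i = 0 then 1 else 0)"
      by (intro sum.cong) auto
    then show "1 = (\<Sum>i\<le>Suc n. of_real (if i = 0 then 1 else 0) * z ^ i)" by (simp only: sum.delta finite_atMost) simp
  qed
  have "poly1 (Suc n) (\<lambda>z. q z - q (-1))"
    using poly1_lin[OF q one, of 1 "- Re (q (-1))"] Im by simp
  moreover have "((\<lambda>z. q z - q (-1)) has_field_derivative f z) (at z)" for z
    using DERIV_diff[OF qd[of z] DERIV_const] by simp
  ultimately show ?thesis by (intro exI[of _ "\<lambda>z. q z - q (-1)"]) auto
qed

definition primC :: "nat \<Rightarrow> complex \<Rightarrow> complex" where
  "primC k = (SOME p. poly1 (Suc k) p \<and> (\<forall>z. (p has_field_derivative etaC k z) (at z)) \<and> p (-1) = 0)"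

lemma primC: "poly1 (Suc k) (primC k)" "(primC k has_field_derivative etaC k z) (at z)" "primC k (-1) = 0"
  using someI_ex[OF poly1_primitive[OF poly1_etaC[of k]]] by (auto simp: primC_def)

lemma legendre_minus: "legendre k (- x) = (-1) ^ k * legendre k x"
  by (induction k rule: legendre.induct[where ?P = "\<lambda>k x'. legendre k (- x) = (-1) ^ k * legendre k x"]) (auto simp: field_simps)

lemma legendre_one: "legendre k 1 = 1"
  by (induction k rule: legendre.induct[where ?P = "\<lambda>k x'. legendre k 1 = 1"]) (auto simp: field_simps)

lemma eta1_minus: "2 \<le> k \<Longrightarrow> eta1 k (- x) = (-1) ^ k * eta1 k x"
  by (simp add: eta1_def legendre_minus[of _ x] algebra_simps diff_divide_distrib uminus_power_if)

lemma eta1_ends: "2 \<le> k \<Longrightarrow> eta1 k 1 = 0" "2 \<le> k \<Longrightarrow> eta1 k (-1) = 0"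
proof -
  assume k: "2 \<le> k"
  show "eta1 k 1 = 0" by (simp add: eta1_def legendre_one)
  then show "eta1 k (-1) = 0" using eta1_minus[OF k, of 1] by simp
qed

lemma etaC_m1: "2 \<le> k \<Longrightarrow> etaC k (-1) = 0"
  using etaC_of_real[of k "-1"] eta1_ends(2) by simp

definition tensC :: "index \<Rightarrow> complex \<Rightarrow> complex \<Rightarrow> complex" where
  "tensC m x y = etaC (fst m) x * etaC (snd m) y"

lemma poly_fun_tensC: "poly_fun (total_deg m) (tensC m)"
  unfolding tensC_def[abs_def] total_deg_def by (intro poly_fun_mult poly1_poly_fun poly1_etaC)

lemma restr_tensC: "restr (tensC m) = eta_tensor m"
  by (auto simp: fun_eq_iff restr_def tensC_def eta_tensor_def etaC_of_real)

text \<open>Functions of opposite parity in one variable have orthogonal gradients.\<close>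

lemma odd_integral_zero:
  fixes F :: plane_fun
  assumes "continuous_on UNIV F"
  shows "(\<And>x y. F (- x, y) = - F (x, y)) \<Longrightarrow> (LINT z|MO. F z) = 0"
    "(\<And>x y. F (x, - y) = - F (x, y)) \<Longrightarrow> (LINT z|MO. F z) = 0"
proof -
  assume odd: "\<And>x y. F (- x, y) = - F (x, y)"
  have "integral {-1..1} (\<lambda>x. F (x, y)) = 0" for y
    using Henstock_Kurzweil_Integration.integral_reflect_real[of 1 "-1" "\<lambda>x. F (x, y)"] by (simp add: odd)
  then show "(LINT z|MO. F z) = 0"
    unfolding continuous_LINT_eq[OF assms]
    by (subst integral_prod_continuous, blast intro: continuous_on_subset[OF assms],
        subst integral_swap_continuous) (auto intro: continuous_on_subset[OF assms])
next
  assume odd: "\<And>x y. F (x, - y) = - F (x, y)"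
  have "integral {-1..1} (\<lambda>y. F (x, y)) = 0" for x
    using Henstock_Kurzweil_Integration.integral_reflect_real[of 1 "-1" "\<lambda>y. F (x, y)"] by (simp add: odd)
  then show "(LINT z|MO. F z) = 0"
    unfolding continuous_LINT_eq[OF assms]
    by (subst integral_prod_continuous) (auto intro: continuous_on_subset[OF assms])
qed

lemma C1_grad_H10_inner:
  assumes "C1_grad u ux uy" "C1_grad v vx vy"
  shows "H10_inner u v = (LINT z|MO. ux z * vx z + uy z * vy z)"
  unfolding H10_inner_def
proof (rule integral_cong_AE)
  show "(\<lambda>x. wgrad u x \<bullet> wgrad v x) \<in> borel_measurable MO"
    using L2_measurable[OF wgrad_L2[OF C1_grad_H1[OF assms(1)]]] L2_measurable[OF wgrad_L2[OF C1_grad_H1[OF assms(2)]]] by simp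
  show "(\<lambda>z. ux z * vx z + uy z * vy z) \<in> borel_measurable MO"
    by (intro continuous_imp_MO_measurable continuous_intros c1D[OF assms(1)] c1D[OF assms(2)])
  show "AE x in MO. wgrad u x \<bullet> wgrad v x = ux x * vx x + uy x * vy x"
    using C1_grad_wgrad[OF assms(1)] C1_grad_wgrad[OF assms(2)] by eventually_elim simp
qed

lemma C1_grad_unique:
  assumes "C1_grad u ux uy" "C1_grad u vx vy"
  shows "ux = vx" "uy = vy"
proof -
  have eq: "(\<lambda>h. fst h * ux z + snd h * uy z) = (\<lambda>h. fst h * vx z + snd h * vy z)" for z
    by (rule has_derivative_unique[OF c1D(1)[OF assms(1)] c1D(1)[OF assms(2)]])
  show "ux = vx" "uy = vy"
    using fun_cong[OF eq, of "(1, 0)"] fun_cong[OF eq, of "(0, 1)"] by auto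
qed

lemma C1_grad_reflect:
  assumes "C1_grad u ux uy"
  shows "C1_grad (\<lambda>z. u (- fst z, snd z)) (\<lambda>z. - ux (- fst z, snd z)) (\<lambda>z. uy (- fst z, snd z))"
    "C1_grad (\<lambda>z. u (fst z, - snd z)) (\<lambda>z. ux (fst z, - snd z)) (\<lambda>z. - uy (fst z, - snd z))"
proof -
  have a: "((\<lambda>z::real\<times>real. (- fst z, snd z)) has_derivative (\<lambda>h. (- fst h, snd h))) (at z)"
    "((\<lambda>z::real\<times>real. (fst z, - snd z)) has_derivative (\<lambda>h. (fst h, - snd h))) (at z)" for z
    by (auto intro!: derivative_eq_intros)
  have c: "continuous_on UNIV (\<lambda>z. f (- fst z, snd z))" "continuous_on UNIV (\<lambda>z. f (fst z, - snd z))" if "continuous_on UNIV f" for f :: plane_fun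
    by (rule continuous_on_compose2[OF that]; auto intro!: continuous_intros)+
  show "C1_grad (\<lambda>z. u (- fst z, snd z)) (\<lambda>z. - ux (- fst z, snd z)) (\<lambda>z. uy (- fst z, snd z))"
    unfolding C1_grad_def
    by (intro conjI allI has_derivative_eq_rhs[OF has_derivative_compose[OF a(1) c1D(1)[OF assms]]] continuous_on_minus c c1D[OF assms]) auto
  show "C1_grad (\<lambda>z. u (fst z, - snd z)) (\<lambda>z. ux (fst z, - snd z)) (\<lambda>z. - uy (fst z, - snd z))"
    unfolding C1_grad_def
    by (intro conjI allI has_derivative_eq_rhs[OF has_derivative_compose[OF a(2) c1D(1)[OF assms]]] continuous_on_minus c c1D[OF assms]) auto
qed

lemma C1_grad_cmult: "C1_grad u ux uy \<Longrightarrow> C1_grad (\<lambda>z. a * u z) (\<lambda>z. a * ux z) (\<lambda>z. a * uy z)"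
  using C1_grad_mult[OF C1_grad_basic(1)[of a], of u ux uy] by simp

text \<open>Reflecting a tensor function multiplies it by a sign; comparing the gradient of the
  reflected function with the gradient of the multiple gives the parities of the derivatives by
  uniqueness.\<close>

lemma tensor_parity:
  assumes "m \<in> KK"
  defines "ux \<equiv> restr (Dx (tensC m))" and "uy \<equiv> restr (Dy (tensC m))"
  shows "ux (- x, y) = - ((-1) ^ fst m * ux (x, y))" "uy (- x, y) = (-1) ^ fst m * uy (x, y)"
    "ux (x, - y) = (-1) ^ snd m * ux (x, y)" "uy (x, - y) = - ((-1) ^ snd m * uy (x, y))"
proof -
  have u: "C1_grad (eta_tensor m) ux uy"
    using poly_fun_derivs(4)[OF poly_fun_tensC[of m]] by (simp add: restr_tensC ux_def uy_def)
  have m2: "2 \<le> fst m" "2 \<le> snd m" using assms by (auto simp: KK_def)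
  have e: "(\<lambda>z. eta_tensor m (- fst z, snd z)) = (\<lambda>z. (-1) ^ fst m * eta_tensor m z)"
    "(\<lambda>z. eta_tensor m (fst z, - snd z)) = (\<lambda>z. (-1) ^ snd m * eta_tensor m z)"
    by (auto simp: eta_tensor_def eta1_minus m2)
  note 1 = C1_grad_unique[OF C1_grad_reflect(1)[OF u, unfolded e] C1_grad_cmult[OF u]]
  note 2 = C1_grad_unique[OF C1_grad_reflect(2)[OF u, unfolded e] C1_grad_cmult[OF u]]
  show "ux (- x, y) = - ((-1) ^ fst m * ux (x, y))" "uy (- x, y) = (-1) ^ fst m * uy (x, y)"
    "ux (x, - y) = (-1) ^ snd m * ux (x, y)" "uy (x, - y) = - ((-1) ^ snd m * uy (x, y))"
    using fun_cong[OF 1(1), of "(x, y)"] fun_cong[OF 1(2), of "(x, y)"] fun_cong[OF 2(1), of "(x, y)"] fun_cong[OF 2(2), of "(x, y)"]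
    by (simp_all add: minus_equation_iff)
qed

lemma C1_grad_eta_tensor: "C1_grad (eta_tensor m) (restr (Dx (tensC m))) (restr (Dy (tensC m)))"
  using poly_fun_derivs(4)[OF poly_fun_tensC[of m]] by (simp add: restr_tensC)

lemma eta_tensor_orthogonal:
  assumes m: "m \<in> KK" "l \<in> KK" "\<not> same_family m l"
  shows "H10_inner (eta_tensor m) (eta_tensor l) = 0"
proof -
  let ?F = "\<lambda>z. restr (Dx (tensC m)) z * restr (Dx (tensC l)) z + restr (Dy (tensC m)) z * restr (Dy (tensC l)) z"
  note p = tensor_parity[OF m(1)] tensor_parity[OF m(2)]
  have c: "continuous_on UNIV ?F"
    by (intro continuous_intros c1D[OF C1_grad_eta_tensor])
  have "(LINT z|MO. ?F z) = 0"
  proof (cases "even (fst m) = even (fst l)")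
    case False
    then have "(-1) ^ fst m * (-1) ^ fst l = (-1::real)" by (auto simp: uminus_power_if)
    then have "?F (- x, y) = - ?F (x, y)" for x y
      unfolding p by (auto simp: uminus_power_if split: if_splits)
    then show ?thesis by (rule odd_integral_zero(1)[OF c])
  next
    case True
    then have "even (snd m) \<noteq> even (snd l)" using m(3) by (auto simp: same_family_def)
    then have "(-1) ^ snd m * (-1) ^ snd l = (-1::real)" by (auto simp: uminus_power_if)
    then have "?F (x, - y) = - ?F (x, y)" for x y
      unfolding p by (auto simp: uminus_power_if split: if_splits)
    then show ?thesis by (rule odd_integral_zero(2)[OF c])
  qed
  then show ?thesis using C1_grad_H10_inner[OF C1_grad_eta_tensor C1_grad_eta_tensor] by simp
qed

lemma C1_grad_eta: "C1_grad (eta m) (\<lambda>z. 1 / H10_norm (eta_tensor m) * restr (Dx (tensC m)) z) (\<lambda>z. 1 / H10_norm (eta_tensor m) * restr (Dy (tensC m)) z)"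
proof -
  have "eta m = (\<lambda>z. 1 / H10_norm (eta_tensor m) * eta_tensor m z)" by (auto simp: eta_def)
  then show ?thesis by (subst (1) \<open>eta m = _\<close>) (rule C1_grad_cmult[OF C1_grad_eta_tensor])
qed

lemma eta_orthogonal:
  assumes m: "m \<in> KK" "l \<in> KK" "\<not> same_family m l"
  shows "H10_inner (eta m) (eta l) = 0"
proof -
  let ?a = "1 / H10_norm (eta_tensor m)" and ?b = "1 / H10_norm (eta_tensor l)"
  have "H10_inner (eta m) (eta l) = (LINT z|MO. (?a * ?b) * (restr (Dx (tensC m)) z * restr (Dx (tensC l)) z + restr (Dy (tensC m)) z * restr (Dy (tensC l)) z))"
    unfolding C1_grad_H10_inner[OF C1_grad_eta C1_grad_eta] by (rule Bochner_Integration.integral_cong) (auto simp: algebra_simps)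
  also have "\<dots> = (?a * ?b) * H10_inner (eta_tensor m) (eta_tensor l)"
    unfolding C1_grad_H10_inner[OF C1_grad_eta_tensor C1_grad_eta_tensor] by (rule integral_mult_right_zero)
  finally show ?thesis using eta_tensor_orthogonal[OF m] by simp
qed

section \<open>Growth of the orthonormal basis on complex ellipses\<close>

context gs_basis
begin

lemma gs_orthonormal:
  assumes "i \<in> KK" "j \<in> KK"
  shows "H10_inner (basis_fun G i) (basis_fun G j) = (if i = j then 1 else 0)"
proof (cases "same_family i j")
  case True
  then show ?thesis by (rule gs_orthonormal_family[OF assms])
next
  case False
  have "H10_inner (basis_fun G i) (basis_fun G j) = 0"
    unfolding basis_fun_inner[OF assms]
  proof (intro sum.neutral ballI)
    fix l m assume lm: "l \<in> upto_index j" "m \<in> upto_index i"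
    then have "\<not> same_family m l" using False by (auto simp: upto_index_def same_family_def)
    then show "G m i * G l j * H10_inner (eta m) (eta l) = 0"
      using eta_orthogonal[OF upto_KK[OF lm(2)] upto_KK[OF lm(1)]] by simp
  qed
  then show ?thesis using False by (auto simp: same_family_def)
qed

definition FC :: "index \<Rightarrow> complex \<Rightarrow> complex \<Rightarrow> complex" where
  "FC l x y = (\<Sum>m\<in>upto_index l. of_real (G m l / H10_norm (eta_tensor m)) * (etaC (fst m) x * etaC (snd m) y))"

text \<open>The primitive in y, zero for y = -1, of the Gram-Schmidt function. In two dimensions the
  energy norm does not control values of the function itself, but it does control those of this
  primitive.\<close>

definition QC :: "index \<Rightarrow> complex \<Rightarrow> complex \<Rightarrow> complex" where
  "QC l x y = (\<Sum>m\<in>upto_index l. of_real (G m l / H10_norm (eta_tensor m)) * (etaC (fst m) x * primC (snd m) y))"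

lemma poly_fun_FC: "poly_fun (total_deg l) (FC l)"
  unfolding FC_def[abs_def]
proof (intro poly_fun_sum poly_fun_scale)
  fix m assume "m \<in> upto_index l"
  then have "fst m + snd m \<le> total_deg l" by (auto simp: upto_index_def total_deg_def)
  then show "poly_fun (total_deg l) (\<lambda>x y. etaC (fst m) x * etaC (snd m) y)"
    using poly_fun_mult[OF poly1_poly_fun(1)[OF poly1_etaC] poly1_poly_fun(2)[OF poly1_etaC]] poly_fun_weaken by blast
qed

lemma poly_fun_QC: "poly_fun (Suc (total_deg l)) (QC l)"
  unfolding QC_def[abs_def]
proof (intro poly_fun_sum poly_fun_scale)
  fix m assume "m \<in> upto_index l"
  then have "fst m + Suc (snd m) \<le> Suc (total_deg l)" by (auto simp: upto_index_def total_deg_def)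
  then show "poly_fun (Suc (total_deg l)) (\<lambda>x y. etaC (fst m) x * primC (snd m) y)"
    using poly_fun_mult[OF poly1_poly_fun(1)[OF poly1_etaC] poly1_poly_fun(2)[OF primC(1)]] poly_fun_weaken by blast
qed

lemma restr_FC: "restr (FC l) = basis_fun G l"
  by (auto simp: restr_def FC_def basis_fun_def eta_def eta_tensor_def etaC_of_real fun_eq_iff simp flip: of_real_mult)

lemma C1_grad_gs: "C1_grad (basis_fun G l) (restr (Dx (FC l))) (restr (Dy (FC l)))"
  using poly_fun_derivs(4)[OF poly_fun_FC[of l]] by (simp add: restr_FC)

lemma FC_edges: "FC l (-1) y = 0" "FC l x (-1) = 0"
proof -
  have "etaC (fst m) (-1) = 0" "etaC (snd m) (-1) = 0" if "m \<in> upto_index l" for m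
    using upto_KK[OF that] by (auto simp: KK_def intro: etaC_m1)
  then show "FC l (-1) y = 0" "FC l x (-1) = 0" by (simp_all add: FC_def)
qed

lemma QC_edge: "QC l x (-1) = 0"
  by (simp add: QC_def primC)

lemma Dy_QC: "Dy (QC l) = FC l"
proof -
  have "((\<lambda>y. QC l x y) has_field_derivative FC l x y) (at y)" for x y
    unfolding QC_def FC_def
    by (intro DERIV_sum DERIV_cmult primC(2))
  then show ?thesis by (auto simp: Dy_def fun_eq_iff DERIV_imp_deriv)
qed

lemma gs_edge: "basis_fun G l (-1, y) = 0"
  using poly_fun_restr[OF poly_fun_FC, of l "-1" y] FC_edges(1)[of l] by (simp add: restr_FC)

text \<open>Integrating from the edge x = -1, where p vanishes, and then in y from -1 bounds the
  primitive by the double integral of the absolute value of the x-derivative of p, uniformly in the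
  index.\<close>

lemma QC_square_bound:
  assumes l: "l \<in> KK" and ab: "\<bar>a\<bar> \<le> 1" "\<bar>b\<bar> \<le> 1"
  shows "norm (QC l (of_real a) (of_real b)) \<le> 5 / 2"
proof -
  define p where "p = basis_fun G l"
  define px where "px = restr (Dx (FC l))"
  define q where "q = restr (QC l)"
  have cp: "C1_grad p px (restr (Dy (FC l)))" by (simp add: p_def px_def C1_grad_gs)
  have cq: "C1_grad q (restr (Dx (QC l))) p"
    using poly_fun_derivs(4)[OF poly_fun_QC[of l]] by (simp add: q_def p_def Dy_QC restr_FC)
  note cont = c1D(2,3)[OF cp] C1_grad_continuous[OF cp] C1_grad_continuous[OF cq]
  have q1: "q (x, -1) = 0" for x
    using poly_fun_restr[OF poly_fun_QC, of l x "-1"] QC_edge[of l] by (simp add: q_def)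
  have sec: "continuous_on A (\<lambda>t. f (t, y))" "continuous_on A (\<lambda>t. f (y, t))" if "continuous_on UNIV f" for f :: plane_fun and A y
    by (rule continuous_on_compose2[OF that]; auto intro!: continuous_intros)+
  have pa: "\<bar>p (a, u)\<bar> \<le> integral {-1..1} (\<lambda>t. \<bar>px (t, u)\<bar>)" for u
  proof -
    have "((\<lambda>t. px (t, u)) has_integral p (a, u) - p (-1, u)) {-1..a}"
      using ab by (intro fundamental_theorem_of_calculus)
        (auto simp flip: has_real_derivative_iff_has_vector_derivative intro!: has_field_derivative_at_within C1_grad_section_derivative(2)[OF cp])
    then have "p (a, u) = integral {-1..a} (\<lambda>t. px (t, u))" by (simp add: integral_unique p_def gs_edge)
    also have "\<bar>\<dots>\<bar> \<le> integral {-1..a} (\<lambda>t. \<bar>px (t, u)\<bar>)"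
      using integral_norm_bound_integral[of "\<lambda>t. px (t, u)" "{-1..a}" "\<lambda>t. \<bar>px (t, u)\<bar>"]
        integrable_continuous_real[OF sec(1)[OF cont(1)]] integrable_continuous_real[OF continuous_on_rabs[OF sec(1)[OF cont(1)]]]
      by simp
    also have "\<dots> \<le> integral {-1..1} (\<lambda>t. \<bar>px (t, u)\<bar>)"
      using ab by (intro integral_subset_le integrable_continuous_real[OF continuous_on_rabs[OF sec(1)[OF cont(1)]]]) auto
    finally show ?thesis .
  qed
  have "((\<lambda>u. p (a, u)) has_integral q (a, b) - q (a, -1)) {-1..b}"
    using ab by (intro fundamental_theorem_of_calculus)
      (auto simp flip: has_real_derivative_iff_has_vector_derivative intro!: has_field_derivative_at_within C1_grad_section_derivative(1)[OF cq])
  then have "q (a, b) = integral {-1..b} (\<lambda>u. p (a, u))" by (simp add: integral_unique q1)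
  also have "\<bar>\<dots>\<bar> \<le> integral {-1..b} (\<lambda>t. \<bar>p (a, t)\<bar>)"
    using integral_norm_bound_integral[of "\<lambda>t. p (a, t)" "{-1..b}" "\<lambda>t. \<bar>p (a, t)\<bar>"]
      integrable_continuous_real[OF sec(2)[OF cont(3)]] integrable_continuous_real[OF continuous_on_rabs[OF sec(2)[OF cont(3)]]]
    by simp
  also have "\<dots> \<le> integral {-1..1} (\<lambda>t. \<bar>p (a, t)\<bar>)"
    using ab by (intro integral_subset_le integrable_continuous_real[OF continuous_on_rabs[OF sec(2)[OF cont(3)]]]) auto
  also have "\<dots> \<le> integral {-1..1} (\<lambda>u. integral {-1..1} (\<lambda>t. \<bar>px (t, u)\<bar>))"
  proof (rule integral_le[OF integrable_continuous_real[OF continuous_on_rabs[OF sec(2)[OF cont(3)]]] _ pa])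
    have "continuous_on ({-1..1} \<times> cbox (-1) 1) (\<lambda>(u, t). \<bar>px (t, u)\<bar>)"
      unfolding case_prod_unfold
      by (intro continuous_on_rabs continuous_on_compose2[OF cont(1)]) (auto intro!: continuous_intros)
    from integral_continuous_on_param[OF this]
    show "(\<lambda>u. integral {-1..1} (\<lambda>t. \<bar>px (t, u)\<bar>)) integrable_on {-1..1}"
      by (intro integrable_continuous_real) simp
  qed
  also have "\<dots> = (LINT z|MO. \<bar>px z\<bar>)"
  proof -
    have c: "continuous_on UNIV (\<lambda>z. \<bar>px z\<bar>)" by (intro continuous_on_rabs cont)
    show ?thesis
      unfolding continuous_LINT_eq[OF c]
      by (subst integral_prod_continuous, rule continuous_on_subset[OF c], simp,
          subst integral_swap_continuous) (auto intro: continuous_on_subset[OF c])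
  qed
  \<comment> \<open>With |t| \<le> 1/2 + t^2/2, the square of area 4 contributes 2 and the unit
    energy of p contributes 1/2.\<close>
  also have "\<dots> \<le> (LINT z|MO. 1/2 + (px z * px z + restr (Dy (FC l)) z * restr (Dy (FC l)) z) / 2)"
  proof (rule integral_mono)
    show "integrable MO (\<lambda>z. \<bar>px z\<bar>)" "integrable MO (\<lambda>z. 1/2 + (px z * px z + restr (Dy (FC l)) z * restr (Dy (FC l)) z) / 2)"
      by (intro bdd_meas_integrable bdd_meas_continuous continuous_intros cont; simp)+
    fix z
    have "0 \<le> (\<bar>px z\<bar> - 1)\<^sup>2" by simp
    then have "\<bar>px z\<bar> \<le> 1/2 + px z * px z / 2" unfolding power2_diff power2_abs by (simp add: power2_eq_square)
    then show "\<bar>px z\<bar> \<le> 1/2 + (px z * px z + restr (Dy (FC l)) z * restr (Dy (FC l)) z) / 2"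
      using zero_le_square[of "restr (Dy (FC l)) z"] unfolding add_divide_distrib by linarith
  qed
  also have "\<dots> = (LINT z|MO. 1/2) + (LINT z|MO. px z * px z + restr (Dy (FC l)) z * restr (Dy (FC l)) z) / 2"
    by (subst Bochner_Integration.integral_add) (auto intro!: bdd_meas_integrable bdd_meas_continuous continuous_intros cont)
  also have "(LINT z|MO. px z * px z + restr (Dy (FC l)) z * restr (Dy (FC l)) z) = 1"
    using C1_grad_H10_inner[OF cp cp] gs_orthonormal[OF l l] by (simp add: p_def)
  also have "(LINT z|MO. 1/2) = (2::real)"
    by (subst continuous_LINT_eq) (auto simp: content_Pair)
  finally have "\<bar>q (a, b)\<bar> \<le> 5/2" by simp
  then show ?thesis using poly_fun_restr[OF poly_fun_QC, of l a b] by (simp add: q_def)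
qed

text \<open>Walsh's inequality is applied to the bounded primitive on the larger ellipse, and its
  y-derivative is estimated by Cauchy on the smaller one. The extra degree of the primitive only
  changes the constant.\<close>

lemma FC_growth:
  assumes "1 \<le> R'" "R' < R"
  obtains C where "0 \<le> C" "\<And>l x y. l \<in> KK \<Longrightarrow> x \<in> ellipse R' \<Longrightarrow> y \<in> ellipse R' \<Longrightarrow> norm (FC l x y) \<le> C * (R\<^sup>2) ^ total_deg l"
proof -
  let ?d = "(R + 1 / R - (R' + 1 / R')) / 2"
  have d: "0 < ?d" using joukowski_strict_mono[OF assms] by simp
  have "norm (FC l x y) \<le> (5 / 2 * R\<^sup>2 / ?d) * (R\<^sup>2) ^ total_deg l" if "l \<in> KK" "x \<in> ellipse R'" "y \<in> ellipse R'" for l x y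
  proof -
    have sub: "ellipse R' \<subseteq> ellipse R" using assms by (intro ellipse_mono) auto
    have Q: "norm (QC l x' y') \<le> 5 / 2 * R ^ (2 * Suc (total_deg l))" if "x' \<in> ellipse R" "y' \<in> ellipse R" for x' y'
      using assms by (intro poly_fun_Walsh[OF poly_fun_QC QC_square_bound[OF \<open>l \<in> KK\<close>] that]) auto
    have "norm (deriv (\<lambda>y. QC l x y) y) \<le> (5 / 2 * R ^ (2 * Suc (total_deg l))) / ?d"
      by (rule deriv_bound_ellipse[OF poly_fun_holomorphic(2)[OF poly_fun_QC] Q]) (use that sub assms in auto)
    then have "norm (Dy (QC l) x y) \<le> (5 / 2 * R ^ (2 * Suc (total_deg l))) / ?d" by (simp add: Dy_def)
    also have "R ^ (2 * Suc (total_deg l)) = R\<^sup>2 * (R\<^sup>2) ^ total_deg l" by (simp only: power_mult power_Suc)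
    also have "(5 / 2 * (R\<^sup>2 * (R\<^sup>2) ^ total_deg l)) / ?d = (5 / 2 * R\<^sup>2 / ?d) * (R\<^sup>2) ^ total_deg l"
      by (simp only: times_divide_eq_left mult.assoc)
    finally show ?thesis by (simp only: Dy_QC)
  qed
  moreover have "0 \<le> 5 / 2 * R\<^sup>2 / ?d" using d by simp
  ultimately show ?thesis using that by blast
qed

end

section \<open>Rigidity of the coefficients\<close>

lemma span_ofI: "finite F \<Longrightarrow> F \<subseteq> \<Lambda> \<Longrightarrow> (\<lambda>x. \<Sum>k\<in>F. c k * \<phi> k x) \<in> span_of \<phi> \<Lambda>"
  unfolding span_of_def by blast

lemma span_ofE:
  assumes "f \<in> span_of \<phi> \<Lambda>"
  obtains F c where "finite F" "F \<subseteq> \<Lambda>" "f = (\<lambda>x. \<Sum>k\<in>F. c k * \<phi> k x)"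
  using assms unfolding span_of_def by blast

lemma span_of_scale: assumes "f \<in> span_of \<phi> \<Lambda>" shows "(\<lambda>x. a * f x) \<in> span_of \<phi> \<Lambda>"
proof -
  obtain F c where F: "finite F" "F \<subseteq> \<Lambda>" "f = (\<lambda>x. \<Sum>k\<in>F. c k * \<phi> k x)"
    by (rule span_ofE[OF assms])
  show ?thesis using span_ofI[OF F(1,2), of "\<lambda>k. a * c k" \<phi>] F(3) by (simp add: sum_distrib_left mult.assoc)
qed

lemma span_of_add:
  assumes "f \<in> span_of \<phi> \<Lambda>" "g \<in> span_of \<phi> \<Lambda>"
  shows "(\<lambda>x. f x + g x) \<in> span_of \<phi> \<Lambda>"
proof -
  obtain F c where F: "finite F" "F \<subseteq> \<Lambda>" "f = (\<lambda>x. \<Sum>k\<in>F. c k * \<phi> k x)"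
    by (rule span_ofE[OF assms(1)])
  obtain H d where H: "finite H" "H \<subseteq> \<Lambda>" "g = (\<lambda>x. \<Sum>k\<in>H. d k * \<phi> k x)"
    by (rule span_ofE[OF assms(2)])
  have "f x = (\<Sum>k\<in>F \<union> H. (if k \<in> F then c k else 0) * \<phi> k x)" for x
    unfolding F(3) using F H by (intro sum.mono_neutral_cong_left) auto
  moreover have "g x = (\<Sum>k\<in>F \<union> H. (if k \<in> H then d k else 0) * \<phi> k x)" for x
    unfolding H(3) using F H by (intro sum.mono_neutral_cong_left) auto
  ultimately have "(\<lambda>x. f x + g x) = (\<lambda>x. \<Sum>k\<in>F \<union> H. ((if k \<in> F then c k else 0) + (if k \<in> H then d k else 0)) * \<phi> k x)"
    by (auto simp: fun_eq_iff distrib_right sum.distrib)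
  then show ?thesis using span_ofI[of "F \<union> H" \<Lambda>] F H by simp
qed

lemma span_of_diff:
  assumes "f \<in> span_of \<phi> \<Lambda>" "g \<in> span_of \<phi> \<Lambda>"
  shows "(\<lambda>x. f x - g x) \<in> span_of \<phi> \<Lambda>"
  using span_of_add[OF assms(1) span_of_scale[OF assms(2), of "-1"]] by simp

lemma span_of_zero: "(\<lambda>x. 0) \<in> span_of \<phi> \<Lambda>"
  using span_ofI[of "{}" \<Lambda>] by simp

lemma span_of_base: "k \<in> \<Lambda> \<Longrightarrow> \<phi> k \<in> span_of \<phi> \<Lambda>"
  using span_ofI[of "{k}" \<Lambda> "\<lambda>_. 1" \<phi>] by simp

lemma span_of_sum:
  assumes "\<And>i. i \<in> I \<Longrightarrow> f i \<in> span_of \<phi> \<Lambda>"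
  shows "(\<lambda>x. \<Sum>i\<in>I. c i * f i x) \<in> span_of \<phi> \<Lambda>"
  using assms
proof (induction I rule: infinite_finite_induct)
  case (insert i I)
  then show ?case using span_of_add[OF span_of_scale[of "f i" \<phi> \<Lambda> "c i"], of "\<lambda>x. \<Sum>i\<in>I. c i * f i x"] by simp
qed (auto simp: span_of_zero)

lemma span_of_mono: "\<Lambda> \<subseteq> \<Lambda>' \<Longrightarrow> span_of \<phi> \<Lambda> \<subseteq> span_of \<phi> \<Lambda>'"
  unfolding span_of_def by blast

section \<open>Multiplication by the coordinates inside the span of the tensor basis\<close>

lemma legendre_rec: "x * legendre (Suc n) x = ((real n + 2) * legendre (Suc (Suc n)) x + (real n + 1) * legendre n x) / (2 * real n + 3)"
proof -
  have "(2 * real n + 3) * x * legendre (Suc n) x = (real n + 2) * legendre (Suc (Suc n)) x + (real n + 1) * legendre n x"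
    by simp
  then show ?thesis by (simp add: eq_divide_eq mult_ac)
qed

text \<open>Bonnet's recursion, applied to both Legendre polynomials in \<open>eta1 k\<close>,
  regroups into neighbouring differences. At k = 2 the lower neighbour would leave the index range,
  and there it is absent: x (L0 - L2) = (3/5) (L1 - L3).\<close>

lemma eta1_times:
  assumes "2 \<le> k"
  shows "\<exists>A B. (\<forall>x. x * eta1 k x = A * eta1 (Suc k) x + B * eta1 (k - 1) x) \<and> (k = 2 \<longrightarrow> B = 0)"
proof -
  define s where "s k = sqrt (4 * real k - 2)" for k
  have s: "s j \<noteq> 0" if "1 \<le> j" for j using that by (simp add: s_def)
  have e: "eta1 j x = (legendre (j - 2) x - legendre j x) / s j" for j x by (simp add: eta1_def s_def)
  show ?thesis
  proof (cases "k = 2")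
    case True
    have s3: "s 2 \<noteq> 0" "s (Suc 2) \<noteq> 0" using s[of 2] s[of 3] by auto
    have *: "x * (legendre 0 x - legendre 2 x) = (3/5) * (legendre 1 x - legendre 3 x)" for x
      by (simp add: numeral_2_eq_2 numeral_3_eq_3 field_simps)
    have e1: "eta1 k x = (legendre 0 x - legendre 2 x) / s 2" "eta1 (Suc k) x = (legendre 1 x - legendre 3 x) / s (Suc 2)" for x
      unfolding e True by (simp_all add: numeral_3_eq_3 del: legendre.simps)
    have "x * eta1 k x = (3/5) * (s (Suc 2) / s 2) * eta1 (Suc k) x + 0 * eta1 (k - 1) x" for x
    proof -
      have "x * eta1 k x = (x * (legendre 0 x - legendre 2 x)) / s 2" unfolding e1 by simp
      also have "\<dots> = ((3/5) * (legendre 1 x - legendre 3 x)) / s 2" unfolding * ..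
      also have "\<dots> = (3/5) * (s (Suc 2) / s 2) * eta1 (Suc k) x + 0 * eta1 (k - 1) x"
        unfolding e1 using s3(2) by simp
      finally show ?thesis .
    qed
    then show ?thesis by blast
  next
    case False
    then obtain n where k: "k = Suc (Suc (Suc n))" using assms
      by (metis One_nat_def Suc_1 Suc_le_D le_antisym not_less_eq_eq nat.inject old.nat.exhaust le0 numeral_2_eq_2)
    define j where "j = Suc n"
    have kj: "k = Suc (Suc j)" by (simp add: k j_def)
    let ?A = "(real j + 3) / (2 * real j + 5)" and ?B = "real j / (2 * real j + 1)"
    have "x * (legendre j x - legendre (Suc (Suc j)) x) = ?A * (legendre (Suc j) x - legendre (Suc (Suc (Suc j))) x) + ?B * (legendre n x - legendre (Suc j) x)" for x
    proof -
      have 1: "x * legendre j x = ((real j + 1) * legendre (Suc j) x + real j * legendre n x) / (2 * real j + 1)"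
        using legendre_rec[of x n] by (simp only: j_def of_nat_Suc) (simp add: algebra_simps)
      have 2: "x * legendre (Suc (Suc j)) x = ((real j + 3) * legendre (Suc (Suc (Suc j))) x + (real j + 2) * legendre (Suc j) x) / (2 * real j + 5)"
        using legendre_rec[of x "Suc j"] by (simp only: of_nat_Suc) (simp add: algebra_simps)
      define p q r where "p = legendre n x" and "q = legendre (Suc j) x" and "r = legendre (Suc (Suc (Suc j))) x"
      have "2 * real j + 1 \<noteq> 0" "2 * real j + 5 \<noteq> 0" by (auto simp: add_nonneg_eq_0_iff)
      then show ?thesis
        unfolding right_diff_distrib[of x] 1 2 p_def[symmetric] q_def[symmetric] r_def[symmetric]
        by (simp add: divide_simps) (simp add: algebra_simps)
    qed
    then have "x * eta1 k x = (?A * (s (Suc k) / s k)) * eta1 (Suc k) x + (?B * (s (k - 1) / s k)) * eta1 (k - 1) x" for x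
    proof -
      assume *: "\<And>x. x * (legendre j x - legendre (Suc (Suc j)) x) = ?A * (legendre (Suc j) x - legendre (Suc (Suc (Suc j))) x) + ?B * (legendre n x - legendre (Suc j) x)"
      have nz: "s k \<noteq> 0" "s (Suc k) \<noteq> 0" "s (k - 1) \<noteq> 0" using kj by (auto intro!: s)
      have e1: "eta1 k x = (legendre j x - legendre (Suc (Suc j)) x) / s k" 
        "eta1 (Suc k) x = (legendre (Suc j) x - legendre (Suc (Suc (Suc j))) x) / s (Suc k)"
        "eta1 (k - 1) x = (legendre n x - legendre (Suc j) x) / s (k - 1)"
        unfolding e by (simp_all add: kj j_def del: legendre.simps)
      have "x * eta1 k x = (x * (legendre j x - legendre (Suc (Suc j)) x)) / s k" unfolding e1 by simp
      also have "\<dots> = (?A * (legendre (Suc j) x - legendre (Suc (Suc (Suc j))) x) + ?B * (legendre n x - legendre (Suc j) x)) / s k"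
        unfolding * ..
      also have "\<dots> = (?A * (s (Suc k) / s k)) * eta1 (Suc k) x + (?B * (s (k - 1) / s k)) * eta1 (k - 1) x"
        unfolding e1 using nz by (simp add: add_divide_distrib)
      finally show ?thesis .
    qed
    then show ?thesis using False by blast
  qed
qed

lemma tensor_times_X:
  assumes "f \<in> span_of eta_tensor KK"
  shows "(\<lambda>z. fst z * f z) \<in> span_of eta_tensor KK"
proof -
  have base: "(\<lambda>z. fst z * eta_tensor k z) \<in> span_of eta_tensor KK" if k: "k \<in> KK" for k
  proof -
    have k2: "2 \<le> fst k" using k by (simp add: KK_def)
    obtain A B where AB: "\<And>x. x * eta1 (fst k) x = A * eta1 (Suc (fst k)) x + B * eta1 (fst k - 1) x" "fst k = 2 \<Longrightarrow> B = 0"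
      using eta1_times[OF k2] by blast
    have eq: "(\<lambda>z. fst z * eta_tensor k z) = (\<lambda>z. A * eta_tensor (Suc (fst k), snd k) z + B * eta_tensor (fst k - 1, snd k) z)"
      unfolding eta_tensor_def by (simp add: mult.assoc[symmetric] AB(1)) (simp add: algebra_simps)
    have "(\<lambda>z. A * eta_tensor (Suc (fst k), snd k) z) \<in> span_of eta_tensor KK"
      by (intro span_of_scale span_of_base) (use k in \<open>auto simp: KK_def\<close>)
    moreover have "(\<lambda>z. B * eta_tensor (fst k - 1, snd k) z) \<in> span_of eta_tensor KK"
    proof (cases "fst k = 2")
      case True
      then show ?thesis using AB(2) by (simp add: span_of_zero)
    next
      case False
      then show ?thesis by (intro span_of_scale span_of_base) (use k in \<open>auto simp: KK_def\<close>)
    qed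
    ultimately show ?thesis unfolding eq by (rule span_of_add)
  qed
  obtain F c where F: "finite F" "F \<subseteq> KK" "f = (\<lambda>x. \<Sum>k\<in>F. c k * eta_tensor k x)"
    by (rule span_ofE[OF assms])
  have "(\<lambda>z. fst z * f z) = (\<lambda>z. \<Sum>k\<in>F. c k * (fst z * eta_tensor k z))"
    unfolding F(3) by (simp add: sum_distrib_left mult_ac)
  then show ?thesis using span_of_sum[of F "\<lambda>k z. fst z * eta_tensor k z" eta_tensor KK c] base F(2) by auto
qed

lemma tensor_times_Y:
  assumes "f \<in> span_of eta_tensor KK"
  shows "(\<lambda>z. snd z * f z) \<in> span_of eta_tensor KK"
proof -
  have base: "(\<lambda>z. snd z * eta_tensor k z) \<in> span_of eta_tensor KK" if k: "k \<in> KK" for k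
  proof -
    have k2: "2 \<le> snd k" using k by (simp add: KK_def)
    obtain A B where AB: "\<And>x. x * eta1 (snd k) x = A * eta1 (Suc (snd k)) x + B * eta1 (snd k - 1) x" "snd k = 2 \<Longrightarrow> B = 0"
      using eta1_times[OF k2] by blast
    have eq: "(\<lambda>z. snd z * eta_tensor k z) = (\<lambda>z. A * eta_tensor (fst k, Suc (snd k)) z + B * eta_tensor (fst k, snd k - 1) z)"
    proof
      fix z
      have "snd z * eta_tensor k z = eta1 (fst k) (fst z) * (snd z * eta1 (snd k) (snd z))"
        by (simp add: eta_tensor_def)
      then show "snd z * eta_tensor k z = A * eta_tensor (fst k, Suc (snd k)) z + B * eta_tensor (fst k, snd k - 1) z"
        unfolding AB(1) by (simp add: eta_tensor_def algebra_simps)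
    qed
    have "(\<lambda>z. A * eta_tensor (fst k, Suc (snd k)) z) \<in> span_of eta_tensor KK"
      by (intro span_of_scale span_of_base) (use k in \<open>auto simp: KK_def\<close>)
    moreover have "(\<lambda>z. B * eta_tensor (fst k, snd k - 1) z) \<in> span_of eta_tensor KK"
    proof (cases "snd k = 2")
      case True
      then show ?thesis using AB(2) by (simp add: span_of_zero)
    next
      case False
      then show ?thesis by (intro span_of_scale span_of_base) (use k in \<open>auto simp: KK_def\<close>)
    qed
    ultimately show ?thesis unfolding eq by (rule span_of_add)
  qed
  obtain F c where F: "finite F" "F \<subseteq> KK" "f = (\<lambda>x. \<Sum>k\<in>F. c k * eta_tensor k x)"
    by (rule span_ofE[OF assms])
  have "(\<lambda>z. snd z * f z) = (\<lambda>z. \<Sum>k\<in>F. c k * (snd z * eta_tensor k z))"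
    unfolding F(3) by (simp add: sum_distrib_left mult_ac)
  then show ?thesis using span_of_sum[of F "\<lambda>k z. snd z * eta_tensor k z" eta_tensor KK c] base F(2) by auto
qed

definition Bc :: "complex \<Rightarrow> complex \<Rightarrow> complex" where
  "Bc x y = (1 - x * x) * (1 - y * y)"

lemma poly_fun_Bc: "poly_fun 4 Bc"
proof -
  have x: "poly_fun 2 (\<lambda>x y. 1 - x * x)" "poly_fun 2 (\<lambda>x y. 1 - y * y)"
    using poly_fun_diff[OF poly_fun_const[of 2 1] poly_fun_mult[OF poly_fun_X[of 0] poly_fun_X[of 0], simplified, folded numeral_2_eq_2]]
      poly_fun_diff[OF poly_fun_const[of 2 1] poly_fun_mult[OF poly_fun_Y[of 0] poly_fun_Y[of 0], simplified, folded numeral_2_eq_2]] by simp_all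
  show ?thesis unfolding Bc_def[abs_def] using poly_fun_mult[OF x] by simp
qed

lemma restr_Bc: "restr Bc z = (1 - fst z * fst z) * (1 - snd z * snd z)"
  by (simp add: restr_def Bc_def)

text \<open>Since \<open>eta1 2\<close> is (3/2)(1 - s^2) divided by the square root of 6, the
  bubble is a multiple of the lowest tensor function.\<close>

lemma Bc_span: "restr Bc \<in> span_of eta_tensor KK"
proof -
  have e: "1 - s * s = (2 / 3 * sqrt 6) * eta1 2 s" for s
    by (simp add: eta1_def numeral_2_eq_2 field_simps)
  have "restr Bc = (\<lambda>z. ((2 / 3 * sqrt 6) * (2 / 3 * sqrt 6)) * eta_tensor (2, 2) z)"
    by (auto simp: restr_Bc e eta_tensor_def fun_eq_iff)
  then show ?thesis
    by (rule ssubst) (intro span_of_scale span_of_base, simp add: KK_def)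
qed

lemma poly_fun_times_span: "poly_fun n P \<Longrightarrow> f \<in> span_of eta_tensor KK \<Longrightarrow> (\<lambda>z. restr P z * f z) \<in> span_of eta_tensor KK"
proof (induction arbitrary: f rule: poly_fun.induct)
  case (poly_fun_mult n F m G)
  then show ?case unfolding restr_mult[OF poly_fun_mult.hyps] using poly_fun_mult.IH(1)[OF poly_fun_mult.IH(2)[OF poly_fun_mult.prems]] by (simp add: mult.assoc)
next
  case (poly_fun_add n F G)
  then show ?case unfolding restr_add using span_of_add[OF poly_fun_add.IH(1) poly_fun_add.IH(2)] by (simp add: distrib_right)
qed (auto simp: restr_const restr_X restr_Y span_of_scale tensor_times_X tensor_times_Y)

text \<open>A polynomial multiple of the bubble is a finite combination of basis functions, so the
  decay of finitely many rows of the stiffness matrix yields decay of its pairings.\<close>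

lemma bubble_tensor_span: assumes "poly_fun n P" shows "restr (\<lambda>x y. Bc x y * P x y) \<in> span_of eta_tensor KK"
  unfolding restr_mult[OF poly_fun_Bc assms] using poly_fun_times_span[OF assms Bc_span] by (simp add: mult.commute)

lemma bounded_linear_mult_exp: "0 < a \<Longrightarrow> (real d + 1) * exp (- a * real d) \<le> 1 / a + 1"
proof -
  assume a: "0 < a"
  have "a * real d \<le> exp (a * real d)" using exp_ge_add_one_self[of "a * real d"] by linarith
  then have "real d * exp (- (a * real d)) \<le> 1 / a"
    using a by (simp add: exp_minus field_simps)
  moreover have "exp (- (a * real d)) \<le> 1" using a by simp
  moreover have "(real d + 1) * exp (- a * real d) = real d * exp (- (a * real d)) + exp (- (a * real d))"
    by (simp add: distrib_right)
  ultimately show ?thesis by linarith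
qed

lemma card_total_deg: "finite {l \<in> KK. total_deg l = d}" "card {l \<in> KK. total_deg l = d} \<le> d + 1"
proof -
  have sub: "{l \<in> KK. total_deg l = d} \<subseteq> (\<lambda>i. (i, d - i)) ` {..d}"
    by (auto simp: total_deg_def image_iff)
  show "finite {l \<in> KK. total_deg l = d}" by (rule finite_subset[OF sub]) simp
  have "card {l \<in> KK. total_deg l = d} \<le> card ((\<lambda>i. (i, d - i)) ` {..d})"
    by (rule card_mono[OF _ sub]) simp
  also have "\<dots> \<le> card {..d}" by (rule card_image_le) simp
  finally show "card {l \<in> KK. total_deg l = d} \<le> d + 1" by simp
qed

section \<open>Exponential decay and the analytic representer\<close>

locale decay_basis = gs_basis +
  fixes \<nu> \<sigma> :: plane_fun and Ka c \<gamma> :: real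
  assumes coef: "bdd_meas \<nu>" "bdd_meas \<sigma>" "\<forall>x\<in>Omega. 0 \<le> \<nu> x" "\<forall>x\<in>Omega. 0 \<le> \<sigma> x"
    and upper: "0 \<le> Ka" "\<And>v. v \<in> H10 \<Longrightarrow> sqrt (a_form \<nu> \<sigma> v v) \<le> Ka * H10_norm v"
    and dense: "\<And>v e. v \<in> H10 \<Longrightarrow> 0 < e \<Longrightarrow> \<exists>F c. finite F \<and> F \<subseteq> KK \<and> H10_norm (\<lambda>x. v x - (\<Sum>k\<in>F. c k * basis_fun Gt k x)) < e"
    and cpos: "0 < c" and gpos: "0 < \<gamma>"
    and decay: "\<And>k l. k \<in> KK \<Longrightarrow> l \<in> KK \<Longrightarrow> \<bar>a_form \<nu> \<sigma> (basis_fun Gt k) (basis_fun Gt l)\<bar> \<le> c * exp (- \<gamma> * real (l1_dist k l))"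
begin

abbreviation \<phi> where "\<phi> \<equiv> basis_fun Gt"
abbreviation a where "a \<equiv> a_form \<nu> \<sigma>"

lemma sym_form_a: "sym_form a" by (rule sym_form_a_form[OF coef(1,2)])

lemma a_nonneg: "0 \<le> a v v" by (rule a_form_nonneg[OF coef(3,4)])

lemma a_bound: assumes "u \<in> H10" "v \<in> H10" shows "\<bar>a u v\<bar> \<le> Ka * H10_norm u * (Ka * H10_norm v)"
proof -
  have "\<bar>a u v\<bar> \<le> sqrt (a u u) * sqrt (a v v)" by (rule sym_form_Cauchy_Schwarz[OF sym_form_a a_nonneg assms])
  also have "\<dots> \<le> Ka * H10_norm u * (Ka * H10_norm v)"
    by (intro mult_mono upper(2) assms) (auto simp: upper(1) H10_norm_nonneg a_nonneg)
  finally show ?thesis .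
qed

lemma span_H10: "f \<in> span_of \<phi> KK \<Longrightarrow> f \<in> H10"
  by (erule span_ofE) (auto intro!: H10_sum basis_H10)

lemma eta_span: "k \<in> KK \<Longrightarrow> eta k \<in> span_of \<phi> KK"
proof (induction "card (upto_index k)" arbitrary: k rule: less_induct)
  case less
  define S where "S = upto_index k - {k}"
  have IH: "eta m \<in> span_of \<phi> KK" if "m \<in> S" for m
    using that by (intro less.hyps) (auto simp: S_def intro!: upto_index_card less.prems intro: upto_KK)
  have k: "k \<in> upto_index k" by (rule self_upto_index[OF less.prems])
  have "\<phi> k x = G k k * eta k x + (\<Sum>m\<in>S. Gt m k * eta m x)" for x
    unfolding basis_fun_def S_def
    by (subst sum.remove[OF finite_upto_index k]) (simp add: Gt_diag)
  then have "eta k = (\<lambda>x. (1 / G k k) * (\<phi> k x - (\<Sum>m\<in>S. Gt m k * eta m x)))"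
    using G_diag[OF less.prems] by (auto simp: fun_eq_iff)
  moreover have "(\<lambda>x. (1 / G k k) * (\<phi> k x - (\<Sum>m\<in>S. Gt m k * eta m x))) \<in> span_of \<phi> KK"
    by (intro span_of_scale span_of_diff span_of_base less.prems span_of_sum IH)
  ultimately show ?case by simp
qed

lemma tensor_span: "span_of eta_tensor KK \<subseteq> span_of \<phi> KK"
proof
  fix f assume "f \<in> span_of eta_tensor KK"
  then obtain F c where F: "finite F" "F \<subseteq> KK" "f = (\<lambda>x. \<Sum>k\<in>F. c k * eta_tensor k x)"
    by (rule span_ofE)
  have "eta_tensor k \<in> span_of \<phi> KK" if "k \<in> KK" for k
  proof -
    have "eta_tensor k = (\<lambda>x. H10_norm (eta_tensor k) * eta k x)"
      using eta_tensor_norm_nonzero[OF that] by (auto simp: eta_def)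
    then show ?thesis using span_of_scale[OF eta_span[OF that]] by metis
  qed
  then show "f \<in> span_of \<phi> KK" unfolding F(3) using F(2) by (intro span_of_sum) auto
qed

definition bubble :: "(complex \<Rightarrow> complex \<Rightarrow> complex) \<Rightarrow> plane_fun" where
  "bubble P = restr (\<lambda>x y. Bc x y * P x y)"

lemma bubble_span: "poly_fun n P \<Longrightarrow> bubble P \<in> span_of \<phi> KK"
  unfolding bubble_def using bubble_tensor_span tensor_span by blast

lemma bubble_H10: "poly_fun n P \<Longrightarrow> bubble P \<in> H10"
  by (rule span_H10[OF bubble_span])

lemma phi_unthresholded: "pmax < total_deg l \<Longrightarrow> \<phi> l = basis_fun G l"
  by (auto simp: basis_fun_def basis_fun_def thresholded_def)

lemma l1_dist_total: "total_deg l \<le> total_deg k + l1_dist k l"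
  by (simp add: total_deg_def l1_dist_def)

text \<open>For fixed k the distance to l is at least the difference of the total degrees, so the
  assumed decay is a decay in the degree of l. Beyond \<open>pmax\<close> the basis function is the
  Gram-Schmidt function; the finitely many lower ones go into the constant.\<close>

lemma decay_gs:
  assumes k: "k \<in> KK"
  shows "\<exists>C\<ge>0. \<forall>l\<in>KK. \<bar>a (\<phi> k) (basis_fun G l)\<bar> \<le> C * exp (- \<gamma> * real (total_deg l))"
proof -
  define S where "S = {l \<in> KK. total_deg l \<le> pmax}"
  have fS: "finite S" unfolding S_def using finite_total_deg[of pmax] by (rule rev_finite_subset) auto
  define C1 where "C1 = c * exp (\<gamma> * real (total_deg k))"
  define C2 where "C2 = (\<Sum>l\<in>S. \<bar>a (\<phi> k) (basis_fun G l)\<bar>) * exp (\<gamma> * real pmax)"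
  have pos: "0 \<le> C1" "0 \<le> C2" using cpos by (auto simp: C1_def C2_def intro!: mult_nonneg_nonneg sum_nonneg)
  have "\<bar>a (\<phi> k) (basis_fun G l)\<bar> \<le> (C1 + C2) * exp (- \<gamma> * real (total_deg l))" if l: "l \<in> KK" for l
  proof (cases "total_deg l \<le> pmax")
    case True
    have "\<bar>a (\<phi> k) (basis_fun G l)\<bar> \<le> (\<Sum>l\<in>S. \<bar>a (\<phi> k) (basis_fun G l)\<bar>)"
      by (rule member_le_sum) (use True l fS in \<open>auto simp: S_def\<close>)
    also have "\<dots> = C2 * exp (- \<gamma> * real pmax)" by (simp add: C2_def exp_minus)
    also have "\<dots> \<le> C2 * exp (- \<gamma> * real (total_deg l))"
      using True gpos pos by (intro mult_left_mono) auto
    also have "\<dots> \<le> (C1 + C2) * exp (- \<gamma> * real (total_deg l))" using pos by (intro mult_right_mono) auto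
    finally show ?thesis .
  next
    case False
    then have "\<bar>a (\<phi> k) (basis_fun G l)\<bar> \<le> c * exp (- \<gamma> * real (l1_dist k l))" using decay[OF k l] phi_unthresholded[of l] by simp
    also have "\<dots> \<le> c * exp (\<gamma> * real (total_deg k) - \<gamma> * real (total_deg l))"
    proof -
      have "real (total_deg l) \<le> real (total_deg k) + real (l1_dist k l)" using l1_dist_total[of l k] by linarith
      then have "\<gamma> * real (total_deg l) \<le> \<gamma> * (real (total_deg k) + real (l1_dist k l))" using gpos by simp
      then show ?thesis using cpos by (simp add: algebra_simps)
    qed
    also have "\<dots> = C1 * exp (- \<gamma> * real (total_deg l))" by (simp add: C1_def exp_diff exp_minus divide_inverse)
    also have "\<dots> \<le> (C1 + C2) * exp (- \<gamma> * real (total_deg l))" using pos by (intro mult_right_mono) auto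
    finally show ?thesis .
  qed
  then show ?thesis using pos by (intro exI[of _ "C1 + C2"]) auto
qed

lemma decay_span:
  assumes "f \<in> span_of \<phi> KK"
  obtains C where "0 \<le> C" "\<And>l. l \<in> KK \<Longrightarrow> \<bar>a f (basis_fun G l)\<bar> \<le> C * exp (- \<gamma> * real (total_deg l))"
proof -
  obtain F d where F: "finite F" "F \<subseteq> KK" "f = (\<lambda>x. \<Sum>k\<in>F. d k * \<phi> k x)"
    by (rule span_ofE[OF assms])
  have "\<forall>k\<in>KK. \<exists>C\<ge>0. \<forall>l\<in>KK. \<bar>a (\<phi> k) (basis_fun G l)\<bar> \<le> C * exp (- \<gamma> * real (total_deg l))"
    using decay_gs by blast
  then obtain C where C: "\<And>k. k \<in> KK \<Longrightarrow> 0 \<le> C k" "\<And>k l. k \<in> KK \<Longrightarrow> l \<in> KK \<Longrightarrow> \<bar>a (\<phi> k) (basis_fun G l)\<bar> \<le> C k * exp (- \<gamma> * real (total_deg l))"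
    by metis
  have "\<bar>a f (basis_fun G l)\<bar> \<le> (\<Sum>k\<in>F. \<bar>d k\<bar> * C k) * exp (- \<gamma> * real (total_deg l))" if l: "l \<in> KK" for l
  proof -
    have "a f (basis_fun G l) = (\<Sum>k\<in>F. d k * a (\<phi> k) (basis_fun G l))"
      unfolding F(3) using F(2) by (intro sym_form_sum[OF sym_form_a gs_H10[OF l]] basis_H10) auto
    also have "\<bar>\<dots>\<bar> \<le> (\<Sum>k\<in>F. \<bar>d k * a (\<phi> k) (basis_fun G l)\<bar>)" by (rule sum_abs)
    also have "\<dots> \<le> (\<Sum>k\<in>F. \<bar>d k\<bar> * C k * exp (- \<gamma> * real (total_deg l)))"
    proof (rule sum_mono)
      fix k assume "k \<in> F"
      then have "\<bar>a (\<phi> k) (basis_fun G l)\<bar> \<le> C k * exp (- \<gamma> * real (total_deg l))" using C(2)[of k l] F(2) l by blast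
      from mult_left_mono[OF this abs_ge_zero[of "d k"]]
      show "\<bar>d k * a (\<phi> k) (basis_fun G l)\<bar> \<le> \<bar>d k\<bar> * C k * exp (- \<gamma> * real (total_deg l))" by (simp add: abs_mult mult.assoc)
    qed
    finally show ?thesis by (simp add: sum_distrib_right)
  qed
  moreover have "0 \<le> (\<Sum>k\<in>F. \<bar>d k\<bar> * C k)" using C(1) F(2) by (intro sum_nonneg) auto
  ultimately show ?thesis using that by blast
qed

text \<open>The orthonormal expansion of the representer, with all indices of one total degree
  gathered into one term, so that a simple series in the degree remains.\<close>

definition rep_term :: "(complex \<Rightarrow> complex \<Rightarrow> complex) \<Rightarrow> nat \<Rightarrow> complex \<Rightarrow> complex \<Rightarrow> complex" where
  "rep_term P d x y = (\<Sum>l\<in>{l \<in> KK. total_deg l = d}. of_real (a (bubble P) (basis_fun G l)) * FC l x y)"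

text \<open>The representer of \<open>a(bubble P, \<cdot>)\<close> in the \<open>H10\<close> inner product, extended to complex arguments.\<close>

definition W :: "(complex \<Rightarrow> complex \<Rightarrow> complex) \<Rightarrow> complex \<Rightarrow> complex \<Rightarrow> complex" where
  "W P x y = (\<Sum>d. rep_term P d x y)"

text \<open>The decay rate \<gamma> is spent in quarters. With R = exp(\<gamma>/4) the growth
  (R^2)^d takes two, the number of indices of degree d takes one, and exp(-\<gamma>/4) is left as
  the ratio of the series. \<open>R0\<close> stays strictly below R to leave room for the Cauchy
  estimate in \<open>FC_growth\<close>.\<close>

definition R0 :: real where "R0 = (1 + exp (\<gamma> / 4)) / 2"

lemma R0: "1 < R0" "R0 < exp (\<gamma> / 4)"
  using gpos by (auto simp: R0_def)

lemma poly_fun_rep_term: "poly_fun d (rep_term P d)"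
  unfolding rep_term_def[abs_def] by (intro poly_fun_sum poly_fun_scale) (use poly_fun_FC in auto)

lemma rep_term_edges: "rep_term P d (-1) y = 0" "rep_term P d x (-1) = 0"
  by (simp_all add: rep_term_def FC_edges)

lemma poly_series_W:
  assumes "poly_fun n P"
  shows "poly_series R0 (rep_term P) (W P)"
  unfolding W_def[abs_def]
proof -
  let ?R = "exp (\<gamma> / 4)"
  obtain C where C: "0 \<le> C" "\<And>l. l \<in> KK \<Longrightarrow> \<bar>a (bubble P) (basis_fun G l)\<bar> \<le> C * exp (- \<gamma> * real (total_deg l))"
    using decay_span[OF bubble_span[OF assms]] by blast
  obtain D where D: "0 \<le> D" "\<And>l x y. l \<in> KK \<Longrightarrow> x \<in> ellipse R0 \<Longrightarrow> y \<in> ellipse R0 \<Longrightarrow> norm (FC l x y) \<le> D * (?R\<^sup>2) ^ total_deg l"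
    by (rule FC_growth[of R0 ?R]) (use R0 in auto)
  show "poly_series R0 (rep_term P) (\<lambda>x y. \<Sum>d. rep_term P d x y)"
  proof (rule poly_series_suminf)
    show "\<exists>n. poly_fun n (rep_term P d)" for d using poly_fun_rep_term by blast
    show "0 \<le> (4 / \<gamma> + 1) * (C * D)" using gpos C D by simp
    show "0 \<le> exp (- \<gamma> / 4)" "exp (- \<gamma> / 4) < 1" using gpos by auto
    fix d x y assume xy: "x \<in> ellipse R0" "y \<in> ellipse R0"
    have e2: "(?R\<^sup>2) ^ d = exp (\<gamma> / 2 * real d)"
      by (simp add: power2_eq_square flip: exp_add exp_of_nat2_mult)
    have "norm (rep_term P d x y) \<le> (\<Sum>l\<in>{l \<in> KK. total_deg l = d}. (C * exp (- \<gamma> * real d)) * (D * (?R\<^sup>2) ^ d))"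
      unfolding rep_term_def
    proof (rule order_trans[OF norm_sum sum_mono])
      fix l assume "l \<in> {l \<in> KK. total_deg l = d}"
      then show "norm (of_real (a (bubble P) (basis_fun G l)) * FC l x y) \<le> (C * exp (- \<gamma> * real d)) * (D * (?R\<^sup>2) ^ d)"
        using C(2)[of l] D(2)[of l x y] xy C(1) unfolding norm_mult norm_of_real by (intro mult_mono) auto
    qed
    also have "\<dots> = real (card {l \<in> KK. total_deg l = d}) * ((C * exp (- \<gamma> * real d)) * (D * (?R\<^sup>2) ^ d))" by simp
    also have "\<dots> \<le> (real d + 1) * ((C * exp (- \<gamma> * real d)) * (D * (?R\<^sup>2) ^ d))"
      using card_total_deg(2)[of d] C D by (intro mult_right_mono) auto
    also have "\<dots> = ((real d + 1) * exp (- (\<gamma> / 4) * real d)) * ((C * D) * exp (- \<gamma> / 4) ^ d)"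
    proof -
      have "exp (- \<gamma> * real d) * exp (\<gamma> / 2 * real d) = exp (- (\<gamma> / 4) * real d) * exp (- \<gamma> / 4) ^ d"
        by (simp flip: exp_add exp_of_nat2_mult add: algebra_simps)
      then show ?thesis unfolding e2 by (simp add: mult_ac)
    qed
    also have "\<dots> \<le> (4 / \<gamma> + 1) * ((C * D) * exp (- \<gamma> / 4) ^ d)"
      using bounded_linear_mult_exp[of "\<gamma> / 4" d] gpos C D by (intro mult_right_mono) auto
    finally show "norm (rep_term P d x y) \<le> (4 / \<gamma> + 1) * (C * D) * exp (- \<gamma> / 4) ^ d" by (simp add: mult.assoc)
  qed
qed

end

section \<open>Real traces of polynomial series and weak identities\<close>

lemma Omega_abs: "z \<in> Omega \<Longrightarrow> \<bar>fst z\<bar> \<le> 1" "z \<in> Omega \<Longrightarrow> \<bar>snd z\<bar> \<le> 1"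
  by (auto simp: Omega_def)

lemma poly_series_bdd_meas:
  assumes "poly_series R g F" "1 < R"
  shows "bdd_meas (restr F)"
proof -
  have "continuous_on Omega (\<lambda>z. (\<lambda>p. F (fst p) (snd p)) (of_real (fst z), of_real (snd z)))"
    by (rule continuous_on_compose2[OF poly_series_continuous[OF assms(1)]])
      (auto intro!: continuous_intros real_in_ellipse[OF assms(2)] Omega_abs)
  then have "continuous_on Omega (restr F)"
    unfolding restr_def[abs_def] by (intro continuous_on_Re) simp
  then have m: "restr F \<in> borel_measurable MO" by (rule continuous_imp_measurable_on_sets_lebesgue) simp
  obtain C q where Cq: "0 \<le> C" "0 \<le> q" "q < 1" "\<And>d x y. x \<in> ellipse R \<Longrightarrow> y \<in> ellipse R \<Longrightarrow> norm (g d x y) \<le> C * q ^ d"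
    using poly_series_bound[OF assms(1)] by blast
  have "\<bar>restr F z\<bar> \<le> C * (1 / (1 - q))" if "z \<in> Omega" for z
  proof -
    have E: "of_real (fst z) \<in> ellipse R" "of_real (snd z) \<in> ellipse R" using real_in_ellipse[OF assms(2)] Omega_abs[OF that] by auto
    have s: "(\<lambda>d. C * q ^ d) sums (C * (1 / (1 - q)))" using Cq by (intro sums_mult geometric_sums) auto
    have "norm (F (of_real (fst z)) (of_real (snd z))) \<le> C * (1 / (1 - q))"
      using norm_suminf_le[of "\<lambda>d. g d (of_real (fst z)) (of_real (snd z))" "\<lambda>d. C * q ^ d"] Cq(4)[OF E] s
        poly_series_sums[OF assms(1) E] by (simp add: sums_iff)
    then show ?thesis using abs_Re_le_cmod order_trans unfolding restr_def by blast
  qed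
  then show ?thesis using m unfolding bdd_meas_def by blast
qed

text \<open>Dominated convergence, with the sum of the geometric series as majorant of all partial
  sums.\<close>

lemma poly_series_integral_sums:
  assumes "poly_series R g F" "1 < R" "bdd_meas v"
  shows "(\<lambda>d. LINT z|MO. restr (g d) z * v z) sums (LINT z|MO. restr F z * v z)"
  unfolding sums_def
proof -
  obtain C q where Cq: "0 \<le> C" "0 \<le> q" "q < 1" "\<And>d x y. x \<in> ellipse R \<Longrightarrow> y \<in> ellipse R \<Longrightarrow> norm (g d x y) \<le> C * q ^ d"
    using poly_series_bound[OF assms(1)] by blast
  have cg: "bdd_meas (restr (g d))" for d
  proof -
    obtain n where "poly_fun n (g d)" using poly_series_PFD[OF assms(1)] by blast
    from C1_grad_continuous[OF poly_fun_derivs(4)[OF this]] show ?thesis by (rule bdd_meas_continuous)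
  qed
  have i: "integrable MO (\<lambda>z. restr (g d) z * v z)" for d by (intro bdd_meas_integrable bdd_meas_mult cg assms)
  have "(\<lambda>n. LINT z|MO. (\<Sum>d<n. restr (g d) z * v z)) \<longlonglongrightarrow> (LINT z|MO. restr F z * v z)"
  proof (rule integral_dominated_convergence[where w = "\<lambda>z. C * (1 / (1 - q)) * \<bar>v z\<bar>"])
    show "(\<lambda>z. restr F z * v z) \<in> borel_measurable MO"
      using poly_series_bdd_meas[OF assms(1,2)] assms(3) by (auto simp: bdd_meas_def)
    show "(\<lambda>z. \<Sum>d<n. restr (g d) z * v z) \<in> borel_measurable MO" for n
      using borel_measurable_integrable[OF i] by (intro borel_measurable_sum)
    show "integrable MO (\<lambda>z. C * (1 / (1 - q)) * \<bar>v z\<bar>)"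
      using bdd_meas_integrable[OF assms(3)] by simp
    show "AE z in MO. (\<lambda>n. \<Sum>d<n. restr (g d) z * v z) \<longlonglongrightarrow> restr F z * v z"
    proof (rule AE_I2)
      fix z assume "z \<in> space MO"
      then have E: "of_real (fst z) \<in> ellipse R" "of_real (snd z) \<in> ellipse R" using real_in_ellipse[OF assms(2)] Omega_abs[of z] by auto
      have "(\<lambda>d. restr (g d) z * v z) sums (restr F z * v z)"
        unfolding restr_def by (intro sums_mult2 sums_Re poly_series_sums[OF assms(1) E])
      then show "(\<lambda>n. \<Sum>d<n. restr (g d) z * v z) \<longlonglongrightarrow> restr F z * v z" by (simp add: sums_def)
    qed
    show "AE z in MO. norm (\<Sum>d<n. restr (g d) z * v z) \<le> C * (1 / (1 - q)) * \<bar>v z\<bar>" for n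
    proof (rule AE_I2)
      fix z assume "z \<in> space MO"
      then have E: "of_real (fst z) \<in> ellipse R" "of_real (snd z) \<in> ellipse R" using real_in_ellipse[OF assms(2)] Omega_abs[of z] by auto
      have "norm (\<Sum>d<n. restr (g d) z * v z) \<le> (\<Sum>d<n. C * q ^ d * \<bar>v z\<bar>)"
      proof (rule order_trans[OF norm_sum sum_mono])
        fix d
        have "\<bar>restr (g d) z\<bar> \<le> C * q ^ d"
          using Cq(4)[OF E, of d] abs_Re_le_cmod order_trans unfolding restr_def by blast
        then show "norm (restr (g d) z * v z) \<le> C * q ^ d * \<bar>v z\<bar>" by (simp add: abs_mult mult_right_mono)
      qed
      also have "\<dots> = C * (\<Sum>d<n. q ^ d) * \<bar>v z\<bar>" by (simp add: sum_distrib_left sum_distrib_right)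
      also have "\<dots> \<le> C * (1 / (1 - q)) * \<bar>v z\<bar>"
      proof -
        have "(\<Sum>d<n. q ^ d) \<le> (\<Sum>d. q ^ d)" using Cq by (intro sum_le_suminf summable_geometric) auto
        also have "\<dots> = 1 / (1 - q)" using Cq by (intro suminf_geometric) auto
        finally show ?thesis using Cq by (intro mult_right_mono mult_left_mono) auto
      qed
      finally show "norm (\<Sum>d<n. restr (g d) z * v z) \<le> C * (1 / (1 - q)) * \<bar>v z\<bar>" .
    qed
  qed
  then show "(\<lambda>n. \<Sum>d<n. LINT z|MO. restr (g d) z * v z) \<longlonglongrightarrow> (LINT z|MO. restr F z * v z)"
    using i by simp
qed

lemma test_grad_bdd_meas: "v \<in> test_functions \<Longrightarrow> bdd_meas (\<lambda>z. fst (grad v z))" "v \<in> test_functions \<Longrightarrow> bdd_meas (\<lambda>z. snd (grad v z))"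
  by (intro bdd_meas_continuous c1D[OF test_C1_grad]; assumption)+

lemma poly_series_parts:
  assumes "poly_series R g F" "1 < R1" "R1 < R" "v \<in> test_functions"
  shows "(LINT z|MO. restr F z * fst (grad v z)) = - (LINT z|MO. restr (Dx F) z * v z)"
    "(LINT z|MO. restr F z * snd (grad v z)) = - (LINT z|MO. restr (Dy F) z * v z)"
proof -
  have R: "1 < R" "1 \<le> R1" using assms by auto
  have p: "(LINT z|MO. restr (g d) z * fst (grad v z)) = - (LINT z|MO. restr (Dx (g d)) z * v z)"
    "(LINT z|MO. restr (g d) z * snd (grad v z)) = - (LINT z|MO. restr (Dy (g d)) z * v z)" for d
  proof -
    obtain n where n: "poly_fun n (g d)" using poly_series_PFD[OF assms(1)] by blast
    note C1_grad_integration_by_parts[OF poly_fun_derivs(4)[OF n] assms(4)]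
    then show "(LINT z|MO. restr (g d) z * fst (grad v z)) = - (LINT z|MO. restr (Dx (g d)) z * v z)"
      "(LINT z|MO. restr (g d) z * snd (grad v z)) = - (LINT z|MO. restr (Dy (g d)) z * v z)"
      by (simp_all add: mult.commute)
  qed
  note v = test_bdd_meas[OF assms(4)]
  show "(LINT z|MO. restr F z * fst (grad v z)) = - (LINT z|MO. restr (Dx F) z * v z)"
    by (rule sums_unique2[OF poly_series_integral_sums[OF assms(1) R(1) test_grad_bdd_meas(1)[OF assms(4)]]])
      (use sums_minus[OF poly_series_integral_sums[OF poly_series_Dx[OF assms(1) R(2) assms(3)] assms(2) v]] p in simp)
  show "(LINT z|MO. restr F z * snd (grad v z)) = - (LINT z|MO. restr (Dy F) z * v z)"
    by (rule sums_unique2[OF poly_series_integral_sums[OF assms(1) R(1) test_grad_bdd_meas(2)[OF assms(4)]]])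
      (use sums_minus[OF poly_series_integral_sums[OF poly_series_Dy[OF assms(1) R(2) assms(3)] assms(2) v]] p in simp)
qed

lemma poly_fun_weak_laplacian:
  assumes P: "poly_fun n P" and v: "v \<in> test_functions"
  shows "(LINT z|MO. restr (Dx P) z * fst (grad v z) + restr (Dy P) z * snd (grad v z)) = - (LINT z|MO. restr (Lap P) z * v z)"
proof -
  note s = poly_fun_derivs[OF P]
  have i: "integrable MO (\<lambda>z. restr F z * fst (grad v z))" "integrable MO (\<lambda>z. restr F z * snd (grad v z))" "integrable MO (\<lambda>z. v z * restr F z)"
    if "poly_fun n F" for F n
    by (intro bdd_meas_integrable bdd_meas_mult test_grad_bdd_meas[OF v] test_bdd_meas[OF v] bdd_meas_continuous C1_grad_continuous[OF poly_fun_derivs(4)[OF that]])+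
  have "(LINT z|MO. restr (Dx P) z * fst (grad v z) + restr (Dy P) z * snd (grad v z)) = (LINT z|MO. restr (Dx P) z * fst (grad v z)) + (LINT z|MO. restr (Dy P) z * snd (grad v z))"
    by (rule Bochner_Integration.integral_add[OF i(1)[OF s(1)] i(2)[OF s(2)]])
  also have "\<dots> = - (LINT z|MO. v z * restr (Dx (Dx P)) z) - (LINT z|MO. v z * restr (Dy (Dy P)) z)"
    unfolding C1_grad_integration_by_parts(1)[OF poly_fun_derivs(4)[OF s(1)] v] C1_grad_integration_by_parts(2)[OF poly_fun_derivs(4)[OF s(2)] v] by simp
  also have "\<dots> = - (LINT z|MO. v z * restr (Dx (Dx P)) z + v z * restr (Dy (Dy P)) z)"
    using i(3)[OF poly_fun_derivs(1)[OF s(1)]] i(3)[OF poly_fun_derivs(2)[OF s(2)]] by simp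
  also have "\<dots> = - (LINT z|MO. restr (Lap P) z * v z)"
    unfolding Lap_def[abs_def] restr_add by (simp add: algebra_simps)
  finally show ?thesis .
qed

lemma poly_fun_test: "poly_fun n P \<Longrightarrow> v \<in> test_functions \<Longrightarrow> (\<lambda>z. restr P z * v z) \<in> test_functions"
  by (rule test_functions_mult[OF _ poly_fun_smooth])

lemma C1_grad_a_form:
  assumes u: "C1_grad u ux uy" and w: "C1_grad w wx wy" and nu: "bdd_meas \<nu>" "bdd_meas \<sigma>"
  shows "a_form \<nu> \<sigma> u w = (LINT z|MO. \<nu> z * (ux z * wx z + uy z * wy z) + \<sigma> z * (u z * w z))"
proof -
  have m: "\<nu> \<in> borel_measurable MO" using nu by (simp add: bdd_meas_def)
  have b: "bdd_meas (\<lambda>z. \<nu> z * (ux z * wx z + uy z * wy z))" "bdd_meas (\<lambda>z. \<sigma> z * (u z * w z))"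
    by (intro bdd_meas_mult bdd_meas_add nu bdd_meas_continuous c1D[OF u] c1D[OF w] C1_grad_continuous[OF u] C1_grad_continuous[OF w])+
  have "(LINT x|MO. \<nu> x * (wgrad u x \<bullet> wgrad w x)) = (LINT z|MO. \<nu> z * (ux z * wx z + uy z * wy z))"
  proof (rule integral_cong_AE)
    show "(\<lambda>x. \<nu> x * (wgrad u x \<bullet> wgrad w x)) \<in> borel_measurable MO"
      using m L2_measurable[OF wgrad_L2[OF C1_grad_H1[OF u]]] L2_measurable[OF wgrad_L2[OF C1_grad_H1[OF w]]] by simp
    show "(\<lambda>z. \<nu> z * (ux z * wx z + uy z * wy z)) \<in> borel_measurable MO"
      using b(1) by (simp add: bdd_meas_def)
    show "AE x in MO. \<nu> x * (wgrad u x \<bullet> wgrad w x) = \<nu> x * (ux x * wx x + uy x * wy x)"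
      using C1_grad_wgrad[OF u] C1_grad_wgrad[OF w] by eventually_elim simp
  qed
  then show ?thesis
    unfolding a_form_def using bdd_meas_integrable[OF b(1)] bdd_meas_integrable[OF b(2)] by simp
qed

text \<open>The set where h is nonzero is open, and a nonempty open set is not a null set.\<close>

lemma AE_zero_imp_zero:
  assumes "continuous_on Omega h" "AE z in MO. h z = (0::real)" "z \<in> Omega"
  shows "h z = 0"
proof (rule ccontr)
  assume nz: "h z \<noteq> 0"
  define U where "U = {z \<in> Omega. h z \<noteq> 0}"
  have "open U"
  proof -
    have "U = Omega \<inter> h -` (- {0})" by (auto simp: U_def)
    then show ?thesis using continuous_open_preimage[OF assms(1) open_Omega, of "- {0}"] by (simp add: open_Compl)
  qed
  have "U \<noteq> {}" using nz assms(3) by (auto simp: U_def)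
  have "AE z in lebesgue. z \<in> Omega \<longrightarrow> h z = 0"
    using assms(2) by (subst (asm) AE_restrict_space_iff) auto
  then have "AE z in lebesgue. z \<notin> U" by eventually_elim (auto simp: U_def)
  then have "negligible U"
    using \<open>open U\<close> by (subst negligible_iff_null_sets) (simp add: AE_iff_null_sets lborelD_Collect null_sets_def borel_open AE_iff_null_sets[symmetric])
  then show False using open_not_negligible[OF \<open>open U\<close> \<open>U \<noteq> {}\<close>] by simp
qed

section \<open>Identification of the representer with a weak solution\<close>

context decay_basis
begin

text \<open>Partial sums, on the real plane, of the expansion of the representer: the orthonormal
  projections of the functional onto the functions of total degree below n.\<close>

definition wn :: "(complex \<Rightarrow> complex \<Rightarrow> complex) \<Rightarrow> nat \<Rightarrow> plane_fun" where
  "wn P n z = (\<Sum>l\<in>{l \<in> KK. total_deg l < n}. a (bubble P) (basis_fun G l) * basis_fun G l z)"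

lemma fin_less: "finite {l \<in> KK. total_deg l < n}"
  by (rule finite_subset[OF _ finite_total_deg[of n]]) auto

lemma wn_H10: "wn P n \<in> H10"
  unfolding wn_def[abs_def] by (intro H10_sum gs_H10) auto

lemma wn_basis_fun:
  assumes "l \<in> KK" "total_deg l < n"
  shows "H10_inner (wn P n) (basis_fun G l) = a (bubble P) (basis_fun G l)"
proof -
  have "H10_inner (wn P n) (basis_fun G l) = (\<Sum>j\<in>{l \<in> KK. total_deg l < n}. a (bubble P) (basis_fun G j) * H10_inner (basis_fun G j) (basis_fun G l))"
    unfolding wn_def[abs_def] by (intro sym_form_sum[OF sym_form_H10_inner] gs_H10 assms) auto
  also have "\<dots> = (\<Sum>j\<in>{l \<in> KK. total_deg l < n}. a (bubble P) (basis_fun G j) * (if j = l then 1 else 0))"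
    using gs_orthonormal assms by (intro sum.cong) auto
  also have "\<dots> = a (bubble P) (basis_fun G l)"
    using assms fin_less by (simp add: if_distrib[of "\<lambda>c. _ * c"] sum.delta cong: if_cong)
  finally show ?thesis .
qed

text \<open>Tested with itself, the partial sum gives its squared norm as the form applied to the
  bubble and the partial sum; one factor of the norm cancels. The bound does not depend on
  n.\<close>

lemma wn_norm:
  assumes "poly_fun m P"
  shows "H10_norm (wn P n) \<le> Ka * H10_norm (bubble P) * Ka"
proof -
  let ?S = "{l \<in> KK. total_deg l < n}"
  have b: "bubble P \<in> H10" by (rule bubble_H10[OF assms])
  have "H10_inner (wn P n) (wn P n) = (\<Sum>l\<in>?S. a (bubble P) (basis_fun G l) * H10_inner (wn P n) (basis_fun G l))"
    by (subst (2) wn_def[abs_def]) (intro sym_form_sum_right[OF sym_form_H10_inner wn_H10] gs_H10; simp)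
  also have "\<dots> = (\<Sum>l\<in>?S. a (bubble P) (basis_fun G l) * a (bubble P) (basis_fun G l))"
    using wn_basis_fun by (intro sum.cong) auto
  also have "\<dots> = a (bubble P) (wn P n)"
    by (subst wn_def[abs_def]) (intro sym_form_sum_right[OF sym_form_a b, symmetric] gs_H10; simp)
  also have "\<dots> \<le> Ka * H10_norm (bubble P) * (Ka * H10_norm (wn P n))"
    using a_bound[OF b wn_H10[of P n]] by simp
  finally have "(H10_norm (wn P n)) * H10_norm (wn P n) \<le> (Ka * H10_norm (bubble P) * Ka) * H10_norm (wn P n)"
    by (simp add: H10_norm_sq[symmetric] power2_eq_square mult.assoc)
  then show ?thesis
    using H10_norm_nonneg[of "wn P n"] H10_norm_nonneg[of "bubble P"] upper(1)
    by (cases "H10_norm (wn P n) = 0") (auto simp: mult_le_cancel_right)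
qed

text \<open>A basis function involves only Gram-Schmidt functions of no larger degree, so the
  pairing is exact as soon as n exceeds all degrees that occur in f.\<close>

lemma wn_span_eventually:
  assumes "poly_fun m P" "f \<in> span_of \<phi> KK"
  shows "\<forall>\<^sub>F n in sequentially. H10_inner (wn P n) f = a (bubble P) f"
proof -
  have b: "bubble P \<in> H10" by (rule bubble_H10[OF assms(1)])
  have base: "H10_inner (wn P n) (\<phi> k) = a (bubble P) (\<phi> k)" if "k \<in> KK" "total_deg k < n" for n k
  proof -
    let ?c = "\<lambda>j. (if j = k then 1 else 0) + M j k"
    have eq: "\<phi> k = (\<lambda>x. \<Sum>j\<in>upto_index k. ?c j * basis_fun G j x)" using basis_expansion[OF that(1)] by auto
    have p: "\<And>j. j \<in> upto_index k \<Longrightarrow> basis_fun G j \<in> H10" by (intro gs_H10 upto_KK)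
    have "H10_inner (wn P n) (\<phi> k) = (\<Sum>j\<in>upto_index k. ?c j * H10_inner (wn P n) (basis_fun G j))"
      unfolding eq by (rule sym_form_sum_right[OF sym_form_H10_inner wn_H10 p])
    also have "\<dots> = (\<Sum>j\<in>upto_index k. ?c j * a (bubble P) (basis_fun G j))"
    proof (intro sum.cong refl)
      fix j assume j: "j \<in> upto_index k"
      then have "total_deg j < n" using that(2) by (auto simp: upto_index_def)
      then show "?c j * H10_inner (wn P n) (basis_fun G j) = ?c j * a (bubble P) (basis_fun G j)" using wn_basis_fun[OF upto_KK[OF j]] by simp
    qed
    also have "\<dots> = a (bubble P) (\<phi> k)"
      unfolding eq by (rule sym_form_sum_right[OF sym_form_a b p, symmetric])
    finally show ?thesis .
  qed
  obtain F d where F: "finite F" "F \<subseteq> KK" "f = (\<lambda>x. \<Sum>k\<in>F. d k * \<phi> k x)"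
    by (rule span_ofE[OF assms(2)])
  define N where "N = Suc (\<Sum>k\<in>F. total_deg k)"
  have "H10_inner (wn P n) f = a (bubble P) f" if "N \<le> n" for n
  proof -
    have pF: "\<And>k. k \<in> F \<Longrightarrow> \<phi> k \<in> H10" using F(2) basis_H10 by blast
    have "H10_inner (wn P n) f = (\<Sum>k\<in>F. d k * H10_inner (wn P n) (\<phi> k))"
      unfolding F(3) by (rule sym_form_sum_right[OF sym_form_H10_inner wn_H10 pF])
    also have "\<dots> = (\<Sum>k\<in>F. d k * a (bubble P) (\<phi> k))"
    proof (intro sum.cong refl)
      fix k assume k: "k \<in> F"
      have "total_deg k \<le> (\<Sum>k\<in>F. total_deg k)" by (rule member_le_sum[OF k]) (use F in auto)
      then have "total_deg k < n" using that by (simp add: N_def)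
      then have "H10_inner (wn P n) (\<phi> k) = a (bubble P) (\<phi> k)" using base k F(2) by blast
      then show "d k * H10_inner (wn P n) (\<phi> k) = d k * a (bubble P) (\<phi> k)" by simp
    qed
    also have "\<dots> = a (bubble P) f"
      unfolding F(3) by (rule sym_form_sum_right[OF sym_form_a b pF, symmetric])
    finally show ?thesis .
  qed
  then show ?thesis unfolding eventually_sequentially by blast
qed

text \<open>Exactness on the span, the uniform bound on the partial sums and density of the span
  give convergence against every element of \<open>H10\<close>.\<close>

lemma wn_limit:
  assumes "poly_fun m P" "v \<in> H10"
  shows "(\<lambda>n. H10_inner (wn P n) v) \<longlonglongrightarrow> a (bubble P) v"
proof (rule LIMSEQ_I)
  fix e :: real assume e: "0 < e"
  have b: "bubble P \<in> H10" by (rule bubble_H10[OF assms(1)])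
  define K where "K = Ka * H10_norm (bubble P) * Ka"
  have K: "0 \<le> K" using upper(1) H10_norm_nonneg by (simp add: K_def)
  obtain F d where F: "finite F" "F \<subseteq> KK" "H10_norm (\<lambda>x. v x - (\<Sum>k\<in>F. d k * \<phi> k x)) < e / (2 * K + 1)"
    using dense[OF assms(2), of "e / (2 * K + 1)"] e K by auto
  define f where "f = (\<lambda>x. \<Sum>k\<in>F. d k * \<phi> k x)"
  have fs: "f \<in> span_of \<phi> KK" unfolding f_def by (rule span_ofI[OF F(1,2)])
  have fH: "f \<in> H10" by (rule span_H10[OF fs])
  define g where "g = (\<lambda>x. v x - f x)"
  have gH: "g \<in> H10" unfolding g_def by (rule H10_diff[OF assms(2) fH])
  have gn: "H10_norm g < e / (2 * K + 1)" using F(3) by (simp add: g_def f_def)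
  have v: "v = (\<lambda>x. f x + g x)" by (simp add: g_def)
  obtain N where N: "\<And>n. N \<le> n \<Longrightarrow> H10_inner (wn P n) f = a (bubble P) f"
    using wn_span_eventually[OF assms(1) fs] unfolding eventually_sequentially by blast
  have "norm (H10_inner (wn P n) v - a (bubble P) v) < e" if "N \<le> n" for n
  proof -
    have "H10_inner (wn P n) v - a (bubble P) v = H10_inner (wn P n) g - a (bubble P) g"
      unfolding v using sym_form_right(1)[OF sym_form_H10_inner fH gH wn_H10] sym_form_right(1)[OF sym_form_a fH gH b] N[OF that] by simp
    also have "\<bar>\<dots>\<bar> \<le> K * H10_norm g + K * H10_norm g"
    proof -
      have "\<bar>H10_inner (wn P n) g\<bar> \<le> H10_norm (wn P n) * H10_norm g" by (rule H10_Cauchy_Schwarz[OF wn_H10 gH])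
      also have "\<dots> \<le> K * H10_norm g" using wn_norm[OF assms(1)] H10_norm_nonneg by (intro mult_right_mono) (auto simp: K_def)
      finally have 1: "\<bar>H10_inner (wn P n) g\<bar> \<le> K * H10_norm g" .
      have 2: "\<bar>a (bubble P) g\<bar> \<le> K * H10_norm g" using a_bound[OF b gH] by (simp add: K_def mult.assoc)
      show ?thesis using 1 2 by linarith
    qed
    also have "\<dots> = 2 * K * H10_norm g" by simp
    also have "\<dots> \<le> 2 * K * (e / (2 * K + 1))" using gn K by (intro mult_left_mono) auto
    also have "\<dots> < e" using e K by (simp add: field_simps)
    finally show ?thesis by simp
  qed
  then show "\<exists>no. \<forall>n\<ge>no. norm (H10_inner (wn P n) v - a (bubble P) v) < e" by blast
qed

lemma wn_eq: "wn P n = (\<lambda>z. \<Sum>d<n. 1 * restr (rep_term P d) z)"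
proof
  fix z
  have "{l \<in> KK. total_deg l < n} = (\<Union>d\<in>{..<n}. {l \<in> KK. total_deg l = d})" by auto
  then have "wn P n z = (\<Sum>d<n. \<Sum>l\<in>{l \<in> KK. total_deg l = d}. a (bubble P) (basis_fun G l) * basis_fun G l z)"
    unfolding wn_def by (subst sum.UNION_disjoint[symmetric]) (use card_total_deg(1) in auto)
  then show "wn P n z = (\<Sum>d<n. 1 * restr (rep_term P d) z)"
    by (simp add: rep_term_def[abs_def] restr_sum restr_scale restr_FC)
qed

definition R1 :: real where "R1 = (1 + R0) / 2"

lemma R1: "1 < R1" "R1 < R0" using R0 by (auto simp: R1_def)

lemma poly_series_LapW: "poly_fun m P \<Longrightarrow> poly_series R1 (\<lambda>d. Lap (rep_term P d)) (Lap (W P))"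
  by (rule poly_series_Lap[OF poly_series_W, of _ _ _ "(R1 + R0) / 2"]) (use R1 in auto)

lemma rep_term_H10: "restr (rep_term P d) \<in> H10"
  unfolding rep_term_def[abs_def] restr_sum restr_scale restr_FC by (intro H10_sum gs_H10) auto

text \<open>Each term is integrated by parts against the test function, and both sides of the
  resulting series are summed. In the sense of distributions, the operator applied to the bubble
  multiple is minus the Laplacian of the representer, now an analytic function.\<close>

lemma weak_identity:
  assumes P: "poly_fun m P" and v: "v \<in> test_functions"
  shows "a (bubble P) v = - (LINT z|MO. restr (Lap (W P)) z * v z)"
proof -
  have "H10_inner (restr (rep_term P d)) v = - (LINT z|MO. restr (Lap (rep_term P d)) z * v z)" for d
    unfolding C1_grad_H10_inner[OF poly_fun_derivs(4)[OF poly_fun_rep_term[of d P]] test_C1_grad[OF v]] by (rule poly_fun_weak_laplacian[OF poly_fun_rep_term v])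
  moreover have "H10_inner (wn P n) v = (\<Sum>d<n. 1 * H10_inner (restr (rep_term P d)) v)" for n
    unfolding wn_eq by (rule sym_form_sum[OF sym_form_H10_inner test_H10[OF v] rep_term_H10])
  ultimately have "H10_inner (wn P n) v = (\<Sum>d<n. - (LINT z|MO. restr (Lap (rep_term P d)) z * v z))" for n
    by simp
  then have "(\<lambda>d. - (LINT z|MO. restr (Lap (rep_term P d)) z * v z)) sums a (bubble P) v"
    using wn_limit[OF P test_H10[OF v]] by (simp add: sums_def)
  moreover have "(\<lambda>d. - (LINT z|MO. restr (Lap (rep_term P d)) z * v z)) sums - (LINT z|MO. restr (Lap (W P)) z * v z)"
    by (intro sums_minus poly_series_integral_sums[OF poly_series_LapW[OF P] R1(1) test_bdd_meas[OF v]])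
  ultimately show ?thesis by (rule sums_unique2)
qed

end

section \<open>Analytic functions on ellipses without reference to an expansion\<close>

definition poly_approx :: "real \<Rightarrow> (complex \<Rightarrow> complex \<Rightarrow> complex) \<Rightarrow> bool" where
  "poly_approx R F \<longleftrightarrow> (\<exists>g. poly_series R g F)"

lemma poly_approx_I: "poly_series R g F \<Longrightarrow> poly_approx R F"
  by (auto simp: poly_approx_def)

lemma poly_approx_add: "poly_approx R F \<Longrightarrow> poly_approx R G \<Longrightarrow> poly_approx R (\<lambda>x y. F x y + G x y)"
  unfolding poly_approx_def using poly_series_add by blast

lemma poly_approx_diff: "poly_approx R F \<Longrightarrow> poly_approx R G \<Longrightarrow> poly_approx R (\<lambda>x y. F x y - G x y)"
  unfolding poly_approx_def using poly_series_diff by blast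

lemma poly_approx_mult: "poly_fun n P \<Longrightarrow> poly_approx R F \<Longrightarrow> poly_approx R (\<lambda>x y. P x y * F x y)"
  unfolding poly_approx_def using poly_series_mult by blast

lemma poly_approx_scale: "poly_approx R F \<Longrightarrow> poly_approx R (\<lambda>x y. of_real k * F x y)"
  by (rule poly_approx_mult[OF poly_fun_const[of 0]])

lemma poly_approx_poly_fun: "poly_fun n P \<Longrightarrow> poly_approx R P"
  unfolding poly_approx_def using poly_series_poly_fun by blast

lemma poly_approx_Dx: "poly_approx R F \<Longrightarrow> 1 \<le> R' \<Longrightarrow> R' < R \<Longrightarrow> poly_approx R' (Dx F)"
  and poly_approx_Dy: "poly_approx R F \<Longrightarrow> 1 \<le> R' \<Longrightarrow> R' < R \<Longrightarrow> poly_approx R' (Dy F)"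
  unfolding poly_approx_def using poly_series_Dx poly_series_Dy by blast+

lemma poly_approx_mono: "poly_approx R F \<Longrightarrow> 1 \<le> R' \<Longrightarrow> R' \<le> R \<Longrightarrow> poly_approx R' F"
  unfolding poly_approx_def using poly_series_mono by blast

lemma poly_approx_bdd_meas: "poly_approx R F \<Longrightarrow> 1 < R \<Longrightarrow> bdd_meas (restr F)"
  unfolding poly_approx_def using poly_series_bdd_meas by blast

lemma poly_approx_restr: "poly_approx R F \<Longrightarrow> 1 < R \<Longrightarrow> \<bar>s\<bar> \<le> 1 \<Longrightarrow> \<bar>t\<bar> \<le> 1 \<Longrightarrow> F (of_real s) (of_real t) = of_real (restr F (s, t))"
  unfolding poly_approx_def by (elim exE) (rule poly_series_restr)

lemma poly_approx_continuous_square: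
  assumes "poly_approx R F" "1 < R"
  shows "continuous_on ({-1..1} \<times> {-1..1}) (restr F)"
proof -
  obtain g where g: "poly_series R g F" using assms(1) by (auto simp: poly_approx_def)
  have "continuous_on ({-1..1} \<times> {-1..1}) (\<lambda>z. (\<lambda>p. F (fst p) (snd p)) (of_real (fst z), of_real (snd z)))"
    by (rule continuous_on_compose2[OF poly_series_continuous[OF g]])
      (auto intro!: continuous_intros real_in_ellipse[OF assms(2)])
  then show ?thesis
    unfolding restr_def[abs_def] by (intro continuous_on_Re) simp
qed

lemma Omega_subset_square: "Omega \<subseteq> {-1..1} \<times> {-1..1}"
  by (auto simp: Omega_def)

lemma poly_approx_continuous_Omega: "poly_approx R F \<Longrightarrow> 1 < R \<Longrightarrow> continuous_on Omega (restr F)"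
  by (rule continuous_on_subset[OF poly_approx_continuous_square Omega_subset_square])

lemma zero_islimpt_reals: "0 islimpt complex_of_real ` {0<..<1}"
  unfolding islimpt_approachable
proof (intro allI impI)
  fix e :: real assume e: "0 < e"
  define t where "t = min (1/2) (e/2)"
  have t: "0 < t" "t < 1" "t < e" using e by (auto simp: t_def)
  then show "\<exists>x'\<in>complex_of_real ` {0<..<1}. x' \<noteq> 0 \<and> dist x' 0 < e" by (intro bexI[of _ "of_real t"]) (auto simp: dist_norm)
qed

text \<open>Real points accumulate inside the ellipse, so identities found almost everywhere on the
  square continue to the complex points of the diamond at the corner.\<close>

lemma poly_approx_eq_real_imp_eq:
  assumes F: "poly_approx R F" "poly_approx R G" and R: "1 < R'" "R' < R"
    and eq: "\<And>z. z \<in> Omega \<Longrightarrow> restr F z = restr G z"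
    and xy: "x \<in> ellipse R'" "y \<in> ellipse R'"
  shows "F x y = G x y"
proof -
  obtain f where f: "poly_series R f F" using F(1) by (auto simp: poly_approx_def)
  obtain g where g: "poly_series R g G" using F(2) by (auto simp: poly_approx_def)
  let ?A = "complex_of_real ` {0<..<1}"
  have sub: "?A \<subseteq> ellipse R'" using R by (auto intro!: real_in_ellipse)
  have z: "0 \<in> ellipse R'" using real_in_ellipse[of R' 0] R by simp
  note lim = zero_islimpt_reals
  have "F x y - G x y = 0"
  proof (rule identity_ellipse[where F = "\<lambda>x y. F x y - G x y", OF _ _ sub sub z z lim lim _ xy])
    show "(\<lambda>x. F x y - G x y) holomorphic_on ellipse R'" if "y \<in> ellipse R'" for y
      using R that by (intro holomorphic_intros poly_series_holomorphic(1)[OF f] poly_series_holomorphic(1)[OF g]) auto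
    show "(\<lambda>y. F x y - G x y) holomorphic_on ellipse R'" if "x \<in> ellipse R'" for x
      using R that by (intro holomorphic_intros poly_series_holomorphic(2)[OF f] poly_series_holomorphic(2)[OF g]) auto
    fix a b assume "a \<in> ?A" "b \<in> ?A"
    then obtain s t where st: "a = of_real s" "b = of_real t" "0 < s" "s < 1" "0 < t" "t < 1" by auto
    have "F a b = of_real (restr F (s, t))" "G a b = of_real (restr G (s, t))"
      unfolding st(1,2) using poly_approx_restr[OF F(1), of s t] poly_approx_restr[OF F(2), of s t] R st by auto
    then show "F a b - G a b = 0" using eq[of "(s, t)"] st by (simp add: Omega_def)
  qed
  then show ?thesis by simp
qed

lemma restr_poly_fun_mult: "poly_fun n P \<Longrightarrow> restr (\<lambda>x y. P x y * F x y) z = restr P z * restr F z"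
  by (simp add: restr_def poly_fun_real)

lemma poly_fun_D_mult:
  assumes "poly_fun n F" "poly_fun m G"
  shows "Dx (\<lambda>x y. F x y * G x y) = (\<lambda>x y. F x y * Dx G x y + Dx F x y * G x y)"
    "Dy (\<lambda>x y. F x y * G x y) = (\<lambda>x y. F x y * Dy G x y + Dy F x y * G x y)"
  using lines_Dx(3,4)[OF lines_mult[OF poly_fun_derivs(3)[OF assms(1)] poly_fun_derivs(3)[OF assms(2)]]] by simp_all

lemma poly_fun_D_add:
  assumes "poly_fun n F" "poly_fun m G"
  shows "Dx (\<lambda>x y. F x y + G x y) = (\<lambda>x y. Dx F x y + Dx G x y)"
    "Dy (\<lambda>x y. F x y + G x y) = (\<lambda>x y. Dy F x y + Dy G x y)"
  using lines_Dx(3,4)[OF lines_add[OF poly_fun_derivs(3)[OF assms(1)] poly_fun_derivs(3)[OF assms(2)]]] by simp_all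

lemma poly_fun_Lap_mult:
  assumes "poly_fun n F" "poly_fun m G"
  shows "Lap (\<lambda>x y. F x y * G x y) x y = F x y * Lap G x y + 2 * (Dx F x y * Dx G x y + Dy F x y * Dy G x y) + Lap F x y * G x y"
proof -
  note F = poly_fun_derivs(1,2)[OF assms(1)] and G = poly_fun_derivs(1,2)[OF assms(2)]
  show ?thesis
    unfolding Lap_def poly_fun_D_mult[OF assms] poly_fun_D_add(1)[OF poly_fun_mult[OF assms(1) G(1)] poly_fun_mult[OF F(1) assms(2)]]
      poly_fun_D_add(2)[OF poly_fun_mult[OF assms(1) G(2)] poly_fun_mult[OF F(2) assms(2)]]
      poly_fun_D_mult(1)[OF assms(1) G(1)] poly_fun_D_mult(1)[OF F(1) assms(2)] poly_fun_D_mult(2)[OF assms(1) G(2)] poly_fun_D_mult(2)[OF F(2) assms(2)]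
    by (simp add: algebra_simps)
qed

lemma poly_fun_basic: "poly_fun 0 (\<lambda>x y. 1)" "poly_fun 1 (\<lambda>x y. x)" "poly_fun 1 (\<lambda>x y. y)" "poly_fun 2 (\<lambda>x y. x * x)"
proof -
  show "poly_fun 0 (\<lambda>x y. 1)" by (rule poly_fun_const[of 0 1, unfolded of_real_1])
  show "poly_fun 1 (\<lambda>x y. x)" unfolding One_nat_def by (rule poly_fun_X)
  show "poly_fun 1 (\<lambda>x y. y)" unfolding One_nat_def by (rule poly_fun_Y)
  show "poly_fun 2 (\<lambda>x y. x * x)" using poly_fun_mult[OF poly_fun_X[of 0] poly_fun_X[of 0]] by (simp only: add_Suc add_0 numeral_2_eq_2)
qed

lemma D_basic: "Dx (\<lambda>x y. 1) = (\<lambda>x y. 0)" "Dy (\<lambda>x y. 1) = (\<lambda>x y. 0)" "Dx (\<lambda>x y. x) = (\<lambda>x y. 1)" "Dy (\<lambda>x y. x) = (\<lambda>x y. 0)"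
   "Dx (\<lambda>x y. y) = (\<lambda>x y. 0)" "Dy (\<lambda>x y. y) = (\<lambda>x y. 1)"
  by (rule lines_Dx(3)[OF lines_const] lines_Dx(4)[OF lines_const] lines_Dx(3)[OF lines_X] lines_Dx(4)[OF lines_X] lines_Dx(3)[OF lines_Y] lines_Dx(4)[OF lines_Y])+

lemma D_XX: "Dx (\<lambda>x y. x * x) = (\<lambda>x y. 2 * x)" "Dy (\<lambda>x y. x * x) = (\<lambda>x y. 0)"
  using lines_Dx(3,4)[OF lines_mult[OF lines_X lines_X]] by (simp_all add: fun_eq_iff)

lemma restr_basic: "restr (\<lambda>x y. x * x) z = fst z * fst z" "restr (\<lambda>x y. 2 * x) z = 2 * fst z"
  by (simp_all add: restr_def)

section \<open>Coefficients of the operator from commutators\<close>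

context decay_basis
begin

text \<open>The integrand of \<open>a(bP, Qv)\<close> for polynomials \<open>P\<close>, \<open>Q\<close> and a test function \<open>v\<close>.\<close>

definition Tint :: "(complex \<Rightarrow> complex \<Rightarrow> complex) \<Rightarrow> (complex \<Rightarrow> complex \<Rightarrow> complex) \<Rightarrow> plane_fun \<Rightarrow> plane_fun" where
  "Tint P Q v z = \<nu> z * ((restr Bc z * restr (Dx P) z + restr (Dx Bc) z * restr P z) * (restr Q z * fst (grad v z) + restr (Dx Q) z * v z)
      + (restr Bc z * restr (Dy P) z + restr (Dy Bc) z * restr P z) * (restr Q z * snd (grad v z) + restr (Dy Q) z * v z))
     + \<sigma> z * ((restr Bc z * restr P z) * (restr Q z * v z))"

abbreviation DD where "DD P \<equiv> Lap (W P)"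

lemma poly_fun_bdd_meas: "poly_fun n P \<Longrightarrow> bdd_meas (restr P)"
  by (intro bdd_meas_continuous C1_grad_continuous[OF poly_fun_derivs(4)])

lemma Tint_bdd_meas:
  assumes "poly_fun n P" "poly_fun m Q" "v \<in> test_functions"
  shows "bdd_meas (Tint P Q v)"
  unfolding Tint_def[abs_def]
  by (intro bdd_meas_add bdd_meas_mult coef test_bdd_meas[OF assms(3)] test_grad_bdd_meas[OF assms(3)]
    poly_fun_bdd_meas[OF poly_fun_Bc] poly_fun_bdd_meas[OF assms(1)] poly_fun_bdd_meas[OF assms(2)] poly_fun_bdd_meas[OF poly_fun_derivs(1)[OF assms(1)]] poly_fun_bdd_meas[OF poly_fun_derivs(1)[OF assms(2)]]
    poly_fun_bdd_meas[OF poly_fun_derivs(2)[OF assms(1)]] poly_fun_bdd_meas[OF poly_fun_derivs(2)[OF assms(2)]] poly_fun_bdd_meas[OF poly_fun_derivs(1)[OF poly_fun_Bc]] poly_fun_bdd_meas[OF poly_fun_derivs(2)[OF poly_fun_Bc]])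

lemma DD_bdd_meas: "poly_fun n P \<Longrightarrow> bdd_meas (restr (DD P))"
  by (rule poly_approx_bdd_meas[OF poly_approx_I[OF poly_series_LapW] R1(1)])

text \<open>A polynomial times a test function is a test function. Polynomials can thus be moved
  between the two arguments of the form, which turns commutators into differences of
  \<open>Tint\<close> terms.\<close>

lemma DD_Tint:
  assumes "poly_fun n P" "poly_fun m Q" "v \<in> test_functions"
  shows "(LINT z|MO. restr (DD P) z * (restr Q z * v z)) = - (LINT z|MO. Tint P Q v z)"
proof -
  have "a (bubble P) (\<lambda>z. restr Q z * v z) = (LINT z|MO. Tint P Q v z)"
    unfolding bubble_def restr_mult[OF poly_fun_Bc assms(1)] Tint_def
    by (rule C1_grad_a_form[OF C1_grad_mult[OF poly_fun_derivs(4)[OF poly_fun_Bc] poly_fun_derivs(4)[OF assms(1)]] C1_grad_mult[OF poly_fun_derivs(4)[OF assms(2)] test_C1_grad[OF assms(3)]] coef(1,2)])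
  then show ?thesis using weak_identity[OF assms(1) poly_fun_test[OF assms(2,3)]] by simp
qed

text \<open>The operator \<open>DD = - \<L>(b \<cdot>)\<close> has order two; its coefficients come from commutators with the
  coordinates, \<open>CX = [DD, x] 1\<close>, \<open>CY = [DD, y] 1\<close> and \<open>NN = [[DD, x], x] 1 / 2\<close>, the last being \<open>\<nu>b\<close>.\<close>

definition CX where "CX x y = DD (\<lambda>x y. x) x y - x * DD (\<lambda>x y. 1) x y"
definition CY where "CY x y = DD (\<lambda>x y. y) x y - y * DD (\<lambda>x y. 1) x y"
definition NN where "NN x y = of_real (1/2) * (DD (\<lambda>x y. x * x) x y - of_real 2 * (x * DD (\<lambda>x y. x) x y) + x * x * DD (\<lambda>x y. 1) x y)"

lemma poly_approx_DD: "poly_fun n P \<Longrightarrow> poly_approx R1 (DD P)"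
  by (rule poly_approx_I[OF poly_series_LapW])

lemma poly_approx_CN: "poly_approx R1 CX" "poly_approx R1 CY" "poly_approx R1 NN"
  unfolding CX_def[abs_def] CY_def[abs_def] NN_def[abs_def]
  by (intro poly_approx_diff poly_approx_add poly_approx_scale poly_approx_mult[OF poly_fun_basic(2)] poly_approx_mult[OF poly_fun_basic(3)] poly_approx_mult[OF poly_fun_basic(4)] poly_approx_DD[OF poly_fun_basic(1)] poly_approx_DD[OF poly_fun_basic(2)] poly_approx_DD[OF poly_fun_basic(3)] poly_approx_DD[OF poly_fun_basic(4)])+

lemma restr_CN:
  "restr CX z = restr (DD (\<lambda>x y. x)) z - fst z * restr (DD (\<lambda>x y. 1)) z"
  "restr CY z = restr (DD (\<lambda>x y. y)) z - snd z * restr (DD (\<lambda>x y. 1)) z"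
  "restr NN z = 1/2 * (restr (DD (\<lambda>x y. x * x)) z - 2 * (fst z * restr (DD (\<lambda>x y. x)) z) + fst z * fst z * restr (DD (\<lambda>x y. 1)) z)"
  by (simp_all add: restr_def CX_def CY_def NN_def)

lemma integrable_Tint: "poly_fun n P \<Longrightarrow> poly_fun m Q \<Longrightarrow> v \<in> test_functions \<Longrightarrow> integrable MO (Tint P Q v)"
  by (rule bdd_meas_integrable[OF Tint_bdd_meas])

lemma integrable_DD: "poly_fun n P \<Longrightarrow> poly_fun m Q \<Longrightarrow> v \<in> test_functions \<Longrightarrow> integrable MO (\<lambda>z. restr (DD P) z * (restr Q z * v z))"
  by (intro bdd_meas_integrable bdd_meas_mult DD_bdd_meas poly_fun_bdd_meas test_bdd_meas)

text \<open>In this symmetric combination of multipliers everything cancels except the product of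
  the derivatives of the two factors x, that is, \<nu> b. No derivative of \<nu> appears.\<close>

lemma NN_weak:
  assumes v: "v \<in> test_functions"
  shows "(LINT z|MO. restr NN z * v z) = (LINT z|MO. \<nu> z * restr Bc z * v z)"
proof -
  let ?O = "\<lambda>x y::complex. 1::complex" and ?X = "\<lambda>x y::complex. x" and ?XX = "\<lambda>x y::complex. x * x"
  note i = integrable_DD[OF poly_fun_basic(4) poly_fun_basic(1) v] integrable_DD[OF poly_fun_basic(2) poly_fun_basic(2) v] integrable_DD[OF poly_fun_basic(1) poly_fun_basic(4) v]
  note j = integrable_Tint[OF poly_fun_basic(4) poly_fun_basic(1) v] integrable_Tint[OF poly_fun_basic(2) poly_fun_basic(2) v] integrable_Tint[OF poly_fun_basic(1) poly_fun_basic(4) v]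
  have "(LINT z|MO. restr NN z * v z) = (LINT z|MO. 1/2 * (restr (DD ?XX) z * (restr ?O z * v z)) - restr (DD ?X) z * (restr ?X z * v z) + 1/2 * (restr (DD ?O) z * (restr ?XX z * v z)))"
    by (intro Bochner_Integration.integral_cong refl) (simp add: restr_CN restr_01 restr_X restr_basic algebra_simps)
  also have "\<dots> = 1/2 * (LINT z|MO. restr (DD ?XX) z * (restr ?O z * v z)) - (LINT z|MO. restr (DD ?X) z * (restr ?X z * v z)) + 1/2 * (LINT z|MO. restr (DD ?O) z * (restr ?XX z * v z))"
    using i by simp
  also have "\<dots> = 1/2 * - (LINT z|MO. Tint ?XX ?O v z) - - (LINT z|MO. Tint ?X ?X v z) + 1/2 * - (LINT z|MO. Tint ?O ?XX v z)"
    by (simp only: DD_Tint[OF poly_fun_basic(4) poly_fun_basic(1) v] DD_Tint[OF poly_fun_basic(2) poly_fun_basic(2) v] DD_Tint[OF poly_fun_basic(1) poly_fun_basic(4) v])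
  also have "\<dots> = (LINT z|MO. Tint ?X ?X v z - 1/2 * Tint ?XX ?O v z - 1/2 * Tint ?O ?XX v z)"
    using j by simp
  also have "\<dots> = (LINT z|MO. \<nu> z * restr Bc z * v z)"
    by (intro Bochner_Integration.integral_cong refl)
      (simp add: Tint_def D_basic D_XX restr_01 restr_X restr_basic, simp add: field_simps)
  finally show ?thesis .
qed

lemma NN_AE: "AE z in MO. restr NN z = \<nu> z * restr Bc z"
proof (rule fundamental_lemma_eq)
  show "integrable MO (restr NN)" by (rule bdd_meas_integrable[OF poly_approx_bdd_meas[OF poly_approx_CN(3) R1(1)]])
  show "integrable MO (\<lambda>z. \<nu> z * restr Bc z)" by (intro bdd_meas_integrable bdd_meas_mult coef poly_fun_bdd_meas[OF poly_fun_Bc])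
  fix \<psi> assume "\<psi> \<in> test_functions"
  from NN_weak[OF this] show "(LINT z|MO. \<psi> z * restr NN z) = (LINT z|MO. \<psi> z * (\<nu> z * restr Bc z))"
    by (simp add: mult_ac)
qed

text \<open>Commuting with a coordinate removes the reaction term and all terms without a derivative
  of that coordinate, in whichever argument the coordinate stands. The extra polynomial
  \<open>Q\<close> is needed when the coefficients are reassembled in
  \<open>EE_real\<close>.\<close>

lemma C_weak:
  assumes Q: "poly_fun n Q" and v: "v \<in> test_functions"
  shows "(LINT z|MO. restr CX z * (restr Q z * v z)) = - (LINT z|MO. \<nu> z * (restr Bc z * (restr Q z * fst (grad v z) + restr (Dx Q) z * v z) - restr (Dx Bc) z * (restr Q z * v z)))"
    "(LINT z|MO. restr CY z * (restr Q z * v z)) = - (LINT z|MO. \<nu> z * (restr Bc z * (restr Q z * snd (grad v z) + restr (Dy Q) z * v z) - restr (Dy Bc) z * (restr Q z * v z)))"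
proof -
  let ?O = "\<lambda>x y::complex. 1::complex" and ?X = "\<lambda>x y::complex. x" and ?XQ = "\<lambda>x y::complex. x * Q x y"
    and ?Y = "\<lambda>x y::complex. y" and ?YQ = "\<lambda>x y::complex. y * Q x y"
  note XQ = poly_fun_mult[OF poly_fun_basic(2) Q] and YQ = poly_fun_mult[OF poly_fun_basic(3) Q]
  note i = integrable_DD[OF poly_fun_basic(2) Q v] integrable_DD[OF poly_fun_basic(1) XQ v] integrable_DD[OF poly_fun_basic(3) Q v] integrable_DD[OF poly_fun_basic(1) YQ v]
  note j = integrable_Tint[OF poly_fun_basic(2) Q v] integrable_Tint[OF poly_fun_basic(1) XQ v] integrable_Tint[OF poly_fun_basic(3) Q v] integrable_Tint[OF poly_fun_basic(1) YQ v]
  note dX = poly_fun_D_mult[OF poly_fun_basic(2) Q] and dY = poly_fun_D_mult[OF poly_fun_basic(3) Q]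
  have "(LINT z|MO. restr CX z * (restr Q z * v z)) = (LINT z|MO. restr (DD ?X) z * (restr Q z * v z) - restr (DD ?O) z * (restr ?XQ z * v z))"
    by (intro Bochner_Integration.integral_cong refl) (simp add: restr_CN restr_poly_fun_mult[OF poly_fun_basic(2)] restr_X algebra_simps)
  also have "\<dots> = - (LINT z|MO. Tint ?X Q v z) - - (LINT z|MO. Tint ?O ?XQ v z)"
    using i by (simp add: DD_Tint[OF poly_fun_basic(2) Q v] DD_Tint[OF poly_fun_basic(1) XQ v])
  also have "\<dots> = - (LINT z|MO. Tint ?X Q v z - Tint ?O ?XQ v z)" using j by simp
  also have "(LINT z|MO. Tint ?X Q v z - Tint ?O ?XQ v z) = (LINT z|MO. \<nu> z * (restr Bc z * (restr Q z * fst (grad v z) + restr (Dx Q) z * v z) - restr (Dx Bc) z * (restr Q z * v z)))"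
    by (intro Bochner_Integration.integral_cong refl)
      (simp add: Tint_def dX D_basic restr_01 restr_X restr_add restr_poly_fun_mult[OF poly_fun_basic(2)] algebra_simps)
  finally show "(LINT z|MO. restr CX z * (restr Q z * v z)) = - (LINT z|MO. \<nu> z * (restr Bc z * (restr Q z * fst (grad v z) + restr (Dx Q) z * v z) - restr (Dx Bc) z * (restr Q z * v z)))" .
  have "(LINT z|MO. restr CY z * (restr Q z * v z)) = (LINT z|MO. restr (DD ?Y) z * (restr Q z * v z) - restr (DD ?O) z * (restr ?YQ z * v z))"
    by (intro Bochner_Integration.integral_cong refl) (simp add: restr_CN restr_poly_fun_mult[OF poly_fun_basic(3)] restr_Y algebra_simps)
  also have "\<dots> = - (LINT z|MO. Tint ?Y Q v z) - - (LINT z|MO. Tint ?O ?YQ v z)"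
    using i by (simp add: DD_Tint[OF poly_fun_basic(3) Q v] DD_Tint[OF poly_fun_basic(1) YQ v])
  also have "\<dots> = - (LINT z|MO. Tint ?Y Q v z - Tint ?O ?YQ v z)" using j by simp
  also have "(LINT z|MO. Tint ?Y Q v z - Tint ?O ?YQ v z) = (LINT z|MO. \<nu> z * (restr Bc z * (restr Q z * snd (grad v z) + restr (Dy Q) z * v z) - restr (Dy Bc) z * (restr Q z * v z)))"
    by (intro Bochner_Integration.integral_cong refl)
      (simp add: Tint_def dY D_basic restr_01 restr_Y restr_add restr_poly_fun_mult[OF poly_fun_basic(3)] algebra_simps)
  finally show "(LINT z|MO. restr CY z * (restr Q z * v z)) = - (LINT z|MO. \<nu> z * (restr Bc z * (restr Q z * snd (grad v z) + restr (Dy Q) z * v z) - restr (Dy Bc) z * (restr Q z * v z)))" .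
qed

definition R2 :: real where "R2 = (1 + R1) / 2"

lemma R2: "1 < R2" "R2 < R1" using R1 by (auto simp: R2_def)

lemma poly_approx_DN: "poly_approx R2 (Dx NN)" "poly_approx R2 (Dy NN)"
  using poly_approx_Dx[OF poly_approx_CN(3)] poly_approx_Dy[OF poly_approx_CN(3)] R2 by auto

lemma int_cong_NN:
  assumes "bdd_meas h"
  shows "(LINT z|MO. \<nu> z * restr Bc z * h z) = (LINT z|MO. restr NN z * h z)"
proof (rule integral_cong_AE)
  show "(\<lambda>z. \<nu> z * restr Bc z * h z) \<in> borel_measurable MO" "(\<lambda>z. restr NN z * h z) \<in> borel_measurable MO"
    using assms coef poly_fun_bdd_meas[OF poly_fun_Bc] poly_approx_bdd_meas[OF poly_approx_CN(3) R1(1)] by (auto simp: bdd_meas_def)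
  show "AE z in MO. \<nu> z * restr Bc z * h z = restr NN z * h z" using NN_AE by eventually_elim simp
qed

text \<open>Strongly, the first order coefficient is the derivative of \<nu> b plus \<nu> times the
  derivative of b. The derivative falls on \<open>NN\<close>, the analytic representative of \<nu>
  b, through integration by parts against the test function.\<close>

lemma C_AE: "AE z in MO. restr CX z = restr (Dx NN) z + \<nu> z * restr (Dx Bc) z"
  "AE z in MO. restr CY z = restr (Dy NN) z + \<nu> z * restr (Dy Bc) z"
proof -
  obtain g where g: "poly_series R1 g NN" using poly_approx_CN(3) by (auto simp: poly_approx_def)
  note b = coef(1) poly_fun_bdd_meas[OF poly_fun_Bc] poly_fun_bdd_meas[OF poly_fun_derivs(1)[OF poly_fun_Bc]] poly_fun_bdd_meas[OF poly_fun_derivs(2)[OF poly_fun_Bc]] poly_approx_bdd_meas[OF poly_approx_CN(1) R1(1)]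
    poly_approx_bdd_meas[OF poly_approx_CN(2) R1(1)] poly_approx_bdd_meas[OF poly_approx_DN(1) R2(1)] poly_approx_bdd_meas[OF poly_approx_DN(2) R2(1)]
  show "AE z in MO. restr CX z = restr (Dx NN) z + \<nu> z * restr (Dx Bc) z"
  proof (rule fundamental_lemma_eq)
    show "integrable MO (restr CX)" "integrable MO (\<lambda>z. restr (Dx NN) z + \<nu> z * restr (Dx Bc) z)"
      by (intro bdd_meas_integrable bdd_meas_add bdd_meas_mult b)+
    fix v assume v: "v \<in> test_functions"
    note bv = test_bdd_meas[OF v] test_grad_bdd_meas[OF v]
    have "(LINT z|MO. v z * restr CX z) = - (LINT z|MO. \<nu> z * restr Bc z * fst (grad v z) - \<nu> z * restr (Dx Bc) z * v z)"
      using C_weak(1)[OF poly_fun_basic(1) v] by (simp add: restr_01 D_basic algebra_simps)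
    also have "\<dots> = - (LINT z|MO. \<nu> z * restr Bc z * fst (grad v z)) + (LINT z|MO. \<nu> z * restr (Dx Bc) z * v z)"
      by (subst Bochner_Integration.integral_diff) (auto intro!: bdd_meas_integrable bdd_meas_mult b bv)
    also have "(LINT z|MO. \<nu> z * restr Bc z * fst (grad v z)) = - (LINT z|MO. restr (Dx NN) z * v z)"
      unfolding int_cong_NN[OF bv(2)] by (rule poly_series_parts(1)[OF g R2 v])
    also have "- (- (LINT z|MO. restr (Dx NN) z * v z)) + (LINT z|MO. \<nu> z * restr (Dx Bc) z * v z) = (LINT z|MO. restr (Dx NN) z * v z + \<nu> z * restr (Dx Bc) z * v z)"
      by (subst Bochner_Integration.integral_add) (auto intro!: bdd_meas_integrable bdd_meas_mult b bv)
    finally show "(LINT z|MO. v z * restr CX z) = (LINT z|MO. v z * (restr (Dx NN) z + \<nu> z * restr (Dx Bc) z))"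
      by (simp add: algebra_simps)
  qed
  show "AE z in MO. restr CY z = restr (Dy NN) z + \<nu> z * restr (Dy Bc) z"
  proof (rule fundamental_lemma_eq)
    show "integrable MO (restr CY)" "integrable MO (\<lambda>z. restr (Dy NN) z + \<nu> z * restr (Dy Bc) z)"
      by (intro bdd_meas_integrable bdd_meas_add bdd_meas_mult b)+
    fix v assume v: "v \<in> test_functions"
    note bv = test_bdd_meas[OF v] test_grad_bdd_meas[OF v]
    have "(LINT z|MO. v z * restr CY z) = - (LINT z|MO. \<nu> z * restr Bc z * snd (grad v z) - \<nu> z * restr (Dy Bc) z * v z)"
      using C_weak(2)[OF poly_fun_basic(1) v] by (simp add: restr_01 D_basic algebra_simps)
    also have "\<dots> = - (LINT z|MO. \<nu> z * restr Bc z * snd (grad v z)) + (LINT z|MO. \<nu> z * restr (Dy Bc) z * v z)"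
      by (subst Bochner_Integration.integral_diff) (auto intro!: bdd_meas_integrable bdd_meas_mult b bv)
    also have "(LINT z|MO. \<nu> z * restr Bc z * snd (grad v z)) = - (LINT z|MO. restr (Dy NN) z * v z)"
      unfolding int_cong_NN[OF bv(3)] by (rule poly_series_parts(2)[OF g R2 v])
    also have "- (- (LINT z|MO. restr (Dy NN) z * v z)) + (LINT z|MO. \<nu> z * restr (Dy Bc) z * v z) = (LINT z|MO. restr (Dy NN) z * v z + \<nu> z * restr (Dy Bc) z * v z)"
      by (subst Bochner_Integration.integral_add) (auto intro!: bdd_meas_integrable bdd_meas_mult b bv)
    finally show "(LINT z|MO. v z * restr CY z) = (LINT z|MO. v z * (restr (Dy NN) z + \<nu> z * restr (Dy Bc) z))"
      by (simp add: algebra_simps)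
  qed
qed

lemma continuous_poly_fun_Omega: "poly_fun n P \<Longrightarrow> continuous_on Omega (restr P)"
  by (rule continuous_on_subset[OF C1_grad_continuous[OF poly_fun_derivs(4)] subset_UNIV])

lemma AE_eq_Omega:
  assumes "continuous_on Omega f" "continuous_on Omega g" "AE z in MO. f z = (g z :: real)" "z \<in> Omega"
  shows "f z = g z"
proof -
  have "AE z in MO. f z - g z = 0" using assms(3) by eventually_elim simp
  from AE_zero_imp_zero[OF continuous_on_diff[OF assms(1,2)] this assms(4)] show ?thesis by simp
qed

text \<open>Multiplication by b replaces the remaining \<nu> b by \<open>NN\<close>. Only functions
  continuous in the open square are left, so the identity holds everywhere and not just almost
  everywhere.\<close>

lemma C_eq:
  assumes "z \<in> Omega"
  shows "restr Bc z * restr CX z = restr Bc z * restr (Dx NN) z + restr NN z * restr (Dx Bc) z"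
    "restr Bc z * restr CY z = restr Bc z * restr (Dy NN) z + restr NN z * restr (Dy Bc) z"
proof -
  note c = continuous_poly_fun_Omega[OF poly_fun_Bc] continuous_poly_fun_Omega[OF poly_fun_derivs(1)[OF poly_fun_Bc]] continuous_poly_fun_Omega[OF poly_fun_derivs(2)[OF poly_fun_Bc]]
    poly_approx_continuous_Omega[OF poly_approx_CN(1) R1(1)] poly_approx_continuous_Omega[OF poly_approx_CN(2) R1(1)] poly_approx_continuous_Omega[OF poly_approx_CN(3) R1(1)]
    poly_approx_continuous_Omega[OF poly_approx_DN(1) R2(1)] poly_approx_continuous_Omega[OF poly_approx_DN(2) R2(1)]
  have "AE z in MO. restr Bc z * restr CX z = restr Bc z * restr (Dx NN) z + restr NN z * restr (Dx Bc) z"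
    using NN_AE C_AE(1) by eventually_elim (simp add: algebra_simps)
  then show "restr Bc z * restr CX z = restr Bc z * restr (Dx NN) z + restr NN z * restr (Dx Bc) z"
    by (intro AE_eq_Omega[OF _ _ _ assms] continuous_intros c)
  have "AE z in MO. restr Bc z * restr CY z = restr Bc z * restr (Dy NN) z + restr NN z * restr (Dy Bc) z"
    using NN_AE C_AE(2) by eventually_elim (simp add: algebra_simps)
  then show "restr Bc z * restr CY z = restr Bc z * restr (Dy NN) z + restr NN z * restr (Dy Bc) z"
    by (intro AE_eq_Omega[OF _ _ _ assms] continuous_intros c)
qed

definition EE where
  "EE P x y = P x y * DD (\<lambda>x y. 1) x y + Dx P x y * CX x y + Dy P x y * CY x y + Lap P x y * NN x y"

lemma poly_approx_EE: assumes "poly_fun n P" shows "poly_approx R1 (EE P)"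
  unfolding EE_def[abs_def]
  by (intro poly_approx_add poly_approx_mult[OF assms] poly_approx_mult[OF poly_fun_derivs(1)[OF assms]] poly_approx_mult[OF poly_fun_derivs(2)[OF assms]] poly_approx_mult[OF poly_fun_Lap[OF assms]] poly_approx_CN poly_approx_DD[OF poly_fun_basic(1)])

text \<open>A second order operator is determined by its action on \<open>1, x, y, x\<^sup>2\<close> and the identity of its second order
  coefficients; here in the weak form that needs no derivative of \<open>\<nu>\<close>.\<close>

lemma EE_real:
  assumes P: "poly_fun n P" and z: "z \<in> Omega"
  shows "restr (EE P) z = restr (DD P) z"
proof (rule AE_eq_Omega[OF poly_approx_continuous_Omega[OF poly_approx_EE[OF P] R1(1)] poly_approx_continuous_Omega[OF poly_approx_DD[OF P] R1(1)] _ z])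
  note P1 = poly_fun_derivs(1,2)[OF P]
  have rpE: "restr (EE P) z = restr P z * restr (DD (\<lambda>x y. 1)) z + restr (Dx P) z * restr CX z + restr (Dy P) z * restr CY z + restr (Lap P) z * restr NN z" for z
    unfolding EE_def[abs_def] restr_add restr_poly_fun_mult[OF P] restr_poly_fun_mult[OF P1(1)] restr_poly_fun_mult[OF P1(2)] restr_poly_fun_mult[OF poly_fun_Lap[OF P]] ..
  note b = coef(1,2) poly_fun_bdd_meas[OF P] poly_fun_bdd_meas[OF P1(1)] poly_fun_bdd_meas[OF P1(2)] poly_fun_bdd_meas[OF poly_fun_Lap[OF P]] DD_bdd_meas[OF poly_fun_basic(1)] poly_approx_bdd_meas[OF poly_approx_CN(1) R1(1)]
    poly_approx_bdd_meas[OF poly_approx_CN(2) R1(1)] poly_approx_bdd_meas[OF poly_approx_CN(3) R1(1)] poly_fun_bdd_meas[OF poly_fun_Bc] poly_fun_bdd_meas[OF poly_fun_derivs(1)[OF poly_fun_Bc]] poly_fun_bdd_meas[OF poly_fun_derivs(2)[OF poly_fun_Bc]]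
    poly_fun_bdd_meas[OF poly_fun_derivs(1)[OF P1(1)]] poly_fun_bdd_meas[OF poly_fun_derivs(2)[OF P1(2)]]
  show "AE z in MO. restr (EE P) z = restr (DD P) z"
  proof (rule fundamental_lemma_eq)
    show "integrable MO (restr (EE P))" "integrable MO (restr (DD P))"
      by (intro bdd_meas_integrable poly_approx_bdd_meas[OF poly_approx_EE[OF P] R1(1)] DD_bdd_meas[OF P])+
    fix v assume v: "v \<in> test_functions"
    note bv = test_bdd_meas[OF v] test_grad_bdd_meas[OF v]
    let ?cx = "\<lambda>z. \<nu> z * (restr Bc z * (restr (Dx P) z * fst (grad v z) + restr (Dx (Dx P)) z * v z) - restr (Dx Bc) z * (restr (Dx P) z * v z))"
    let ?cy = "\<lambda>z. \<nu> z * (restr Bc z * (restr (Dy P) z * snd (grad v z) + restr (Dy (Dy P)) z * v z) - restr (Dy Bc) z * (restr (Dy P) z * v z))"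
    have ic: "integrable MO ?cx" "integrable MO ?cy" "integrable MO (\<lambda>z. \<nu> z * restr Bc z * (restr (Lap P) z * v z))"
      by (intro bdd_meas_integrable bdd_meas_mult bdd_meas_diff bdd_meas_add b bv)+
    have "(LINT z|MO. v z * restr (EE P) z) = (LINT z|MO. restr (DD (\<lambda>x y. 1)) z * (restr P z * v z) + restr CX z * (restr (Dx P) z * v z) + restr CY z * (restr (Dy P) z * v z) + restr NN z * (restr (Lap P) z * v z))"
      by (intro Bochner_Integration.integral_cong refl) (simp add: rpE algebra_simps)
    also have "\<dots> = (LINT z|MO. restr (DD (\<lambda>x y. 1)) z * (restr P z * v z)) + (LINT z|MO. restr CX z * (restr (Dx P) z * v z)) + (LINT z|MO. restr CY z * (restr (Dy P) z * v z)) + (LINT z|MO. restr NN z * (restr (Lap P) z * v z))"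
    proof -
      have i: "integrable MO (\<lambda>z. restr (DD (\<lambda>x y. 1)) z * (restr P z * v z))" "integrable MO (\<lambda>z. restr CX z * (restr (Dx P) z * v z))"
        "integrable MO (\<lambda>z. restr CY z * (restr (Dy P) z * v z))" "integrable MO (\<lambda>z. restr NN z * (restr (Lap P) z * v z))"
        by (intro bdd_meas_integrable bdd_meas_mult b bv)+
      show ?thesis using i by simp
    qed
    also have "\<dots> = - (LINT z|MO. Tint (\<lambda>x y. 1) P v z) + - (LINT z|MO. ?cx z) + - (LINT z|MO. ?cy z) + (LINT z|MO. \<nu> z * restr Bc z * (restr (Lap P) z * v z))"
      unfolding DD_Tint[OF poly_fun_basic(1) P v] C_weak(1)[OF P1(1) v] C_weak(2)[OF P1(2) v] int_cong_NN[OF bdd_meas_mult[OF b(6) bv(1)]] ..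
    also have "\<dots> = - (LINT z|MO. Tint (\<lambda>x y. 1) P v z + ?cx z + ?cy z - \<nu> z * restr Bc z * (restr (Lap P) z * v z))"
      using ic integrable_Tint[OF poly_fun_basic(1) P v] by simp
    \<comment> \<open>Pointwise, the two commutator integrands add the terms in which P carries the
      derivative and remove those in which it is differentiated as a multiplier of v; the second
      derivatives they introduce are exactly the subtracted Laplacian term.\<close>
    also have "\<dots> = - (LINT z|MO. Tint P (\<lambda>x y. 1) v z)"
      by (intro arg_cong[of _ _ uminus] Bochner_Integration.integral_cong refl)
        (simp add: Tint_def D_basic restr_01 Lap_def[abs_def] restr_add algebra_simps)
    also have "\<dots> = (LINT z|MO. restr (DD P) z * (restr (\<lambda>x y. 1) z * v z))"
      by (rule DD_Tint[OF P poly_fun_basic(1) v, symmetric])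
    finally show "(LINT z|MO. v z * restr (EE P) z) = (LINT z|MO. v z * restr (DD P) z)"
      by (simp add: restr_01 mult.commute)
  qed
qed

lemma EE_complex: "poly_fun n P \<Longrightarrow> x \<in> ellipse R2 \<Longrightarrow> y \<in> ellipse R2 \<Longrightarrow> EE P x y = DD P x y"
  by (rule poly_approx_eq_real_imp_eq[OF poly_approx_EE poly_approx_DD R2 EE_real])

lemma diamond_int_cong_ellipse:
  assumes "small R s" "\<And>x y. x \<in> ellipse R \<Longrightarrow> y \<in> ellipse R \<Longrightarrow> F x y = H x y"
  shows "diamond_int s F = diamond_int s H"
  unfolding diamond_int_def
  by (intro Henstock_Kurzweil_Integration.integral_cong assms(2)) (auto simp: mem_cbox_s intro!: Ph_in_ellipse[OF assms(1)])

text \<open>On the diamond \<open>EE P\<close> is the Laplacian of the representer, whose expansion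
  vanishes term by term on the edges x = -1 and y = -1. This is the compatibility condition
  contributed by P.\<close>

lemma EE_diamond_int_zero:
  assumes P: "poly_fun n P" and s: "small R2 s"
  shows "diamond_int s (EE P) = 0"
proof -
  have "diamond_int s (EE P) = diamond_int s (DD P)" by (rule diamond_int_cong_ellipse[OF s EE_complex[OF P]])
  also have "\<dots> = 0"
    by (rule diamond_poly_series[OF poly_series_W[OF P], of R2]) (use R0 R1 R2 s in \<open>auto simp: rep_term_edges\<close>)
  finally show ?thesis .
qed

lemma NN_bound:
  assumes "\<And>z. z \<in> Omega \<Longrightarrow> \<bar>\<nu> z\<bar> \<le> B" "z \<in> Omega"
  shows "\<bar>restr NN z\<bar> \<le> B * restr Bc z"
proof -
  \<comment> \<open>Taking the positive part turns the almost everywhere inequality into an equation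
    with zero for a continuous function.\<close>
  let ?h = "\<lambda>z. max 0 (\<bar>restr NN z\<bar> - B * restr Bc z)"
  have bp: "0 \<le> restr Bc z" if "z \<in> Omega" for z
    using that Omega_abs[OF that] by (auto simp: restr_Bc Omega_def intro!: mult_nonneg_nonneg abs_square_le_1[THEN iffD2, simplified power2_eq_square])
  have "AE z in MO. ?h z = 0"
    using NN_AE AE_space
  proof eventually_elim
    fix z assume z: "restr NN z = \<nu> z * restr Bc z" "z \<in> space MO"
    have "\<bar>restr NN z\<bar> \<le> B * restr Bc z"
      using assms(1)[of z] bp[of z] z by (auto simp: abs_mult intro!: mult_right_mono)
    then show "?h z = 0" by simp
  qed
  then have "?h z = 0"
    by (rule AE_zero_imp_zero[OF _ _ assms(2), rotated])
      (intro continuous_intros poly_approx_continuous_Omega[OF poly_approx_CN(3) R1(1)] continuous_poly_fun_Omega[OF poly_fun_Bc])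
  then show ?thesis by (simp add: max_def split: if_splits)
qed

text \<open>The analytic representative is continuous up to the boundary, is bounded by a multiple
  of b inside, and b vanishes on the edges; points of the open square are moved to the edge along
  \<open>s\<close>.\<close>

lemma NN_edge_real:
  assumes "\<bar>q\<bar> < 1"
  shows "restr NN (-1, q) = 0" "restr NN (q, -1) = 0"
proof -
  obtain B where B: "\<And>z. z \<in> Omega \<Longrightarrow> \<bar>\<nu> z\<bar> \<le> B" using coef(1) by (auto simp: bdd_meas_def)
  note cont = poly_approx_continuous_square[OF poly_approx_CN(3) R1(1)]
  define s where "s n = - 1 + 1 / (real n + 2)" for n
  have s: "- 1 < s n" "s n < 1" for n by (auto simp: s_def field_simps)
  have sl: "s \<longlonglongrightarrow> -1"
  proof (rule LIMSEQ_I)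
    fix r :: real assume "0 < r"
    then obtain m where m: "inverse (real (Suc m)) < r" using reals_Archimedean by blast
    have "norm (s n - - 1) < r" if "m \<le> n" for n
    proof -
      have "norm (s n - - 1) = 1 / (real n + 2)" by (simp add: s_def)
      also have "\<dots> \<le> inverse (real (Suc m))" using that by (simp add: divide_inverse)
      finally show ?thesis using m by simp
    qed
    then show "\<exists>no. \<forall>n\<ge>no. norm (s n - - 1) < r" by blast
  qed
  have lim: "(\<lambda>n. restr NN (f n)) \<longlonglongrightarrow> restr NN l" if "f \<longlonglongrightarrow> l" "\<And>n. f n \<in> {-1..1} \<times> {-1..1}" "l \<in> {-1..1} \<times> {-1..1}" for f l
    using continuous_on_tendsto_compose[OF cont that(1,3)] that(2) by simp
  have z: "restr NN l = 0" if f: "f \<longlonglongrightarrow> l" "\<And>n. f n \<in> Omega" "l \<in> {-1..1} \<times> {-1..1}" "restr Bc l = 0" for f l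
  proof -
    have "(\<lambda>n. restr NN (f n)) \<longlonglongrightarrow> restr NN l" by (rule lim[OF f(1) _ f(3)]) (use f(2) Omega_subset_square in blast)
    moreover have "(\<lambda>n. restr NN (f n)) \<longlonglongrightarrow> 0"
    proof (rule tendsto_rabs_zero_cancel, rule tendsto_sandwich[OF _ _ tendsto_const])
      have "(\<lambda>n. B * restr Bc (f n)) \<longlonglongrightarrow> B * restr Bc l"
        by (intro tendsto_intros continuous_on_tendsto_compose[OF C1_grad_continuous[OF poly_fun_derivs(4)[OF poly_fun_Bc]] f(1)]) auto
      then show "(\<lambda>n. B * restr Bc (f n)) \<longlonglongrightarrow> 0" using f(4) by simp
    qed (use NN_bound[OF B f(2)] in auto)
    ultimately show ?thesis by (rule LIMSEQ_unique)
  qed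
  show "restr NN (-1, q) = 0"
    by (rule z[of "\<lambda>n. (s n, q)"]) (use s assms sl in \<open>auto simp: Omega_def restr_Bc intro!: tendsto_intros\<close>)
  show "restr NN (q, -1) = 0"
    by (rule z[of "\<lambda>n. (q, s n)"]) (use s assms sl in \<open>auto simp: Omega_def restr_Bc intro!: tendsto_intros\<close>)
qed

end

section \<open>Constancy of the diffusion coefficient and vanishing of the reaction\<close>

lemma poly_approx_section_derivative:
  assumes F: "poly_approx R F" "1 < R'" "R' < R" and z: "(s, t) \<in> Omega"
  shows "((\<lambda>s. restr F (s, t)) has_real_derivative restr (Dx F) (s, t)) (at s)"
    "((\<lambda>t. restr F (s, t)) has_real_derivative restr (Dy F) (s, t)) (at t)"
proof -
  obtain g where g: "poly_series R g F" using F(1) by (auto simp: poly_approx_def)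
  have e: "of_real s \<in> ellipse R'" "of_real t \<in> ellipse R'" using z F by (auto simp: Omega_def intro!: real_in_ellipse)
  have D: "((\<lambda>s. Re (h (of_real s))) has_real_derivative Re D) (at x)"
    if "(h has_field_derivative D) (at (of_real x))" for h D x
    using bounded_linear.has_vector_derivative[OF bounded_linear_Re has_vector_derivative_real_field[OF that]]
    by (simp add: has_real_derivative_iff_has_vector_derivative)
  show "((\<lambda>s. restr F (s, t)) has_real_derivative restr (Dx F) (s, t)) (at s)"
    using D[of "\<lambda>x. F x (of_real t)" _ s] poly_series_chain[OF g _ F(3), of 0 1 "of_real s" "of_real t" 0] e F(2) by (simp add: restr_def)
  show "((\<lambda>t. restr F (s, t)) has_real_derivative restr (Dy F) (s, t)) (at t)"
    using D[of "F (of_real s)" _ t] poly_series_chain[OF g _ F(3), of "of_real s" 0 "of_real t" 0 1] e F(2) by (simp add: restr_def)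
qed

lemma holomorphic_ellipse_zero:
  assumes "f holomorphic_on ellipse R" "1 < R" "\<And>t. \<bar>t\<bar> < 1 \<Longrightarrow> f (of_real t) = 0" "z \<in> ellipse R"
  shows "f z = 0"
proof (rule analytic_continuation[OF assms(1) open_ellipse connected_ellipse _ _ _ _ assms(4)])
  let ?A = "complex_of_real ` {0<..<1}"
  show "?A \<subseteq> ellipse R" using assms(2) by (auto intro!: real_in_ellipse)
  show "0 \<in> ellipse R" using real_in_ellipse[OF assms(2), of 0] by simp
  show "0 islimpt ?A" by (rule zero_islimpt_reals)
  show "f w = 0" if "w \<in> ?A" for w using that assms(3) by auto
qed

lemma restr_Bc_pos: "z \<in> Omega \<Longrightarrow> 0 < restr Bc z"
  by (auto simp: restr_Bc Omega_def intro!: mult_pos_pos abs_square_less_1[THEN iffD2, simplified power2_eq_square])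

context decay_basis
begin

text \<open>The identity theorem along each edge extends the zeros from real to complex points; on
  the diamond the free coordinate is taken in the ellipse, as \<open>corner_first_order\<close>
  demands.\<close>

lemma NN_edge:
  assumes "y \<in> ellipse R2"
  shows "NN (-1) y = 0" "NN y (-1) = 0"
proof -
  obtain g where g: "poly_series R1 g NN" using poly_approx_CN(3) by (auto simp: poly_approx_def)
  have m: "-1 \<in> ellipse R2" using real_in_ellipse[OF R2(1), of "-1"] by simp
  have r: "NN (-1) (of_real t) = 0" "NN (of_real t) (-1) = 0" if "\<bar>t\<bar> < 1" for t
    using poly_approx_restr[OF poly_approx_CN(3) R1(1), of "-1" t] poly_approx_restr[OF poly_approx_CN(3) R1(1), of t "-1"] NN_edge_real[OF that] that by simp_all
  show "NN (-1) y = 0"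
    by (rule holomorphic_ellipse_zero[OF poly_series_holomorphic(2)[OF g _ R2(2) m] R2(1) r(1) assms]) (use R2 in auto)
  show "NN y (-1) = 0"
    by (rule holomorphic_ellipse_zero[OF poly_series_holomorphic(1)[OF g _ R2(2) m] R2(1) r(2) assms]) (use R2 in auto)
qed

definition R3 :: real where "R3 = (1 + R2) / 2"
definition R4 :: real where "R4 = (1 + R3) / 2"

lemma R34: "1 < R4" "R4 < R3" "R3 < R2" "R4 < R2" 
proof -
  have 3: "1 < R3" "R3 < R2" using R2 by (auto simp: R3_def)
  have "1 < R4" "R4 < R3" using 3 by (auto simp: R4_def)
  with 3 show "1 < R4" "R4 < R3" "R3 < R2" "R4 < R2" by linarith+
qed

lemma small_R: "small R4 s \<Longrightarrow> small R2 s" "small R2 s \<Longrightarrow> small R1 s"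
  using joukowski_strict_mono[of R4 R2] joukowski_strict_mono[of R2 R1] R34 R2 by (auto simp: small_def)

lemma first_order_complex:
  assumes "x \<in> ellipse R4" "y \<in> ellipse R4"
  shows "CX x y + \<i> * CY x y = 2 * (Dx NN x y + \<i> * Dy NN x y)"
proof -
  have A: "poly_approx R2 (DD (\<lambda>x y. 1))" "poly_approx R2 CX" "poly_approx R2 CY" "poly_approx R2 NN"
    using R2 by (intro poly_approx_mono[OF poly_approx_DD[OF poly_fun_basic(1)]] poly_approx_mono[OF poly_approx_CN(1)] poly_approx_mono[OF poly_approx_CN(2)] poly_approx_mono[OF poly_approx_CN(3)]; simp)+
  obtain g0 where g0: "poly_series R2 g0 (DD (\<lambda>x y. 1))" using A(1) by (auto simp: poly_approx_def)
  obtain g1 where g1: "poly_series R2 g1 CX" using A(2) by (auto simp: poly_approx_def)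
  obtain g2 where g2: "poly_series R2 g2 CY" using A(3) by (auto simp: poly_approx_def)
  obtain g3 where g3: "poly_series R2 g3 NN" using A(4) by (auto simp: poly_approx_def)
  show ?thesis
    by (rule corner_first_order[OF R34(1,2,3) g0 g1 g2 g3 _ NN_edge assms])
      (rule EE_diamond_int_zero[OF _ small_R(1), unfolded EE_def[abs_def]])
qed

text \<open>At real points all four functions are real, so the one complex relation obtained at a
  corner splits into two real relations.\<close>

lemma first_order_real:
  assumes z: "z \<in> Omega"
  shows "restr CX z = 2 * restr (Dx NN) z" "restr CY z = 2 * restr (Dy NN) z"
proof -
  obtain s t where st: "z = (s, t)" by (cases z)
  have a: "\<bar>s\<bar> \<le> 1" "\<bar>t\<bar> \<le> 1" using Omega_abs[OF z] st by auto
  have "of_real (restr CX z) + \<i> * of_real (restr CY z) = 2 * (of_real (restr (Dx NN) z) + \<i> * of_real (restr (Dy NN) z))"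
    using first_order_complex[OF real_in_ellipse[OF R34(1) a(1)] real_in_ellipse[OF R34(1) a(2)]]
    unfolding poly_approx_restr[OF poly_approx_CN(1) R1(1) a] poly_approx_restr[OF poly_approx_CN(2) R1(1) a] poly_approx_restr[OF poly_approx_DN(1) R2(1) a] poly_approx_restr[OF poly_approx_DN(2) R2(1) a] st .
  then show "restr CX z = 2 * restr (Dx NN) z" "restr CY z = 2 * restr (Dy NN) z"
    by (auto simp: complex_eq_iff)
qed

text \<open>The corner gives the first order coefficient as twice the derivative of
  \<open>NN\<close>; the divergence form of the operator gives it through \<open>C_eq\<close>.
  Equating the two says that the quotient of \<open>NN\<close> by b, the function \<nu>, has zero
  gradient.\<close>

lemma log_derivative:
  assumes z: "z \<in> Omega"
  shows "restr Bc z * restr (Dx NN) z = restr NN z * restr (Dx Bc) z" "restr Bc z * restr (Dy NN) z = restr NN z * restr (Dy Bc) z"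
  using C_eq[OF z] first_order_real[OF z] by simp_all

text \<open>At the centre b equals 1, so this is the value there of the quotient of
  \<open>NN\<close> by b.\<close>

definition nu0 :: real where "nu0 = restr NN (0, 0)"

lemma NN_real:
  assumes z: "z \<in> Omega"
  shows "restr NN z = nu0 * restr Bc z"
proof -
  obtain s t where st: "z = (s, t)" by (cases z)
  define q where "q z = restr NN z / restr Bc z" for z
  note Bd = poly_approx_section_derivative[OF poly_approx_poly_fun[OF poly_fun_Bc] R2] and Nd = poly_approx_section_derivative[OF poly_approx_CN(3) R2]
  have ne: "restr Bc z \<noteq> 0" if "z \<in> Omega" for z using restr_Bc_pos[OF that] by simp
  have qx: "((\<lambda>s. q (s, t)) has_real_derivative 0) (at s)" if "(s, t) \<in> Omega" for s t
    using DERIV_divide[OF Nd(1)[OF that] Bd(1)[OF that] ne[OF that]] log_derivative(1)[OF that] by (simp add: q_def mult.commute)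
  have qy: "((\<lambda>t. q (s, t)) has_real_derivative 0) (at t)" if "(s, t) \<in> Omega" for s t
    using DERIV_divide[OF Nd(2)[OF that] Bd(2)[OF that] ne[OF that]] log_derivative(2)[OF that] by (simp add: q_def mult.commute)
  have "q (s, t) = q (0, t)"
    by (rule DERIV_isconst3[where a = "-1" and b = 1 and f = "\<lambda>s. q (s, t)"]) (use z st qx in \<open>auto simp: Omega_def\<close>)
  also have "\<dots> = q (0, 0)"
    by (rule DERIV_isconst3[where a = "-1" and b = 1 and f = "\<lambda>t. q (0, t)"]) (use z st qy in \<open>auto simp: Omega_def\<close>)
  also have "\<dots> = nu0" by (simp add: q_def nu0_def restr_Bc)
  finally show ?thesis using ne[OF z] by (simp add: q_def st field_simps)
qed

lemma nu_AE: "AE z in MO. \<nu> z = nu0"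
  using NN_AE AE_space
proof eventually_elim
  fix z assume "restr NN z = \<nu> z * restr Bc z" "z \<in> space MO"
  then show "\<nu> z = nu0" using NN_real[of z] restr_Bc_pos[of z] by simp
qed

lemma CN_complex:
  assumes xy: "x \<in> ellipse R2" "y \<in> ellipse R2"
  shows "NN x y = of_real nu0 * Bc x y" "CX x y = of_real (2 * nu0) * Dx Bc x y" "CY x y = of_real (2 * nu0) * Dy Bc x y"
proof -
  note D = poly_fun_derivs(1,2)[OF poly_fun_Bc]
  show "NN x y = of_real nu0 * Bc x y"
    by (rule poly_approx_eq_real_imp_eq[OF poly_approx_CN(3) poly_approx_scale[OF poly_approx_poly_fun[OF poly_fun_Bc]] R2 _ xy]) (simp add: restr_scale NN_real)
  have d: "restr (Dx NN) z = nu0 * restr (Dx Bc) z" "restr (Dy NN) z = nu0 * restr (Dy Bc) z" if "z \<in> Omega" for z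
    using log_derivative[OF that] restr_Bc_pos[OF that] NN_real[OF that] by simp_all
  show "CX x y = of_real (2 * nu0) * Dx Bc x y"
    by (rule poly_approx_eq_real_imp_eq[OF poly_approx_CN(1) poly_approx_scale[OF poly_approx_poly_fun[OF D(1)]] R2 _ xy]) (simp only: restr_scale first_order_real d)
  show "CY x y = of_real (2 * nu0) * Dy Bc x y"
    by (rule poly_approx_eq_real_imp_eq[OF poly_approx_CN(2) poly_approx_scale[OF poly_approx_poly_fun[OF D(2)]] R2 _ xy]) (simp only: restr_scale first_order_real d)
qed

text \<open>With the higher coefficients known, \<open>EE P\<close> minus \<open>nu0\<close> times
  the Laplacian of b P is P times the defect S. Both diamond integrals vanish, the second because b
  P is zero on the edges, so S has vanishing integral against every polynomial.\<close>

lemma zero_order: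
  assumes xy: "x \<in> ellipse R4" "y \<in> ellipse R4"
  shows "DD (\<lambda>x y. 1) x y = of_real nu0 * Lap Bc x y"
proof -
  define S where "S x y = DD (\<lambda>x y. 1) x y - of_real nu0 * Lap Bc x y" for x y
  have "poly_approx R1 S" unfolding S_def[abs_def] by (intro poly_approx_diff poly_approx_DD[OF poly_fun_basic(1)] poly_approx_scale poly_approx_poly_fun[OF poly_fun_Lap[OF poly_fun_Bc]])
  then have "poly_approx R2 S" using R2 by (intro poly_approx_mono[OF \<open>poly_approx R1 S\<close>]) auto
  then obtain g where g: "poly_series R2 g S" by (auto simp: poly_approx_def)
  obtain s where s: "small R4 s" using small_exists[OF R34(1)] by blast
  note s2 = small_R(1)[OF s] and s1 = small_R(2)[OF small_R(1)[OF s]]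
  have dc: "dcont s F" if F: "poly_approx R1 F" for F
  proof -
    obtain g where "poly_series R1 g F" using F by (auto simp: poly_approx_def)
    then show ?thesis using s1 by (rule poly_series_dcont)
  qed
  have V: "diamond_int s (\<lambda>x y. P x y * S x y) = 0" if P: "poly_fun n P" for n P
  proof -
    have BP: "poly_fun (4 + n) (\<lambda>x y. Bc x y * P x y)" by (rule poly_fun_mult[OF poly_fun_Bc P])
    have "diamond_int s (\<lambda>x y. P x y * S x y) = diamond_int s (\<lambda>x y. EE P x y - of_real nu0 * Lap (\<lambda>x y. Bc x y * P x y) x y)"
      by (rule diamond_int_cong_ellipse[OF s2]) (simp only: EE_def S_def CN_complex poly_fun_Lap_mult[OF poly_fun_Bc P], simp add: algebra_simps)
    also have "\<dots> = diamond_int s (EE P) - of_real nu0 * diamond_int s (Lap (\<lambda>x y. Bc x y * P x y))"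
      unfolding diamond_int_diff[OF dc[OF poly_approx_EE[OF P]] dc[OF poly_approx_scale[OF poly_approx_poly_fun[OF poly_fun_Lap[OF BP]]]]] diamond_int_cmult ..
    also have "diamond_int s (Lap (\<lambda>x y. Bc x y * P x y)) = 0"
      by (rule diamond_poly_fun[OF BP]) (use s in \<open>auto simp: Bc_def small_def\<close>)
    finally show ?thesis using EE_diamond_int_zero[OF P s2] by simp
  qed
  have "S x y = 0" by (rule corner_zero_order[OF R34(1,4) g s V xy])
  then show ?thesis by (simp add: S_def)
qed

text \<open>The operator applied to b is now known to be -\<open>nu0\<close> times the Laplacian of
  b, and the diffusion part alone already accounts for it; hence \<sigma> b is weakly zero, and b is
  positive in the square.\<close>

lemma sigma_AE: "AE z in MO. \<sigma> z = 0"
proof -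
  have bB: "bdd_meas (restr Bc)" by (rule poly_fun_bdd_meas[OF poly_fun_Bc])
  have r: "restr (DD (\<lambda>x y. 1)) z = nu0 * restr (Lap Bc) z" if z: "z \<in> Omega" for z
    using zero_order[OF real_in_ellipse[OF R34(1)] real_in_ellipse[OF R34(1)], OF Omega_abs[OF z]] by (simp add: restr_def)
  have "AE z in MO. \<sigma> z * restr Bc z = 0"
  proof (rule fundamental_lemma)
    show "integrable MO (\<lambda>z. \<sigma> z * restr Bc z)" by (intro bdd_meas_integrable bdd_meas_mult coef bB)
    fix v assume v: "v \<in> test_functions"
    note bv = test_bdd_meas[OF v] test_grad_bdd_meas[OF v]
    note b = bdd_meas_mult coef bB bv poly_fun_bdd_meas[OF poly_fun_derivs(1)[OF poly_fun_Bc]] poly_fun_bdd_meas[OF poly_fun_derivs(2)[OF poly_fun_Bc]]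
    let ?g = "\<lambda>z. restr (Dx Bc) z * fst (grad v z) + restr (Dy Bc) z * snd (grad v z)"
    have "- (nu0 * (LINT z|MO. restr (Lap Bc) z * v z)) = - (LINT z|MO. restr (DD (\<lambda>x y. 1)) z * v z)"
      unfolding integral_mult_right_zero[symmetric]
      by (intro arg_cong[of _ _ uminus] Bochner_Integration.integral_cong refl) (simp add: r)
    also have "\<dots> = a (restr Bc) v"
      using weak_identity[OF poly_fun_basic(1) v] by (simp add: bubble_def)
    also have "\<dots> = (LINT z|MO. \<nu> z * ?g z + \<sigma> z * (restr Bc z * v z))"
      by (rule C1_grad_a_form[OF poly_fun_derivs(4)[OF poly_fun_Bc] test_C1_grad[OF v] coef(1,2)])
    also have "\<dots> = (LINT z|MO. \<nu> z * ?g z) + (LINT z|MO. \<sigma> z * (restr Bc z * v z))"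
      by (intro Bochner_Integration.integral_add bdd_meas_integrable bdd_meas_add b)
    also have "(LINT z|MO. \<nu> z * ?g z) = (LINT z|MO. nu0 * ?g z)"
    proof (rule integral_cong_AE)
      have "bdd_meas (\<lambda>z. \<nu> z * ?g z)" "bdd_meas (\<lambda>z. nu0 * ?g z)" by (intro bdd_meas_add b bdd_meas_const)+
      then show "(\<lambda>z. \<nu> z * ?g z) \<in> borel_measurable MO" "(\<lambda>z. nu0 * ?g z) \<in> borel_measurable MO" by (auto simp: bdd_meas_def)
      show "AE z in MO. \<nu> z * ?g z = nu0 * ?g z" using nu_AE by eventually_elim simp
    qed
    also have "\<dots> = - (nu0 * (LINT z|MO. restr (Lap Bc) z * v z))"
      using poly_fun_weak_laplacian[OF poly_fun_Bc v] by simp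
    finally show "(LINT z|MO. v z * (\<sigma> z * restr Bc z)) = 0" by (simp add: mult_ac)
  qed
  then show ?thesis using AE_space
  proof eventually_elim
    fix z assume "\<sigma> z * restr Bc z = 0" "z \<in> space MO"
    then show "\<sigma> z = 0" using restr_Bc_pos[of z] by simp
  qed
qed

theorem a_form_rigid:
  assumes "v \<in> H10" "w \<in> H10"
  shows "a v w = nu0 * H10_inner v w"
proof -
  note g = L2_inner[OF wgrad_L2[OF H10_H1[OF assms(1)]] wgrad_L2[OF H10_H1[OF assms(2)]]]
  have "(LINT z|MO. \<nu> z * (wgrad v z \<bullet> wgrad w z)) = (LINT z|MO. nu0 * (wgrad v z \<bullet> wgrad w z))"
  proof (rule integral_cong_AE)
    show "(\<lambda>z. \<nu> z * (wgrad v z \<bullet> wgrad w z)) \<in> borel_measurable MO" "(\<lambda>z. nu0 * (wgrad v z \<bullet> wgrad w z)) \<in> borel_measurable MO"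
      using borel_measurable_integrable[OF g] coef(1) by (auto simp: bdd_meas_def)
    show "AE z in MO. \<nu> z * (wgrad v z \<bullet> wgrad w z) = nu0 * (wgrad v z \<bullet> wgrad w z)" using nu_AE by eventually_elim simp
  qed
  moreover have "(LINT z|MO. \<sigma> z * (v z * w z)) = 0"
    by (rule integral_eq_zero_AE) (use sigma_AE in eventually_elim, simp)
  ultimately show ?thesis by (simp add: a_form_def H10_inner_def)
qed

lemma nu0_bounds:
  assumes "\<forall>x\<in>Omega. lo \<le> \<nu> x \<and> \<nu> x \<le> hi"
  shows "lo \<le> nu0" "nu0 \<le> hi"
proof -
  have z: "(0, 0) \<in> Omega" by (simp add: Omega_def)
  \<comment> \<open>This maximum is zero exactly when both bounds hold; being a constant function,
    it can be moved from almost everywhere to the point (0, 0).\<close>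
  have "AE z in MO. max (max 0 (lo - nu0)) (nu0 - hi) = 0"
    using nu_AE AE_space
  proof eventually_elim
    fix z assume "\<nu> z = nu0" "z \<in> space MO"
    then show "max (max 0 (lo - nu0)) (nu0 - hi) = 0" using assms by force
  qed
  from AE_zero_imp_zero[OF continuous_on_const this z] show "lo \<le> nu0" "nu0 \<le> hi" by linarith+
qed

end

section \<open>The adaptive algorithm\<close>

lemma sum_weighted_Cauchy_Schwarz:
  fixes x y d :: "'i \<Rightarrow> real"
  assumes "\<And>i. i \<in> F \<Longrightarrow> 0 < d i"
  shows "\<bar>\<Sum>i\<in>F. x i * y i\<bar> \<le> sqrt (\<Sum>i\<in>F. (x i)\<^sup>2 * d i) * sqrt (\<Sum>i\<in>F. (y i)\<^sup>2 / d i)"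
proof -
  have "\<bar>\<Sum>i\<in>F. x i * y i\<bar> \<le> (\<Sum>i\<in>F. \<bar>x i * sqrt (d i)\<bar> * \<bar>y i / sqrt (d i)\<bar>)"
    by (rule order_trans[OF sum_abs sum_mono]) (use assms in \<open>force simp: abs_mult\<close>)
  also have "\<dots> \<le> L2_set (\<lambda>i. x i * sqrt (d i)) F * L2_set (\<lambda>i. y i / sqrt (d i)) F"
    by (rule L2_set_mult_ineq)
  also have "L2_set (\<lambda>i. x i * sqrt (d i)) F = sqrt (\<Sum>i\<in>F. (x i)\<^sup>2 * d i)"
    unfolding L2_set_def using assms by (intro arg_cong[of _ _ sqrt] sum.cong refl) (simp add: power_mult_distrib less_imp_le)
  also have "L2_set (\<lambda>i. y i / sqrt (d i)) F = sqrt (\<Sum>i\<in>F. (y i)\<^sup>2 / d i)"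
    unfolding L2_set_def using assms by (intro arg_cong[of _ _ sqrt] sum.cong refl) (simp add: power_divide less_imp_le)
  finally show ?thesis .
qed

lemma finite_ENRICH: assumes "finite \<Lambda>" shows "finite (ENRICH \<Lambda> J)"
proof -
  have "ENRICH \<Lambda> J \<subseteq> (\<Union>l\<in>\<Lambda>. {..fst l + J} \<times> {..snd l + J})"
    by (force simp: ENRICH_def l1_dist_def)
  then show ?thesis by (rule finite_subset) (use assms in auto)
qed

lemma ENRICH_KK: "ENRICH \<Lambda> J \<subseteq> KK" by (auto simp: ENRICH_def)

text \<open>The left side tends to zero as J grows, so the set whose least element defines
  \<open>J_theta\<close> is nonempty.\<close>

lemma J_theta_bound:
  assumes "0 < g" "0 < B"
  shows "\<exists>J. CA * exp (- g * real J) \<le> B"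
proof -
  have "(\<lambda>J. CA * exp (- g * real J)) \<longlonglongrightarrow> CA * 0"
  proof (intro tendsto_mult tendsto_const)
    have "(\<lambda>J. exp (- g) ^ J) \<longlonglongrightarrow> 0" by (rule LIMSEQ_realpow_zero) (use assms in auto)
    then show "(\<lambda>J. exp (- g * real J)) \<longlonglongrightarrow> 0" by (simp add: exp_of_nat_mult[symmetric] mult.commute)
  qed
  then have "eventually (\<lambda>J. CA * exp (- g * real J) < B) sequentially"
    using assms(2) by (intro order_tendstoD(2)) auto
  then show ?thesis by (auto simp: eventually_sequentially intro: less_imp_le)
qed

section \<open>Dual norms, Galerkin optimality, marking and coarsening\<close>

text \<open>The bilinear form is known here only through \<open>rigid\<close>, as a multiple of the
  inner product, so energy norm and \<open>H10_norm\<close> differ by a constant factor that cancels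
  in best approximation.\<close>

locale adaptive =
  fixes \<phi> :: "index \<Rightarrow> plane_fun" and \<phi>s :: "index \<Rightarrow> functional" and \<nu> \<sigma> u :: plane_fun and f :: functional
    and \<nu>0 \<beta>l \<beta>u ds :: real
  assumes rigid: "\<And>v w. v \<in> H10 \<Longrightarrow> w \<in> H10 \<Longrightarrow> a_form \<nu> \<sigma> v w = \<nu>0 * H10_inner v w"
    and nu0: "0 < \<nu>0"
    and f: "f \<in> H10_dual" and u: "u \<in> H10" and solution: "\<And>v. v \<in> H10 \<Longrightarrow> a_form \<nu> \<sigma> u v = f v"
    and basis: "\<And>k. k \<in> KK \<Longrightarrow> \<phi> k \<in> H10"
    and dense: "\<And>v e. v \<in> H10 \<Longrightarrow> 0 < e \<Longrightarrow> \<exists>F c. finite F \<and> F \<subseteq> KK \<and> H10_norm (\<lambda>x. v x - (\<Sum>k\<in>F. c k * \<phi> k x)) < e"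
    and dual: "is_dual_basis \<phi> \<phi>s"
    and beta: "0 < \<beta>l" "\<beta>l \<le> \<beta>u"
    and equiv: "\<And>v. v \<in> H10 \<Longrightarrow> \<beta>l * H10_norm v \<le> phi_norm \<phi> \<phi>s v" "\<And>v. v \<in> H10 \<Longrightarrow> phi_norm \<phi> \<phi>s v \<le> \<beta>u * H10_norm v"
    and weight: "\<And>k. k \<in> KK \<Longrightarrow> 1 \<le> d_weight \<phi> k" "\<And>k. k \<in> KK \<Longrightarrow> d_weight \<phi> k \<le> ds"
begin

abbreviation d where "d \<equiv> d_weight \<phi>"
abbreviation dnorm where "dnorm \<equiv> phi_dual_norm \<phi>"

lemma d_pos: "k \<in> KK \<Longrightarrow> 0 < d k" using weight(1)[of k] by simp

lemma beta_u: "0 < \<beta>u" using beta by simp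

lemma comb_H10: "F \<subseteq> KK \<Longrightarrow> (\<lambda>x. \<Sum>k\<in>F. c k * \<phi> k x) \<in> H10"
  by (intro H10_sum basis) auto

lemma span_H10: "\<Lambda> \<subseteq> KK \<Longrightarrow> v \<in> span_of \<phi> \<Lambda> \<Longrightarrow> v \<in> H10"
  by (erule span_ofE) (auto intro!: comb_H10)

lemma dual_dual: "k \<in> KK \<Longrightarrow> \<phi>s k \<in> H10_dual" and dual_basis: "k \<in> KK \<Longrightarrow> l \<in> KK \<Longrightarrow> \<phi>s k (\<phi> l) = (if k = l then 1 else 0)"
  using dual by (auto simp: is_dual_basis_def)

lemma dual_comb:
  assumes "finite F" "F \<subseteq> KK" "k \<in> KK"
  shows "\<phi>s k (\<lambda>x. \<Sum>j\<in>F. c j * \<phi> j x) = (if k \<in> F then c k else 0)"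
proof -
  have "\<phi>s k (\<lambda>x. \<Sum>j\<in>F. c j * \<phi> j x) = (\<Sum>j\<in>F. c j * \<phi>s k (\<phi> j))"
    using assms by (intro H10_dual_sum dual_dual basis) auto
  also have "\<dots> = (\<Sum>j\<in>F. if k = j then c j else 0)"
    using assms by (intro sum.cong refl) (auto simp: dual_basis)
  finally show ?thesis using assms(1) by simp
qed

lemma phi_norm_comb:
  assumes "finite F" "F \<subseteq> KK"
  shows "phi_norm \<phi> \<phi>s (\<lambda>x. \<Sum>j\<in>F. c j * \<phi> j x) = sqrt (\<Sum>k\<in>F. (c k)\<^sup>2 * d k)"
proof -
  let ?v = "\<lambda>x. \<Sum>j\<in>F. c j * \<phi> j x"
  have "(\<Sum>\<^sub>\<infinity>k\<in>KK. \<bar>\<phi>s k ?v\<bar>\<^sup>2 * d k) = (\<Sum>k\<in>F. \<bar>\<phi>s k ?v\<bar>\<^sup>2 * d k)"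
    by (rule infsum_KK_eq[OF assms]) (simp add: dual_comb[OF assms])
  also have "\<dots> = (\<Sum>k\<in>F. (c k)\<^sup>2 * d k)"
  proof (rule sum.cong[OF refl])
    fix k assume "k \<in> F"
    then show "\<bar>\<phi>s k ?v\<bar>\<^sup>2 * d k = (c k)\<^sup>2 * d k" using dual_comb[OF assms, of k c] assms(2) by auto
  qed
  finally show ?thesis by (simp add: phi_norm_def)
qed

lemma comb_norm:
  assumes "finite F" "F \<subseteq> KK"
  shows "H10_norm (\<lambda>x. \<Sum>j\<in>F. c j * \<phi> j x) \<le> sqrt (\<Sum>k\<in>F. (c k)\<^sup>2 * d k) / \<beta>l"
  using equiv(1)[OF comb_H10[OF assms(2)], of c] beta unfolding phi_norm_comb[OF assms] by (simp add: field_simps)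

text \<open>The functional is tested with the combination whose coefficients are its own values
  divided by the weights. The left side is reproduced, the norm of the combination is at most its
  square root over \<open>\<beta>l\<close>, and one square root cancels.\<close>

lemma dual_finite_bound:
  assumes g: "g \<in> H10_dual" and b: "\<And>v. v \<in> H10 \<Longrightarrow> \<bar>g v\<bar> \<le> C * H10_norm v" "0 \<le> C" and F: "finite F" "F \<subseteq> KK"
  shows "(\<Sum>k\<in>F. \<bar>g (\<phi> k)\<bar>\<^sup>2 / d k) \<le> (C / \<beta>l)\<^sup>2"
proof -
  define S where "S = (\<Sum>k\<in>F. \<bar>g (\<phi> k)\<bar>\<^sup>2 / d k)"
  let ?c = "\<lambda>k. g (\<phi> k) / d k"
  have S0: "0 \<le> S" unfolding S_def using F by (intro sum_nonneg divide_nonneg_pos d_pos) auto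
  have "S = (\<Sum>k\<in>F. ?c k * g (\<phi> k))" unfolding S_def by (intro sum.cong refl) (simp add: power2_eq_square)
  also have "\<dots> = g (\<lambda>x. \<Sum>k\<in>F. ?c k * \<phi> k x)" using F by (intro H10_dual_sum[symmetric] g basis) auto
  also have "\<dots> \<le> C * H10_norm (\<lambda>x. \<Sum>k\<in>F. ?c k * \<phi> k x)" using b(1)[OF comb_H10[OF F(2)], of ?c] by simp
  also have "\<dots> \<le> C * (sqrt (\<Sum>k\<in>F. (?c k)\<^sup>2 * d k) / \<beta>l)" by (intro mult_left_mono comb_norm F b)
  also have "(\<Sum>k\<in>F. (?c k)\<^sup>2 * d k) = S"
    unfolding S_def
  proof (intro sum.cong refl)
    fix k assume "k \<in> F"
    then show "(?c k)\<^sup>2 * d k = \<bar>g (\<phi> k)\<bar>\<^sup>2 / d k" using d_pos[of k] F by (simp add: power2_eq_square subset_iff)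
  qed
  finally have "sqrt S * sqrt S \<le> C / \<beta>l * sqrt S" using S0 by (simp add: mult.commute)
  then have "sqrt S \<le> C / \<beta>l"
    using S0 b(2) beta by (cases "S = 0") (simp, simp only: mult_le_cancel_right, simp)
  then have "(sqrt S)\<^sup>2 \<le> (C / \<beta>l)\<^sup>2" using S0 by (intro power_mono) auto
  then show ?thesis using S0 by (simp add: S_def)
qed

lemma dual_summable: assumes g: "g \<in> H10_dual" shows "(\<lambda>k. \<bar>g (\<phi> k)\<bar>\<^sup>2 / d k) summable_on KK"
proof -
  obtain C where C: "0 \<le> C" "\<And>v. v \<in> H10 \<Longrightarrow> \<bar>g v\<bar> \<le> C * H10_norm v" using H10_dual_bound[OF g] by blast
  show ?thesis
  proof (rule nonneg_bdd_above_summable_on)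
    show "0 \<le> \<bar>g (\<phi> k)\<bar>\<^sup>2 / d k" if "k \<in> KK" for k using d_pos[OF that] by simp
    show "bdd_above (sum (\<lambda>k. \<bar>g (\<phi> k)\<bar>\<^sup>2 / d k) ` {F. F \<subseteq> KK \<and> finite F})"
      by (rule bdd_aboveI[of _ "(C / \<beta>l)\<^sup>2"]) (use dual_finite_bound[OF g C(2,1)] in auto)
  qed
qed

lemma dnorm_nonneg: "0 \<le> dnorm g"
  unfolding phi_dual_norm_def using d_pos by (auto intro!: infsum_nonneg divide_nonneg_pos)

lemma dnorm_sq: "(dnorm g)\<^sup>2 = (\<Sum>\<^sub>\<infinity>k\<in>KK. \<bar>g (\<phi> k)\<bar>\<^sup>2 / d k)"
  unfolding phi_dual_norm_def using d_pos by (auto intro!: real_sqrt_pow2 infsum_nonneg divide_nonneg_pos)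

lemma dnorm_le:
  assumes g: "g \<in> H10_dual" and "0 \<le> B" "\<And>F. finite F \<Longrightarrow> F \<subseteq> KK \<Longrightarrow> (\<Sum>k\<in>F. \<bar>g (\<phi> k)\<bar>\<^sup>2 / d k) \<le> B\<^sup>2"
  shows "dnorm g \<le> B"
proof (rule power2_le_imp_le)
  show "(dnorm g)\<^sup>2 \<le> B\<^sup>2"
    unfolding dnorm_sq by (rule infsum_le_finite_sums[OF dual_summable[OF g] assms(3)])
qed fact

lemma dnorm_finite:
  assumes g: "g \<in> H10_dual" "finite F" "F \<subseteq> KK"
  shows "sqrt (\<Sum>k\<in>F. \<bar>g (\<phi> k)\<bar>\<^sup>2 / d k) \<le> dnorm g"
proof -
  have "(\<Sum>k\<in>F. \<bar>g (\<phi> k)\<bar>\<^sup>2 / d k) \<le> (dnorm g)\<^sup>2"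
    unfolding dnorm_sq using d_pos by (intro finite_sum_le_infsum[OF dual_summable[OF g(1)] g(2,3)]) (simp add: divide_nonneg_pos)
  then show ?thesis using dnorm_nonneg by (intro real_le_lsqrt) auto
qed

lemma dnorm_bound:
  assumes "g \<in> H10_dual" "\<And>v. v \<in> H10 \<Longrightarrow> \<bar>g v\<bar> \<le> C * H10_norm v" "0 \<le> C"
  shows "dnorm g \<le> C / \<beta>l"
  by (rule dnorm_le[OF assms(1)]) (use assms beta dual_finite_bound in auto)

lemma dnorm_triangle:
  assumes g: "g \<in> H10_dual" and h: "h \<in> H10_dual"
  shows "dnorm h \<le> dnorm g + dnorm (\<lambda>v. g v - h v)"
proof (rule dnorm_le[OF h])
  show "0 \<le> dnorm g + dnorm (\<lambda>v. g v - h v)" by (intro add_nonneg_nonneg dnorm_nonneg)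
  fix F assume F: "finite F" "F \<subseteq> KK"
  have e: "L2_set (\<lambda>k. h (\<phi> k) / sqrt (d k)) F = sqrt (\<Sum>k\<in>F. \<bar>h (\<phi> k)\<bar>\<^sup>2 / d k)" for h
    unfolding L2_set_def using F d_pos
    by (intro arg_cong[of _ _ sqrt] sum.cong refl) (simp add: power_divide less_imp_le subset_iff)
  have "sqrt (\<Sum>k\<in>F. \<bar>h (\<phi> k)\<bar>\<^sup>2 / d k) = L2_set (\<lambda>k. g (\<phi> k) / sqrt (d k) + - ((g (\<phi> k) - h (\<phi> k)) / sqrt (d k))) F"
    unfolding e[symmetric] by (simp add: diff_divide_distrib)
  also have "\<dots> \<le> L2_set (\<lambda>k. g (\<phi> k) / sqrt (d k)) F + L2_set (\<lambda>k. - ((g (\<phi> k) - h (\<phi> k)) / sqrt (d k))) F"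
    by (rule L2_set_triangle_ineq)
  also have "L2_set (\<lambda>k. - ((g (\<phi> k) - h (\<phi> k)) / sqrt (d k))) F = L2_set (\<lambda>k. (g (\<phi> k) - h (\<phi> k)) / sqrt (d k)) F"
    by (simp add: L2_set_def)
  also have "L2_set (\<lambda>k. g (\<phi> k) / sqrt (d k)) F + L2_set (\<lambda>k. (g (\<phi> k) - h (\<phi> k)) / sqrt (d k)) F \<le> dnorm g + dnorm (\<lambda>v. g v - h v)"
    unfolding e e[of "\<lambda>v. g v - h v"] by (intro add_mono dnorm_finite g H10_dual_diff h F)
  finally have "(sqrt (\<Sum>k\<in>F. \<bar>h (\<phi> k)\<bar>\<^sup>2 / d k))\<^sup>2 \<le> (dnorm g + dnorm (\<lambda>v. g v - h v))\<^sup>2"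
    using F d_pos by (intro power_mono) (auto intro!: sum_nonneg divide_nonneg_pos)
  then show "(\<Sum>k\<in>F. \<bar>h (\<phi> k)\<bar>\<^sup>2 / d k) \<le> (dnorm g + dnorm (\<lambda>v. g v - h v))\<^sup>2"
    using F d_pos by (subst (asm) real_sqrt_pow2) (auto intro!: sum_nonneg divide_nonneg_pos)
qed

text \<open>Finite combinations are dense and the functional is bounded by some constant, so the
  better constant K, known on combinations, extends to all of \<open>H10\<close>.\<close>

lemma extend_bound:
  assumes g: "g \<in> H10_dual" and K: "0 \<le> K"
    and b: "\<And>F c. finite F \<Longrightarrow> F \<subseteq> KK \<Longrightarrow> \<bar>g (\<lambda>x. \<Sum>k\<in>F. c k * \<phi> k x)\<bar> \<le> K * H10_norm (\<lambda>x. \<Sum>k\<in>F. c k * \<phi> k x)"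
    and v: "v \<in> H10"
  shows "\<bar>g v\<bar> \<le> K * H10_norm v"
proof (rule field_le_epsilon)
  fix e :: real assume e: "0 < e"
  obtain C where C: "0 \<le> C" "\<And>v. v \<in> H10 \<Longrightarrow> \<bar>g v\<bar> \<le> C * H10_norm v" using H10_dual_bound[OF g] by blast
  define e' where "e' = e / (C + K + 1)"
  have e': "0 < e'" using e C K by (simp add: e'_def)
  obtain F c where F: "finite F" "F \<subseteq> KK" "H10_norm (\<lambda>x. v x - (\<Sum>k\<in>F. c k * \<phi> k x)) < e'"
    using dense[OF v e'] by blast
  define w where "w = (\<lambda>x. \<Sum>k\<in>F. c k * \<phi> k x)"
  have w: "w \<in> H10" unfolding w_def by (rule comb_H10[OF F(2)])
  define h where "h = (\<lambda>x. v x - w x)"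
  have h: "h \<in> H10" "H10_norm h < e'" using F(3) H10_diff[OF v w] by (simp_all add: h_def w_def)
  have "g v = g (\<lambda>x. h x + w x)" by (simp add: h_def)
  also have "\<dots> = g h + g w" by (rule H10_dual_add[OF g h(1) w])
  finally have "\<bar>g v\<bar> \<le> C * H10_norm h + K * H10_norm w" using C(2)[OF h(1)] b[OF F(1,2), of c] by (simp add: w_def)
  moreover have "w = (\<lambda>x. v x - h x)" by (simp add: h_def)
  then have "H10_norm w \<le> H10_norm v + H10_norm h" using H10_norm_diff[OF v h(1)] by simp
  moreover have "C * H10_norm h \<le> C * e'" using h(2) C(1) by (intro mult_left_mono) auto
  ultimately have "\<bar>g v\<bar> \<le> C * e' + K * (H10_norm v + e')"
    using mult_left_mono[of "H10_norm w" "H10_norm v + e'" K] h(2) K by linarith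
  also have "\<dots> = K * H10_norm v + (C + K) * e'" by (simp add: algebra_simps)
  also have "(C + K) * e' \<le> e" using e C K by (simp add: e'_def field_simps)
  finally show "\<bar>g v\<bar> \<le> K * H10_norm v + e" by simp
qed

text \<open>On finite combinations this is weighted Cauchy-Schwarz between coefficients and values
  of the functional; the partial sums are bounded by the full norms.\<close>

lemma dual_pairing:
  assumes g: "g \<in> H10_dual" and v: "v \<in> H10"
  shows "\<bar>g v\<bar> \<le> dnorm g * \<beta>u * H10_norm v"
proof (rule extend_bound[OF g _ _ v])
  show "0 \<le> dnorm g * \<beta>u" using dnorm_nonneg beta_u by simp
  fix F c assume F: "finite F" "F \<subseteq> KK"
  have "\<bar>g (\<lambda>x. \<Sum>k\<in>F. c k * \<phi> k x)\<bar> = \<bar>\<Sum>k\<in>F. c k * g (\<phi> k)\<bar>"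
    using F by (subst H10_dual_sum[OF g basis]) auto
  also have "\<dots> \<le> sqrt (\<Sum>k\<in>F. (c k)\<^sup>2 * d k) * sqrt (\<Sum>k\<in>F. (g (\<phi> k))\<^sup>2 / d k)"
    using F by (intro sum_weighted_Cauchy_Schwarz d_pos) auto
  also have "\<dots> = phi_norm \<phi> \<phi>s (\<lambda>x. \<Sum>k\<in>F. c k * \<phi> k x) * sqrt (\<Sum>k\<in>F. \<bar>g (\<phi> k)\<bar>\<^sup>2 / d k)"
    unfolding phi_norm_comb[OF F] by simp
  also have "\<dots> \<le> (\<beta>u * H10_norm (\<lambda>x. \<Sum>k\<in>F. c k * \<phi> k x)) * dnorm g"
    using F d_pos beta_u by (intro mult_mono equiv comb_H10 dnorm_finite g) (auto intro!: sum_nonneg divide_nonneg_pos mult_nonneg_nonneg H10_norm_nonneg less_imp_le[OF beta_u])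
  finally show "\<bar>g (\<lambda>x. \<Sum>k\<in>F. c k * \<phi> k x)\<bar> \<le> dnorm g * \<beta>u * H10_norm (\<lambda>x. \<Sum>k\<in>F. c k * \<phi> k x)" by (simp add: mult_ac)
qed

lemma a_dual: assumes "w \<in> H10" shows "(\<lambda>v. \<nu>0 * H10_inner w v) \<in> H10_dual"
proof -
  have "\<bar>\<nu>0 * H10_inner w v\<bar> \<le> (\<nu>0 * H10_norm w) * H10_norm v" if "v \<in> H10" for v
    using mult_left_mono[OF H10_Cauchy_Schwarz[OF assms that], of \<nu>0] nu0 by (simp add: abs_mult mult.assoc)
  then show ?thesis
    unfolding H10_dual_def using assms sym_form_right[OF sym_form_H10_inner]
    by (auto simp: distrib_left intro: exI[of _ "\<nu>0 * H10_norm w"])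
qed

lemma dual_cong:
  assumes "g \<in> H10_dual" "\<And>v. v \<in> H10 \<Longrightarrow> h v = g v"
  shows "h \<in> H10_dual"
  using assms H10_add H10_scale unfolding H10_dual_def by simp

lemma residual_eq: "w \<in> H10 \<Longrightarrow> v \<in> H10 \<Longrightarrow> residual \<nu> \<sigma> f w v = \<nu>0 * H10_inner (\<lambda>x. u x - w x) v"
  unfolding residual_def solution[symmetric] rigid[OF u] rigid sym_form_diff[OF sym_form_H10_inner u, of w v]
  by (simp add: right_diff_distrib sym_form_diff[OF sym_form_H10_inner u] rigid)

lemma residual_dual: "w \<in> H10 \<Longrightarrow> residual \<nu> \<sigma> f w \<in> H10_dual"
  by (rule dual_cong[OF a_dual residual_eq]) (auto intro: H10_diff u)

lemma residual_norm:
  assumes w: "w \<in> H10"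
  shows "dnorm (residual \<nu> \<sigma> f w) \<le> \<nu>0 * H10_norm (\<lambda>x. u x - w x) / \<beta>l"
proof (rule dnorm_bound[OF residual_dual[OF w]])
  fix v assume v: "v \<in> H10"
  show "\<bar>residual \<nu> \<sigma> f w v\<bar> \<le> \<nu>0 * H10_norm (\<lambda>x. u x - w x) * H10_norm v"
    using mult_left_mono[OF H10_Cauchy_Schwarz[OF H10_diff[OF u w] v], of \<nu>0] nu0
    by (simp add: residual_eq[OF w v] abs_mult mult.assoc)
qed (use nu0 H10_norm_nonneg in auto)

text \<open>As the form is a multiple of the inner product, Galerkin orthogonality is orthogonality
  in \<open>H10_inner\<close>, and the quasi-optimality constant is 1.\<close>

lemma GAL_optimal:
  assumes gal: "is_GAL \<nu> \<sigma> f \<phi> \<Lambda> w" and L: "\<Lambda> \<subseteq> KK" and v: "v \<in> span_of \<phi> \<Lambda>"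
  shows "H10_norm (\<lambda>x. u x - w x) \<le> H10_norm (\<lambda>x. u x - v x)"
proof -
  have w: "w \<in> span_of \<phi> \<Lambda>" "\<And>z. z \<in> span_of \<phi> \<Lambda> \<Longrightarrow> a_form \<nu> \<sigma> w z = f z" using gal by (auto simp: is_GAL_def)
  note H = span_H10[OF L]
  have orth: "H10_inner (\<lambda>x. u x - w x) z = 0" if "z \<in> span_of \<phi> \<Lambda>" for z
  proof -
    have "\<nu>0 * H10_inner u z = \<nu>0 * H10_inner w z"
      using w(2)[OF that] solution[OF H[OF that]] rigid[OF u H[OF that]] rigid[OF H[OF w(1)] H[OF that]] by simp
    then show ?thesis using nu0 by (simp add: sym_form_diff[OF sym_form_H10_inner u H[OF w(1)] H[OF that]])
  qed
  let ?e = "\<lambda>x. u x - w x"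
  have e: "?e \<in> H10" by (intro H10_diff u H w)
  have ev: "(\<lambda>x. u x - v x) \<in> H10" by (intro H10_diff u H v)
  have "(\<lambda>x. u x - v x) = (\<lambda>x. ?e x + (w x - v x))" by auto
  then have "H10_inner ?e (\<lambda>x. u x - v x) = H10_inner ?e ?e + H10_inner ?e (\<lambda>x. w x - v x)"
    using sym_form_right(1)[OF sym_form_H10_inner e H10_diff[OF H[OF w(1)] H[OF v]] e] by simp
  also have "H10_inner ?e (\<lambda>x. w x - v x) = 0" by (intro orth span_of_diff w v)
  finally have "H10_norm ?e * H10_norm ?e \<le> H10_norm ?e * H10_norm (\<lambda>x. u x - v x)"
    using H10_Cauchy_Schwarz[OF e ev] by (simp add: H10_norm_sq[symmetric] power2_eq_square)
  then show ?thesis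
    using H10_norm_nonneg[of ?e] H10_norm_nonneg[of "\<lambda>x. u x - v x"] by (cases "H10_norm ?e = 0") auto
qed

lemma dual_sum: assumes "finite F" "F \<subseteq> KK" shows "(\<lambda>v. \<Sum>k\<in>F. b k * \<phi>s k v) \<in> H10_dual"
  using assms
proof (induction F)
    case empty
    have "\<exists>C. \<forall>v\<in>H10. 0 \<le> C * H10_norm v" by (rule exI[of _ 0]) simp
    then show ?case by (simp add: H10_dual_def)
  next
    case (insert k F)
    have k: "\<phi>s k \<in> H10_dual" using insert.prems by (intro dual_dual) auto
    obtain C where C: "0 \<le> C" "\<And>v. v \<in> H10 \<Longrightarrow> \<bar>\<phi>s k v\<bar> \<le> C * H10_norm v" using H10_dual_bound[OF k] by blast
    have "(\<lambda>v. - b k * \<phi>s k v) \<in> H10_dual"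
      unfolding H10_dual_def
    proof (intro CollectI conjI ballI allI exI)
      fix v assume v: "v \<in> H10"
      show "\<bar>- b k * \<phi>s k v\<bar> \<le> (\<bar>b k\<bar> * C) * H10_norm v"
        using mult_left_mono[OF C(2)[OF v], of "\<bar>b k\<bar>"] by (simp add: abs_mult mult.assoc)
    qed (simp_all add: H10_dual_add[OF k] H10_dual_scale[OF k] algebra_simps)
    from H10_dual_diff[OF insert.IH this] insert show ?case by (simp add: add.commute)
qed

lemma proj_dual_dual: "finite F \<Longrightarrow> F \<subseteq> KK \<Longrightarrow> proj_dual \<phi> \<phi>s F g \<in> H10_dual"
  unfolding proj_dual_def by (rule dual_sum)

lemma proj_dual_basis:
  assumes "finite F" "F \<subseteq> KK" "k \<in> KK"
  shows "proj_dual \<phi> \<phi>s F g (\<phi> k) = (if k \<in> F then g (\<phi> k) else 0)"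
proof -
  have "proj_dual \<phi> \<phi>s F g (\<phi> k) = (\<Sum>j\<in>F. if j = k then g (\<phi> j) else 0)"
    unfolding proj_dual_def by (intro sum.cong refl) (use assms in \<open>auto simp: dual_basis\<close>)
  then show ?thesis using assms(1) by simp
qed

text \<open>Pythagoras for the weighted coefficients: the marked part carries at least the fraction
  \<theta>^2 of the squared norm, so the rest carries at most 1 - \<theta>^2.\<close>

lemma doerfler_complement:
  assumes g: "g \<in> H10_dual" and F: "doerfler_admissible \<phi> \<phi>s g \<theta> F" and th: "0 < \<theta>" "\<theta> < 1"
  shows "dnorm (\<lambda>v. g v - proj_dual \<phi> \<phi>s F g v) \<le> sqrt (1 - \<theta>\<^sup>2) * dnorm g"
proof -
  have F': "finite F" "F \<subseteq> KK" "\<theta> * dnorm g \<le> dnorm (proj_dual \<phi> \<phi>s F g)" using F by (auto simp: doerfler_admissible_def)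
  note p = proj_dual_dual[OF F'(1,2), of g]
  have "(dnorm (proj_dual \<phi> \<phi>s F g))\<^sup>2 = (\<Sum>k\<in>F. \<bar>g (\<phi> k)\<bar>\<^sup>2 / d k)"
    unfolding dnorm_sq
  proof (subst infsum_KK_eq[OF F'(1,2)])
    show "\<bar>proj_dual \<phi> \<phi>s F g (\<phi> k)\<bar>\<^sup>2 / d k = 0" if "k \<in> KK" "k \<notin> F" for k
      using that by (simp add: proj_dual_basis[OF F'(1,2)])
    show "(\<Sum>k\<in>F. \<bar>proj_dual \<phi> \<phi>s F g (\<phi> k)\<bar>\<^sup>2 / d k) = (\<Sum>k\<in>F. \<bar>g (\<phi> k)\<bar>\<^sup>2 / d k)"
    proof (rule sum.cong[OF refl])
      fix k assume "k \<in> F"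
      then show "\<bar>proj_dual \<phi> \<phi>s F g (\<phi> k)\<bar>\<^sup>2 / d k = \<bar>g (\<phi> k)\<bar>\<^sup>2 / d k"
        using proj_dual_basis[OF F'(1,2), of k g] F'(2) by auto
    qed
  qed
  then have low: "\<theta>\<^sup>2 * (dnorm g)\<^sup>2 \<le> (\<Sum>k\<in>F. \<bar>g (\<phi> k)\<bar>\<^sup>2 / d k)"
    using power_mono[OF F'(3), of 2] th dnorm_nonneg by (simp add: power_mult_distrib)
  have th2: "\<theta>\<^sup>2 \<le> 1" using th by (simp add: power_le_one)
  show ?thesis
  proof (rule dnorm_le[OF H10_dual_diff[OF g p]])
    show "0 \<le> sqrt (1 - \<theta>\<^sup>2) * dnorm g" using th2 dnorm_nonneg by simp
    fix H assume H: "finite H" "H \<subseteq> KK"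
    have "(\<Sum>k\<in>H. \<bar>g (\<phi> k) - proj_dual \<phi> \<phi>s F g (\<phi> k)\<bar>\<^sup>2 / d k) = (\<Sum>k\<in>H. if k \<in> F then 0 else \<bar>g (\<phi> k)\<bar>\<^sup>2 / d k)"
    proof (rule sum.cong[OF refl])
      fix k assume "k \<in> H"
      then show "\<bar>g (\<phi> k) - proj_dual \<phi> \<phi>s F g (\<phi> k)\<bar>\<^sup>2 / d k = (if k \<in> F then 0 else \<bar>g (\<phi> k)\<bar>\<^sup>2 / d k)"
        using proj_dual_basis[OF F'(1,2), of k g] H(2) by auto
    qed
    also have "\<dots> = (\<Sum>k\<in>H - F. \<bar>g (\<phi> k)\<bar>\<^sup>2 / d k)"
      using H by (intro sum.mono_neutral_cong_right) auto
    also have "\<dots> = (\<Sum>k\<in>(H - F) \<union> F. \<bar>g (\<phi> k)\<bar>\<^sup>2 / d k) - (\<Sum>k\<in>F. \<bar>g (\<phi> k)\<bar>\<^sup>2 / d k)"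
      using H F' by (subst sum.union_disjoint) auto
    also have "\<dots> \<le> (dnorm g)\<^sup>2 - \<theta>\<^sup>2 * (dnorm g)\<^sup>2"
    proof (rule diff_mono[OF _ low])
      show "(\<Sum>k\<in>(H - F) \<union> F. \<bar>g (\<phi> k)\<bar>\<^sup>2 / d k) \<le> (dnorm g)\<^sup>2"
        unfolding dnorm_sq using H F' d_pos
        by (intro finite_sum_le_infsum[OF dual_summable[OF g]]) (auto intro!: divide_nonneg_pos)
    qed
    also have "\<dots> = (sqrt (1 - \<theta>\<^sup>2) * dnorm g)\<^sup>2" using th2 by (simp add: power_mult_distrib algebra_simps)
    finally show "(\<Sum>k\<in>H. \<bar>g (\<phi> k) - proj_dual \<phi> \<phi>s F g (\<phi> k)\<bar>\<^sup>2 / d k) \<le> (sqrt (1 - \<theta>\<^sup>2) * dnorm g)\<^sup>2" .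
  qed
qed

text \<open>The factor is 1 + 2: the error of w, plus the coarsening error, which is 2 \<epsilon> in
  the energy-space norm because the tolerance already contains \<open>\<beta>l\<close>. The new
  Galerkin solution is at least as good as the projection of w.\<close>

lemma coarse_bound:
  assumes w: "w \<in> span_of \<phi> \<Lambda>s" "\<Lambda>s \<subseteq> KK" "finite \<Lambda>s" and e: "H10_norm (\<lambda>x. u x - w x) \<le> \<epsilon>"
    and c: "is_COARSE \<phi> \<phi>s \<beta>l \<Lambda>s w \<epsilon> \<Lambda>" and gal: "is_GAL \<nu> \<sigma> f \<phi> \<Lambda> w'"
  shows "H10_norm (\<lambda>x. u x - w' x) \<le> 3 * \<epsilon>"
proof -
  have L: "\<Lambda> \<subseteq> \<Lambda>s" "phi_norm \<phi> \<phi>s (\<lambda>x. w x - proj \<phi> \<phi>s \<Lambda> w x) \<le> 2 * \<beta>l * \<epsilon>" using c by (auto simp: is_COARSE_def)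
  have LK: "\<Lambda> \<subseteq> KK" "finite \<Lambda>" using L(1) w(2,3) finite_subset by auto
  have p: "proj \<phi> \<phi>s \<Lambda> w \<in> span_of \<phi> \<Lambda>" unfolding proj_def by (rule span_ofI[OF LK(2) subset_refl])
  note H = span_H10[OF w(2,1)] span_H10[OF LK(1) p]
  let ?h = "\<lambda>x. w x - proj \<phi> \<phi>s \<Lambda> w x"
  have "\<beta>l * H10_norm ?h \<le> \<beta>l * (2 * \<epsilon>)"
    using equiv(1)[OF H10_diff[OF H]] L(2) by (simp add: mult_ac)
  then have h: "H10_norm ?h \<le> 2 * \<epsilon>" using beta by simp
  have "(\<lambda>x. u x - proj \<phi> \<phi>s \<Lambda> w x) = (\<lambda>x. (u x - w x) + ?h x)" by auto
  then have "H10_norm (\<lambda>x. u x - proj \<phi> \<phi>s \<Lambda> w x) \<le> H10_norm (\<lambda>x. u x - w x) + H10_norm ?h"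
    using H10_norm_add[OF H10_diff[OF u H(1)] H10_diff[OF H]] by simp
  with GAL_optimal[OF gal LK(1) p] e h show ?thesis by linarith
qed

end

section \<open>The truncated inverse, enrichment and contraction\<close>

lemma has_sum_finite_sum:
  fixes h :: "'m \<Rightarrow> 'i \<Rightarrow> real"
  assumes "\<And>m. m \<in> H \<Longrightarrow> (h m has_sum s m) A"
  shows "((\<lambda>l. \<Sum>m\<in>H. h m l) has_sum (\<Sum>m\<in>H. s m)) A"
  using assms by (induction H rule: infinite_finite_induct) (auto intro: has_sum_add)

lemma has_sum_abs_le:
  fixes h :: "'i \<Rightarrow> real"
  assumes "(h has_sum s) A" "\<And>F. finite F \<Longrightarrow> F \<subseteq> A \<Longrightarrow> \<bar>sum h F\<bar> \<le> B"
  shows "\<bar>s\<bar> \<le> B"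
proof (rule tendsto_upperbound)
  show "((\<lambda>F. \<bar>sum h F\<bar>) \<longlongrightarrow> \<bar>s\<bar>) (finite_subsets_at_top A)"
    using assms(1) by (intro tendsto_rabs) (simp add: has_sum_def)
  show "\<forall>\<^sub>F F in finite_subsets_at_top A. \<bar>sum h F\<bar> \<le> B"
    by (rule eventually_finite_subsets_at_top_weakI) (use assms(2) in auto)
qed simp

context adaptive
begin

abbreviation A :: index_matrix where "A \<equiv> (\<lambda>l k. a_form \<nu> \<sigma> (\<phi> k) (\<phi> l))"

text \<open>The identity A Ainv = I fixes only the value of an infinite sum, which would be 0 by
  default if the sum diverged. Convergence comes from boundedness of A applied to a column of Ainv,
  which lies in \<open>ell2\<close> as the image of a unit vector.\<close>

lemma inverse_column:
  assumes inv: "is_ell2_inverse KK A Ainv" and F: "finite F" "F \<subseteq> KK" and m: "m \<in> KK"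
  shows "((\<lambda>l. A m l * (\<Sum>k\<in>F. Ainv l k * g k)) has_sum (if m \<in> F then g m else 0)) KK"
proof -
  obtain C where C: "op_bound KK A C" using inv by (auto simp: is_ell2_inverse_def op_bounded_def)
  have ob: "op_bounded KK Ainv" and id: "is_identity KK (mat_mult KK A Ainv)" using inv by (auto simp: is_ell2_inverse_def)
  have col: "((\<lambda>l. A m l * Ainv l k) has_sum (if m = k then 1 else 0)) KK" if k: "k \<in> KK" for k
  proof -
    let ?e = "\<lambda>j. if j = k then 1 else 0 :: real"
    have e: "?e \<in> ell2 KK" by (rule ell2_finite_support[of "{k}"]) (use k in auto)
    have "mat_vec KK Ainv ?e = (\<lambda>l. Ainv l k)"
      unfolding mat_vec_def by (intro ext, subst infsum_KK_eq[of "{k}"]) (use k in auto)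
    then have "(\<lambda>l. Ainv l k) \<in> ell2 KK" using op_norm_bound(1)[OF ob e] by simp
    then have "(\<lambda>l. A m l * Ainv l k) summable_on KK" using C m by (simp add: op_bound_def)
    moreover have "(\<Sum>\<^sub>\<infinity>l\<in>KK. A m l * Ainv l k) = (if m = k then 1 else 0)"
      using id m k unfolding is_identity_def mat_mult_def by simp
    ultimately show ?thesis by (simp add: has_sum_iff)
  qed
  have "((\<lambda>l. \<Sum>k\<in>F. A m l * Ainv l k * g k) has_sum (\<Sum>k\<in>F. (if m = k then 1 else 0) * g k)) KK"
    by (intro has_sum_finite_sum has_sum_cmult_left col) (use F in auto)
  also have "(\<lambda>l. \<Sum>k\<in>F. A m l * Ainv l k * g k) = (\<lambda>l. A m l * (\<Sum>k\<in>F. Ainv l k * g k))"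
    by (simp add: sum_distrib_left mult.assoc)
  also have "(\<Sum>k\<in>F. (if m = k then 1 else 0) * g k) = (\<Sum>k\<in>F. if m = k then g k else 0)"
    by (intro sum.cong refl) auto
  finally show ?thesis using F(1) by simp
qed

text \<open>The banded inverse applied to coefficients supported in F has support in the enriched
  set; this gives w. The error functional has the values A z on the basis, with z the discarded tail
  of the inverse applied to g. Against a finite combination it is a limit of pairings with finite
  partial sums of z, whose norms are bounded uniformly through \<open>ds\<close> and
  \<open>\<beta>l\<close>, so the estimate is made without forming the infinite combination.\<close>

lemma banded_inverse:
  assumes inv: "is_ell2_inverse KK A Ainv" and F: "finite F" "F \<subseteq> KK"
    and tail: "op_bounded KK (\<lambda>l k. Ainv l k - band J Ainv l k)" "op_norm KK (\<lambda>l k. Ainv l k - band J Ainv l k) \<le> \<tau>"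
    and v: "v \<in> H10"
  shows "\<bar>(\<Sum>k\<in>F. g k * \<phi>s k v) - \<nu>0 * H10_inner (\<lambda>x. \<Sum>l\<in>ENRICH F J. (\<Sum>k\<in>F. band J Ainv l k * g k) * \<phi> l x) v\<bar>
    \<le> \<nu>0 * (sqrt ds * (\<tau> * sqrt (\<Sum>k\<in>F. (g k)\<^sup>2)) / \<beta>l) * H10_norm v"
proof -
  define T where "T l k = Ainv l k - band J Ainv l k" for l k
  define gz where "gz k = (if k \<in> F then g k else 0)" for k
  define X where "X l = (\<Sum>k\<in>F. Ainv l k * g k)" for l
  define XJ where "XJ l = (\<Sum>k\<in>F. band J Ainv l k * g k)" for l
  define z where "z l = X l - XJ l" for l
  define Q where "Q = \<tau> * sqrt (\<Sum>k\<in>F. (g k)\<^sup>2)"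
  define w where "w = (\<lambda>x. \<Sum>l\<in>ENRICH F J. XJ l * \<phi> l x)"
  note fin = finite_ENRICH[OF F(1), of J] ENRICH_KK[of F J]
  have w: "w \<in> H10" unfolding w_def by (rule comb_H10[OF fin(2)])
  have ds: "1 \<le> ds" using weight[of "(2, 2)"] by (simp add: KK_def)
  have gz: "gz \<in> ell2 KK" "ell2_norm KK gz = sqrt (\<Sum>k\<in>F. (g k)\<^sup>2)"
    using ell2_finite_support[OF F, of gz] by (simp_all add: gz_def)
  have mv: "mat_vec KK T gz = z"
  proof
    fix l
    have "mat_vec KK T gz l = (\<Sum>k\<in>F. T l k * gz k)"
      unfolding mat_vec_def by (rule infsum_KK_eq[OF F]) (simp add: gz_def)
    then show "mat_vec KK T gz l = z l"
      by (simp add: z_def X_def XJ_def T_def gz_def left_diff_distrib sum_subtractf)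
  qed
  have tailT: "op_bounded KK T" "op_norm KK T \<le> \<tau>" using tail by (simp_all add: T_def[abs_def])
  have z: "z \<in> ell2 KK" using op_norm_bound(1)[OF tailT(1) gz(1)] by (simp add: mv)
  have zn: "ell2_norm KK z \<le> Q"
    using op_norm_bound(2)[OF tailT(1) gz(1)] mult_right_mono[OF tailT(2), of "ell2_norm KK gz"]
    by (simp add: mv gz(2) Q_def sum_nonneg)
  have Q0: "0 \<le> Q" using zn by (rule order_trans[rotated]) (simp add: ell2_norm_def infsum_nonneg)
  have zfin: "(\<Sum>l\<in>H. (z l)\<^sup>2) \<le> Q\<^sup>2" if "finite H" "H \<subseteq> KK" for H
  proof -
    have "(ell2_norm KK z)\<^sup>2 \<le> Q\<^sup>2" using zn by (intro power_mono) (simp_all add: ell2_norm_def infsum_nonneg)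
    then show ?thesis using ell2_finite_sum[OF z that] by linarith
  qed
  have Znorm: "H10_norm (\<lambda>x. \<Sum>l\<in>H. z l * \<phi> l x) \<le> sqrt ds * Q / \<beta>l" if H: "finite H" "H \<subseteq> KK" for H
  proof -
    have "(\<Sum>l\<in>H. (z l)\<^sup>2 * d l) \<le> (\<Sum>l\<in>H. (z l)\<^sup>2 * ds)" using H weight(2) by (intro sum_mono mult_left_mono) auto
    also have "\<dots> \<le> Q\<^sup>2 * ds" unfolding sum_distrib_right[symmetric] using zfin[OF H] ds by (intro mult_right_mono) auto
    finally have "sqrt (\<Sum>l\<in>H. (z l)\<^sup>2 * d l) \<le> sqrt (Q\<^sup>2 * ds)" by simp
    also have "\<dots> = sqrt ds * Q" using Q0 by (simp add: real_sqrt_mult)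
    finally show ?thesis using comb_norm[OF H, of z] beta by (meson divide_right_mono less_imp_le order_trans)
  qed
  have gdual: "(\<lambda>v. \<Sum>k\<in>F. g k * \<phi>s k v) \<in> H10_dual" by (rule dual_sum[OF F])
  have q: "(\<lambda>v. (\<Sum>k\<in>F. g k * \<phi>s k v) - \<nu>0 * H10_inner w v) \<in> H10_dual"
    by (rule H10_dual_diff[OF gdual a_dual[OF w]])
  let ?q = "\<lambda>v. (\<Sum>k\<in>F. g k * \<phi>s k v) - \<nu>0 * H10_inner w v"
  \<comment> \<open>The coefficients z are \<open>X\<close> - \<open>XJ\<close>. The full inverse
    reproduces g on F, and the banded part is a finite combination, so its image is the pairing with
    w.\<close>
  have qm: "((\<lambda>l. A m l * z l) has_sum ?q (\<phi> m)) KK" if m: "m \<in> KK" for m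
  proof -
    have 1: "((\<lambda>l. A m l * X l) has_sum gz m) KK"
      unfolding X_def gz_def by (rule inverse_column[OF inv F m])
    have 2: "((\<lambda>l. A m l * XJ l) has_sum (\<Sum>l\<in>ENRICH F J. A m l * XJ l)) KK"
    proof (rule has_sum_finite_neutralI[OF fin _ refl])
      fix l assume l: "l \<in> KK - ENRICH F J"
      then have "band J Ainv l k = 0" if "k \<in> F" for k using that by (auto simp: ENRICH_def band_def)
      then show "A m l * XJ l = 0" by (simp add: XJ_def)
    qed
    have "((\<lambda>l. A m l * X l + - 1 * (A m l * XJ l)) has_sum gz m + - 1 * (\<Sum>l\<in>ENRICH F J. A m l * XJ l)) KK"
      by (intro has_sum_add 1 has_sum_cmult_right 2)
    moreover have "(\<Sum>k\<in>F. g k * \<phi>s k (\<phi> m)) = gz m"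
    proof -
      have "(\<Sum>k\<in>F. g k * \<phi>s k (\<phi> m)) = (\<Sum>k\<in>F. if m = k then g k else 0)"
        by (intro sum.cong refl) (use F(2) m in \<open>auto simp: dual_basis\<close>)
      then show ?thesis using F(1) by (simp add: gz_def)
    qed
    moreover have "\<nu>0 * H10_inner w (\<phi> m) = (\<Sum>l\<in>ENRICH F J. A m l * XJ l)"
    proof -
      have "H10_inner w (\<phi> m) = (\<Sum>l\<in>ENRICH F J. XJ l * H10_inner (\<phi> l) (\<phi> m))"
        unfolding w_def using fin(2) by (intro sym_form_sum[OF sym_form_H10_inner] basis m) auto
      then have "\<nu>0 * H10_inner w (\<phi> m) = (\<Sum>l\<in>ENRICH F J. \<nu>0 * (XJ l * H10_inner (\<phi> l) (\<phi> m)))"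
        by (simp add: sum_distrib_left)
      also have "\<dots> = (\<Sum>l\<in>ENRICH F J. A m l * XJ l)"
        by (intro sum.cong refl) (use fin(2) m in \<open>auto simp: rigid basis subset_iff\<close>)
      finally show ?thesis .
    qed
    ultimately show ?thesis by (simp add: z_def right_diff_distrib)
  qed
  have "\<bar>?q v\<bar> \<le> \<nu>0 * (sqrt ds * Q / \<beta>l) * H10_norm v"
  proof (rule extend_bound[OF q _ _ v])
    show "0 \<le> \<nu>0 * (sqrt ds * Q / \<beta>l)" using nu0 ds Q0 beta by simp
    fix H c assume H: "finite H" "H \<subseteq> KK"
    let ?v = "\<lambda>x. \<Sum>m\<in>H. c m * \<phi> m x"
    have "?q ?v = (\<Sum>m\<in>H. c m * ?q (\<phi> m))"
      using H(2) by (intro H10_dual_sum[OF q] basis) auto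
    then have hs: "((\<lambda>l. \<Sum>m\<in>H. c m * (A m l * z l)) has_sum ?q ?v) KK"
      using H(2) by (simp only:) (intro has_sum_finite_sum has_sum_cmult_right qm, auto)
    show "\<bar>?q ?v\<bar> \<le> \<nu>0 * (sqrt ds * Q / \<beta>l) * H10_norm ?v"
    proof (rule has_sum_abs_le[OF hs])
      fix Y assume Y: "finite Y" "Y \<subseteq> KK"
      let ?Z = "\<lambda>x. \<Sum>l\<in>Y. z l * \<phi> l x"
      have ZH: "?Z \<in> H10" "?v \<in> H10" by (rule comb_H10[OF Y(2)], rule comb_H10[OF H(2)])
      have "\<nu>0 * H10_inner ?Z ?v = \<nu>0 * (\<Sum>l\<in>Y. z l * (\<Sum>m\<in>H. c m * H10_inner (\<phi> l) (\<phi> m)))"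
      proof -
        have "H10_inner ?Z ?v = (\<Sum>l\<in>Y. z l * H10_inner (\<phi> l) ?v)"
          using Y(2) by (intro sym_form_sum[OF sym_form_H10_inner ZH(2)] basis) auto
        also have "\<dots> = (\<Sum>l\<in>Y. z l * (\<Sum>m\<in>H. c m * H10_inner (\<phi> l) (\<phi> m)))"
          using Y(2) H(2) by (intro sum.cong refl arg_cong2[of _ _ _ _ "(*)"] sym_form_sum_right[OF sym_form_H10_inner] basis) auto
        finally show ?thesis by simp
      qed
      also have "\<dots> = (\<Sum>l\<in>Y. \<Sum>m\<in>H. c m * (A m l * z l))"
        unfolding sum_distrib_left
      proof (intro sum.cong refl)
        fix l m assume "l \<in> Y" "m \<in> H"
        then have "A m l = \<nu>0 * H10_inner (\<phi> l) (\<phi> m)" using Y H by (intro rigid basis) auto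
        then show "\<nu>0 * (z l * (c m * H10_inner (\<phi> l) (\<phi> m))) = c m * (A m l * z l)" by (simp only: mult_ac)
      qed
      finally have "\<bar>\<Sum>l\<in>Y. \<Sum>m\<in>H. c m * (A m l * z l)\<bar> = \<bar>\<nu>0 * H10_inner ?Z ?v\<bar>" by simp
      also have "\<dots> = \<nu>0 * \<bar>H10_inner ?Z ?v\<bar>" using nu0 by (simp add: abs_mult)
      also have "\<dots> \<le> \<nu>0 * (H10_norm ?Z * H10_norm ?v)"
        using nu0 by (intro mult_left_mono H10_Cauchy_Schwarz ZH) auto
      also have "\<dots> \<le> \<nu>0 * (sqrt ds * Q / \<beta>l * H10_norm ?v)"
        using nu0 by (intro mult_left_mono mult_right_mono Znorm Y H10_norm_nonneg) auto
      finally show "\<bar>\<Sum>l\<in>Y. \<Sum>m\<in>H. c m * (A m l * z l)\<bar> \<le> \<nu>0 * (sqrt ds * Q / \<beta>l) * H10_norm ?v" by simp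
    qed
  qed
  then show ?thesis by (simp only: w_def Q_def XJ_def)
qed

text \<open>For the error y of un + w, \<nu>0 times the square of its norm splits into three
  pairings with y: the residual minus its approximation, the approximation minus its marked part,
  and the marked part minus the image of w. The assumption on \<delta>, the Doerfler property and
  the choice of the band width make each of them at most \<nu>0 (\<open>\<beta>u\<close> /
  \<open>\<alpha>l\<close>) sqrt(1 - \<theta>^2) times the norms of \<open>rt\<close> and y.\<close>

lemma enrich_error:
  assumes inv: "is_ell2_inverse KK A Ainv"
    and tail: "op_bounded KK (\<lambda>l k. Ainv l k - band J Ainv l k)" "op_norm KK (\<lambda>l k. Ainv l k - band J Ainv l k) \<le> \<tau>" "0 \<le> \<tau>"
    and tau: "\<tau> \<le> \<beta>l\<^sup>2 / ds * sqrt ((1 - \<theta>\<^sup>2) / (\<alpha>l * \<alpha>u))"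
    and al: "0 < \<alpha>l" "\<alpha>l \<le> \<nu>0" "\<nu>0 \<le> \<alpha>u" and th: "0 < \<theta>" "\<theta> < 1" and del: "0 < \<delta>" "\<delta> \<le> sqrt (1 - \<theta>\<^sup>2)"
    and un: "un \<in> H10" and res: "is_F_RES \<nu> \<sigma> f \<phi> \<phi>s un \<delta> rt" and doe: "is_DOERFLER \<phi> \<phi>s rt \<theta> F"
  obtains w where "w \<in> span_of \<phi> (ENRICH F J)"
    "H10_norm (\<lambda>x. u x - (un x + w x)) \<le> 3 * (\<beta>u / \<alpha>l) * sqrt (1 - \<theta>\<^sup>2) * dnorm rt"
proof -
  define s where "s = sqrt (1 - \<theta>\<^sup>2)"
  have s: "0 \<le> s" using th by (simp add: s_def power_le_one)
  define w where "w = (\<lambda>x. \<Sum>l\<in>ENRICH F J. (\<Sum>k\<in>F. band J Ainv l k * rt (\<phi> k)) * \<phi> l x)"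
  have rt: "rt \<in> H10_dual" "dnorm (\<lambda>v. residual \<nu> \<sigma> f un v - rt v) \<le> \<delta> * dnorm rt" using res by (auto simp: is_F_RES_def)
  have adm: "doerfler_admissible \<phi> \<phi>s rt \<theta> F" and F: "finite F" "F \<subseteq> KK" using doe by (auto simp: is_DOERFLER_def doerfler_admissible_def)
  note fin = finite_ENRICH[OF F(1), of J] ENRICH_KK[of F J]
  have w: "w \<in> span_of \<phi> (ENRICH F J)" unfolding w_def by (rule span_ofI[OF fin(1) subset_refl])
  have wH: "w \<in> H10" by (rule span_H10[OF fin(2) w])
  have eH: "(\<lambda>x. u x - un x) \<in> H10" by (rule H10_diff[OF u un])
  define y where "y = (\<lambda>x. (u x - un x) - w x)"
  have y: "y \<in> H10" unfolding y_def by (rule H10_diff[OF eH wH])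
  have ds: "1 \<le> ds" using weight[of "(2, 2)"] by (simp add: KK_def)
  let ?p = "proj_dual \<phi> \<phi>s F rt"
  have p: "?p \<in> H10_dual" by (rule proj_dual_dual[OF F])
  note N = H10_norm_nonneg[of y] dnorm_nonneg[of rt]
  have t1: "\<bar>residual \<nu> \<sigma> f un y - rt y\<bar> \<le> s * dnorm rt * \<beta>u * H10_norm y"
  proof -
    have "\<bar>residual \<nu> \<sigma> f un y - rt y\<bar> \<le> dnorm (\<lambda>v. residual \<nu> \<sigma> f un v - rt v) * \<beta>u * H10_norm y"
      by (rule dual_pairing[OF H10_dual_diff[OF residual_dual[OF un] rt(1)] y])
    also have "\<dots> \<le> (s * dnorm rt) * \<beta>u * H10_norm y"
      using N beta_u rt(2) mult_right_mono[OF del(2) N(2)] by (intro mult_right_mono) (auto simp: s_def)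
    finally show ?thesis .
  qed
  have t2: "\<bar>rt y - ?p y\<bar> \<le> s * dnorm rt * \<beta>u * H10_norm y"
  proof -
    have "\<bar>rt y - ?p y\<bar> \<le> dnorm (\<lambda>v. rt v - ?p v) * \<beta>u * H10_norm y"
      by (rule dual_pairing[OF H10_dual_diff[OF rt(1) p] y])
    also have "\<dots> \<le> (s * dnorm rt) * \<beta>u * H10_norm y"
      using N beta_u doerfler_complement[OF rt(1) adm th] by (intro mult_right_mono) (auto simp: s_def)
    finally show ?thesis .
  qed
  have t3: "\<bar>?p y - \<nu>0 * H10_inner w y\<bar> \<le> \<nu>0 * (\<beta>u / \<alpha>l * s * dnorm rt) * H10_norm y"
  proof -
    \<comment> \<open>Passing from the weighted dual norm to plain \<open>ell2\<close> costs sqrt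
      ds. A second sqrt ds comes from \<open>banded_inverse\<close>, and together they cancel the ds
      in the bound for \<tau>.\<close>
    have "(\<Sum>k\<in>F. (rt (\<phi> k))\<^sup>2) \<le> (\<Sum>k\<in>F. ds * (\<bar>rt (\<phi> k)\<bar>\<^sup>2 / d k))"
    proof (rule sum_mono)
      fix k assume "k \<in> F"
      then have "k \<in> KK" using F(2) by blast
      then have "0 < d k" "d k \<le> ds" by (rule d_pos, rule weight(2))
      then have "(rt (\<phi> k))\<^sup>2 * 1 \<le> (rt (\<phi> k))\<^sup>2 * (ds / d k)" by (intro mult_left_mono) auto
      then show "(rt (\<phi> k))\<^sup>2 \<le> ds * (\<bar>rt (\<phi> k)\<bar>\<^sup>2 / d k)" by (simp add: mult_ac)
    qed
    then have "sqrt (\<Sum>k\<in>F. (rt (\<phi> k))\<^sup>2) \<le> sqrt (ds * (\<Sum>k\<in>F. \<bar>rt (\<phi> k)\<bar>\<^sup>2 / d k))"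
      by (simp add: sum_distrib_left)
    also have "\<dots> \<le> sqrt ds * dnorm rt"
      using dnorm_finite[OF rt(1) F] ds by (simp add: real_sqrt_mult mult_left_mono)
    finally have g: "sqrt (\<Sum>k\<in>F. (rt (\<phi> k))\<^sup>2) \<le> sqrt ds * dnorm rt" .
    \<comment> \<open>The geometric mean of the two ellipticity constants is at least the smaller
      one, so the mixed constant in the definition of the band width may be replaced by
      \<open>\<alpha>l\<close>.\<close>
    have "\<alpha>l = sqrt (\<alpha>l * \<alpha>l)" using al by simp
    also have "\<dots> \<le> sqrt (\<alpha>l * \<alpha>u)" using al by (intro real_sqrt_le_mono mult_left_mono) auto
    finally have "sqrt ((1 - \<theta>\<^sup>2) / (\<alpha>l * \<alpha>u)) \<le> s / \<alpha>l"
      unfolding real_sqrt_divide s_def[symmetric] using al s by (intro divide_left_mono) auto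
    then have "\<beta>l\<^sup>2 / ds * sqrt ((1 - \<theta>\<^sup>2) / (\<alpha>l * \<alpha>u)) \<le> \<beta>l\<^sup>2 / ds * (s / \<alpha>l)"
      using ds by (intro mult_left_mono) auto
    with tau have tau': "\<tau> \<le> \<beta>l\<^sup>2 / ds * (s / \<alpha>l)" by linarith
    have "sqrt ds * (\<tau> * sqrt (\<Sum>k\<in>F. (rt (\<phi> k))\<^sup>2)) / \<beta>l \<le> sqrt ds * (\<tau> * (sqrt ds * dnorm rt)) / \<beta>l"
      using ds tail(3) beta g by (intro divide_right_mono mult_left_mono) auto
    also have "\<dots> = (sqrt ds * sqrt ds * dnorm rt / \<beta>l) * \<tau>" by (simp only: times_divide_eq_left times_divide_eq_right mult_ac)
    also have "\<dots> = (ds * dnorm rt / \<beta>l) * \<tau>" using ds by simp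
    also have "\<dots> \<le> (ds * dnorm rt / \<beta>l) * (\<beta>l\<^sup>2 / ds * (s / \<alpha>l))"
      using ds N beta by (intro mult_left_mono tau') auto
    also have "\<dots> = \<beta>l / \<alpha>l * s * dnorm rt" using ds beta al by (simp add: field_simps power2_eq_square)
    also have "\<dots> \<le> \<beta>u / \<alpha>l * s * dnorm rt"
      using beta al s N by (intro mult_right_mono divide_right_mono) auto
    finally have K: "sqrt ds * (\<tau> * sqrt (\<Sum>k\<in>F. (rt (\<phi> k))\<^sup>2)) / \<beta>l \<le> \<beta>u / \<alpha>l * s * dnorm rt" .
    have "\<bar>?p y - \<nu>0 * H10_inner w y\<bar> \<le> \<nu>0 * (sqrt ds * (\<tau> * sqrt (\<Sum>k\<in>F. (rt (\<phi> k))\<^sup>2)) / \<beta>l) * H10_norm y"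
      unfolding w_def proj_dual_def by (rule banded_inverse[OF inv F tail(1,2) y])
    also have "\<dots> \<le> \<nu>0 * (\<beta>u / \<alpha>l * s * dnorm rt) * H10_norm y"
      using K nu0 N by (intro mult_right_mono mult_left_mono) auto
    finally show ?thesis .
  qed
  have "\<nu>0 * (H10_norm y * H10_norm y) = \<nu>0 * H10_inner y y" by (simp add: H10_norm_sq[symmetric] power2_eq_square)
  also have "H10_inner y y = H10_inner (\<lambda>x. u x - un x) y - H10_inner w y"
    unfolding y_def by (rule sym_form_diff[OF sym_form_H10_inner eH wH]) (use y in \<open>simp add: y_def\<close>)
  also have "\<nu>0 * \<dots> = (residual \<nu> \<sigma> f un y - rt y) + (rt y - ?p y) + (?p y - \<nu>0 * H10_inner w y)"
    by (simp add: residual_eq[OF un y] right_diff_distrib)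
  also have "\<dots> \<le> s * dnorm rt * \<beta>u * H10_norm y + s * dnorm rt * \<beta>u * H10_norm y + \<nu>0 * (\<beta>u / \<alpha>l * s * dnorm rt) * H10_norm y"
    using t1 t2 t3 by linarith
  also have "\<dots> \<le> \<nu>0 * (3 * (\<beta>u / \<alpha>l) * s * dnorm rt) * H10_norm y"
  proof -
    \<comment> \<open>The first two contributions lack a factor \<nu>0 / \<open>\<alpha>l\<close>,
      which is at least 1; inserting it gives all three the same bound.\<close>
    have "s * dnorm rt * \<beta>u * H10_norm y * \<alpha>l \<le> s * dnorm rt * \<beta>u * H10_norm y * \<nu>0"
      using al s N beta_u by (intro mult_left_mono) auto
    then have "s * dnorm rt * \<beta>u * H10_norm y \<le> \<nu>0 * (\<beta>u / \<alpha>l * s * dnorm rt) * H10_norm y"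
      using al by (simp add: field_simps)
    moreover have "p + p + q \<le> q'" if "p \<le> q" "q' = 3 * q" for p q q' :: real using that by simp
    moreover have "\<nu>0 * (3 * (\<beta>u / \<alpha>l) * s * dnorm rt) * H10_norm y = 3 * (\<nu>0 * (\<beta>u / \<alpha>l * s * dnorm rt) * H10_norm y)"
      by simp
    ultimately show ?thesis by blast
  qed
  finally have le: "\<nu>0 * (H10_norm y * H10_norm y) \<le> \<nu>0 * ((3 * (\<beta>u / \<alpha>l) * s * dnorm rt) * H10_norm y)" by (simp add: mult.assoc)
  have "0 \<le> 3 * (\<beta>u / \<alpha>l) * s * dnorm rt" using al s N beta_u by simp
  then have "H10_norm y \<le> 3 * (\<beta>u / \<alpha>l) * s * dnorm rt"
  proof (cases "H10_norm y = 0")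
    case False
    then have "0 < H10_norm y" using N(1) by linarith
    moreover have "H10_norm y * H10_norm y \<le> (3 * (\<beta>u / \<alpha>l) * s * dnorm rt) * H10_norm y"
      using le by (simp only: mult_le_cancel_left_pos[OF nu0])
    ultimately show ?thesis by (simp only: mult_le_cancel_right_pos)
  qed simp
  moreover have "(\<lambda>x. u x - (un x + w x)) = y" by (auto simp: y_def)
  ultimately show thesis using that[OF w] by (simp add: s_def)
qed

text \<open>The approximate residual differs from the true one by at most \<delta> of its own norm,
  hence the factor 1 - \<delta>; the true residual is bounded by the error since it is \<nu>0 times
  the pairing with it.\<close>

lemma residual_estimate:
  assumes del: "0 < \<delta>" "\<delta> < 1" and un: "un \<in> H10" and res: "is_F_RES \<nu> \<sigma> f \<phi> \<phi>s un \<delta> rt"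
  shows "dnorm rt \<le> \<nu>0 / (\<beta>l * (1 - \<delta>)) * H10_norm (\<lambda>x. u x - un x)"
proof -
  have rt: "rt \<in> H10_dual" "dnorm (\<lambda>v. residual \<nu> \<sigma> f un v - rt v) \<le> \<delta> * dnorm rt" using res by (auto simp: is_F_RES_def)
  have "dnorm rt * (1 - \<delta>) \<le> dnorm (residual \<nu> \<sigma> f un)"
    using dnorm_triangle[OF residual_dual[OF un] rt(1)] rt(2) by (simp add: algebra_simps)
  also have "\<dots> \<le> \<nu>0 * H10_norm (\<lambda>x. u x - un x) / \<beta>l" by (rule residual_norm[OF un])
  finally show ?thesis using del beta by (simp add: field_simps)
qed

text \<open>The accuracy of the residual is relative, so a vanishing approximation forces a
  vanishing residual. Pairing with the error itself then gives zero norm.\<close>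

lemma residual_zero_imp_exact:
  assumes un: "un \<in> H10" and res: "is_F_RES \<nu> \<sigma> f \<phi> \<phi>s un \<delta> rt" and z: "dnorm rt \<le> 0"
  shows "H10_norm (\<lambda>x. u x - un x) = 0"
proof -
  let ?e = "\<lambda>x. u x - un x"
  have e: "?e \<in> H10" by (rule H10_diff[OF u un])
  have rt: "rt \<in> H10_dual" "dnorm (\<lambda>v. residual \<nu> \<sigma> f un v - rt v) \<le> \<delta> * dnorm rt" using res by (auto simp: is_F_RES_def)
  have z0: "dnorm rt = 0" using z dnorm_nonneg[of rt] by simp
  then have "dnorm (\<lambda>v. residual \<nu> \<sigma> f un v - rt v) = 0" using rt(2) dnorm_nonneg[of "\<lambda>v. residual \<nu> \<sigma> f un v - rt v"] by simp
  then have "residual \<nu> \<sigma> f un ?e = 0"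
    using dual_pairing[OF rt(1) e] dual_pairing[OF H10_dual_diff[OF residual_dual[OF un] rt(1)] e] z0 by simp
  then show ?thesis using nu0 by (simp add: residual_eq[OF un e] H10_norm_def)
qed

text \<open>The enriched candidate un + w lies in the space of the first Galerkin solve, whose error
  is therefore within the tolerance handed to the coarsening; this is the precondition for its
  factor 3. The residual estimate with \<nu>0 \<le> \<open>\<alpha>u\<close> turns the tolerance
  back into the previous error.\<close>

lemma step_error:
  assumes inv: "is_ell2_inverse KK A Ainv"
    and tail: "op_bounded KK (\<lambda>l k. Ainv l k - band J Ainv l k)" "op_norm KK (\<lambda>l k. Ainv l k - band J Ainv l k) \<le> \<tau>" "0 \<le> \<tau>"
    and tau: "\<tau> \<le> \<beta>l\<^sup>2 / ds * sqrt ((1 - \<theta>\<^sup>2) / (\<alpha>l * \<alpha>u))"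
    and al: "0 < \<alpha>l" "\<alpha>l \<le> \<nu>0" "\<nu>0 \<le> \<alpha>u" and th: "0 < \<theta>" "\<theta> < 1" and del: "0 < \<delta>" "\<delta> \<le> sqrt (1 - \<theta>\<^sup>2)" "\<delta> < 1"
    and un: "un \<in> span_of \<phi> \<Lambda>" "\<Lambda> \<subseteq> KK" "finite \<Lambda>" and res: "is_F_RES \<nu> \<sigma> f \<phi> \<phi>s un \<delta> rt"
    and step: "fpc_step \<nu> \<sigma> f \<phi> \<phi>s \<alpha>l \<beta>l \<beta>u J \<theta> \<delta> \<Lambda> rt \<Lambda>' u' r'"
  shows "H10_norm (\<lambda>x. u x - u' x) \<le> 9 * (\<alpha>u / \<alpha>l) * (\<beta>u / \<beta>l) * (sqrt (1 - \<theta>\<^sup>2) / (1 - \<delta>)) * H10_norm (\<lambda>x. u x - un x)"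
    "u' \<in> span_of \<phi> \<Lambda>'" "\<Lambda>' \<subseteq> KK" "finite \<Lambda>'" "is_F_RES \<nu> \<sigma> f \<phi> \<phi>s u' \<delta> r'"
proof -
  obtain \<Lambda>d uh F where s: "is_DOERFLER \<phi> \<phi>s rt \<theta> F" "\<Lambda>d = ENRICH F J" "is_GAL \<nu> \<sigma> f \<phi> (\<Lambda> \<union> \<Lambda>d) uh"
    "is_COARSE \<phi> \<phi>s \<beta>l (\<Lambda> \<union> \<Lambda>d) uh (3 * (\<beta>u / \<alpha>l) * sqrt (1 - \<theta>\<^sup>2) * dnorm rt) \<Lambda>'"
    "is_GAL \<nu> \<sigma> f \<phi> \<Lambda>' u'" "is_F_RES \<nu> \<sigma> f \<phi> \<phi>s u' \<delta> r'"
    using step unfolding fpc_step_def is_E_DOERFLER_def by blast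
  show "is_F_RES \<nu> \<sigma> f \<phi> \<phi>s u' \<delta> r'" by (rule s)
  show "u' \<in> span_of \<phi> \<Lambda>'" using s(5) by (simp add: is_GAL_def)
  have "finite F" using s(1) by (simp add: is_DOERFLER_def doerfler_admissible_def)
  then have L: "\<Lambda> \<union> \<Lambda>d \<subseteq> KK" "finite (\<Lambda> \<union> \<Lambda>d)" using un finite_ENRICH ENRICH_KK s(2) by auto
  have "\<Lambda>' \<subseteq> \<Lambda> \<union> \<Lambda>d" using s(4) by (simp add: is_COARSE_def)
  then show "\<Lambda>' \<subseteq> KK" "finite \<Lambda>'" using L finite_subset by auto
  have unH: "un \<in> H10" by (rule span_H10[OF un(2,1)])
  obtain w where w: "w \<in> span_of \<phi> (ENRICH F J)" "H10_norm (\<lambda>x. u x - (un x + w x)) \<le> 3 * (\<beta>u / \<alpha>l) * sqrt (1 - \<theta>\<^sup>2) * dnorm rt"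
    by (rule enrich_error[OF inv tail tau al th del(1,2) unH res s(1)])
  have "(\<lambda>x. un x + w x) \<in> span_of \<phi> (\<Lambda> \<union> \<Lambda>d)"
    using un(1) w(1) s(2) span_of_mono[of \<Lambda> "\<Lambda> \<union> \<Lambda>d" \<phi>] span_of_mono[of \<Lambda>d "\<Lambda> \<union> \<Lambda>d" \<phi>] by (intro span_of_add) auto
  from GAL_optimal[OF s(3) L(1) this] w(2)
  have uh: "H10_norm (\<lambda>x. u x - uh x) \<le> 3 * (\<beta>u / \<alpha>l) * sqrt (1 - \<theta>\<^sup>2) * dnorm rt" by linarith
  have "uh \<in> span_of \<phi> (\<Lambda> \<union> \<Lambda>d)" using s(3) by (simp add: is_GAL_def)
  have "H10_norm (\<lambda>x. u x - u' x) \<le> 3 * (3 * (\<beta>u / \<alpha>l) * sqrt (1 - \<theta>\<^sup>2) * dnorm rt)"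
    by (rule coarse_bound[OF \<open>uh \<in> _\<close> L uh s(4,5)])
  also have "\<dots> = 9 * (\<beta>u / \<alpha>l) * sqrt (1 - \<theta>\<^sup>2) * dnorm rt" by simp
  also have "\<dots> \<le> 9 * (\<beta>u / \<alpha>l) * sqrt (1 - \<theta>\<^sup>2) * (\<alpha>u / (\<beta>l * (1 - \<delta>)) * H10_norm (\<lambda>x. u x - un x))"
  proof (rule mult_left_mono)
    have "\<nu>0 / (\<beta>l * (1 - \<delta>)) \<le> \<alpha>u / (\<beta>l * (1 - \<delta>))" using al del beta by (intro divide_right_mono) auto
    from mult_right_mono[OF this H10_norm_nonneg[of "\<lambda>x. u x - un x"]] residual_estimate[OF del(1,3) unH res]
    show "dnorm rt \<le> \<alpha>u / (\<beta>l * (1 - \<delta>)) * H10_norm (\<lambda>x. u x - un x)" by linarith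
    show "0 \<le> 9 * (\<beta>u / \<alpha>l) * sqrt (1 - \<theta>\<^sup>2)" using beta_u al th by (simp add: power_le_one)
  qed
  also have "\<dots> = 9 * (\<alpha>u / \<alpha>l) * (\<beta>u / \<beta>l) * (sqrt (1 - \<theta>\<^sup>2) / (1 - \<delta>)) * H10_norm (\<lambda>x. u x - un x)"
    by (simp add: mult_ac)
  finally show "H10_norm (\<lambda>x. u x - u' x) \<le> 9 * (\<alpha>u / \<alpha>l) * (\<beta>u / \<beta>l) * (sqrt (1 - \<theta>\<^sup>2) / (1 - \<delta>)) * H10_norm (\<lambda>x. u x - un x)" .
qed

text \<open>An infinite run contracts to zero error, hence to zero residual, while each passed
  continuation test keeps the residual above a positive number when tol > 0. With zero tolerance a
  finished run has zero residual, which means an exact solution.\<close>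

lemma fpc_convergence:
  assumes inv: "is_ell2_inverse KK A Ainv"
    and tail: "op_bounded KK (\<lambda>l k. Ainv l k - band J Ainv l k)" "op_norm KK (\<lambda>l k. Ainv l k - band J Ainv l k) \<le> \<tau>" "0 \<le> \<tau>"
    and tau: "\<tau> \<le> \<beta>l\<^sup>2 / ds * sqrt ((1 - \<theta>\<^sup>2) / (\<alpha>l * \<alpha>u))"
    and al: "0 < \<alpha>l" "\<alpha>l \<le> \<nu>0" "\<nu>0 \<le> \<alpha>u" and th: "0 < \<theta>" "\<theta> < 1" and del: "0 < \<delta>" "\<delta> \<le> sqrt (1 - \<theta>\<^sup>2)" "\<delta> < 1"
    and rho: "\<rho> = 9 * (\<alpha>u / \<alpha>l) * (\<beta>u / \<beta>l) * (sqrt (1 - \<theta>\<^sup>2) / (1 - \<delta>))"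
    and run: "fpc_run \<nu> \<sigma> f \<phi> \<phi>s \<alpha>l \<beta>l \<beta>u J \<theta> \<delta> tol N \<Lambda> un r"
  shows "enat n < N \<Longrightarrow> H10_norm (\<lambda>x. u x - un (Suc n) x) \<le> \<rho> * H10_norm (\<lambda>x. u x - un n x)"
    "\<rho> < 1 \<Longrightarrow> 0 < tol \<Longrightarrow> N \<noteq> \<infinity>"
    "\<rho> < 1 \<Longrightarrow> N = \<infinity> \<Longrightarrow> (\<lambda>n. H10_norm (\<lambda>x. u x - un n x)) \<longlonglongrightarrow> 0"
    "N = enat n \<Longrightarrow> dnorm (r n) \<le> 0 \<Longrightarrow> H10_norm (\<lambda>x. u x - un n x) = 0"
proof -
  have R: "un 0 = (\<lambda>x. 0)" "\<Lambda> 0 = {}" "is_F_RES \<nu> \<sigma> f \<phi> \<phi>s (un 0) \<delta> (r 0)"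
    "\<And>n. enat n < N \<Longrightarrow> fpc_step \<nu> \<sigma> f \<phi> \<phi>s \<alpha>l \<beta>l \<beta>u J \<theta> \<delta> (\<Lambda> n) (r n) (\<Lambda> (Suc n)) (un (Suc n)) (r (Suc n))"
    "\<And>n. enat (Suc n) < N \<Longrightarrow> tol / (1 + \<delta>) < dnorm (r (Suc n))"
    using run by (auto simp: fpc_run_def)
  define e where "e n = H10_norm (\<lambda>x. u x - un n x)" for n
  note step = step_error[OF inv tail tau al th del]
  have I: "un n \<in> span_of \<phi> (\<Lambda> n) \<and> \<Lambda> n \<subseteq> KK \<and> finite (\<Lambda> n) \<and> is_F_RES \<nu> \<sigma> f \<phi> \<phi>s (un n) \<delta> (r n)" if "enat n \<le> N" for n
    using that
  proof (induction n)
    case 0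
    then show ?case using R(1-3) by (simp add: span_of_zero)
  next
    case (Suc n)
    then have n: "enat n < N" by (metis Suc_ile_eq)
    with Suc.IH have "un n \<in> span_of \<phi> (\<Lambda> n)" "\<Lambda> n \<subseteq> KK" "finite (\<Lambda> n)" "is_F_RES \<nu> \<sigma> f \<phi> \<phi>s (un n) \<delta> (r n)" by auto
    from step(2-5)[OF this R(4)[OF n]] show ?case by simp
  qed
  have contr: "e (Suc n) \<le> \<rho> * e n" if "enat n < N" for n
    using step(1)[OF _ _ _ _ R(4)[OF that]] I[of n] that by (simp add: e_def rho less_imp_le)
  then show "enat n < N \<Longrightarrow> H10_norm (\<lambda>x. u x - un (Suc n) x) \<le> \<rho> * H10_norm (\<lambda>x. u x - un n x)" by (simp add: e_def)
  have unH: "un n \<in> H10" if "enat n \<le> N" for n using I[OF that] span_H10 by blast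
  show "H10_norm (\<lambda>x. u x - un n x) = 0" if N: "N = enat n" and r0: "dnorm (r n) \<le> 0"
  proof -
    have n: "enat n \<le> N" by (simp add: N)
    show ?thesis by (rule residual_zero_imp_exact[OF unH[OF n] _ r0]) (use I[OF n] in blast)
  qed
  have rho0: "0 \<le> \<rho>" unfolding rho using al beta beta_u th del by (simp add: power_le_one)
  have lim: "e \<longlonglongrightarrow> 0" if N: "N = \<infinity>" and r1: "\<rho> < 1"
  proof -
    have b: "e n \<le> \<rho> ^ n * e 0" for n
    proof (induction n)
      case (Suc n)
      have "e (Suc n) \<le> \<rho> * e n" by (rule contr) (simp add: N)
      also have "\<dots> \<le> \<rho> * (\<rho> ^ n * e 0)" using Suc.IH rho0 by (intro mult_left_mono)
      finally show ?case by simp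
    qed simp
    have "(\<lambda>n. \<rho> ^ n * e 0) \<longlonglongrightarrow> 0 * e 0" using rho0 r1 by (intro tendsto_mult LIMSEQ_realpow_zero tendsto_const) auto
    then have "(\<lambda>n. \<rho> ^ n * e 0) \<longlonglongrightarrow> 0" by simp
    from tendsto_sandwich[OF _ _ tendsto_const this, of e] b show ?thesis by (auto simp: e_def H10_norm_nonneg)
  qed
  then show "\<rho> < 1 \<Longrightarrow> N = \<infinity> \<Longrightarrow> (\<lambda>n. H10_norm (\<lambda>x. u x - un n x)) \<longlonglongrightarrow> 0" by (simp add: e_def[abs_def])
  show "\<rho> < 1 \<Longrightarrow> 0 < tol \<Longrightarrow> N \<noteq> \<infinity>"
  proof
    assume r1: "\<rho> < 1" and tol: "0 < tol" and N: "N = \<infinity>"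
    \<comment> \<open>The test is made after each pass, so the lower bound on the residual is
      available only from index 1 on; hence the shift to \<open>Suc n\<close>.\<close>
    let ?K = "\<nu>0 / (\<beta>l * (1 - \<delta>))"
    have lower: "tol / (1 + \<delta>) \<le> ?K * e (Suc n)" for n
      using R(5)[of n] residual_estimate[OF del(1,3) unH, of "Suc n" "r (Suc n)"] I[of "Suc n"] N by (simp add: e_def)
    have "(\<lambda>n. ?K * e (Suc n)) \<longlonglongrightarrow> ?K * 0" by (intro tendsto_mult tendsto_const LIMSEQ_Suc lim N r1)
    then have "tol / (1 + \<delta>) \<le> ?K * 0" by (rule LIMSEQ_le_const) (use lower in blast)
    then show False using tol del by (simp add: divide_le_0_iff)
  qed
qed

end

theorem theorem4p1:
  fixes \<nu> \<sigma> u :: "real \<times> real \<Rightarrow> real"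
    and f :: "(real \<times> real \<Rightarrow> real) \<Rightarrow> real"
    and G L Gt E Ainv :: "nat \<times> nat \<Rightarrow> nat \<times> nat \<Rightarrow> real"
    and \<phi> :: "nat \<times> nat \<Rightarrow> real \<times> real \<Rightarrow> real"
    and \<phi>s :: "nat \<times> nat \<Rightarrow> (real \<times> real \<Rightarrow> real) \<Rightarrow> real"
    and pmax :: nat
    and \<nu>l \<nu>u \<sigma>u \<alpha>l \<alpha>u tolG t \<beta>l \<beta>u ds c \<gamma>L CA \<gamma>inv \<theta> \<delta> tol \<rho> :: real
  assumes \<comment> \<open>the elliptic problem\<close>
        "smooth_on Omega \<nu>" and "smooth_on Omega \<sigma>"
    and "0 < \<nu>l" and "\<forall>x\<in>Omega. \<nu>l \<le> \<nu> x \<and> \<nu> x \<le> \<nu>u"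
    and "\<forall>x\<in>Omega. 0 \<le> \<sigma> x \<and> \<sigma> x \<le> \<sigma>u"
    and "\<alpha>l = \<nu>l" and "\<alpha>u = max \<nu>u \<sigma>u"
    and "\<forall>v\<in>H10. sqrt (a_form \<nu> \<sigma> v v) \<le> sqrt \<alpha>u * H10_norm v"
    and "f \<in> H10_dual"
    and "u \<in> H10" and "\<forall>v\<in>H10. a_form \<nu> \<sigma> u v = f v"
    \<comment> \<open>the basis\<close>
    and "is_gram_schmidt G" and "is_inverse_transpose G L"
    and "tolG < 1" and "0 < t" and "t < 1"
    and "Gt = thresholded pmax t G" and "E = (\<lambda>m k. Gt m k - G m k)"
    and "op_bounded KK (mat_mult KK (mat_transp L) E)"
    and "op_norm KK (mat_mult KK (mat_transp L) E) \<le> tolG"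
    and "\<phi> = basis_fun Gt" and "is_riesz_basis \<phi>" and "is_dual_basis \<phi> \<phi>s"
    and "0 < \<beta>l" and "\<beta>l \<le> \<beta>u"
    and "\<forall>v\<in>H10. \<beta>l * H10_norm v \<le> phi_norm \<phi> \<phi>s v \<and> phi_norm \<phi> \<phi>s v \<le> \<beta>u * H10_norm v"
    and "ds = 1 + (op_norm KK (mat_mult KK (mat_transp L) E))\<^sup>2"
    \<comment> \<open>the stiffness matrix\<close>
    and "0 < c" and "0 < \<gamma>L"
    and "\<forall>k\<in>KK. \<forall>l\<in>KK. \<bar>a_form \<nu> \<sigma> (\<phi> k) (\<phi> l)\<bar> \<le> c * exp (- \<gamma>L * real (l1_dist k l))"
    and "is_ell2_inverse KK (\<lambda>l k. a_form \<nu> \<sigma> (\<phi> k) (\<phi> l)) Ainv"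
    and "0 < CA" and "0 < \<gamma>inv"
    and "\<forall>J::nat. op_bounded KK (\<lambda>l k. Ainv l k - band J Ainv l k) \<and>
           op_norm KK (\<lambda>l k. Ainv l k - band J Ainv l k) \<le> CA * exp (- \<gamma>inv * real J)"
    \<comment> \<open>the parameters of the algorithm\<close>
    and "0 < \<theta>" and "\<theta> < 1" and "0 < \<delta>" and "\<delta> < sqrt (1 - \<theta>\<^sup>2)"
    and "0 \<le> tol" and "tol < 1"
    and "\<rho> = 9 * (\<alpha>u / \<alpha>l) * (\<beta>u / \<beta>l) * (sqrt (1 - \<theta>\<^sup>2) / (1 - \<delta>))"
  shows "\<forall>N \<Lambda> un r.
    fpc_run \<nu> \<sigma> f \<phi> \<phi>s \<alpha>l \<beta>l \<beta>u (J_theta CA \<gamma>inv \<alpha>l \<alpha>u \<beta>l ds \<theta>) \<theta> \<delta> tol N \<Lambda> un r \<longrightarrow>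
      (\<forall>n. enat n < N \<longrightarrow>
         H10_norm (\<lambda>x. u x - un (Suc n) x) \<le> \<rho> * H10_norm (\<lambda>x. u x - un n x)) \<and>
      (\<rho> < 1 \<longrightarrow>
         (0 < tol \<longrightarrow> N \<noteq> \<infinity>) \<and>
         (tol = 0 \<longrightarrow>
            (N = \<infinity> \<longrightarrow> (\<lambda>n. H10_norm (\<lambda>x. u x - un n x)) \<longlonglongrightarrow> 0) \<and>
            (\<forall>n. N = enat n \<and> 0 < n \<and> phi_dual_norm \<phi> (r n) \<le> tol / (1 + \<delta>) \<longrightarrow>
               H10_norm (\<lambda>x. u x - un n x) = 0)))"
proof -
  note gs = assms(12) and invt = assms(13) and Gt = assms(17) and E = assms(18) and riesz = assms(22)
  have phi: "\<phi> = basis_fun (thresholded pmax t G)" using assms(17,21) by simp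
  have basis: "\<phi> k \<in> H10" if "k \<in> KK" for k using riesz that by (simp add: is_riesz_basis_def)
  have density: "\<exists>F c. finite F \<and> F \<subseteq> KK \<and> H10_norm (\<lambda>x. v x - (\<Sum>k\<in>F. c k * \<phi> k x)) < e" if "v \<in> H10" "0 < e" for v e
    using riesz that unfolding is_riesz_basis_def by blast
  have au: "0 < \<alpha>u"
  proof -
    have "(0, 0) \<in> Omega" by (simp add: Omega_def)
    then show ?thesis using assms(3,4,7) by force
  qed
  have bn: "bdd_meas \<nu>" by (rule bdd_meas_smooth[OF assms(1), of "\<nu>u"]) (use assms(3,4) in force)
  have bs: "bdd_meas \<sigma>" by (rule bdd_meas_smooth[OF assms(2), of "\<sigma>u"]) (use assms(5) in force)
  interpret gs_basis G L pmax t
    by (unfold_locales) (use gs invt basis phi in auto)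
  interpret decay_basis G L pmax t \<nu> \<sigma> "sqrt \<alpha>u" c \<gamma>L
  proof (unfold_locales, fold phi)
    show "bdd_meas \<nu>" "bdd_meas \<sigma>" by fact+
    show "\<forall>x\<in>Omega. 0 \<le> \<nu> x" "\<forall>x\<in>Omega. 0 \<le> \<sigma> x" using assms(3-5) by force+
    show "0 \<le> sqrt \<alpha>u" using au by simp
    show "sqrt (a_form \<nu> \<sigma> v v) \<le> sqrt \<alpha>u * H10_norm v" if "v \<in> H10" for v using assms(8) that by blast
    show "\<exists>F c. finite F \<and> F \<subseteq> KK \<and> H10_norm (\<lambda>x. v x - (\<Sum>k\<in>F. c k * \<phi> k x)) < e" if "v \<in> H10" "0 < e" for v e
      by (rule density[OF that])
    show "0 < c" "0 < \<gamma>L" by fact+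
    show "\<bar>a_form \<nu> \<sigma> (\<phi> k) (\<phi> l)\<bar> \<le> c * exp (- \<gamma>L * real (l1_dist k l))" if "k \<in> KK" "l \<in> KK" for k l
      using assms(30) that by blast
  qed
  have n0: "\<alpha>l \<le> nu0" "nu0 \<le> \<alpha>u" using nu0_bounds[OF assms(4)] assms(6,7) by auto
  have al: "0 < \<alpha>l" using assms(3,6) by simp
  have weights: "1 \<le> d_weight \<phi> k" "d_weight \<phi> k \<le> ds" if k: "k \<in> KK" for k
  proof -
    \<comment> \<open>The matrix \<open>M\<close> built from the Gram-Schmidt data is the transpose
      of L times E, whose operator norm defines \<open>ds\<close>.\<close>
    have M: "M = mat_mult KK (mat_transp L) (\<lambda>m k. Gt m k - G m k)" unfolding M_def Gt ..
    have n: "d_weight \<phi> k = 1 + (\<Sum>j\<in>upto_index k. (M j k)\<^sup>2)" unfolding d_weight_def phi by (rule basis_norm[OF k])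
    then show "1 \<le> d_weight \<phi> k" by (simp add: sum_nonneg)
    have "op_bounded KK M" using assms(19) unfolding M E .
    from op_norm_column[OF this k finite_upto_index upto_index_subset]
    show "d_weight \<phi> k \<le> ds" unfolding n assms(27) E M[symmetric] by simp
  qed
  interpret adaptive \<phi> \<phi>s \<nu> \<sigma> u f nu0 \<beta>l \<beta>u ds
  proof
    show "a_form \<nu> \<sigma> v w = nu0 * H10_inner v w" if "v \<in> H10" "w \<in> H10" for v w by (rule a_form_rigid[OF that])
    show "0 < nu0" using al n0 by simp
    show "f \<in> H10_dual" "u \<in> H10" "is_dual_basis \<phi> \<phi>s" "0 < \<beta>l" "\<beta>l \<le> \<beta>u" by fact+
    show "a_form \<nu> \<sigma> u v = f v" if "v \<in> H10" for v using assms(11) that by blast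
    show "\<beta>l * H10_norm v \<le> phi_norm \<phi> \<phi>s v" "phi_norm \<phi> \<phi>s v \<le> \<beta>u * H10_norm v" if "v \<in> H10" for v using assms(26) that by blast+
  qed (rule basis density weights; assumption)+
  define J where "J = J_theta CA \<gamma>inv \<alpha>l \<alpha>u \<beta>l ds \<theta>"
  have th: "0 < 1 - \<theta>\<^sup>2" "\<theta>\<^sup>2 \<ge> 0" using assms(35,36) by (simp_all add: power_less_one_iff)
  have "1 \<le> ds" unfolding assms(27) by simp
  then have "0 < \<beta>l\<^sup>2 / ds * sqrt ((1 - \<theta>\<^sup>2) / (\<alpha>l * \<alpha>u))" using assms(24) th al au by simp
  \<comment> \<open>The minimum defining the enrichment radius is attained because some J satisfies
    the bound; so the radius itself satisfies it.\<close>
  from J_theta_bound[OF assms(33) this, of CA] have tau: "CA * exp (- \<gamma>inv * real J) \<le> \<beta>l\<^sup>2 / ds * sqrt ((1 - \<theta>\<^sup>2) / (\<alpha>l * \<alpha>u))"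
    unfolding J_def J_theta_def by (rule LeastI_ex)
  have tail: "op_bounded KK (\<lambda>l k. Ainv l k - band J Ainv l k)" "op_norm KK (\<lambda>l k. Ainv l k - band J Ainv l k) \<le> CA * exp (- \<gamma>inv * real J)"
    using assms(34) by blast+
  have tau0: "0 \<le> CA * exp (- \<gamma>inv * real J)" using assms(32) by simp
  have "sqrt (1 - \<theta>\<^sup>2) \<le> 1" using th by simp
  then have del: "\<delta> \<le> sqrt (1 - \<theta>\<^sup>2)" "\<delta> < 1" using assms(38) by linarith+
  note conv = fpc_convergence[OF assms(31) tail tau0 tau al n0 assms(35,36) assms(37) del assms(41)]
  show ?thesis
    unfolding J_def[symmetric]
  proof (intro allI impI conjI)
    fix N \<Lambda> un r n
    assume run: "fpc_run \<nu> \<sigma> f \<phi> \<phi>s \<alpha>l \<beta>l \<beta>u J \<theta> \<delta> tol N \<Lambda> un r"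
    show "H10_norm (\<lambda>x. u x - un (Suc n) x) \<le> \<rho> * H10_norm (\<lambda>x. u x - un n x)" if "enat n < N"
      by (rule conv(1)[OF run that])
    show "N \<noteq> \<infinity>" if "\<rho> < 1" "0 < tol" by (rule conv(2)[OF run that])
    show "(\<lambda>n. H10_norm (\<lambda>x. u x - un n x)) \<longlonglongrightarrow> 0" if "\<rho> < 1" "N = \<infinity>" by (rule conv(3)[OF run that])
    show "H10_norm (\<lambda>x. u x - un n x) = 0" if "tol = 0" "N = enat n \<and> 0 < n \<and> phi_dual_norm \<phi> (r n) \<le> tol / (1 + \<delta>)"
      by (rule conv(4)[OF run]) (use that in auto)
  qed
qed

end
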